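(* Let $\mathcal{H}$ be a quasitriangular Hopf algebra over $k$ with universal R-matrix $\mathcal{R}$ and antipode $\gamma$, and let $\mathcal{L}$ be an $\mathcal{H}$-commutative module algebra, equipped with the $\mathcal{H}$-base algebra structure $\mathcal{L}_+$. Then the antipode $\gamma:\mathcal{L}\rtimes\mathcal{H}\to(\mathcal{L}_{op}\rtimes\mathcal{H}_{op})^{op}$, $\gamma(\lambda\otimes h)=(1\otimes\gamma(h))\,t^+(v^{-1}\triangleright\lambda)$, descends to an isomorphism of quantum groupoids $$\gamma:\mathcal{H}_{\mathcal{L}}\to(\mathcal{H}_{\mathcal{L}})^{op}_{op},$$ that is, to an isomorphism of $\mathcal{L}$-bialgebroids compatible with the universal R-matrices.
   Context: $k$ is a field of characteristic zero (or a ring of formal power series over such a field); algebras are associative unital $k$-algebras, $\otimes=\otimes_k$; antipodes of Hopf algebras are invertible. $\mathcal{R}=\mathcal{R}_1\otimes\mathcal{R}_2$ satisfies $(\Delta\otimes\mathrm{id})(\mathcal{R})=\mathcal{R}_{13}\mathcal{R}_{23}$, $(\mathrm{id}\otimes\Delta)(\mathcal{R})=\mathcal{R}_{13}\mathcal{R}_{12}$, $\mathcal{R}\Delta(h)=\Delta^{op}(h)\mathcal{R}$; $\mathcal{R}^+=\mathcal{R}$, $\mathcal{R}^-=\mathcal{R}^{-1}_{21}$; primes denote further copies. $v=\mathcal{R}_1\gamma(\mathcal{R}_2)$ is the (invertible) Drinfeld element. A left $\mathcal{H}$-module algebra $\mathcal{L}$ is $\mathcal{H}$-commutative if $\lambda\mu=(\mathcal{R}_2\triangleright\mu)(\mathcal{R}_1\triangleright\lambda)$.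 A subscript $op$ on an algebra denotes the opposite algebra. **Bialgebroids.** An $\mathcal{L}$-bialgebroid is an algebra $B$ with an algebra homomorphism $s:\mathcal{L}\to B$ and an anti-homomorphism $t:\mathcal{L}\to B$ with commuting images, so that $B$ is an $\mathcal{L}$-bimodule by $\lambda\cdot a=s(\lambda)a$, $a\cdot\lambda=t(\lambda)a$; a coassociative bimodule map $\Delta:B\to B\otimes_{\mathcal{L}}B$ which is an algebra homomorphism into $\{z: z(t(\lambda)\otimes1)=z(1\otimes s(\lambda))\ \forall\lambda\}$; and a bimodule map $\varepsilon:B\to\mathcal{L}$ with $\varepsilon(1)=1$, $\varepsilon(a\,s(\varepsilon(b)))=\varepsilon(ab)=\varepsilon(a\,t(\varepsilon(b)))$ and the counit axioms. Homomorphisms are algebra and bimodule maps respecting coproducts and counits. The coopposite $B^{op}$ is the $\mathcal{L}_{op}$-bialgebroid with the same algebra, source $t$, target $s$, coproduct $\Delta^{op}(a)=a^{(2)}\otimes_{\mathcal{L}_{op}}a^{(1)}$ and the same counit map. **Quantum groupoids.** In $B\otimes_{\mathcal{L}_{op}}B$ one has $s(\lambda)a\otimes b=a\otimes t(\lambda)b$. A quantum groupoid (quasitriangular bialgebroid) is an $\mathcal{L}$-bialgebroid $B$ with $\mathcal{Q}\in B\otimes_{\mathcal{L}_{op}}B$ (universal R-matrix) such that $\mathcal{Q}(t(\lambda)\otimes1)=\mathcal{Q}(1\otimes s(\lambda))$; $\mathcal{Q}\Delta(a)=\Delta^{op}(a)\mathcal{Q}$; $(\Delta^{op}\otimes\mathrm{id})(\mathcal{Q})=\mathcal{Q}_1\otimes\mathcal{Q}(1\otimes\mathcal{Q}_2)$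 and $(\mathrm{id}\otimes\Delta^{op})(\mathcal{Q})=\mathcal{Q}(\mathcal{Q}_1\otimes1)\otimes\mathcal{Q}_2$ over $\mathcal{L}_{op}$; and there is $\bar{\mathcal{Q}}\in B\otimes_{\mathcal{L}}B$ with $\bar{\mathcal{Q}}(s(\lambda)\otimes1)=\bar{\mathcal{Q}}(1\otimes t(\lambda))$, $\mathcal{Q}\bar{\mathcal{Q}}=1\otimes_{\mathcal{L}_{op}}1$, $\bar{\mathcal{Q}}\mathcal{Q}=1\otimes_{\mathcal{L}}1$. Then $\bar{\mathcal{Q}}$ is the universal R-matrix of the coopposite bialgebroid $B^{op}$. **$\mathcal{L}\rtimes\mathcal{H}$ and $\mathcal{H}_{\mathcal{L}}$.** $\mathcal{L}\rtimes\mathcal{H}=\mathcal{L}_+\rtimes\mathcal{H}$ is the smash product algebra $(\lambda\otimes f)(\mu\otimes g)=\lambda(f^{(1)}\triangleright\mu)\otimes f^{(2)}g$ with $s(\lambda)=\lambda\otimes1$, $t^+(\lambda)=\mathcal{R}_2\triangleright\lambda\otimes\mathcal{R}_1$, $\Delta(\lambda\otimes h)=(\lambda\otimes h^{(1)})\otimes_{\mathcal{L}}(1\otimes h^{(2)})$, $\varepsilon(\lambda\otimes h)=\lambda\varepsilon(h)$. Let $\phi(\lambda\otimes h)=(\mathcal{R}_2\mathcal{R}_{1'})\triangleright\lambda\otimes\mathcal{R}_1\mathcal{R}_{2'}h$, an algebra automorphism; the left ideal $J_\phi$ generated by the image of $\phi-\mathrm{id}$ is a two-sided ideal and a biideal,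 and $\mathcal{H}_{\mathcal{L}}=(\mathcal{L}\rtimes\mathcal{H})/J_\phi$ is a quantum groupoid with universal R-matrix the image of $(1\otimes\mathcal{R}_1)\otimes_{\mathcal{L}_{op}}(1\otimes\mathcal{R}_2)$. **Opposites.** $\mathcal{H}_{op}$ (opposite multiplication, same comultiplication, antipode $\gamma^{-1}$) is quasitriangular with universal R-matrix $\mathcal{R}^{-1}$, and $\mathcal{L}_{op}$ is an $\mathcal{H}_{op}$-commutative module algebra under $x\blacktriangleright\lambda=\gamma^{-1}(x)\triangleright\lambda$. Applying the constructions of the previous paragraph to $(\mathcal{H}_{op},\mathcal{R}^{-1},\mathcal{L}_{op},\blacktriangleright)$ gives the $\mathcal{L}_{op}$-bialgebroid $\mathcal{L}_{op}\rtimes\mathcal{H}_{op}$, the automorphism $\phi^\bullet$, the biideal $J_{\phi^\bullet}$, and the quantum groupoid $(\mathcal{H}_{\mathcal{L}})_{op}:=(\mathcal{L}_{op}\rtimes\mathcal{H}_{op})/J_{\phi^\bullet}$ over $\mathcal{L}_{op}$; $(\mathcal{H}_{\mathcal{L}})^{op}_{op}$ is its coopposite, an $\mathcal{L}$-bialgebroid. The algebra $\mathcal{L}_{op}\rtimes\mathcal{H}_{op}$ is identified with the opposite algebra of $\mathcal{L}\rtimes\mathcal{H}$ so that the subspaces $\mathcal{L}$ and $\mathcal{H}$ correspond identically (thus $\lambda\otimes h\in\mathcal{L}_{op}\rtimes\mathcal{H}_{op}$ corresponds to $(1\otimes h)(\lambda\otimes1)\in\mathcal{L}\rtimes\mathcal{H}$);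 under this identification the formula for $\gamma(\lambda\otimes h)$ is computed in $\mathcal{L}\rtimes\mathcal{H}$, and $\gamma:\mathcal{L}\rtimes\mathcal{H}\to(\mathcal{L}_{op}\rtimes\mathcal{H}_{op})^{op}$ is an isomorphism of $\mathcal{L}$-bialgebroids. *)

theory Defs
  imports "HOL-Algebra.Free_Abelian_Groups" "HOL-Algebra.QuotRing" "HOL-Algebra.Module"
begin

text \<open>The import order matters: with \<open>Free_Abelian_Groups\<close> last, constants from its ancestors
  shadow the record fields \<open>mult\<close> and \<open>zero\<close>.\<close>

section \<open>The base ring\<close>

definition char_zero_field :: "('k, 'x) ring_scheme \<Rightarrow> bool" where
  "char_zero_field K \<longleftrightarrow> field K \<and> (\<forall>n::nat. n > 0 \<longrightarrow> [n] \<cdot>\<^bsub>K\<^esub> \<one>\<^bsub>K\<^esub> \<noteq> \<zero>\<^bsub>K\<^esub>)"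

definition fps_ring :: "('k, 'x) ring_scheme \<Rightarrow> (nat \<Rightarrow> 'k) ring" where
  "fps_ring K =
    \<lparr>carrier = {f. \<forall>n. f n \<in> carrier K},
     mult = (\<lambda>f g n. \<Oplus>\<^bsub>K\<^esub>i\<in>{..n}. f i \<otimes>\<^bsub>K\<^esub> g (n - i)),
     one = (\<lambda>n. if n = 0 then \<one>\<^bsub>K\<^esub> else \<zero>\<^bsub>K\<^esub>),
     zero = (\<lambda>n. \<zero>\<^bsub>K\<^esub>),
     add = (\<lambda>f g n. f n \<oplus>\<^bsub>K\<^esub> g n)\<rparr>"

text \<open>The coefficient field may be taken on the element type of \<open>k\<close>, because it embeds into
  \<open>k\<close> as the constant series.\<close>

definition base_ring :: "'k ring \<Rightarrow> bool" where
  "base_ring k \<longleftrightarrow>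
     char_zero_field k \<or> (\<exists>K :: 'k ring. char_zero_field K \<and> cring k \<and> fps_ring K \<simeq> k)"


section \<open>Algebras and tensor products\<close>

definition k_algebra :: "('k, 'x) ring_scheme \<Rightarrow> ('k, 'a, 'y) module_scheme \<Rightarrow> bool" where
  "k_algebra k A \<longleftrightarrow> module k A \<and> ring A \<and>
     (\<forall>r\<in>carrier k. \<forall>x\<in>carrier A. \<forall>y\<in>carrier A.
        (r \<odot>\<^bsub>A\<^esub> x) \<otimes>\<^bsub>A\<^esub> y = r \<odot>\<^bsub>A\<^esub> (x \<otimes>\<^bsub>A\<^esub> y) \<and>
        x \<otimes>\<^bsub>A\<^esub> (r \<odot>\<^bsub>A\<^esub> y) = r \<odot>\<^bsub>A\<^esub> (x \<otimes>\<^bsub>A\<^esub> y))"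

definition alg_hom ::
  "('k, 'x) ring_scheme \<Rightarrow> ('k, 'a, 'y) module_scheme \<Rightarrow> ('k, 'b, 'z) module_scheme \<Rightarrow> ('a \<Rightarrow> 'b) set"
  where
  "alg_hom k A B = {f \<in> ring_hom A B.
     \<forall>r\<in>carrier k. \<forall>x\<in>carrier A. f (r \<odot>\<^bsub>A\<^esub> x) = r \<odot>\<^bsub>B\<^esub> f x}"

definition opp :: "('a, 'x) ring_scheme \<Rightarrow> ('a, 'x) ring_scheme" where
  "opp A = A\<lparr>mult := (\<lambda>x y. y \<otimes>\<^bsub>A\<^esub> x)\<rparr>"

type_synonym ('m, 'n) tens = "(('m \<times> 'n) \<Rightarrow>\<^sub>0 int) set"

text \<open>\<open>tensor S \<alpha> \<beta> M N\<close> is the abelian group generated by pairs \<open>(a, b)\<close> subject to biadditivity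
  and \<open>(\<alpha> s a, b) = (a, \<beta> s b)\<close> for \<open>s \<in> S\<close>. Only its additive structure is meaningful.\<close>

definition tensor_relations ::
  "'s set \<Rightarrow> ('s \<Rightarrow> 'm \<Rightarrow> 'm) \<Rightarrow> ('s \<Rightarrow> 'n \<Rightarrow> 'n) \<Rightarrow>
   ('m, 'x) ring_scheme \<Rightarrow> ('n, 'y) ring_scheme \<Rightarrow> (('m \<times> 'n) \<Rightarrow>\<^sub>0 int) set" where
  "tensor_relations S \<alpha> \<beta> M N =
     {frag_of (a \<oplus>\<^bsub>M\<^esub> a', b) - frag_of (a, b) - frag_of (a', b) | a a' b.
        a \<in> carrier M \<and> a' \<in> carrier M \<and> b \<in> carrier N} \<union>
     {frag_of (a, b \<oplus>\<^bsub>N\<^esub> b') - frag_of (a, b) - frag_of (a, b') | a b b'.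
        a \<in> carrier M \<and> b \<in> carrier N \<and> b' \<in> carrier N} \<union>
     {frag_of (\<alpha> s a, b) - frag_of (a, \<beta> s b) | s a b.
        s \<in> S \<and> a \<in> carrier M \<and> b \<in> carrier N}"

definition tensor ::
  "'s set \<Rightarrow> ('s \<Rightarrow> 'm \<Rightarrow> 'm) \<Rightarrow> ('s \<Rightarrow> 'n \<Rightarrow> 'n) \<Rightarrow>
   ('m, 'x) ring_scheme \<Rightarrow> ('n, 'y) ring_scheme \<Rightarrow> ('m, 'n) tens ring" where
  "tensor S \<alpha> \<beta> M N =
    (let F = free_Abelian_group (carrier M \<times> carrier N);
         T = F Mod (generate F (tensor_relations S \<alpha> \<beta> M N))
     in \<lparr>carrier = carrier T, mult = undefined, one = undefined,
         zero = \<one>\<^bsub>T\<^esub>, add = mult T\<rparr>)"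

text \<open>Pure tensors: in a tensor product \<open>T\<close> the zero element is the subgroup of relations,
  so \<open>a \<boxtimes>\<^bsub>T\<^esub> b\<close> is the coset of \<open>(a, b)\<close>.\<close>

definition pure_tensor :: "(('m, 'n) tens, 'x) ring_scheme \<Rightarrow> 'm \<Rightarrow> 'n \<Rightarrow> ('m, 'n) tens"
    (infixl \<open>\<boxtimes>\<index>\<close> 75) where
  "a \<boxtimes>\<^bsub>T\<^esub> b = \<zero>\<^bsub>T\<^esub> #>\<^bsub>free_Abelian_group UNIV\<^esub> frag_of (a, b)"

text \<open>\<open>tlift G f\<close> is the additive map from a tensor product to \<open>G\<close> induced by a balanced map \<open>f\<close>,
  that is, \<open>a \<boxtimes> b \<mapsto> f a b\<close>. Thus \<open>tlift G (\<lambda>a b. f a b) X\<close> renders the Sweedler-type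
  expression \<open>f X\<^sub>1 X\<^sub>2\<close>.\<close>

definition tlift :: "('g, 'x) ring_scheme \<Rightarrow> ('m \<Rightarrow> 'n \<Rightarrow> 'g) \<Rightarrow> ('m, 'n) tens \<Rightarrow> 'g" where
  "tlift G f X = the_elem
     ((\<lambda>c. \<Oplus>\<^bsub>G\<^esub>p\<in>Poly_Mapping.keys c. [Poly_Mapping.lookup c p] \<cdot>\<^bsub>G\<^esub> f (fst p) (snd p)) ` X)"

definition tmap ::
  "(('c, 'd) tens, 'x) ring_scheme \<Rightarrow> ('a \<Rightarrow> 'c) \<Rightarrow> ('b \<Rightarrow> 'd) \<Rightarrow> ('a, 'b) tens \<Rightarrow> ('c, 'd) tens" where
  "tmap T f g X = tlift T (\<lambda>a b. f a \<boxtimes>\<^bsub>T\<^esub> g b) X"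

definition tflip :: "(('n, 'm) tens, 'x) ring_scheme \<Rightarrow> ('m, 'n) tens \<Rightarrow> ('n, 'm) tens" where
  "tflip T X = tlift T (\<lambda>a b. b \<boxtimes>\<^bsub>T\<^esub> a) X"

text \<open>\<open>(id \<otimes> D)(X)\<close> for \<open>D\<close> with values in a tensor product, with the result re-bracketed
  into \<open>T3\<close>, a triple tensor product of the form \<open>T \<otimes> N\<close>, where \<open>T\<close> is a tensor product.\<close>

definition tmap_right ::
  "(('a, 'b) tens, 'x) ring_scheme \<Rightarrow> ((('a, 'b) tens, 'c) tens, 'y) ring_scheme \<Rightarrow>
   ('d \<Rightarrow> ('b, 'c) tens) \<Rightarrow> ('a, 'd) tens \<Rightarrow> (('a, 'b) tens, 'c) tens" where
  "tmap_right T T3 D X =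
     tlift T3 (\<lambda>a d. tlift T3 (\<lambda>b c. (a \<boxtimes>\<^bsub>T\<^esub> b) \<boxtimes>\<^bsub>T3\<^esub> c) (D d)) X"

text \<open>Componentwise products: \<open>tmul_pure T A X c d = X (c \<otimes> d)\<close> and
  \<open>tmul T A X Y = X Y\<close>. Over a noncommutative base, right multiplication of a tensor by
  \<open>c \<otimes> d\<close> is always well defined, whereas \<open>X Y\<close> is well defined if \<open>X (c \<otimes> d)\<close> is
  balanced in \<open>(c, d)\<close>; so the sum over \<open>Y\<close> has to be the outer one. The tensor product \<open>T\<close>
  is the one containing \<open>X\<close> and the result, while \<open>Y\<close> may belong to another one.\<close>

definition tmul_pure ::
  "(('a, 'b) tens, 'x) ring_scheme \<Rightarrow> ('a, 'y) ring_scheme \<Rightarrow> ('b, 'z) ring_scheme \<Rightarrow>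
   ('a, 'b) tens \<Rightarrow> 'a \<Rightarrow> 'b \<Rightarrow> ('a, 'b) tens" where
  "tmul_pure T A B X c d = tlift T (\<lambda>a b. (a \<otimes>\<^bsub>A\<^esub> c) \<boxtimes>\<^bsub>T\<^esub> (b \<otimes>\<^bsub>B\<^esub> d)) X"

definition tmul ::
  "(('a, 'b) tens, 'x) ring_scheme \<Rightarrow> ('a, 'y) ring_scheme \<Rightarrow> ('b, 'z) ring_scheme \<Rightarrow>
   ('a, 'b) tens \<Rightarrow> ('a, 'b) tens \<Rightarrow> ('a, 'b) tens" where
  "tmul T A B X Y = tlift T (\<lambda>c d. tmul_pure T A B X c d) Y"

definition ktensor ::
  "('k, 'x) ring_scheme \<Rightarrow> ('k, 'a, 'y) module_scheme \<Rightarrow> ('k, 'b, 'z) module_scheme \<Rightarrow>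
   ('k, ('a, 'b) tens) module" where
  "ktensor k A B =
    (let T = tensor (carrier k) (smult A) (smult B) A B
     in \<lparr>carrier = carrier T, mult = tmul T A B, one = \<one>\<^bsub>A\<^esub> \<boxtimes>\<^bsub>T\<^esub> \<one>\<^bsub>B\<^esub>,
         zero = \<zero>\<^bsub>T\<^esub>, add = add T,
         smult = (\<lambda>r. tmap T (\<lambda>a. r \<odot>\<^bsub>A\<^esub> a) (\<lambda>b. b))\<rparr>)"


section \<open>Quasitriangular Hopf algebras and module algebras\<close>

record ('k, 'h) hopf = "('k, 'h) module" +
  comult :: "'h \<Rightarrow> ('h, 'h) tens"
  counit :: "'h \<Rightarrow> 'k"
  antipode :: "'h \<Rightarrow> 'h"

abbreviation tensor2 where "tensor2 k H \<equiv> ktensor k H H"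
abbreviation tensor3 where "tensor3 k H \<equiv> ktensor k (ktensor k H H) H"

locale hopf_algebra =
  fixes k :: "('k, 'x) ring_scheme" and H :: "('k, 'h, 'y) hopf_scheme"
  assumes algebra: "k_algebra k H"
    and comult_hom: "comult H \<in> alg_hom k H (tensor2 k H)"
    and counit_hom: "counit H \<in> ring_hom H k"
    and counit_linear:
      "\<And>r x. \<lbrakk>r \<in> carrier k; x \<in> carrier H\<rbrakk> \<Longrightarrow> counit H (r \<odot>\<^bsub>H\<^esub> x) = r \<otimes>\<^bsub>k\<^esub> counit H x"
    and coassoc: "\<And>x. x \<in> carrier H \<Longrightarrow>
      tmap (tensor3 k H) (comult H) (\<lambda>b. b) (comult H x) =
      tmap_right (tensor2 k H) (tensor3 k H) (comult H) (comult H x)"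
    and counit_left: "\<And>x. x \<in> carrier H \<Longrightarrow> tlift H (\<lambda>a b. counit H a \<odot>\<^bsub>H\<^esub> b) (comult H x) = x"
    and counit_right: "\<And>x. x \<in> carrier H \<Longrightarrow> tlift H (\<lambda>a b. counit H b \<odot>\<^bsub>H\<^esub> a) (comult H x) = x"
    and antipode_add: "\<And>x y. \<lbrakk>x \<in> carrier H; y \<in> carrier H\<rbrakk> \<Longrightarrow>
      antipode H (x \<oplus>\<^bsub>H\<^esub> y) = antipode H x \<oplus>\<^bsub>H\<^esub> antipode H y"
    and antipode_smult: "\<And>r x. \<lbrakk>r \<in> carrier k; x \<in> carrier H\<rbrakk> \<Longrightarrow>
      antipode H (r \<odot>\<^bsub>H\<^esub> x) = r \<odot>\<^bsub>H\<^esub> antipode H x"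
    and antipode_left: "\<And>x. x \<in> carrier H \<Longrightarrow>
      tlift H (\<lambda>a b. antipode H a \<otimes>\<^bsub>H\<^esub> b) (comult H x) = counit H x \<odot>\<^bsub>H\<^esub> \<one>\<^bsub>H\<^esub>"
    and antipode_right: "\<And>x. x \<in> carrier H \<Longrightarrow>
      tlift H (\<lambda>a b. a \<otimes>\<^bsub>H\<^esub> antipode H b) (comult H x) = counit H x \<odot>\<^bsub>H\<^esub> \<one>\<^bsub>H\<^esub>"
    and antipode_bij: "bij_betw (antipode H) (carrier H) (carrier H)"

text \<open>\<open>leg12 k H X = X \<otimes> 1\<close>, \<open>leg13 k H X = X\<^sub>1 \<otimes> 1 \<otimes> X\<^sub>2\<close>, \<open>leg23 k H X = 1 \<otimes> X\<close>.\<close>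

definition leg12 where
  "leg12 k H X = X \<boxtimes>\<^bsub>tensor3 k H\<^esub> \<one>\<^bsub>H\<^esub>"
definition leg13 where
  "leg13 k H X = tmap (tensor3 k H) (\<lambda>a. a \<boxtimes>\<^bsub>tensor2 k H\<^esub> \<one>\<^bsub>H\<^esub>) (\<lambda>b. b) X"
definition leg23 where
  "leg23 k H X = tmap (tensor3 k H) (\<lambda>a. \<one>\<^bsub>H\<^esub> \<boxtimes>\<^bsub>tensor2 k H\<^esub> a) (\<lambda>b. b) X"

locale quasitriangular_hopf = hopf_algebra k H
  for k :: "('k, 'x) ring_scheme" and H :: "('k, 'h, 'y) hopf_scheme" +
  fixes R :: "('h, 'h) tens"
  assumes R_invertible: "R \<in> Units (tensor2 k H)"
    and comult_R_left:
      "tmap (tensor3 k H) (comult H) (\<lambda>b. b) R = leg13 k H R \<otimes>\<^bsub>tensor3 k H\<^esub> leg23 k H R"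
    and comult_R_right:
      "tmap_right (tensor2 k H) (tensor3 k H) (comult H) R
         = leg13 k H R \<otimes>\<^bsub>tensor3 k H\<^esub> leg12 k H R"
    and R_comult: "\<And>x. x \<in> carrier H \<Longrightarrow>
      R \<otimes>\<^bsub>tensor2 k H\<^esub> comult H x = tflip (tensor2 k H) (comult H x) \<otimes>\<^bsub>tensor2 k H\<^esub> R"

locale commutative_module_algebra = quasitriangular_hopf k H R
  for k :: "('k, 'x) ring_scheme" and H :: "('k, 'h, 'y) hopf_scheme" and R +
  fixes L :: "('k, 'l, 'z) module_scheme" and act :: "'h \<Rightarrow> 'l \<Rightarrow> 'l"
  assumes L_algebra: "k_algebra k L"
    and act_closed: "\<And>x l. \<lbrakk>x \<in> carrier H; l \<in> carrier L\<rbrakk> \<Longrightarrow> act x l \<in> carrier L"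
    and act_add_left: "\<And>x y l. \<lbrakk>x \<in> carrier H; y \<in> carrier H; l \<in> carrier L\<rbrakk> \<Longrightarrow>
      act (x \<oplus>\<^bsub>H\<^esub> y) l = act x l \<oplus>\<^bsub>L\<^esub> act y l"
    and act_add_right: "\<And>x l m. \<lbrakk>x \<in> carrier H; l \<in> carrier L; m \<in> carrier L\<rbrakk> \<Longrightarrow>
      act x (l \<oplus>\<^bsub>L\<^esub> m) = act x l \<oplus>\<^bsub>L\<^esub> act x m"
    and act_smult_left: "\<And>r x l. \<lbrakk>r \<in> carrier k; x \<in> carrier H; l \<in> carrier L\<rbrakk> \<Longrightarrow>
      act (r \<odot>\<^bsub>H\<^esub> x) l = r \<odot>\<^bsub>L\<^esub> act x l"
    and act_smult_right: "\<And>r x l. \<lbrakk>r \<in> carrier k; x \<in> carrier H; l \<in> carrier L\<rbrakk> \<Longrightarrow>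
      act x (r \<odot>\<^bsub>L\<^esub> l) = r \<odot>\<^bsub>L\<^esub> act x l"
    and act_mult: "\<And>x y l. \<lbrakk>x \<in> carrier H; y \<in> carrier H; l \<in> carrier L\<rbrakk> \<Longrightarrow>
      act (x \<otimes>\<^bsub>H\<^esub> y) l = act x (act y l)"
    and act_one: "\<And>l. l \<in> carrier L \<Longrightarrow> act \<one>\<^bsub>H\<^esub> l = l"
    and act_prod: "\<And>x l m. \<lbrakk>x \<in> carrier H; l \<in> carrier L; m \<in> carrier L\<rbrakk> \<Longrightarrow>
      act x (l \<otimes>\<^bsub>L\<^esub> m) = tlift L (\<lambda>a b. act a l \<otimes>\<^bsub>L\<^esub> act b m) (comult H x)"
    and act_unit: "\<And>x. x \<in> carrier H \<Longrightarrow> act x \<one>\<^bsub>L\<^esub> = counit H x \<odot>\<^bsub>L\<^esub> \<one>\<^bsub>L\<^esub>"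
    and H_commutative: "\<And>l m. \<lbrakk>l \<in> carrier L; m \<in> carrier L\<rbrakk> \<Longrightarrow>
      l \<otimes>\<^bsub>L\<^esub> m = tlift L (\<lambda>r1 r2. act r2 m \<otimes>\<^bsub>L\<^esub> act r1 l) R"


section \<open>Bialgebroids and quantum groupoids\<close>

record ('k, 'l, 'b) bialgebroid = "('k, 'b) module" +
  src :: "'l \<Rightarrow> 'b"
  tgt :: "'l \<Rightarrow> 'b"
  cop :: "'b \<Rightarrow> ('b, 'b) tens"
  cou :: "'b \<Rightarrow> 'l"

record ('k, 'l, 'b) quantum_groupoid = "('k, 'l, 'b) bialgebroid" +
  rmat :: "('b, 'b) tens"

text \<open>\<open>A \<otimes>\<^sub>L A\<close> with respect to maps \<open>s, t : L \<rightarrow> A\<close>: here \<open>t(l) a \<otimes> b = a \<otimes> s(l) b\<close>.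
  In \<open>btensor3\<close> the base acts on \<open>A \<otimes>\<^sub>L A\<close> from the right through the second factor.\<close>

definition btensor ::
  "('l, 'x) ring_scheme \<Rightarrow> ('l \<Rightarrow> 'b) \<Rightarrow> ('l \<Rightarrow> 'b) \<Rightarrow> ('b, 'y) ring_scheme \<Rightarrow> ('b, 'b) tens ring" where
  "btensor L s t A = tensor (carrier L) (\<lambda>l a. t l \<otimes>\<^bsub>A\<^esub> a) (\<lambda>l b. s l \<otimes>\<^bsub>A\<^esub> b) A A"

definition btensor3 ::
  "('l, 'x) ring_scheme \<Rightarrow> ('l \<Rightarrow> 'b) \<Rightarrow> ('l \<Rightarrow> 'b) \<Rightarrow> ('b, 'y) ring_scheme \<Rightarrow>
   (('b, 'b) tens, 'b) tens ring" where
  "btensor3 L s t A = tensor (carrier L)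
     (\<lambda>l. tmap (btensor L s t A) (\<lambda>a. a) (\<lambda>b. t l \<otimes>\<^bsub>A\<^esub> b)) (\<lambda>l b. s l \<otimes>\<^bsub>A\<^esub> b)
     (btensor L s t A) A"

text \<open>\<open>B \<otimes>\<^sub>L B\<close> and \<open>B \<otimes> B\<close> over \<open>L\<^sub>o\<^sub>p\<close> (where \<open>s(l) a \<otimes> b = a \<otimes> t(l) b\<close>), and the
  corresponding triple products.\<close>

abbreviation over_L where "over_L L B \<equiv> btensor L (src B) (tgt B) B"
abbreviation over_L3 where "over_L3 L B \<equiv> btensor3 L (src B) (tgt B) B"
abbreviation over_Lop where "over_Lop L B \<equiv> btensor L (tgt B) (src B) B"
abbreviation over_Lop3 where "over_Lop3 L B \<equiv> btensor3 L (tgt B) (src B) B"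

definition cop_op ::
  "('l, 'x) ring_scheme \<Rightarrow> ('k, 'l, 'b, 'y) bialgebroid_scheme \<Rightarrow> 'b \<Rightarrow> ('b, 'b) tens" where
  "cop_op L B a = tflip (over_Lop L B) (cop B a)"

locale bialgebroid =
  fixes k :: "('k, 'x) ring_scheme" and L :: "('k, 'l, 'y) module_scheme"
    and B :: "('k, 'l, 'b, 'z) bialgebroid_scheme"
  assumes base_algebra: "k_algebra k L"
    and total_algebra: "k_algebra k B"
    and src_hom: "src B \<in> alg_hom k L B"
    and tgt_antihom: "tgt B \<in> alg_hom k (opp L) B"
    and src_tgt_commute: "\<And>l m. \<lbrakk>l \<in> carrier L; m \<in> carrier L\<rbrakk> \<Longrightarrow>
      src B l \<otimes>\<^bsub>B\<^esub> tgt B m = tgt B m \<otimes>\<^bsub>B\<^esub> src B l"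
    and cop_closed: "\<And>a. a \<in> carrier B \<Longrightarrow> cop B a \<in> carrier (over_L L B)"
    and cop_add: "\<And>a b. \<lbrakk>a \<in> carrier B; b \<in> carrier B\<rbrakk> \<Longrightarrow>
      cop B (a \<oplus>\<^bsub>B\<^esub> b) = cop B a \<oplus>\<^bsub>over_L L B\<^esub> cop B b"
    and cop_src: "\<And>l a. \<lbrakk>l \<in> carrier L; a \<in> carrier B\<rbrakk> \<Longrightarrow>
      cop B (src B l \<otimes>\<^bsub>B\<^esub> a) = tmap (over_L L B) (\<lambda>x. src B l \<otimes>\<^bsub>B\<^esub> x) (\<lambda>y. y) (cop B a)"
    and cop_tgt: "\<And>l a. \<lbrakk>l \<in> carrier L; a \<in> carrier B\<rbrakk> \<Longrightarrow>
      cop B (tgt B l \<otimes>\<^bsub>B\<^esub> a) = tmap (over_L L B) (\<lambda>x. x) (\<lambda>y. tgt B l \<otimes>\<^bsub>B\<^esub> y) (cop B a)"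
    and coassoc: "\<And>a. a \<in> carrier B \<Longrightarrow>
      tmap (over_L3 L B) (cop B) (\<lambda>b. b) (cop B a) =
      tmap_right (over_L L B) (over_L3 L B) (cop B) (cop B a)"
    and cop_takeuchi: "\<And>l a. \<lbrakk>l \<in> carrier L; a \<in> carrier B\<rbrakk> \<Longrightarrow>
      tmul_pure (over_L L B) B B (cop B a) (tgt B l) \<one>\<^bsub>B\<^esub> =
      tmul_pure (over_L L B) B B (cop B a) \<one>\<^bsub>B\<^esub> (src B l)"
    and cop_mult: "\<And>a b. \<lbrakk>a \<in> carrier B; b \<in> carrier B\<rbrakk> \<Longrightarrow>
      cop B (a \<otimes>\<^bsub>B\<^esub> b) = tmul (over_L L B) B B (cop B a) (cop B b)"
    and cop_one: "cop B \<one>\<^bsub>B\<^esub> = \<one>\<^bsub>B\<^esub> \<boxtimes>\<^bsub>over_L L B\<^esub> \<one>\<^bsub>B\<^esub>"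
    and cou_closed: "\<And>a. a \<in> carrier B \<Longrightarrow> cou B a \<in> carrier L"
    and cou_add: "\<And>a b. \<lbrakk>a \<in> carrier B; b \<in> carrier B\<rbrakk> \<Longrightarrow>
      cou B (a \<oplus>\<^bsub>B\<^esub> b) = cou B a \<oplus>\<^bsub>L\<^esub> cou B b"
    and cou_src: "\<And>l a. \<lbrakk>l \<in> carrier L; a \<in> carrier B\<rbrakk> \<Longrightarrow>
      cou B (src B l \<otimes>\<^bsub>B\<^esub> a) = l \<otimes>\<^bsub>L\<^esub> cou B a"
    and cou_tgt: "\<And>l a. \<lbrakk>l \<in> carrier L; a \<in> carrier B\<rbrakk> \<Longrightarrow>
      cou B (tgt B l \<otimes>\<^bsub>B\<^esub> a) = cou B a \<otimes>\<^bsub>L\<^esub> l"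
    and cou_one: "cou B \<one>\<^bsub>B\<^esub> = \<one>\<^bsub>L\<^esub>"
    and cou_mult_src: "\<And>a b. \<lbrakk>a \<in> carrier B; b \<in> carrier B\<rbrakk> \<Longrightarrow>
      cou B (a \<otimes>\<^bsub>B\<^esub> src B (cou B b)) = cou B (a \<otimes>\<^bsub>B\<^esub> b)"
    and cou_mult_tgt: "\<And>a b. \<lbrakk>a \<in> carrier B; b \<in> carrier B\<rbrakk> \<Longrightarrow>
      cou B (a \<otimes>\<^bsub>B\<^esub> tgt B (cou B b)) = cou B (a \<otimes>\<^bsub>B\<^esub> b)"
    and cou_left: "\<And>a. a \<in> carrier B \<Longrightarrow> tlift B (\<lambda>x y. src B (cou B x) \<otimes>\<^bsub>B\<^esub> y) (cop B a) = a"
    and cou_right: "\<And>a. a \<in> carrier B \<Longrightarrow> tlift B (\<lambda>x y. tgt B (cou B y) \<otimes>\<^bsub>B\<^esub> x) (cop B a) = a"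

text \<open>\<open>Q'\<close> is the inverse of the universal R-matrix \<open>Q\<close>, living in \<open>B \<otimes>\<^sub>L B\<close>.\<close>

definition rmat_inverse ::
  "('l, 'x) ring_scheme \<Rightarrow> ('k, 'l, 'b, 'y) bialgebroid_scheme \<Rightarrow>
   ('b, 'b) tens \<Rightarrow> ('b, 'b) tens \<Rightarrow> bool" where
  "rmat_inverse L B Q Q' \<longleftrightarrow>
     Q' \<in> carrier (over_L L B) \<and>
     (\<forall>l\<in>carrier L. tmul_pure (over_L L B) B B Q' (src B l) \<one>\<^bsub>B\<^esub> =
                    tmul_pure (over_L L B) B B Q' \<one>\<^bsub>B\<^esub> (tgt B l)) \<and>
     tmul (over_Lop L B) B B Q Q' = \<one>\<^bsub>B\<^esub> \<boxtimes>\<^bsub>over_Lop L B\<^esub> \<one>\<^bsub>B\<^esub> \<and>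
     tmul (over_L L B) B B Q' Q = \<one>\<^bsub>B\<^esub> \<boxtimes>\<^bsub>over_L L B\<^esub> \<one>\<^bsub>B\<^esub>"

text \<open>In the two hexagon axioms the right-hand sides are \<open>Q\<^sub>1 \<otimes> Q (1 \<otimes> Q\<^sub>2)\<close> and
  \<open>Q (Q\<^sub>1 \<otimes> 1) \<otimes> Q\<^sub>2\<close>.\<close>

locale quantum_groupoid = bialgebroid k L B
  for k :: "('k, 'x) ring_scheme" and L :: "('k, 'l, 'y) module_scheme"
    and B :: "('k, 'l, 'b, 'z) quantum_groupoid_scheme" +
  assumes rmat_closed: "rmat B \<in> carrier (over_Lop L B)"
    and rmat_balanced: "\<And>l. l \<in> carrier L \<Longrightarrow>
      tmul_pure (over_Lop L B) B B (rmat B) (tgt B l) \<one>\<^bsub>B\<^esub> =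
      tmul_pure (over_Lop L B) B B (rmat B) \<one>\<^bsub>B\<^esub> (src B l)"
    and rmat_cop: "\<And>a. a \<in> carrier B \<Longrightarrow>
      tmul (over_Lop L B) B B (rmat B) (cop B a) = tmul (over_Lop L B) B B (cop_op L B a) (rmat B)"
    and hexagon_left:
      "tmap (over_Lop3 L B) (cop_op L B) (\<lambda>b. b) (rmat B) =
       tmap_right (over_Lop L B) (over_Lop3 L B)
         (\<lambda>b. tmul_pure (over_Lop L B) B B (rmat B) \<one>\<^bsub>B\<^esub> b) (rmat B)"
    and hexagon_right:
      "tmap_right (over_Lop L B) (over_Lop3 L B) (cop_op L B) (rmat B) =
       tmap (over_Lop3 L B)
         (\<lambda>a. tmul_pure (over_Lop L B) B B (rmat B) a \<one>\<^bsub>B\<^esub>) (\<lambda>b. b) (rmat B)"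
    and rmat_invertible: "\<exists>Q'. rmat_inverse L B (rmat B) Q'"

definition coopposite ::
  "('l, 'x) ring_scheme \<Rightarrow> ('k, 'l, 'b, 'y) quantum_groupoid_scheme \<Rightarrow>
   ('k, 'l, 'b, 'y) quantum_groupoid_scheme" where
  "coopposite L B = B\<lparr>src := tgt B, tgt := src B, cop := cop_op L B,
     rmat := (THE Q'. rmat_inverse L B (rmat B) Q')\<rparr>"

definition bialgebroid_iso where
  "bialgebroid_iso k L A B f \<longleftrightarrow>
     bialgebroid k L A \<and> bialgebroid k L B \<and>
     f \<in> alg_hom k A B \<and> bij_betw f (carrier A) (carrier B) \<and>
     (\<forall>l\<in>carrier L. \<forall>a\<in>carrier A. f (src A l \<otimes>\<^bsub>A\<^esub> a) = src B l \<otimes>\<^bsub>B\<^esub> f a) \<and>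
     (\<forall>l\<in>carrier L. \<forall>a\<in>carrier A. f (tgt A l \<otimes>\<^bsub>A\<^esub> a) = tgt B l \<otimes>\<^bsub>B\<^esub> f a) \<and>
     (\<forall>a\<in>carrier A. cop B (f a) = tmap (over_L L B) f f (cop A a)) \<and>
     (\<forall>a\<in>carrier A. cou B (f a) = cou A a)"

definition quantum_groupoid_iso where
  "quantum_groupoid_iso k L A B f \<longleftrightarrow>
     quantum_groupoid k L A \<and> quantum_groupoid k L B \<and> bialgebroid_iso k L A B f \<and>
     tmap (over_Lop L B) f f (rmat A) = rmat B"


section \<open>The smash product bialgebroid and its quotient\<close>

definition smash_algebra ::
  "('k, 'x) ring_scheme \<Rightarrow> ('k, 'h, 'y) hopf_scheme \<Rightarrow> ('k, 'l, 'z) module_scheme \<Rightarrow>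
   ('h \<Rightarrow> 'l \<Rightarrow> 'l) \<Rightarrow> ('k, ('l, 'h) tens) module" where
  "smash_algebra k H L act =
    (let T = ktensor k L H
     in T\<lparr>mult := (\<lambda>X Y. tlift T (\<lambda>l f. tlift T (\<lambda>m g. tlift T (\<lambda>f1 f2.
            (l \<otimes>\<^bsub>L\<^esub> act f1 m) \<boxtimes>\<^bsub>T\<^esub> (f2 \<otimes>\<^bsub>H\<^esub> g)) (comult H f)) Y) X)\<rparr>)"

definition smash ::
  "('k, 'x) ring_scheme \<Rightarrow> ('k, 'h, 'y) hopf_scheme \<Rightarrow> ('h, 'h) tens \<Rightarrow>
   ('k, 'l, 'z) module_scheme \<Rightarrow> ('h \<Rightarrow> 'l \<Rightarrow> 'l) \<Rightarrow> ('k, 'l, ('l, 'h) tens) bialgebroid" where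
  "smash k H R L act =
    (let A = smash_algebra k H L act;
         s = (\<lambda>l. l \<boxtimes>\<^bsub>A\<^esub> \<one>\<^bsub>H\<^esub>);
         t = (\<lambda>l. tlift A (\<lambda>r1 r2. act r2 l \<boxtimes>\<^bsub>A\<^esub> r1) R);
         T = btensor L s t A
     in \<lparr>carrier = carrier A, mult = mult A, one = one A, zero = zero A, add = add A,
         smult = smult A, src = s, tgt = t,
         cop = tlift T (\<lambda>l h. tlift T (\<lambda>h1 h2.
                 (l \<boxtimes>\<^bsub>A\<^esub> h1) \<boxtimes>\<^bsub>T\<^esub> (\<one>\<^bsub>L\<^esub> \<boxtimes>\<^bsub>A\<^esub> h2)) (comult H h)),
         cou = tlift L (\<lambda>l h. counit H h \<odot>\<^bsub>L\<^esub> l)\<rparr>)"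

definition phi ::
  "('k, 'x) ring_scheme \<Rightarrow> ('k, 'h, 'y) hopf_scheme \<Rightarrow> ('h, 'h) tens \<Rightarrow>
   ('k, 'l, 'z) module_scheme \<Rightarrow> ('h \<Rightarrow> 'l \<Rightarrow> 'l) \<Rightarrow> ('l, 'h) tens \<Rightarrow> ('l, 'h) tens" where
  "phi k H R L act =
    (let A = smash k H R L act
     in tlift A (\<lambda>l h. tlift A (\<lambda>r1 r2. tlift A (\<lambda>r1' r2'.
          act (r2 \<otimes>\<^bsub>H\<^esub> r1') l \<boxtimes>\<^bsub>A\<^esub> (r1 \<otimes>\<^bsub>H\<^esub> r2' \<otimes>\<^bsub>H\<^esub> h)) R) R))"

definition left_ideal :: "'a set \<Rightarrow> ('a, 'x) ring_scheme \<Rightarrow> bool" where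
  "left_ideal I A \<longleftrightarrow>
     additive_subgroup I A \<and> (\<forall>a\<in>carrier A. \<forall>x\<in>I. a \<otimes>\<^bsub>A\<^esub> x \<in> I)"

definition J_phi ::
  "('k, 'x) ring_scheme \<Rightarrow> ('k, 'h, 'y) hopf_scheme \<Rightarrow> ('h, 'h) tens \<Rightarrow>
   ('k, 'l, 'z) module_scheme \<Rightarrow> ('h \<Rightarrow> 'l \<Rightarrow> 'l) \<Rightarrow> ('l, 'h) tens set" where
  "J_phi k H R L act =
    (let A = smash k H R L act
     in \<Inter>{I. left_ideal I A \<and> (\<forall>x\<in>carrier A. phi k H R L act x \<ominus>\<^bsub>A\<^esub> x \<in> I)})"

text \<open>The quotient bialgebroid by a biideal \<open>J\<close>; the operations are induced from those of \<open>B\<close>.\<close>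

definition bialgebroid_quotient ::
  "('l, 'x) ring_scheme \<Rightarrow> ('k, 'l, 'b, 'y) bialgebroid_scheme \<Rightarrow> 'b set \<Rightarrow>
   ('k, 'l, 'b set) bialgebroid" where
  "bialgebroid_quotient L B J =
    (let A = B Quot J;
         \<pi> = (\<lambda>x. J +>\<^bsub>B\<^esub> x);
         s = (\<lambda>l. \<pi> (src B l));
         t = (\<lambda>l. \<pi> (tgt B l));
         T = btensor L s t A
     in \<lparr>carrier = carrier A, mult = mult A, one = one A, zero = zero A, add = add A,
         smult = (\<lambda>r X. the_elem ((\<lambda>x. \<pi> (r \<odot>\<^bsub>B\<^esub> x)) ` X)),
         src = s, tgt = t,
         cop = (\<lambda>X. the_elem ((\<lambda>x. tmap T \<pi> \<pi> (cop B x)) ` X)),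
         cou = (\<lambda>X. the_elem (cou B ` X))\<rparr>)"

text \<open>\<open>H\<^sub>L\<close>, with universal R-matrix the image of
  \<open>(1 \<otimes> R\<^sub>1) \<otimes> (1 \<otimes> R\<^sub>2)\<close>.\<close>

definition dynamical_quotient ::
  "('k, 'x) ring_scheme \<Rightarrow> ('k, 'h, 'y) hopf_scheme \<Rightarrow> ('h, 'h) tens \<Rightarrow>
   ('k, 'l, 'z) module_scheme \<Rightarrow> ('h \<Rightarrow> 'l \<Rightarrow> 'l) \<Rightarrow>
   ('k, 'l, ('l, 'h) tens set) quantum_groupoid" where
  "dynamical_quotient k H R L act =
    (let A = smash k H R L act;
         J = J_phi k H R L act;
         B = bialgebroid_quotient L A J;
         j = (\<lambda>h. J +>\<^bsub>A\<^esub> (\<one>\<^bsub>L\<^esub> \<boxtimes>\<^bsub>A\<^esub> h))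
     in bialgebroid.extend B (quantum_groupoid.fields (tmap (over_Lop L B) j j R)))"


section \<open>Opposites and the antipode map\<close>

definition antipode_inv :: "('k, 'h, 'y) hopf_scheme \<Rightarrow> 'h \<Rightarrow> 'h" where
  "antipode_inv H = inv_into (carrier H) (antipode H)"

definition hopf_op :: "('k, 'h, 'y) hopf_scheme \<Rightarrow> ('k, 'h, 'y) hopf_scheme" where
  "hopf_op H = (opp H)\<lparr>antipode := antipode_inv H\<rparr>"

definition act_op :: "('k, 'h, 'y) hopf_scheme \<Rightarrow> ('h \<Rightarrow> 'l \<Rightarrow> 'l) \<Rightarrow> 'h \<Rightarrow> 'l \<Rightarrow> 'l" where
  "act_op H act x l = act (antipode_inv H x) l"

abbreviation smash_op where
  "smash_op k H R L act \<equiv>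
     smash k (hopf_op H) (inv\<^bsub>tensor2 k H\<^esub> R) (opp L) (act_op H act)"

abbreviation J_phi_op where
  "J_phi_op k H R L act \<equiv>
     J_phi k (hopf_op H) (inv\<^bsub>tensor2 k H\<^esub> R) (opp L) (act_op H act)"

abbreviation dynamical_quotient_op where
  "dynamical_quotient_op k H R L act \<equiv>
     dynamical_quotient k (hopf_op H) (inv\<^bsub>tensor2 k H\<^esub> R) (opp L) (act_op H act)"

definition drinfeld :: "('k, 'h, 'y) hopf_scheme \<Rightarrow> ('h, 'h) tens \<Rightarrow> 'h" where
  "drinfeld H R = tlift H (\<lambda>r1 r2. r1 \<otimes>\<^bsub>H\<^esub> antipode H r2) R"

text \<open>The identification of the algebra \<open>L\<^sub>o\<^sub>p \<rtimes> H\<^sub>o\<^sub>p\<close> with the opposite of \<open>L \<rtimes> H\<close>,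
  \<open>l \<otimes> h \<mapsto> (1 \<otimes> h) (l \<otimes> 1)\<close>.\<close>

definition smash_op_identification ::
  "('k, 'x) ring_scheme \<Rightarrow> ('k, 'h, 'y) hopf_scheme \<Rightarrow> ('h, 'h) tens \<Rightarrow>
   ('k, 'l, 'z) module_scheme \<Rightarrow> ('h \<Rightarrow> 'l \<Rightarrow> 'l) \<Rightarrow> ('l, 'h) tens \<Rightarrow> ('l, 'h) tens" where
  "smash_op_identification k H R L act =
    (let A = smash k H R L act
     in tlift A (\<lambda>l h. (\<one>\<^bsub>L\<^esub> \<boxtimes>\<^bsub>A\<^esub> h) \<otimes>\<^bsub>A\<^esub> (l \<boxtimes>\<^bsub>A\<^esub> \<one>\<^bsub>H\<^esub>)))"

text \<open>The antipode \<open>\<gamma>(l \<otimes> h) = (1 \<otimes> \<gamma>(h)) t(v\<^sup>-\<^sup>1 \<rhd> l)\<close>: the formula is evaluated in \<open>L \<rtimes> H\<close>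
  and then transported to \<open>L\<^sub>o\<^sub>p \<rtimes> H\<^sub>o\<^sub>p\<close> along the inverse of the identification.\<close>

definition smash_antipode ::
  "('k, 'x) ring_scheme \<Rightarrow> ('k, 'h, 'y) hopf_scheme \<Rightarrow> ('h, 'h) tens \<Rightarrow>
   ('k, 'l, 'z) module_scheme \<Rightarrow> ('h \<Rightarrow> 'l \<Rightarrow> 'l) \<Rightarrow> ('l, 'h) tens \<Rightarrow> ('l, 'h) tens" where
  "smash_antipode k H R L act X =
    (let A = smash k H R L act;
         v = drinfeld H R
     in inv_into (carrier (smash_op k H R L act)) (smash_op_identification k H R L act)
          (tlift A (\<lambda>l h. (\<one>\<^bsub>L\<^esub> \<boxtimes>\<^bsub>A\<^esub> antipode H h) \<otimes>\<^bsub>A\<^esub> tgt A (act (inv\<^bsub>H\<^esub> v) l)) X))"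

end

theory Submission
  imports Defs
begin

text \<open>\<open>H\<^sub>L\<close> is presented by the algebra maps \<open>s : L \<rightarrow> B\<close> and \<open>i : H \<rightarrow> B\<close> subject to the smash product
  relations and \<open>t\<^sup>+ = t\<^sup>-\<close>, where \<open>t\<^sup>\<plusminus>\<close> are formed with \<open>R\<close> and \<open>R\<^sup>-\<^sup>1\<^sub>2\<^sub>1\<close>. The coopposite of \<open>(H\<^sub>L)\<^sub>o\<^sub>p\<close>
  carries maps of the same kind, namely its own source and \<open>h \<mapsto> [\<gamma>(h)]\<close>, because
  \<open>(\<gamma> \<otimes> \<gamma>)(R) = R\<close>. The two universal properties give mutually inverse algebra maps; coproduct, counit and
  R-matrix are determined on the generators, so these respect the whole structure. The formula for \<open>\<gamma>\<close>
  acquires the Drinfeld element because the identification of the smash product of the opposites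
  with the opposite smash product reverses the order of the two factors.\<close>

section \<open>Sweedler sums and balanced tensor products\<close>

text \<open>Over a noncommutative base the tensor square is not a ring: right multiplication by c
  \<otimes> d is always defined, but a product of two tensors needs a balancing condition.
  Identities are therefore proved as Sweedler sums over fixed lists representing \<Delta>(h), R and
  R^-1; a balanced map evaluated on such a list depends only on the tensor, so every question of
  well-definedness becomes the balancedness of a summand.

  The relation t^+ = t^- is hidden in the generators phi(x) - x of J: one has l \<otimes> h = sum
  t^-(R_1 \<rhd> l) R_2 h, and phi replaces t^- by t^+ in this expression. The two maps are related
  by a symmetry: R^-1_21 is again a universal R-matrix for which L is commutative, and passing to it
  exchanges t^+ with t^-. Statements about t^- are instances of those about t^+.

  That the structure descends is not proved by describing \<Delta>(J): the projected coproduct, the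
  counit and the induced algebra maps each have a kernel closed under left multiplication and do not
  distinguish t^+(l) h from t^-(l) h, which forces them to vanish on J.\<close>

definition ahom :: "('a, 'x) ring_scheme \<Rightarrow> ('b, 'y) ring_scheme \<Rightarrow> ('a \<Rightarrow> 'b) \<Rightarrow> bool" where
  "ahom G K h \<longleftrightarrow> abelian_group G \<and> abelian_group K \<and> (\<forall>x\<in>carrier G. h x \<in> carrier K) \<and>
     (\<forall>x\<in>carrier G. \<forall>y\<in>carrier G. h (x \<oplus>\<^bsub>G\<^esub> y) = h x \<oplus>\<^bsub>K\<^esub> h y)"

lemma ahomI:
  assumes "abelian_group G" "abelian_group K" "\<And>x. x \<in> carrier G \<Longrightarrow> h x \<in> carrier K"
    "\<And>x y. x \<in> carrier G \<Longrightarrow> y \<in> carrier G \<Longrightarrow> h (x \<oplus>\<^bsub>G\<^esub> y) = h x \<oplus>\<^bsub>K\<^esub> h y"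
  shows "ahom G K h"
  using assms by (auto simp: ahom_def)

lemma ahom_closed: "ahom G K h \<Longrightarrow> x \<in> carrier G \<Longrightarrow> h x \<in> carrier K"
  and ahom_add: "ahom G K h \<Longrightarrow> x \<in> carrier G \<Longrightarrow> y \<in> carrier G \<Longrightarrow> h (x \<oplus>\<^bsub>G\<^esub> y) = h x \<oplus>\<^bsub>K\<^esub> h y"
  by (auto simp: ahom_def)

lemma ahom_group_hom:
  assumes "ahom G K h"
  shows "group_hom (add_monoid G) (add_monoid K) h"
  using assms
  by (auto simp: ahom_def group_hom_def group_hom_axioms_def hom_def abelian_group_def
      abelian_group_axioms_def comm_group_def)

lemma ahom_zero:
  assumes "ahom G K h"
  shows "h \<zero>\<^bsub>G\<^esub> = \<zero>\<^bsub>K\<^esub>"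
  using group_hom.hom_one[OF ahom_group_hom[OF assms]] by simp

lemma ahom_neg:
  assumes "ahom G K h" "x \<in> carrier G"
  shows "h (\<ominus>\<^bsub>G\<^esub> x) = \<ominus>\<^bsub>K\<^esub> h x"
  using group_hom.hom_inv[OF ahom_group_hom[OF assms(1)], of x] assms(2) by (simp add: a_inv_def)

lemma ahom_minus:
  assumes "ahom G K h" "x \<in> carrier G" "y \<in> carrier G"
  shows "h (x \<ominus>\<^bsub>G\<^esub> y) = h x \<ominus>\<^bsub>K\<^esub> h y"
proof -
  interpret G: abelian_group G using assms(1) by (simp add: ahom_def)
  show ?thesis using assms by (simp add: a_minus_def ahom_add ahom_neg)
qed

lemma ahom_comp: "ahom G K h \<Longrightarrow> ahom K M g \<Longrightarrow> ahom G M (\<lambda>x. g (h x))"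
  by (auto simp: ahom_def)

text \<open>Sweedler sums: a tensor is given by a list of pairs. Pairs outside \<open>P \<times> P\<close> are skipped, so that
  closure and congruence hold without hypotheses on the list.\<close>

definition Sm :: "'a set \<Rightarrow> ('g, 'x) ring_scheme \<Rightarrow> ('a \<times> 'a) list \<Rightarrow> ('a \<Rightarrow> 'a \<Rightarrow> 'g) \<Rightarrow> 'g" where
  "Sm P G xs f = foldr (\<lambda>p z. if fst p \<in> P \<and> snd p \<in> P then f (fst p) (snd p) \<oplus>\<^bsub>G\<^esub> z else z) xs \<zero>\<^bsub>G\<^esub>"

lemma Sm_Nil [simp]: "Sm P G [] f = \<zero>\<^bsub>G\<^esub>"
  and Sm_Cons: "Sm P G (p # xs) f =
    (if fst p \<in> P \<and> snd p \<in> P then f (fst p) (snd p) \<oplus>\<^bsub>G\<^esub> Sm P G xs f else Sm P G xs f)"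
  by (simp_all add: Sm_def)

text \<open>As a congruence rule it hands the simplifier the membership of both components in
  \<open>P\<close> while the summand is rewritten; this discharges the carrier conditions inside
  nested sums.\<close>

lemma Sm_cong [cong]:
  assumes "P = P'" "G = G'" "xs = ys" "\<And>a b. a \<in> P' \<Longrightarrow> b \<in> P' \<Longrightarrow> f a b = g a b"
  shows "Sm P G xs f = Sm P' G' ys g"
  unfolding assms(1-3) using assms(4) by (induction ys) (auto simp: Sm_Cons)

lemma Sm_cong':
  assumes "\<And>a b. a \<in> P \<Longrightarrow> b \<in> P \<Longrightarrow> f a b = g a b"
  shows "Sm P G xs f = Sm P G xs g"
  using assms by simp

lemma Sm_closed [simp]:
  assumes "abelian_group G" "\<And>a b. a \<in> P \<Longrightarrow> b \<in> P \<Longrightarrow> f a b \<in> carrier G"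
  shows "Sm P G xs f \<in> carrier G"
proof -
  interpret abelian_group G by fact
  show ?thesis using assms(2) by (induction xs) (auto simp: Sm_Cons)
qed

lemma Sm_hom:
  assumes "ahom G K h" "\<And>a b. a \<in> P \<Longrightarrow> b \<in> P \<Longrightarrow> f a b \<in> carrier G"
  shows "h (Sm P G xs f) = Sm P K xs (\<lambda>a b. h (f a b))"
proof -
  have "abelian_group G" using assms(1) by (simp add: ahom_def)
  then show ?thesis using assms
    by (induction xs) (auto simp: Sm_Cons ahom_zero ahom_add)
qed

lemma Sm_zero [simp]:
  assumes "abelian_group G"
  shows "Sm P G xs (\<lambda>a b. \<zero>\<^bsub>G\<^esub>) = \<zero>\<^bsub>G\<^esub>"
proof -
  interpret abelian_group G by fact
  show ?thesis by (induction xs) (auto simp: Sm_Cons)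
qed

lemma Sm_add [simp]:
  assumes "abelian_group G" "\<And>a b. a \<in> P \<Longrightarrow> b \<in> P \<Longrightarrow> f a b \<in> carrier G"
    "\<And>a b. a \<in> P \<Longrightarrow> b \<in> P \<Longrightarrow> g a b \<in> carrier G"
  shows "Sm P G xs (\<lambda>a b. f a b \<oplus>\<^bsub>G\<^esub> g a b) = Sm P G xs f \<oplus>\<^bsub>G\<^esub> Sm P G xs g"
proof -
  interpret abelian_group G by fact
  show ?thesis using assms by (induction xs) (auto simp: Sm_Cons a_ac)
qed

lemma Sm_neg:
  assumes "abelian_group G" "\<And>a b. a \<in> P \<Longrightarrow> b \<in> P \<Longrightarrow> f a b \<in> carrier G"
  shows "Sm P G xs (\<lambda>a b. \<ominus>\<^bsub>G\<^esub> f a b) = \<ominus>\<^bsub>G\<^esub> Sm P G xs f"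
proof -
  interpret abelian_group G by fact
  have "ahom G G (\<lambda>x. \<ominus>\<^bsub>G\<^esub> x)" by (rule ahomI) (auto simp: minus_add assms(1))
  from Sm_hom[where f=f and P=P and xs=xs, OF this assms(2)] show ?thesis by simp
qed

lemma Sm_minus:
  assumes "abelian_group G" "\<And>a b. a \<in> P \<Longrightarrow> b \<in> P \<Longrightarrow> f a b \<in> carrier G"
    "\<And>a b. a \<in> P \<Longrightarrow> b \<in> P \<Longrightarrow> g a b \<in> carrier G"
  shows "Sm P G xs (\<lambda>a b. f a b \<ominus>\<^bsub>G\<^esub> g a b) = Sm P G xs f \<ominus>\<^bsub>G\<^esub> Sm P G xs g"
proof -
  interpret abelian_group G by fact
  show ?thesis using assms by (simp add: a_minus_def Sm_neg)
qed

lemma Sm_swap: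
  assumes "abelian_group G" "\<And>a b c d. a \<in> P \<Longrightarrow> b \<in> P \<Longrightarrow> c \<in> Q \<Longrightarrow> d \<in> Q \<Longrightarrow> f a b c d \<in> carrier G"
  shows "Sm P G xs (\<lambda>a b. Sm Q G ys (\<lambda>c d. f a b c d)) = Sm Q G ys (\<lambda>c d. Sm P G xs (\<lambda>a b. f a b c d))"
proof (induction xs)
  case (Cons p xs)
  then show ?case using assms by (cases "fst p \<in> P"; cases "snd p \<in> P") (simp_all add: Sm_Cons)
qed (use assms in simp)

lemma Sm_append:
  assumes "abelian_group G" "\<And>a b. a \<in> P \<Longrightarrow> b \<in> P \<Longrightarrow> f a b \<in> carrier G"
  shows "Sm P G (xs @ ys) f = Sm P G xs f \<oplus>\<^bsub>G\<^esub> Sm P G ys f"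
proof -
  interpret abelian_group G by fact
  show ?thesis using assms by (induction xs) (auto simp: Sm_Cons a_assoc)
qed

lemma Sm_mem:
  assumes "abelian_group G" "additive_subgroup I G" "\<And>a b. a \<in> P \<Longrightarrow> b \<in> P \<Longrightarrow> f a b \<in> I"
  shows "Sm P G xs f \<in> I"
  using assms(3) additive_subgroup.a_closed[OF assms(2)] additive_subgroup.zero_closed[OF assms(2)]
  by (induction xs) (auto simp: Sm_Cons)

text \<open>R^-1_21 is represented by the list of R^-1 with its pairs reversed; this rule moves the
  reversal from the list into the summand.\<close>

lemma Sm_map_swap [simp]: "Sm P G (map prod.swap xs) f = Sm P G xs (\<lambda>a b. f b a)"
  by (induction xs) (auto simp: Sm_Cons)

section \<open>Balanced maps and the universal property of tensor products\<close>

definition bal where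
  "bal S \<alpha> \<beta> M N G f \<longleftrightarrow> (\<forall>a\<in>carrier M. \<forall>b\<in>carrier N. f a b \<in> carrier G) \<and>
     (\<forall>a\<in>carrier M. \<forall>a'\<in>carrier M. \<forall>b\<in>carrier N. f (a \<oplus>\<^bsub>M\<^esub> a') b = f a b \<oplus>\<^bsub>G\<^esub> f a' b) \<and>
     (\<forall>a\<in>carrier M. \<forall>b\<in>carrier N. \<forall>b'\<in>carrier N. f a (b \<oplus>\<^bsub>N\<^esub> b') = f a b \<oplus>\<^bsub>G\<^esub> f a b') \<and>
     (\<forall>s\<in>S. \<forall>a\<in>carrier M. \<forall>b\<in>carrier N. f (\<alpha> s a) b = f a (\<beta> s b))"

lemma balI:
  assumes "\<And>a b. a \<in> carrier M \<Longrightarrow> b \<in> carrier N \<Longrightarrow> f a b \<in> carrier G"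
    "\<And>a a' b. a \<in> carrier M \<Longrightarrow> a' \<in> carrier M \<Longrightarrow> b \<in> carrier N \<Longrightarrow> f (a \<oplus>\<^bsub>M\<^esub> a') b = f a b \<oplus>\<^bsub>G\<^esub> f a' b"
    "\<And>a b b'. a \<in> carrier M \<Longrightarrow> b \<in> carrier N \<Longrightarrow> b' \<in> carrier N \<Longrightarrow> f a (b \<oplus>\<^bsub>N\<^esub> b') = f a b \<oplus>\<^bsub>G\<^esub> f a b'"
    "\<And>s a b. s \<in> S \<Longrightarrow> a \<in> carrier M \<Longrightarrow> b \<in> carrier N \<Longrightarrow> f (\<alpha> s a) b = f a (\<beta> s b)"
  shows "bal S \<alpha> \<beta> M N G f"
  using assms by (auto simp: bal_def)

text \<open>\<open>T\<close> is required to agree with the tensor product in carrier, zero and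
  addition only, so that the locale also covers records carrying more structure on the same group,
  such as the smash product.\<close>

locale tens =
  fixes S :: "'s set" and \<alpha> :: "'s \<Rightarrow> 'm \<Rightarrow> 'm" and \<beta> :: "'s \<Rightarrow> 'n \<Rightarrow> 'n"
    and M :: "('m, 'x) ring_scheme" and N :: "('n, 'y) ring_scheme"
    and T :: "(('m, 'n) tens, 'z) ring_scheme"
  assumes agM [simp]: "abelian_group M" and agN [simp]: "abelian_group N"
    and alpha_closed: "s \<in> S \<Longrightarrow> a \<in> carrier M \<Longrightarrow> \<alpha> s a \<in> carrier M"
    and beta_closed: "s \<in> S \<Longrightarrow> b \<in> carrier N \<Longrightarrow> \<beta> s b \<in> carrier N"
    and T_carrier: "carrier T = carrier (tensor S \<alpha> \<beta> M N)"
    and T_zero: "\<zero>\<^bsub>T\<^esub> = \<zero>\<^bsub>tensor S \<alpha> \<beta> M N\<^esub>"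
    and T_add: "add T = add (tensor S \<alpha> \<beta> M N)"
begin

abbreviation (input) F where "F \<equiv> free_Abelian_group (carrier M \<times> carrier N)"
abbreviation (input) rels where "rels \<equiv> tensor_relations S \<alpha> \<beta> M N"
abbreviation (input) K where "K \<equiv> generate F rels"

lemma frdiff_mem: "x \<in> carrier F \<Longrightarrow> y \<in> carrier F \<Longrightarrow> x - y \<in> carrier F"
  by (simp, meson Un_least keys_diff order_trans)

lemma fradd_mem: "x \<in> carrier F \<Longrightarrow> y \<in> carrier F \<Longrightarrow> x + y \<in> carrier F"
  by (simp, meson Un_least keys_add order_trans)

lemma rels_sub: "rels \<subseteq> carrier F"
proof -
  interpret M: abelian_group M by simp
  interpret N: abelian_group N by simp
  show ?thesis unfolding tensor_relations_def
    by (auto intro!: frdiff_mem simp del: carrier_free_Abelian_group_iff simp: alpha_closed beta_closed)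
qed

lemma K_normal: "normal K F"
  by (metis comm_group.normal_iff_subgroup abelian_free_Abelian_group group.generate_is_subgroup
      group_free_Abelian_group rels_sub)

lemma carT: "carrier T = (\<lambda>x. K #>\<^bsub>F\<^esub> x) ` carrier F"
  unfolding T_carrier by (simp add: tensor_def Let_def carrier_FactGroup)

lemma zeroT: "\<zero>\<^bsub>T\<^esub> = K"
  unfolding T_zero by (simp add: tensor_def Let_def FactGroup_def)

lemma addT: "x \<oplus>\<^bsub>T\<^esub> y = x <#>\<^bsub>F\<^esub> y"
  unfolding T_add by (simp add: tensor_def Let_def FactGroup_def)

lemma agT [simp]: "abelian_group T"
proof -
  interpret Q: comm_group "F Mod K"
    by (rule comm_group.abelian_FactGroup[OF abelian_free_Abelian_group normal_imp_subgroup[OF K_normal]])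
  have T: "carrier T = carrier (F Mod K)" "\<zero>\<^bsub>T\<^esub> = \<one>\<^bsub>F Mod K\<^esub>"
    "x \<oplus>\<^bsub>T\<^esub> y = x \<otimes>\<^bsub>F Mod K\<^esub> y" for x y
    using T_carrier T_zero T_add by (simp_all add: tensor_def Let_def)
  show ?thesis
    by (rule abelian_groupI, unfold T)
      (assumption | rule Q.m_closed Q.one_closed Q.m_assoc Q.m_comm Q.l_one Q.l_inv_ex)+
qed

lemma coset_add: "x \<in> carrier F \<Longrightarrow> y \<in> carrier F \<Longrightarrow> (K #>\<^bsub>F\<^esub> x) \<oplus>\<^bsub>T\<^esub> (K #>\<^bsub>F\<^esub> y) = K #>\<^bsub>F\<^esub> (x + y)"
  using normal.rcos_sum[OF K_normal, of x y] by (simp add: addT)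

lemma coset_eq:
  assumes "x \<in> carrier F" "y \<in> carrier F" "x - y \<in> K"
  shows "K #>\<^bsub>F\<^esub> x = K #>\<^bsub>F\<^esub> y"
proof -
  have "x = (x - y) \<otimes>\<^bsub>F\<^esub> y" by simp
  then have "x \<in> K #>\<^bsub>F\<^esub> y" using assms(3) unfolding r_coset_def by blast
  then show ?thesis
    by (metis K_normal assms(2) group.repr_independence group_free_Abelian_group normal_imp_subgroup)
qed

text \<open>The coset in \<open>pure_tensor\<close> is formed in the free group on all pairs, the
  one here in the free group on the carriers. Addition is the same in both, hence so is the
  coset.\<close>

lemma pure_eq: "a \<boxtimes>\<^bsub>T\<^esub> b = K #>\<^bsub>F\<^esub> frag_of (a, b)"
  by (simp add: pure_tensor_def zeroT r_coset_def)

lemma pure_closed [simp]: "a \<in> carrier M \<Longrightarrow> b \<in> carrier N \<Longrightarrow> a \<boxtimes>\<^bsub>T\<^esub> b \<in> carrier T"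
  by (auto simp: pure_eq carT)

lemma pure_add_l [simp]:
  assumes "a \<in> carrier M" "a' \<in> carrier M" "b \<in> carrier N"
  shows "(a \<oplus>\<^bsub>M\<^esub> a') \<boxtimes>\<^bsub>T\<^esub> b = a \<boxtimes>\<^bsub>T\<^esub> b \<oplus>\<^bsub>T\<^esub> a' \<boxtimes>\<^bsub>T\<^esub> b"
proof -
  interpret M: abelian_group M by simp
  have "frag_of (a \<oplus>\<^bsub>M\<^esub> a', b) - frag_of (a, b) - frag_of (a', b) \<in> K"
    by (rule generate.incl) (use assms in \<open>auto simp: tensor_relations_def\<close>)
  then have "K #>\<^bsub>F\<^esub> frag_of (a \<oplus>\<^bsub>M\<^esub> a', b) = K #>\<^bsub>F\<^esub> (frag_of (a, b) + frag_of (a', b))"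
    by (intro coset_eq) (use assms in \<open>auto simp: diff_diff_add simp del: carrier_free_Abelian_group_iff intro!: fradd_mem\<close>)
  then show ?thesis using assms by (simp add: pure_eq coset_add)
qed

lemma pure_add_r [simp]:
  assumes "a \<in> carrier M" "b \<in> carrier N" "b' \<in> carrier N"
  shows "a \<boxtimes>\<^bsub>T\<^esub> (b \<oplus>\<^bsub>N\<^esub> b') = a \<boxtimes>\<^bsub>T\<^esub> b \<oplus>\<^bsub>T\<^esub> a \<boxtimes>\<^bsub>T\<^esub> b'"
proof -
  interpret N: abelian_group N by simp
  have "frag_of (a, b \<oplus>\<^bsub>N\<^esub> b') - frag_of (a, b) - frag_of (a, b') \<in> K"
    by (rule generate.incl) (use assms in \<open>auto simp: tensor_relations_def\<close>)
  then have "K #>\<^bsub>F\<^esub> frag_of (a, b \<oplus>\<^bsub>N\<^esub> b') = K #>\<^bsub>F\<^esub> (frag_of (a, b) + frag_of (a, b'))"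
    by (intro coset_eq) (use assms in \<open>auto simp: diff_diff_add simp del: carrier_free_Abelian_group_iff intro!: fradd_mem\<close>)
  then show ?thesis using assms by (simp add: pure_eq coset_add)
qed

lemma pure_bal:
  assumes "s \<in> S" "a \<in> carrier M" "b \<in> carrier N"
  shows "\<alpha> s a \<boxtimes>\<^bsub>T\<^esub> b = a \<boxtimes>\<^bsub>T\<^esub> \<beta> s b"
proof -
  have "frag_of (\<alpha> s a, b) - frag_of (a, \<beta> s b) \<in> K"
    by (rule generate.incl) (use assms in \<open>auto simp: tensor_relations_def\<close>)
  then show ?thesis unfolding pure_eq
    by (intro coset_eq) (use assms in \<open>auto simp: alpha_closed beta_closed\<close>)
qed

lemma pure_ahom_l: "b \<in> carrier N \<Longrightarrow> ahom M T (\<lambda>a. a \<boxtimes>\<^bsub>T\<^esub> b)"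
  and pure_ahom_r: "a \<in> carrier M \<Longrightarrow> ahom N T (\<lambda>b. a \<boxtimes>\<^bsub>T\<^esub> b)"
  by (auto intro!: ahomI)

lemma pure_Sm_l [simp]:
  assumes "b \<in> carrier N" "\<And>x y. x \<in> P \<Longrightarrow> y \<in> P \<Longrightarrow> f x y \<in> carrier M"
  shows "Sm P M xs f \<boxtimes>\<^bsub>T\<^esub> b = Sm P T xs (\<lambda>x y. f x y \<boxtimes>\<^bsub>T\<^esub> b)"
  using Sm_hom[OF pure_ahom_l assms(2)] assms(1) .

lemma pure_Sm_r [simp]:
  assumes "a \<in> carrier M" "\<And>x y. x \<in> P \<Longrightarrow> y \<in> P \<Longrightarrow> f x y \<in> carrier N"
  shows "a \<boxtimes>\<^bsub>T\<^esub> Sm P N xs f = Sm P T xs (\<lambda>x y. a \<boxtimes>\<^bsub>T\<^esub> f x y)"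
  using Sm_hom[OF pure_ahom_r assms(2)] assms(1) .

text \<open>Two cases suffice because zero is \<zero> \<otimes> \<zero> and the negative of a
  \<otimes> b is (-a) \<otimes> b, so every element is a sum of pure tensors.\<close>

lemma induct [consumes 1, case_names pure add]:
  assumes "X \<in> carrier T"
    and P: "\<And>a b. a \<in> carrier M \<Longrightarrow> b \<in> carrier N \<Longrightarrow> P (a \<boxtimes>\<^bsub>T\<^esub> b)"
    and A: "\<And>X Y. X \<in> carrier T \<Longrightarrow> Y \<in> carrier T \<Longrightarrow> P X \<Longrightarrow> P Y \<Longrightarrow> P (X \<oplus>\<^bsub>T\<^esub> Y)"
  shows "P X"
proof -
  interpret M: abelian_group M by simp
  interpret N: abelian_group N by simp
  interpret T: abelian_group T by simp
  have neg: "\<ominus>\<^bsub>M\<^esub> a \<boxtimes>\<^bsub>T\<^esub> b = \<ominus>\<^bsub>T\<^esub> (a \<boxtimes>\<^bsub>T\<^esub> b)" if "a \<in> carrier M" "b \<in> carrier N" for a b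
    using ahom_neg[OF pure_ahom_l] that by simp
  have pz: "\<zero>\<^bsub>T\<^esub> = \<zero>\<^bsub>M\<^esub> \<boxtimes>\<^bsub>T\<^esub> \<zero>\<^bsub>N\<^esub>"
    using ahom_zero[OF pure_ahom_l] by simp
  obtain c where c: "c \<in> carrier F" "X = K #>\<^bsub>F\<^esub> c" using assms(1) carT by auto
  have "Poly_Mapping.keys c \<subseteq> carrier M \<times> carrier N" using c(1) by simp
  \<comment> \<open>Induction on the free group builds elements by differences, so the claim is
    carried along together with its negative.\<close>
  then have "P (K #>\<^bsub>F\<^esub> c) \<and> P (\<ominus>\<^bsub>T\<^esub> (K #>\<^bsub>F\<^esub> c))"
  proof (induction c rule: free_Abelian_group_induct[consumes 1, case_names zero diff one])
    case zero
    have "K #>\<^bsub>F\<^esub> 0 = \<zero>\<^bsub>T\<^esub>" by (simp add: zeroT r_coset_def)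
    moreover have "P \<zero>\<^bsub>T\<^esub>" unfolding pz by (rule P) auto
    ultimately show ?case by (simp add: a_inv_def)
  next
    case (diff x y)
    have x: "K #>\<^bsub>F\<^esub> x \<in> carrier T" "K #>\<^bsub>F\<^esub> y \<in> carrier T" "K #>\<^bsub>F\<^esub> (-y) \<in> carrier T"
      using diff by (auto simp: carT keys_minus)
    have z: "K #>\<^bsub>F\<^esub> 0 = \<zero>\<^bsub>T\<^esub>" by (simp add: zeroT r_coset_def)
    have "(K #>\<^bsub>F\<^esub> y) \<oplus>\<^bsub>T\<^esub> (K #>\<^bsub>F\<^esub> (-y)) = K #>\<^bsub>F\<^esub> 0"
      using coset_add[of y "-y"] diff by (simp add: keys_minus)
    then have m: "K #>\<^bsub>F\<^esub> (-y) = \<ominus>\<^bsub>T\<^esub> (K #>\<^bsub>F\<^esub> y)"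
      unfolding z by (metis T.add.inv_comm T.minus_equality x(2) x(3))
    have "K #>\<^bsub>F\<^esub> (x - y) = (K #>\<^bsub>F\<^esub> x) \<oplus>\<^bsub>T\<^esub> \<ominus>\<^bsub>T\<^esub> (K #>\<^bsub>F\<^esub> y)"
      using coset_add[of x "-y"] diff m by (simp add: keys_minus)
    then show ?case using diff A x by (simp add: T.minus_add)
  next
    case (one p)
    then show ?case using P[of "fst p" "snd p"] P[of "\<ominus>\<^bsub>M\<^esub> (fst p)" "snd p"]
      by (auto simp: neg pure_eq[symmetric])
  qed
  then show ?thesis using c by simp
qed

lemma ahom_eqI:
  assumes "ahom T G f" "ahom T G g" "X \<in> carrier T"
    "\<And>a b. a \<in> carrier M \<Longrightarrow> b \<in> carrier N \<Longrightarrow> f (a \<boxtimes>\<^bsub>T\<^esub> b) = g (a \<boxtimes>\<^bsub>T\<^esub> b)"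
  shows "f X = g X"
  using assms(3) by (induction X rule: induct) (use assms in \<open>auto simp: ahom_add\<close>)

text \<open>\<open>\<phi>\<close> extends \<open>f\<close> additively to the free group and vanishes
  on \<open>K\<close>, because \<open>f\<close> respects each of the three kinds of relations. It is
  therefore constant on every coset, which gives \<open>the_elem\<close> in \<open>tlift\<close> a
  singleton to work on.\<close>

lemma lift_aux:
  assumes G [simp]: "abelian_group G" and f: "bal S \<alpha> \<beta> M N G f"
  defines "\<phi> \<equiv> \<lambda>c. \<Oplus>\<^bsub>G\<^esub>p\<in>Poly_Mapping.keys c. [Poly_Mapping.lookup c p] \<cdot>\<^bsub>G\<^esub> f (fst p) (snd p)"
  shows "c \<in> carrier F \<Longrightarrow> \<phi> c \<in> carrier G"
    and "c \<in> carrier F \<Longrightarrow> d \<in> carrier F \<Longrightarrow> \<phi> (c + d) = \<phi> c \<oplus>\<^bsub>G\<^esub> \<phi> d"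
    and "a \<in> carrier M \<Longrightarrow> b \<in> carrier N \<Longrightarrow> \<phi> (frag_of (a, b)) = f a b"
    and "c \<in> carrier F \<Longrightarrow> tlift G f (K #>\<^bsub>F\<^esub> c) = \<phi> c"
proof -
  interpret G: abelian_group G by fact
  interpret M: abelian_group M by simp
  interpret N: abelian_group N by simp
  have fc: "f a b \<in> carrier G" if "a \<in> carrier M" "b \<in> carrier N" for a b
    using f that by (auto simp: bal_def)
  have pow0: "[(0::int)] \<cdot>\<^bsub>G\<^esub> x = \<zero>\<^bsub>G\<^esub>" if "x \<in> carrier G" for x
    using that by (simp add: add_pow_def)
  have pow1: "[(1::int)] \<cdot>\<^bsub>G\<^esub> x = x" if "x \<in> carrier G" for x
    using that G.add.int_pow_1[of x] by simp
  have sing: "(\<Oplus>\<^bsub>G\<^esub>p\<in>{q}. g p) = g q" if "g q \<in> carrier G" for g and q :: "'m \<times> 'n"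
    using that G.finsum_insert[where F="{}" and a=q and f=g] by simp
  \<comment> \<open>Cancellation makes the keys of \<open>c + d\<close> differ from those of
    \<open>c\<close> and \<open>d\<close>; summing over any finite set that contains the keys allows
    all three to be compared over one index set.\<close>
  have ext: "\<phi> c = (\<Oplus>\<^bsub>G\<^esub>p\<in>A. [Poly_Mapping.lookup c p] \<cdot>\<^bsub>G\<^esub> f (fst p) (snd p))"
    if "finite A" "Poly_Mapping.keys c \<subseteq> A" "A \<subseteq> carrier M \<times> carrier N" for c A
    unfolding \<phi>_def
    by (rule G.add.finprod_mono_neutral_cong_left)
      (use that fc in \<open>auto simp: in_keys_iff subset_iff pow0\<close>)
  show cl: "\<phi> c \<in> carrier G" if "c \<in> carrier F" for c
    unfolding \<phi>_def by (rule G.finsum_closed) (use that fc in auto)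
  show add: "\<phi> (c + d) = \<phi> c \<oplus>\<^bsub>G\<^esub> \<phi> d" if "c \<in> carrier F" "d \<in> carrier F" for c d
  proof -
    let ?A = "Poly_Mapping.keys c \<union> Poly_Mapping.keys d"
    have A: "finite ?A" "?A \<subseteq> carrier M \<times> carrier N" using that by auto
    have "\<phi> (c + d) = (\<Oplus>\<^bsub>G\<^esub>p\<in>?A. [Poly_Mapping.lookup c p] \<cdot>\<^bsub>G\<^esub> f (fst p) (snd p) \<oplus>\<^bsub>G\<^esub>
        [Poly_Mapping.lookup d p] \<cdot>\<^bsub>G\<^esub> f (fst p) (snd p))"
      unfolding ext[OF A(1) keys_add A(2)]
      by (rule G.finsum_cong) (use A fc in \<open>auto simp: lookup_add G.add.int_pow_mult subset_iff simp_implies_def\<close>)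
    also have "\<dots> = \<phi> c \<oplus>\<^bsub>G\<^esub> \<phi> d"
      unfolding ext[OF A(1) Un_upper1 A(2)] ext[OF A(1) Un_upper2 A(2)]
      by (rule G.finsum_addf) (use A fc in \<open>auto simp: subset_iff\<close>)
    finally show ?thesis .
  qed
  show of: "\<phi> (frag_of (a, b)) = f a b" if "a \<in> carrier M" "b \<in> carrier N" for a b
  proof -
    have "\<phi> (frag_of (a, b)) = (\<Oplus>\<^bsub>G\<^esub>p\<in>{(a, b)}. [Poly_Mapping.lookup (frag_of (a, b)) p] \<cdot>\<^bsub>G\<^esub> f (fst p) (snd p))"
      unfolding \<phi>_def by simp
    also have "\<dots> = [(1::int)] \<cdot>\<^bsub>G\<^esub> f a b"
      by (subst sing) (use that fc in auto)
    finally show ?thesis using that fc by (simp add: pow1)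
  qed
  have hom: "group_hom F (add_monoid G) \<phi>"
    by (rule group_hom.intro) (use cl add in \<open>auto simp: group_hom_axioms_def hom_def G.a_group simp del: carrier_free_Abelian_group_iff\<close>)
  then interpret h: group_hom F "add_monoid G" \<phi> .
  have diff: "\<phi> (c - d) = \<phi> c \<ominus>\<^bsub>G\<^esub> \<phi> d" if "c \<in> carrier F" "d \<in> carrier F" for c d
  proof -
    have "c - d \<in> carrier F" using frdiff_mem that by blast
    then have "\<phi> (c - d + d) = \<phi> (c - d) \<oplus>\<^bsub>G\<^esub> \<phi> d" using add that by blast
    then show ?thesis
      using cl[OF that(1)] cl[OF that(2)] cl[OF \<open>c - d \<in> carrier F\<close>] by (simp add: a_minus_def G.a_assoc G.r_neg)
  qed
  have frg: "frag_of (a, b) \<in> carrier F" if "a \<in> carrier M" "b \<in> carrier N" for a b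
    using that by simp
  have canc: "x \<oplus>\<^bsub>G\<^esub> (y \<oplus>\<^bsub>G\<^esub> (\<ominus>\<^bsub>G\<^esub> x \<oplus>\<^bsub>G\<^esub> \<ominus>\<^bsub>G\<^esub> y)) = \<zero>\<^bsub>G\<^esub>"
    if "x \<in> carrier G" "y \<in> carrier G" for x y
    using that G.r_neg[of "x \<oplus>\<^bsub>G\<^esub> y"] by (simp add: G.minus_add G.a_assoc)
  have rel: "\<phi> x = \<zero>\<^bsub>G\<^esub>" if "x \<in> rels" for x
    using that f fc unfolding tensor_relations_def bal_def
    by (auto simp: diff of frdiff_mem alpha_closed beta_closed a_minus_def G.minus_add G.a_ac G.r_neg
        simp del: carrier_free_Abelian_group_iff)
      (simp_all add: canc)
  have "K \<subseteq> kernel F (add_monoid G) \<phi>"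
    by (rule group.generate_subgroup_incl[OF group_free_Abelian_group _ h.subgroup_kernel])
      (use rel rels_sub in \<open>auto simp: kernel_def simp del: carrier_free_Abelian_group_iff\<close>)
  then have K: "x \<in> carrier F" "\<phi> x = \<zero>\<^bsub>G\<^esub>" if "x \<in> K" for x
    using that by (auto simp: kernel_def)
  show "tlift G f (K #>\<^bsub>F\<^esub> c) = \<phi> c" if "c \<in> carrier F"
  proof -
    have "\<phi> ` (K #>\<^bsub>F\<^esub> c) = {\<phi> c}"
    proof -
      have "\<phi> (x + c) = \<phi> c" if "x \<in> K" for x
        using add[OF K(1)[OF that] \<open>c \<in> carrier F\<close>] K(2)[OF that] cl[OF \<open>c \<in> carrier F\<close>] by simp
      moreover have "K \<noteq> {}" by (metis empty_iff generate.one)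
      moreover have "\<phi> ` (K #>\<^bsub>F\<^esub> c) = (\<lambda>x. \<phi> (x + c)) ` K" by (auto simp: r_coset_def image_iff)
      ultimately show ?thesis by auto
    qed
    then show ?thesis unfolding tlift_def \<phi>_def[symmetric] by simp
  qed
qed

lemma lift_pure [simp]:
  assumes "abelian_group G" "bal S \<alpha> \<beta> M N G f" "a \<in> carrier M" "b \<in> carrier N"
  shows "tlift G f (a \<boxtimes>\<^bsub>T\<^esub> b) = f a b"
  unfolding pure_eq
  by (rule trans[OF lift_aux(4)[OF assms(1,2)] lift_aux(3)[OF assms]]) (use assms in simp)

lemma lift_ahom:
  assumes "abelian_group G" "bal S \<alpha> \<beta> M N G f"
  shows "ahom T G (tlift G f)"
proof (rule ahomI)
  show "tlift G f X \<in> carrier G" if "X \<in> carrier T" for X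
    using that lift_aux(1,4)[OF assms] unfolding carT by auto
  show "tlift G f (X \<oplus>\<^bsub>T\<^esub> Y) = tlift G f X \<oplus>\<^bsub>G\<^esub> tlift G f Y" if XY: "X \<in> carrier T" "Y \<in> carrier T" for X Y
  proof -
    obtain c d where c: "c \<in> carrier F" "X = K #>\<^bsub>F\<^esub> c" and d: "d \<in> carrier F" "Y = K #>\<^bsub>F\<^esub> d"
      using XY unfolding carT by blast
    moreover have "c + d \<in> carrier F"
      using monoid.m_closed[OF group.is_monoid[OF group_free_Abelian_group] c(1) d(1)] by simp
    ultimately show ?thesis using lift_aux(2,4)[OF assms] by (simp add: coset_add del: carrier_free_Abelian_group_iff)
  qed
qed (use assms in auto)

lemma lift_add:
  "abelian_group G \<Longrightarrow> bal S \<alpha> \<beta> M N G f \<Longrightarrow> X \<in> carrier T \<Longrightarrow> Y \<in> carrier T \<Longrightarrow>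
   tlift G f (X \<oplus>\<^bsub>T\<^esub> Y) = tlift G f X \<oplus>\<^bsub>G\<^esub> tlift G f Y"
  using ahom_add[OF lift_ahom] .

lemma lift_Sm:
  assumes "abelian_group G" "bal S \<alpha> \<beta> M N G f" "\<And>x y. x \<in> P \<Longrightarrow> y \<in> P \<Longrightarrow> g x y \<in> carrier T"
  shows "tlift G f (Sm P T xs g) = Sm P G xs (\<lambda>x y. tlift G f (g x y))"
  using Sm_hom[OF lift_ahom[OF assms(1,2)] assms(3)] .

end

lemma tens_tensor:
  assumes "abelian_group M" "abelian_group N"
    "\<And>s a. s \<in> S \<Longrightarrow> a \<in> carrier M \<Longrightarrow> \<alpha> s a \<in> carrier M"
    "\<And>s b. s \<in> S \<Longrightarrow> b \<in> carrier N \<Longrightarrow> \<beta> s b \<in> carrier N"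
  shows "tens S \<alpha> \<beta> M N (tensor S \<alpha> \<beta> M N)"
  using assms by (auto simp: tens_def)

text \<open>Origin of the lists behind all Sweedler sums: a pure tensor is a one-element list, and
  addition of tensors is concatenation.\<close>

lemma tens_list_rep:
  assumes "tens S \<alpha> \<beta> M M T" "X \<in> carrier T"
  shows "\<exists>xs. X = Sm (carrier M) T xs (\<lambda>a b. a \<boxtimes>\<^bsub>T\<^esub> b)"
proof -
  interpret tens S \<alpha> \<beta> M M T by fact
  interpret T: abelian_group T by simp
  show ?thesis using assms(2)
  proof (induction X rule: induct)
    case (pure a b)
    then have "a \<boxtimes>\<^bsub>T\<^esub> b = Sm (carrier M) T [(a, b)] (\<lambda>a b. a \<boxtimes>\<^bsub>T\<^esub> b)" by (simp add: Sm_Cons)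
    then show ?case by blast
  next
    case (add X Y)
    then show ?case by (metis Sm_append agT pure_closed)
  qed
qed

section \<open>Quasitriangular bialgebras acting on an algebra\<close>

locale alg =
  fixes k :: "('k, 'x) ring_scheme" and A :: "('k, 'a, 'y) module_scheme"
  assumes alg: "k_algebra k A"

sublocale alg \<subseteq> m: module k A
  using alg by (simp add: k_algebra_def)

sublocale alg \<subseteq> ring A
  using alg by (simp add: k_algebra_def)

context alg
begin

lemma ag [simp]: "abelian_group A" using ring_axioms by (simp add: ring_def)

lemma smult_mult [simp]:
  assumes "r \<in> carrier k" "x \<in> carrier A" "y \<in> carrier A"
  shows "(r \<odot>\<^bsub>A\<^esub> x) \<otimes>\<^bsub>A\<^esub> y = r \<odot>\<^bsub>A\<^esub> (x \<otimes>\<^bsub>A\<^esub> y)" "x \<otimes>\<^bsub>A\<^esub> (r \<odot>\<^bsub>A\<^esub> y) = r \<odot>\<^bsub>A\<^esub> (x \<otimes>\<^bsub>A\<^esub> y)"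
  using alg assms by (simp_all add: k_algebra_def)

declare m.smult_r_distr [simp] l_distr [simp] r_distr [simp] m_assoc [simp]

lemma mult_ahom_l: "x \<in> carrier A \<Longrightarrow> ahom A A (\<lambda>y. x \<otimes>\<^bsub>A\<^esub> y)"
  and mult_ahom_r: "x \<in> carrier A \<Longrightarrow> ahom A A (\<lambda>y. y \<otimes>\<^bsub>A\<^esub> x)"
  and smult_ahom: "r \<in> carrier k \<Longrightarrow> ahom A A (\<lambda>y. r \<odot>\<^bsub>A\<^esub> y)"
  by (auto intro!: ahomI)

lemma mult_Sm [simp]:
  assumes "x \<in> carrier A" "\<And>a b. a \<in> P \<Longrightarrow> b \<in> P \<Longrightarrow> f a b \<in> carrier A"
  shows "x \<otimes>\<^bsub>A\<^esub> Sm P A xs f = Sm P A xs (\<lambda>a b. x \<otimes>\<^bsub>A\<^esub> f a b)"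
    "Sm P A xs f \<otimes>\<^bsub>A\<^esub> x = Sm P A xs (\<lambda>a b. f a b \<otimes>\<^bsub>A\<^esub> x)"
  using Sm_hom[OF mult_ahom_l assms(2)] Sm_hom[OF mult_ahom_r assms(2)] assms(1) by auto

lemma smult_Sm:
  assumes "r \<in> carrier k" "\<And>a b. a \<in> P \<Longrightarrow> b \<in> P \<Longrightarrow> f a b \<in> carrier A"
  shows "Sm P A xs (\<lambda>a b. r \<odot>\<^bsub>A\<^esub> f a b) = r \<odot>\<^bsub>A\<^esub> Sm P A xs f"
  using Sm_hom[where f=f and P=P and xs=xs, OF smult_ahom assms(2)] assms(1) by auto

end

lemma alg_homD:
  assumes "f \<in> alg_hom k A B"
  shows "x \<in> carrier A \<Longrightarrow> f x \<in> carrier B"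
    "x \<in> carrier A \<Longrightarrow> y \<in> carrier A \<Longrightarrow> f (x \<oplus>\<^bsub>A\<^esub> y) = f x \<oplus>\<^bsub>B\<^esub> f y"
    "x \<in> carrier A \<Longrightarrow> y \<in> carrier A \<Longrightarrow> f (x \<otimes>\<^bsub>A\<^esub> y) = f x \<otimes>\<^bsub>B\<^esub> f y"
    "f \<one>\<^bsub>A\<^esub> = \<one>\<^bsub>B\<^esub>"
    "r \<in> carrier k \<Longrightarrow> x \<in> carrier A \<Longrightarrow> f (r \<odot>\<^bsub>A\<^esub> x) = r \<odot>\<^bsub>B\<^esub> f x"
  using assms by (auto simp: alg_hom_def ring_hom_def)

lemma alg_homI:
  assumes "\<And>x. x \<in> carrier A \<Longrightarrow> f x \<in> carrier B"
    "\<And>x y. x \<in> carrier A \<Longrightarrow> y \<in> carrier A \<Longrightarrow> f (x \<oplus>\<^bsub>A\<^esub> y) = f x \<oplus>\<^bsub>B\<^esub> f y"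
    "\<And>x y. x \<in> carrier A \<Longrightarrow> y \<in> carrier A \<Longrightarrow> f (x \<otimes>\<^bsub>A\<^esub> y) = f x \<otimes>\<^bsub>B\<^esub> f y"
    "f \<one>\<^bsub>A\<^esub> = \<one>\<^bsub>B\<^esub>"
    "\<And>r x. r \<in> carrier k \<Longrightarrow> x \<in> carrier A \<Longrightarrow> f (r \<odot>\<^bsub>A\<^esub> x) = r \<odot>\<^bsub>B\<^esub> f x"
  shows "f \<in> alg_hom k A B"
  using assms by (auto simp: alg_hom_def ring_hom_def)

lemma alg_hom_ahom:
  assumes "f \<in> alg_hom k A B" "abelian_group A" "abelian_group B"
  shows "ahom A B f"
  using alg_homD[OF assms(1)] assms(2,3) by (auto intro!: ahomI)

section \<open>Bare tensor powers over k and multilinear maps\<close>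

definition kt2 where
  "kt2 k H = tensor (carrier k) (smult H) (smult H) H H"

text \<open>Like \<open>kt2\<close> a bare abelian group without a product. Neither group depends on
  the multiplication of \<open>H\<close>, so both are unchanged under passage to the opposite Hopf
  algebra.\<close>

definition kt3 where
  "kt3 k H = tensor (carrier k) (\<lambda>r. tmap (kt2 k H) (smult H r) (\<lambda>b. b)) (smult H) (kt2 k H) H"

text \<open>The target \<open>G\<close> is only an abelian group, so linearity over k is expressed
  by moving all scalars into the first argument instead of pulling them out. The same convention is
  used for \<open>bil\<close>.\<close>

definition tri where
  "tri k H G F \<longleftrightarrow>
     (\<forall>a\<in>carrier H. \<forall>b\<in>carrier H. \<forall>c\<in>carrier H. F a b c \<in> carrier G) \<and>
     (\<forall>a\<in>carrier H. \<forall>a'\<in>carrier H. \<forall>b\<in>carrier H. \<forall>c\<in>carrier H.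
        F (a \<oplus>\<^bsub>H\<^esub> a') b c = F a b c \<oplus>\<^bsub>G\<^esub> F a' b c \<and>
        F b (a \<oplus>\<^bsub>H\<^esub> a') c = F b a c \<oplus>\<^bsub>G\<^esub> F b a' c \<and>
        F b c (a \<oplus>\<^bsub>H\<^esub> a') = F b c a \<oplus>\<^bsub>G\<^esub> F b c a') \<and>
     (\<forall>r\<in>carrier k. \<forall>a\<in>carrier H. \<forall>b\<in>carrier H. \<forall>c\<in>carrier H.
        F a (r \<odot>\<^bsub>H\<^esub> b) c = F (r \<odot>\<^bsub>H\<^esub> a) b c \<and> F a b (r \<odot>\<^bsub>H\<^esub> c) = F (r \<odot>\<^bsub>H\<^esub> a) b c)"

lemma triI:
  assumes "\<And>a b c. a \<in> carrier H \<Longrightarrow> b \<in> carrier H \<Longrightarrow> c \<in> carrier H \<Longrightarrow> F a b c \<in> carrier G"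
    "\<And>a a' b c. a \<in> carrier H \<Longrightarrow> a' \<in> carrier H \<Longrightarrow> b \<in> carrier H \<Longrightarrow> c \<in> carrier H \<Longrightarrow>
      F (a \<oplus>\<^bsub>H\<^esub> a') b c = F a b c \<oplus>\<^bsub>G\<^esub> F a' b c"
    "\<And>a a' b c. a \<in> carrier H \<Longrightarrow> a' \<in> carrier H \<Longrightarrow> b \<in> carrier H \<Longrightarrow> c \<in> carrier H \<Longrightarrow>
      F b (a \<oplus>\<^bsub>H\<^esub> a') c = F b a c \<oplus>\<^bsub>G\<^esub> F b a' c"
    "\<And>a a' b c. a \<in> carrier H \<Longrightarrow> a' \<in> carrier H \<Longrightarrow> b \<in> carrier H \<Longrightarrow> c \<in> carrier H \<Longrightarrow>
      F b c (a \<oplus>\<^bsub>H\<^esub> a') = F b c a \<oplus>\<^bsub>G\<^esub> F b c a'"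
    "\<And>r a b c. r \<in> carrier k \<Longrightarrow> a \<in> carrier H \<Longrightarrow> b \<in> carrier H \<Longrightarrow> c \<in> carrier H \<Longrightarrow>
      F a (r \<odot>\<^bsub>H\<^esub> b) c = F (r \<odot>\<^bsub>H\<^esub> a) b c"
    "\<And>r a b c. r \<in> carrier k \<Longrightarrow> a \<in> carrier H \<Longrightarrow> b \<in> carrier H \<Longrightarrow> c \<in> carrier H \<Longrightarrow>
      F a b (r \<odot>\<^bsub>H\<^esub> c) = F (r \<odot>\<^bsub>H\<^esub> a) b c"
  shows "tri k H G F"
  using assms by (simp add: tri_def)

abbreviation bil where "bil k H G F \<equiv> bal (carrier k) (smult H) (smult H) H H G F"

lemma bilI:
  assumes "\<And>a b. a \<in> carrier H \<Longrightarrow> b \<in> carrier H \<Longrightarrow> F a b \<in> carrier G"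
    "\<And>a a' b. a \<in> carrier H \<Longrightarrow> a' \<in> carrier H \<Longrightarrow> b \<in> carrier H \<Longrightarrow>
      F (a \<oplus>\<^bsub>H\<^esub> a') b = F a b \<oplus>\<^bsub>G\<^esub> F a' b"
    "\<And>a a' b. a \<in> carrier H \<Longrightarrow> a' \<in> carrier H \<Longrightarrow> b \<in> carrier H \<Longrightarrow>
      F b (a \<oplus>\<^bsub>H\<^esub> a') = F b a \<oplus>\<^bsub>G\<^esub> F b a'"
    "\<And>r a b. r \<in> carrier k \<Longrightarrow> a \<in> carrier H \<Longrightarrow> b \<in> carrier H \<Longrightarrow>
      F a (r \<odot>\<^bsub>H\<^esub> b) = F (r \<odot>\<^bsub>H\<^esub> a) b"
  shows "bil k H G F"
  by (rule balI) (simp_all add: assms)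

lemma bilD:
  assumes "bil k H G F" "a \<in> carrier H" "b \<in> carrier H"
  shows "F a b \<in> carrier G"
    "a' \<in> carrier H \<Longrightarrow> F (a \<oplus>\<^bsub>H\<^esub> a') b = F a b \<oplus>\<^bsub>G\<^esub> F a' b"
    "b' \<in> carrier H \<Longrightarrow> F a (b \<oplus>\<^bsub>H\<^esub> b') = F a b \<oplus>\<^bsub>G\<^esub> F a b'"
    "r \<in> carrier k \<Longrightarrow> F a (r \<odot>\<^bsub>H\<^esub> b) = F (r \<odot>\<^bsub>H\<^esub> a) b"
  using assms by (simp_all add: bal_def)

lemma triD:
  assumes "tri k H G F" "a \<in> carrier H" "b \<in> carrier H" "c \<in> carrier H"
  shows "F a b c \<in> carrier G"
    "a' \<in> carrier H \<Longrightarrow> F (a \<oplus>\<^bsub>H\<^esub> a') b c = F a b c \<oplus>\<^bsub>G\<^esub> F a' b c"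
    "b' \<in> carrier H \<Longrightarrow> F a (b \<oplus>\<^bsub>H\<^esub> b') c = F a b c \<oplus>\<^bsub>G\<^esub> F a b' c"
    "c' \<in> carrier H \<Longrightarrow> F a b (c \<oplus>\<^bsub>H\<^esub> c') = F a b c \<oplus>\<^bsub>G\<^esub> F a b c'"
    "r \<in> carrier k \<Longrightarrow> F a (r \<odot>\<^bsub>H\<^esub> b) c = F (r \<odot>\<^bsub>H\<^esub> a) b c"
    "r \<in> carrier k \<Longrightarrow> F a b (r \<odot>\<^bsub>H\<^esub> c) = F (r \<odot>\<^bsub>H\<^esub> a) b c"
  using assms by (simp_all add: tri_def)

context alg
begin

sublocale t2: tens "carrier k" "smult A" "smult A" A A "kt2 k A"
  by (unfold kt2_def, rule tens_tensor) auto

lemma smult_t2 [simp]: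
  "r \<in> carrier k \<Longrightarrow> a \<in> carrier A \<Longrightarrow> b \<in> carrier A \<Longrightarrow>
   a \<boxtimes>\<^bsub>kt2 k A\<^esub> (r \<odot>\<^bsub>A\<^esub> b) = (r \<odot>\<^bsub>A\<^esub> a) \<boxtimes>\<^bsub>kt2 k A\<^esub> b"
  using t2.pure_bal by simp

lemma smult_t2_bal: "r \<in> carrier k \<Longrightarrow> bil k A (kt2 k A) (\<lambda>a b. (r \<odot>\<^bsub>A\<^esub> a) \<boxtimes>\<^bsub>kt2 k A\<^esub> b)"
  by (rule bilI) (simp_all flip: m.smult_assoc1 add: m.m_comm)

lemma tmap_smult_t2:
  assumes "r \<in> carrier k"
  shows "ahom (kt2 k A) (kt2 k A) (tmap (kt2 k A) (smult A r) (\<lambda>b. b))"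
    "a \<in> carrier A \<Longrightarrow> b \<in> carrier A \<Longrightarrow>
     tmap (kt2 k A) (smult A r) (\<lambda>b. b) (a \<boxtimes>\<^bsub>kt2 k A\<^esub> b) = (r \<odot>\<^bsub>A\<^esub> a) \<boxtimes>\<^bsub>kt2 k A\<^esub> b"
  unfolding tmap_def[abs_def]
  using t2.lift_ahom[OF t2.agT smult_t2_bal] t2.lift_pure[OF t2.agT smult_t2_bal] assms by auto

sublocale t3: tens "carrier k" "\<lambda>r. tmap (kt2 k A) (smult A r) (\<lambda>b. b)" "smult A" "kt2 k A" A "kt3 k A"
  by (unfold kt3_def, rule tens_tensor) (auto simp: ahom_closed[OF tmap_smult_t2(1)])

lemma smult_t3 [simp]:
  "r \<in> carrier k \<Longrightarrow> a \<in> carrier A \<Longrightarrow> b \<in> carrier A \<Longrightarrow> c \<in> carrier A \<Longrightarrow>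
   (a \<boxtimes>\<^bsub>kt2 k A\<^esub> b) \<boxtimes>\<^bsub>kt3 k A\<^esub> (r \<odot>\<^bsub>A\<^esub> c) = ((r \<odot>\<^bsub>A\<^esub> a) \<boxtimes>\<^bsub>kt2 k A\<^esub> b) \<boxtimes>\<^bsub>kt3 k A\<^esub> c"
  using t3.pure_bal[of r "a \<boxtimes>\<^bsub>kt2 k A\<^esub> b" c] by (simp add: tmap_smult_t2)

text \<open>A trilinear map factors through the triple tensor product by lifting in the first two
  arguments and then in the third. Applying the resulting \<open>\<phi>\<close> to one equation in
  \<open>kt3\<close> yields that equation for every trilinear map, which is how coassociativity and
  the hexagons are put to use.\<close>

lemma tri_factor:
  assumes G: "abelian_group G" and F: "tri k A G F"
  obtains \<phi> where "ahom (kt3 k A) G \<phi>"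
    "\<And>a b c. a \<in> carrier A \<Longrightarrow> b \<in> carrier A \<Longrightarrow> c \<in> carrier A \<Longrightarrow>
       \<phi> ((a \<boxtimes>\<^bsub>kt2 k A\<^esub> b) \<boxtimes>\<^bsub>kt3 k A\<^esub> c) = F a b c"
proof
  interpret G: abelian_group G by fact
  define \<psi> where "\<psi> X c = tlift G (\<lambda>a b. F a b c) X" for X c
  have bF: "bil k A G (\<lambda>a b. F a b c)" if "c \<in> carrier A" for c
    by (rule bilI) (use that in \<open>simp_all add: triD[OF F]\<close>)
  have p: "\<psi> (a \<boxtimes>\<^bsub>kt2 k A\<^esub> b) c = F a b c"
    if "a \<in> carrier A" "b \<in> carrier A" "c \<in> carrier A" for a b c
    unfolding \<psi>_def using that t2.lift_pure[OF G bF] by simp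
  have h: "ahom (kt2 k A) G (\<lambda>X. \<psi> X c)" if "c \<in> carrier A" for c
    unfolding \<psi>_def using t2.lift_ahom[OF G bF] that by blast
  have b: "bal (carrier k) (\<lambda>r. tmap (kt2 k A) (smult A r) (\<lambda>b. b)) (smult A) (kt2 k A) A G \<psi>"
  proof (rule balI)
    fix X c c' assume X: "X \<in> carrier (kt2 k A)" and c: "c \<in> carrier A" "c' \<in> carrier A"
    have "ahom (kt2 k A) G (\<lambda>X. \<psi> X c \<oplus>\<^bsub>G\<^esub> \<psi> X c')"
      by (rule ahomI) (use c h G in \<open>auto simp: ahom_closed[OF h] ahom_add[OF h] G.a_ac\<close>)
    from t2.ahom_eqI[OF h this X] show "\<psi> X (c \<oplus>\<^bsub>A\<^esub> c') = \<psi> X c \<oplus>\<^bsub>G\<^esub> \<psi> X c'"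
      using c by (simp add: p triD[OF F])
  next
    fix r X c assume X: "X \<in> carrier (kt2 k A)" and c: "c \<in> carrier A" "r \<in> carrier k"
    have "ahom (kt2 k A) G (\<lambda>X. \<psi> (tmap (kt2 k A) (smult A r) (\<lambda>b. b) X) c)"
      using ahom_comp[OF tmap_smult_t2(1) h] c by blast
    from t2.ahom_eqI[OF this h X, of "r \<odot>\<^bsub>A\<^esub> c"]
    show "\<psi> (tmap (kt2 k A) (smult A r) (\<lambda>b. b) X) c = \<psi> X (r \<odot>\<^bsub>A\<^esub> c)"
      using c by (simp add: p tmap_smult_t2 triD[OF F])
  qed (use h in \<open>auto simp: ahom_closed[OF h] ahom_add[OF h]\<close>)
  show "ahom (kt3 k A) G (tlift G \<psi>)" by (rule t3.lift_ahom[OF G b])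
  show "tlift G \<psi> ((a \<boxtimes>\<^bsub>kt2 k A\<^esub> b') \<boxtimes>\<^bsub>kt3 k A\<^esub> c) = F a b' c"
    if "a \<in> carrier A" "b' \<in> carrier A" "c \<in> carrier A" for a b' c
    using that by (simp add: t3.lift_pure[OF G b] p)
qed

end

text \<open>Here \<open>D h\<close>, \<open>rs\<close> and \<open>rb\<close> are lists representing \<open>\<Delta>(h)\<close>, \<open>R\<close> and \<open>R\<^sup>-\<^sup>1\<close>.\<close>

locale represented_bialgebra =
  fixes k :: "('k, 'x) ring_scheme" and H :: "('k, 'h, 'y) hopf_scheme" and R :: "('h, 'h) tens"
    and L :: "('k, 'l, 'z) module_scheme" and act :: "'h \<Rightarrow> 'l \<Rightarrow> 'l"
    and D :: "'h \<Rightarrow> ('h \<times> 'h) list" and rs rb :: "('h \<times> 'h) list"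
  assumes H_alg: "k_algebra k H" and L_alg: "k_algebra k L"
    and eps_closed [simp]: "x \<in> carrier H \<Longrightarrow> counit H x \<in> carrier k"
    and eps_add [simp]: "x \<in> carrier H \<Longrightarrow> y \<in> carrier H \<Longrightarrow> counit H (x \<oplus>\<^bsub>H\<^esub> y) = counit H x \<oplus>\<^bsub>k\<^esub> counit H y"
    and eps_mult [simp]: "x \<in> carrier H \<Longrightarrow> y \<in> carrier H \<Longrightarrow> counit H (x \<otimes>\<^bsub>H\<^esub> y) = counit H x \<otimes>\<^bsub>k\<^esub> counit H y"
    and eps_one [simp]: "counit H \<one>\<^bsub>H\<^esub> = \<one>\<^bsub>k\<^esub>"
    and eps_smult [simp]: "r \<in> carrier k \<Longrightarrow> x \<in> carrier H \<Longrightarrow> counit H (r \<odot>\<^bsub>H\<^esub> x) = r \<otimes>\<^bsub>k\<^esub> counit H x"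
    and comult_eq: "h \<in> carrier H \<Longrightarrow> comult H h = Sm (carrier H) (kt2 k H) (D h) (\<lambda>a b. a \<boxtimes>\<^bsub>kt2 k H\<^esub> b)"
    and R_eq: "R = Sm (carrier H) (kt2 k H) rs (\<lambda>a b. a \<boxtimes>\<^bsub>kt2 k H\<^esub> b)"
    and comult_add: "x \<in> carrier H \<Longrightarrow> y \<in> carrier H \<Longrightarrow>
      comult H (x \<oplus>\<^bsub>H\<^esub> y) = comult H x \<oplus>\<^bsub>kt2 k H\<^esub> comult H y"
    and comult_smult: "r \<in> carrier k \<Longrightarrow> x \<in> carrier H \<Longrightarrow>
      comult H (r \<odot>\<^bsub>H\<^esub> x) = Sm (carrier H) (kt2 k H) (D x) (\<lambda>a b. (r \<odot>\<^bsub>H\<^esub> a) \<boxtimes>\<^bsub>kt2 k H\<^esub> b)"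
    and comult_mult: "x \<in> carrier H \<Longrightarrow> y \<in> carrier H \<Longrightarrow>
      comult H (x \<otimes>\<^bsub>H\<^esub> y) = Sm (carrier H) (kt2 k H) (D x) (\<lambda>a b. Sm (carrier H) (kt2 k H) (D y)
        (\<lambda>c d. (a \<otimes>\<^bsub>H\<^esub> c) \<boxtimes>\<^bsub>kt2 k H\<^esub> (b \<otimes>\<^bsub>H\<^esub> d)))"
    and comult_one: "comult H \<one>\<^bsub>H\<^esub> = \<one>\<^bsub>H\<^esub> \<boxtimes>\<^bsub>kt2 k H\<^esub> \<one>\<^bsub>H\<^esub>"
    and coassoc0: "x \<in> carrier H \<Longrightarrow>
      Sm (carrier H) (kt3 k H) (D x) (\<lambda>a b. Sm (carrier H) (kt3 k H) (D a) (\<lambda>c d. (c \<boxtimes>\<^bsub>kt2 k H\<^esub> d) \<boxtimes>\<^bsub>kt3 k H\<^esub> b)) =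
      Sm (carrier H) (kt3 k H) (D x) (\<lambda>a b. Sm (carrier H) (kt3 k H) (D b) (\<lambda>c d. (a \<boxtimes>\<^bsub>kt2 k H\<^esub> c) \<boxtimes>\<^bsub>kt3 k H\<^esub> d))"
    and counit_l: "x \<in> carrier H \<Longrightarrow> Sm (carrier H) H (D x) (\<lambda>a b. counit H a \<odot>\<^bsub>H\<^esub> b) = x"
    and counit_r: "x \<in> carrier H \<Longrightarrow> Sm (carrier H) H (D x) (\<lambda>a b. counit H b \<odot>\<^bsub>H\<^esub> a) = x"
    and hexL0: "Sm (carrier H) (kt3 k H) rs (\<lambda>a b. Sm (carrier H) (kt3 k H) (D a) (\<lambda>c d. (c \<boxtimes>\<^bsub>kt2 k H\<^esub> d) \<boxtimes>\<^bsub>kt3 k H\<^esub> b)) =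
      Sm (carrier H) (kt3 k H) rs (\<lambda>a b. Sm (carrier H) (kt3 k H) rs (\<lambda>c d. (a \<boxtimes>\<^bsub>kt2 k H\<^esub> c) \<boxtimes>\<^bsub>kt3 k H\<^esub> (b \<otimes>\<^bsub>H\<^esub> d)))"
    and hexR0: "Sm (carrier H) (kt3 k H) rs (\<lambda>a b. Sm (carrier H) (kt3 k H) (D b) (\<lambda>c d. (a \<boxtimes>\<^bsub>kt2 k H\<^esub> c) \<boxtimes>\<^bsub>kt3 k H\<^esub> d)) =
      Sm (carrier H) (kt3 k H) rs (\<lambda>a b. Sm (carrier H) (kt3 k H) rs (\<lambda>c d. ((a \<otimes>\<^bsub>H\<^esub> c) \<boxtimes>\<^bsub>kt2 k H\<^esub> d) \<boxtimes>\<^bsub>kt3 k H\<^esub> b))"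
    and Rcomm0: "x \<in> carrier H \<Longrightarrow>
      Sm (carrier H) (kt2 k H) rs (\<lambda>a b. Sm (carrier H) (kt2 k H) (D x) (\<lambda>c d. (a \<otimes>\<^bsub>H\<^esub> c) \<boxtimes>\<^bsub>kt2 k H\<^esub> (b \<otimes>\<^bsub>H\<^esub> d))) =
      Sm (carrier H) (kt2 k H) (D x) (\<lambda>c d. Sm (carrier H) (kt2 k H) rs (\<lambda>a b. (d \<otimes>\<^bsub>H\<^esub> a) \<boxtimes>\<^bsub>kt2 k H\<^esub> (c \<otimes>\<^bsub>H\<^esub> b)))"
    and Rinv10: "Sm (carrier H) (kt2 k H) rs (\<lambda>a b. Sm (carrier H) (kt2 k H) rb (\<lambda>c d. (a \<otimes>\<^bsub>H\<^esub> c) \<boxtimes>\<^bsub>kt2 k H\<^esub> (b \<otimes>\<^bsub>H\<^esub> d))) = \<one>\<^bsub>H\<^esub> \<boxtimes>\<^bsub>kt2 k H\<^esub> \<one>\<^bsub>H\<^esub>"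
    and Rinv20: "Sm (carrier H) (kt2 k H) rb (\<lambda>a b. Sm (carrier H) (kt2 k H) rs (\<lambda>c d. (a \<otimes>\<^bsub>H\<^esub> c) \<boxtimes>\<^bsub>kt2 k H\<^esub> (b \<otimes>\<^bsub>H\<^esub> d))) = \<one>\<^bsub>H\<^esub> \<boxtimes>\<^bsub>kt2 k H\<^esub> \<one>\<^bsub>H\<^esub>"
    and act_closed [simp]: "x \<in> carrier H \<Longrightarrow> l \<in> carrier L \<Longrightarrow> act x l \<in> carrier L"
    and act_add_l [simp]: "x \<in> carrier H \<Longrightarrow> y \<in> carrier H \<Longrightarrow> l \<in> carrier L \<Longrightarrow>
      act (x \<oplus>\<^bsub>H\<^esub> y) l = act x l \<oplus>\<^bsub>L\<^esub> act y l"
    and act_add_r [simp]: "x \<in> carrier H \<Longrightarrow> l \<in> carrier L \<Longrightarrow> m \<in> carrier L \<Longrightarrow>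
      act x (l \<oplus>\<^bsub>L\<^esub> m) = act x l \<oplus>\<^bsub>L\<^esub> act x m"
    and act_smult_l [simp]: "r \<in> carrier k \<Longrightarrow> x \<in> carrier H \<Longrightarrow> l \<in> carrier L \<Longrightarrow>
      act (r \<odot>\<^bsub>H\<^esub> x) l = r \<odot>\<^bsub>L\<^esub> act x l"
    and act_smult_r [simp]: "r \<in> carrier k \<Longrightarrow> x \<in> carrier H \<Longrightarrow> l \<in> carrier L \<Longrightarrow>
      act x (r \<odot>\<^bsub>L\<^esub> l) = r \<odot>\<^bsub>L\<^esub> act x l"
    and act_mult [simp]: "x \<in> carrier H \<Longrightarrow> y \<in> carrier H \<Longrightarrow> l \<in> carrier L \<Longrightarrow>
      act (x \<otimes>\<^bsub>H\<^esub> y) l = act x (act y l)"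
    and act_one [simp]: "l \<in> carrier L \<Longrightarrow> act \<one>\<^bsub>H\<^esub> l = l"
    and act_prod: "x \<in> carrier H \<Longrightarrow> l \<in> carrier L \<Longrightarrow> m \<in> carrier L \<Longrightarrow>
      act x (l \<otimes>\<^bsub>L\<^esub> m) = Sm (carrier H) L (D x) (\<lambda>a b. act a l \<otimes>\<^bsub>L\<^esub> act b m)"
    and act_unit [simp]: "x \<in> carrier H \<Longrightarrow> act x \<one>\<^bsub>L\<^esub> = counit H x \<odot>\<^bsub>L\<^esub> \<one>\<^bsub>L\<^esub>"
    and H_comm: "l \<in> carrier L \<Longrightarrow> m \<in> carrier L \<Longrightarrow>
      l \<otimes>\<^bsub>L\<^esub> m = Sm (carrier H) L rs (\<lambda>a b. act b m \<otimes>\<^bsub>L\<^esub> act a l)"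

sublocale represented_bialgebra \<subseteq> H: alg k H by (rule alg.intro[OF H_alg])
sublocale represented_bialgebra \<subseteq> L: alg k L by (rule alg.intro[OF L_alg])

context represented_bialgebra
begin

abbreviation SS where "SS \<equiv> Sm (carrier H)"
abbreviation T2 where "T2 \<equiv> kt2 k H"
abbreviation T3 where "T3 \<equiv> kt3 k H"
abbreviation \<epsilon> where "\<epsilon> \<equiv> counit H"

lemma Sm_act [simp]:
  assumes "\<And>a b. a \<in> P \<Longrightarrow> b \<in> P \<Longrightarrow> f a b \<in> carrier H" "l \<in> carrier L"
  shows "act (Sm P H xs f) l = Sm P L xs (\<lambda>a b. act (f a b) l)"
  by (rule Sm_hom[of _ _ "\<lambda>x. act x l"]) (auto intro!: ahomI simp: assms)

lemma lift_eq:
  assumes "abelian_group G" "bil k H G F"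
  shows "h \<in> carrier H \<Longrightarrow> tlift G F (comult H h) = SS G (D h) F"
    "tlift G F R = SS G rs F"
    "tlift G F (SS T2 xs (\<lambda>a b. a \<boxtimes>\<^bsub>T2\<^esub> b)) = SS G xs F"
proof -
  show *: "tlift G F (SS T2 xs (\<lambda>a b. a \<boxtimes>\<^bsub>T2\<^esub> b)) = SS G xs F" for xs
    using assms by (simp add: H.t2.lift_Sm)
  show "h \<in> carrier H \<Longrightarrow> tlift G F (comult H h) = SS G (D h) F" "tlift G F R = SS G rs F"
    using * comult_eq R_eq by simp_all
qed

text \<open>\<open>D (x \<oplus> y)\<close> is just some list for the tensor \<Delta>(x + y),
  unrelated as a list to those of \<open>x\<close> and \<open>y\<close>. Equality appears after
  evaluation of a bilinear map, since both sides then depend only on the tensors. The same holds for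
  \<open>D_smult\<close>, \<open>D_mult\<close> and \<open>D_one\<close>.\<close>

lemma D_add:
  assumes "abelian_group G" "bil k H G F" "x \<in> carrier H" "y \<in> carrier H"
  shows "SS G (D (x \<oplus>\<^bsub>H\<^esub> y)) F = SS G (D x) F \<oplus>\<^bsub>G\<^esub> SS G (D y) F"
proof -
  have "comult H x \<in> carrier T2" "comult H y \<in> carrier T2" using assms by (simp_all add: comult_eq)
  then show ?thesis
    using assms H.t2.lift_add[OF assms(1,2), of "comult H x" "comult H y"]
    by (simp add: comult_add[symmetric] lift_eq)
qed

lemma D_smult:
  assumes "abelian_group G" "bil k H G F" "x \<in> carrier H" "r \<in> carrier k"
  shows "SS G (D (r \<odot>\<^bsub>H\<^esub> x)) F = SS G (D x) (\<lambda>a b. F (r \<odot>\<^bsub>H\<^esub> a) b)"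
proof -
  have "SS G (D (r \<odot>\<^bsub>H\<^esub> x)) F = tlift G F (comult H (r \<odot>\<^bsub>H\<^esub> x))" using assms by (simp add: lift_eq)
  also have "\<dots> = SS G (D x) (\<lambda>a b. F (r \<odot>\<^bsub>H\<^esub> a) b)"
    using assms by (simp add: comult_smult H.t2.lift_Sm)
  finally show ?thesis .
qed

lemma D_mult:
  assumes "abelian_group G" "bil k H G F" "x \<in> carrier H" "y \<in> carrier H"
  shows "SS G (D (x \<otimes>\<^bsub>H\<^esub> y)) F = SS G (D x) (\<lambda>a b. SS G (D y) (\<lambda>c d. F (a \<otimes>\<^bsub>H\<^esub> c) (b \<otimes>\<^bsub>H\<^esub> d)))"
proof -
  have "SS G (D (x \<otimes>\<^bsub>H\<^esub> y)) F = tlift G F (comult H (x \<otimes>\<^bsub>H\<^esub> y))" using assms by (simp add: lift_eq)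
  also have "\<dots> = SS G (D x) (\<lambda>a b. SS G (D y) (\<lambda>c d. F (a \<otimes>\<^bsub>H\<^esub> c) (b \<otimes>\<^bsub>H\<^esub> d)))"
    using assms by (simp add: comult_mult H.t2.lift_Sm)
  finally show ?thesis .
qed

lemma D_one:
  assumes "abelian_group G" "bil k H G F"
  shows "SS G (D \<one>\<^bsub>H\<^esub>) F = F \<one>\<^bsub>H\<^esub> \<one>\<^bsub>H\<^esub>"
  using lift_eq(1)[OF assms, of "\<one>\<^bsub>H\<^esub>"] assms by (simp add: comult_one)

lemma coassoc:
  assumes "abelian_group G" "tri k H G F" "h \<in> carrier H"
  shows "SS G (D h) (\<lambda>a b. SS G (D a) (\<lambda>c d. F c d b)) = SS G (D h) (\<lambda>a b. SS G (D b) (\<lambda>c d. F a c d))"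
proof -
  obtain \<phi> where \<phi>: "ahom T3 G \<phi>" "\<And>a b c. a \<in> carrier H \<Longrightarrow> b \<in> carrier H \<Longrightarrow> c \<in> carrier H \<Longrightarrow>
       \<phi> ((a \<boxtimes>\<^bsub>T2\<^esub> b) \<boxtimes>\<^bsub>T3\<^esub> c) = F a b c"
    using H.tri_factor[OF assms(1,2)] by blast
  from arg_cong[OF coassoc0[OF assms(3)], of \<phi>] show ?thesis
    by (simp add: Sm_hom[OF \<phi>(1)] \<phi>(2))
qed

lemma hexL:
  assumes "abelian_group G" "tri k H G F"
  shows "SS G rs (\<lambda>a b. SS G (D a) (\<lambda>c d. F c d b)) = SS G rs (\<lambda>a b. SS G rs (\<lambda>c d. F a c (b \<otimes>\<^bsub>H\<^esub> d)))"
proof -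
  obtain \<phi> where \<phi>: "ahom T3 G \<phi>" "\<And>a b c. a \<in> carrier H \<Longrightarrow> b \<in> carrier H \<Longrightarrow> c \<in> carrier H \<Longrightarrow>
       \<phi> ((a \<boxtimes>\<^bsub>T2\<^esub> b) \<boxtimes>\<^bsub>T3\<^esub> c) = F a b c"
    using H.tri_factor[OF assms(1,2)] by blast
  from arg_cong[OF hexL0, of \<phi>] show ?thesis
    by (simp add: Sm_hom[OF \<phi>(1)] \<phi>(2))
qed

lemma hexR:
  assumes "abelian_group G" "tri k H G F"
  shows "SS G rs (\<lambda>a b. SS G (D b) (\<lambda>c d. F a c d)) = SS G rs (\<lambda>a b. SS G rs (\<lambda>c d. F (a \<otimes>\<^bsub>H\<^esub> c) d b))"
proof -
  obtain \<phi> where \<phi>: "ahom T3 G \<phi>" "\<And>a b c. a \<in> carrier H \<Longrightarrow> b \<in> carrier H \<Longrightarrow> c \<in> carrier H \<Longrightarrow>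
       \<phi> ((a \<boxtimes>\<^bsub>T2\<^esub> b) \<boxtimes>\<^bsub>T3\<^esub> c) = F a b c"
    using H.tri_factor[OF assms(1,2)] by blast
  from arg_cong[OF hexR0, of \<phi>] show ?thesis
    by (simp add: Sm_hom[OF \<phi>(1)] \<phi>(2))
qed

lemma Rcomm:
  assumes "abelian_group G" "bil k H G F" "h \<in> carrier H"
  shows "SS G rs (\<lambda>a b. SS G (D h) (\<lambda>c d. F (a \<otimes>\<^bsub>H\<^esub> c) (b \<otimes>\<^bsub>H\<^esub> d))) =
    SS G (D h) (\<lambda>c d. SS G rs (\<lambda>a b. F (d \<otimes>\<^bsub>H\<^esub> a) (c \<otimes>\<^bsub>H\<^esub> b)))"
  using arg_cong[OF Rcomm0[OF assms(3)], of "tlift G F"] assms by (simp add: H.t2.lift_Sm)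

lemma Rinv1:
  assumes "abelian_group G" "bil k H G F"
  shows "SS G rs (\<lambda>a b. SS G rb (\<lambda>c d. F (a \<otimes>\<^bsub>H\<^esub> c) (b \<otimes>\<^bsub>H\<^esub> d))) = F \<one>\<^bsub>H\<^esub> \<one>\<^bsub>H\<^esub>"
  using arg_cong[OF Rinv10, of "tlift G F"] assms by (simp add: H.t2.lift_Sm)

lemma Rinv2:
  assumes "abelian_group G" "bil k H G F"
  shows "SS G rb (\<lambda>a b. SS G rs (\<lambda>c d. F (a \<otimes>\<^bsub>H\<^esub> c) (b \<otimes>\<^bsub>H\<^esub> d))) = F \<one>\<^bsub>H\<^esub> \<one>\<^bsub>H\<^esub>"
  using arg_cong[OF Rinv20, of "tlift G F"] assms by (simp add: H.t2.lift_Sm)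

lemma tri_bil_l:
  assumes "abelian_group G" "tri k H G F"
  shows "bil k H G (\<lambda>a c. SS G (D a) (\<lambda>x y. F x y c))"
proof -
  have b: "bil k H G (\<lambda>x y. F x y c)" if "c \<in> carrier H" for c
    by (rule bilI) (use that in \<open>simp_all add: triD[OF assms(2)]\<close>)
  show ?thesis
    by (rule bilI) (simp_all add: assms(1) triD[OF assms(2)] D_add[OF _ b] D_smult[OF _ b])
qed

lemma tri_bil_r:
  assumes "abelian_group G" "tri k H G F"
  shows "bil k H G (\<lambda>c a. SS G (D a) (\<lambda>x y. F c x y))"
proof -
  have b: "bil k H G (\<lambda>x y. F c x y)" if "c \<in> carrier H" for c
    by (rule bilI) (use that in \<open>simp_all add: triD[OF assms(2)]\<close>)
  show ?thesis
    by (rule bilI) (simp_all add: assms(1) triD[OF assms(2)] D_add[OF _ b] D_smult[OF _ b])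
qed

section \<open>The counit on the R-matrix, and the inverse R-matrix as a second R-matrix\<close>

lemmas H_scalars = H.m.smult_assoc1[symmetric] H.m.m_comm

lemma counit_l': "ahom H G f \<Longrightarrow> h \<in> carrier H \<Longrightarrow> SS G (D h) (\<lambda>a b. f (\<epsilon> a \<odot>\<^bsub>H\<^esub> b)) = f h"
  using Sm_hom[of H G f "carrier H" "\<lambda>a b. \<epsilon> a \<odot>\<^bsub>H\<^esub> b" "D h"] counit_l[of h] by simp

lemma counit_r': "ahom H G f \<Longrightarrow> h \<in> carrier H \<Longrightarrow> SS G (D h) (\<lambda>a b. f (\<epsilon> b \<odot>\<^bsub>H\<^esub> a)) = f h"
  using Sm_hom[of H G f "carrier H" "\<lambda>a b. \<epsilon> b \<odot>\<^bsub>H\<^esub> a" "D h"] counit_r[of h] by simp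

text \<open>Applying \<epsilon> to the middle leg of (id \<otimes> \<Delta>)(R) = R_13 R_12 gives R
  = R (e \<otimes> 1) with e = (id \<otimes> \<epsilon>)(R). Cancelling R shows e = 1.\<close>

lemma eps_R_r: "SS H rs (\<lambda>a b. \<epsilon> b \<odot>\<^bsub>H\<^esub> a) = \<one>\<^bsub>H\<^esub>"
proof -
  let ?F = "\<lambda>u v. \<epsilon> v \<odot>\<^bsub>H\<^esub> u"
  have bF: "bil k H H ?F"
    by (rule bilI) (simp_all add: H.m.smult_l_distr H_scalars)
  \<comment> \<open>This is R = R (e \<otimes> 1), multiplied from the left by an arbitrary p
    \<otimes> q, which will run over R^-1.\<close>
  have ins: "SS H rs (\<lambda>a b. ?F (p \<otimes>\<^bsub>H\<^esub> a) (q \<otimes>\<^bsub>H\<^esub> b)) =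
      SS H rs (\<lambda>a b. SS H rs (\<lambda>c d. ?F (p \<otimes>\<^bsub>H\<^esub> (a \<otimes>\<^bsub>H\<^esub> c)) (q \<otimes>\<^bsub>H\<^esub> (\<epsilon> d \<odot>\<^bsub>H\<^esub> b))))"
    if pq: "p \<in> carrier H" "q \<in> carrier H" for p q
  proof -
    have h: "ahom H H (\<lambda>b. ?F (p \<otimes>\<^bsub>H\<^esub> a) (q \<otimes>\<^bsub>H\<^esub> b))" if "a \<in> carrier H" for a
      by (rule ahomI) (use that pq in \<open>simp_all add: H.m.smult_l_distr H.m.r_distr\<close>)
    have "SS H rs (\<lambda>a b. ?F (p \<otimes>\<^bsub>H\<^esub> a) (q \<otimes>\<^bsub>H\<^esub> b)) =
        SS H rs (\<lambda>a b. SS H (D b) (\<lambda>x y. ?F (p \<otimes>\<^bsub>H\<^esub> a) (q \<otimes>\<^bsub>H\<^esub> (\<epsilon> x \<odot>\<^bsub>H\<^esub> y))))"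
      by (rule Sm_cong', rule counit_l'[OF h, symmetric])
    also have "\<dots> = SS H rs (\<lambda>a b. SS H rs (\<lambda>c d. ?F (p \<otimes>\<^bsub>H\<^esub> (a \<otimes>\<^bsub>H\<^esub> c)) (q \<otimes>\<^bsub>H\<^esub> (\<epsilon> d \<odot>\<^bsub>H\<^esub> b))))"
      by (rule hexR, simp, rule triI)
        (use pq in \<open>simp_all add: H.m.smult_l_distr H.m.r_distr H.m.l_distr H_scalars H.m.m_lcomm\<close>)
    finally show ?thesis .
  qed
  have "\<one>\<^bsub>H\<^esub> = SS H rb (\<lambda>p q. SS H rs (\<lambda>a b. ?F (p \<otimes>\<^bsub>H\<^esub> a) (q \<otimes>\<^bsub>H\<^esub> b)))"
    using Rinv2[OF _ bF] by simp
  also have "\<dots> = SS H rb (\<lambda>p q. SS H rs (\<lambda>a b. SS H rs (\<lambda>c d. ?F (p \<otimes>\<^bsub>H\<^esub> (a \<otimes>\<^bsub>H\<^esub> c)) (q \<otimes>\<^bsub>H\<^esub> (\<epsilon> d \<odot>\<^bsub>H\<^esub> b)))))"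
    by (rule Sm_cong', rule ins)
  also have "\<dots> = SS H rb (\<lambda>p q. SS H rs (\<lambda>c d. SS H rs (\<lambda>a b. ?F (p \<otimes>\<^bsub>H\<^esub> (a \<otimes>\<^bsub>H\<^esub> c)) (q \<otimes>\<^bsub>H\<^esub> (\<epsilon> d \<odot>\<^bsub>H\<^esub> b)))))"
    by (rule Sm_cong', rule Sm_swap) simp_all
  also have "\<dots> = SS H rs (\<lambda>c d. SS H rb (\<lambda>p q. SS H rs (\<lambda>a b. ?F ((p \<otimes>\<^bsub>H\<^esub> a) \<otimes>\<^bsub>H\<^esub> c) (\<epsilon> d \<odot>\<^bsub>H\<^esub> (q \<otimes>\<^bsub>H\<^esub> b)))))"
    by (subst Sm_swap) simp_all
  also have "\<dots> = SS H rs (\<lambda>c d. ?F (\<one>\<^bsub>H\<^esub> \<otimes>\<^bsub>H\<^esub> c) (\<epsilon> d \<odot>\<^bsub>H\<^esub> \<one>\<^bsub>H\<^esub>))"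
  proof (rule Sm_cong')
    fix c d assume "c \<in> carrier H" "d \<in> carrier H"
    then have "bil k H H (\<lambda>u v. ?F (u \<otimes>\<^bsub>H\<^esub> c) (\<epsilon> d \<odot>\<^bsub>H\<^esub> v))"
      by (intro bilI) (simp_all add: H.m.smult_l_distr H.m.r_distr H_scalars H.m.m_lcomm)
    from Rinv2[OF _ this] show "SS H rb (\<lambda>p q. SS H rs (\<lambda>a b. ?F ((p \<otimes>\<^bsub>H\<^esub> a) \<otimes>\<^bsub>H\<^esub> c) (\<epsilon> d \<odot>\<^bsub>H\<^esub> (q \<otimes>\<^bsub>H\<^esub> b)))) =
      ?F (\<one>\<^bsub>H\<^esub> \<otimes>\<^bsub>H\<^esub> c) (\<epsilon> d \<odot>\<^bsub>H\<^esub> \<one>\<^bsub>H\<^esub>)" by simp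
  qed
  finally show ?thesis by simp
qed

text \<open>The identity R^-1 \<Delta>^op(h) = \<Delta>(h) R^-1, obtained by conjugating R
  \<Delta>(h) = \<Delta>^op(h) R with R^-1: insert R R^-1 on the right, use the relation in the
  middle, cancel R^-1 R on the left.\<close>

lemma Rb_comm:
  assumes G [simp]: "abelian_group G" and F: "bil k H G F" and h: "h \<in> carrier H"
  shows "SS G rb (\<lambda>c d. SS G (D h) (\<lambda>x y. F (c \<otimes>\<^bsub>H\<^esub> y) (d \<otimes>\<^bsub>H\<^esub> x))) =
    SS G (D h) (\<lambda>x y. SS G rb (\<lambda>c d. F (x \<otimes>\<^bsub>H\<^esub> c) (y \<otimes>\<^bsub>H\<^esub> d)))"
proof -
  note Fs = bilD[OF F]
  \<comment> \<open>Evaluates \<open>F\<close> on its argument surrounded by R^-1 on both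
    sides.\<close>
  let ?F' = "\<lambda>u v. SS G rb (\<lambda>c d. SS G rb (\<lambda>p q. F (c \<otimes>\<^bsub>H\<^esub> (u \<otimes>\<^bsub>H\<^esub> p)) (d \<otimes>\<^bsub>H\<^esub> (v \<otimes>\<^bsub>H\<^esub> q))))"
  have ins: "F u v = SS G rs (\<lambda>a b. SS G rb (\<lambda>p q. F (u \<otimes>\<^bsub>H\<^esub> (a \<otimes>\<^bsub>H\<^esub> p)) (v \<otimes>\<^bsub>H\<^esub> (b \<otimes>\<^bsub>H\<^esub> q))))"
    if "u \<in> carrier H" "v \<in> carrier H" for u v
  proof -
    have "bil k H G (\<lambda>x y. F (u \<otimes>\<^bsub>H\<^esub> x) (v \<otimes>\<^bsub>H\<^esub> y))"
      by (rule bilI) (use that in \<open>simp_all add: Fs\<close>)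
    from Rinv1[OF G this] that show ?thesis by simp
  qed
  have "SS G rb (\<lambda>c d. SS G (D h) (\<lambda>x y. F (c \<otimes>\<^bsub>H\<^esub> y) (d \<otimes>\<^bsub>H\<^esub> x))) =
    SS G rb (\<lambda>c d. SS G (D h) (\<lambda>x y. SS G rs (\<lambda>a b. SS G rb (\<lambda>p q. F (c \<otimes>\<^bsub>H\<^esub> (y \<otimes>\<^bsub>H\<^esub> (a \<otimes>\<^bsub>H\<^esub> p))) (d \<otimes>\<^bsub>H\<^esub> (x \<otimes>\<^bsub>H\<^esub> (b \<otimes>\<^bsub>H\<^esub> q)))))))"
    by (rule Sm_cong', rule Sm_cong', subst ins) simp_all
  also have "\<dots> = SS G (D h) (\<lambda>x y. SS G rb (\<lambda>c d. SS G rs (\<lambda>a b. SS G rb (\<lambda>p q. F (c \<otimes>\<^bsub>H\<^esub> (y \<otimes>\<^bsub>H\<^esub> (a \<otimes>\<^bsub>H\<^esub> p))) (d \<otimes>\<^bsub>H\<^esub> (x \<otimes>\<^bsub>H\<^esub> (b \<otimes>\<^bsub>H\<^esub> q)))))))"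
    by (rule Sm_swap) (simp_all add: Fs)
  also have "\<dots> = SS G (D h) (\<lambda>x y. SS G rs (\<lambda>a b. ?F' (y \<otimes>\<^bsub>H\<^esub> a) (x \<otimes>\<^bsub>H\<^esub> b)))"
    by (rule Sm_cong', subst Sm_swap) (simp_all add: Fs)
  also have "\<dots> = SS G rs (\<lambda>a b. SS G (D h) (\<lambda>x y. ?F' (a \<otimes>\<^bsub>H\<^esub> x) (b \<otimes>\<^bsub>H\<^esub> y)))"
    by (rule Rcomm[symmetric, OF G _ h], rule bilI) (simp_all add: Fs)
  also have "\<dots> = SS G (D h) (\<lambda>x y. SS G rs (\<lambda>a b. ?F' (a \<otimes>\<^bsub>H\<^esub> x) (b \<otimes>\<^bsub>H\<^esub> y)))"
    by (rule Sm_swap) (simp_all add: Fs)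
  also have "\<dots> = SS G (D h) (\<lambda>x y. SS G rb (\<lambda>c d. SS G rs (\<lambda>a b. SS G rb (\<lambda>p q. F ((c \<otimes>\<^bsub>H\<^esub> a) \<otimes>\<^bsub>H\<^esub> (x \<otimes>\<^bsub>H\<^esub> p)) ((d \<otimes>\<^bsub>H\<^esub> b) \<otimes>\<^bsub>H\<^esub> (y \<otimes>\<^bsub>H\<^esub> q))))))"
    by (rule Sm_cong', subst Sm_swap) (simp_all add: Fs)
  also have "\<dots> = SS G (D h) (\<lambda>x y. SS G rb (\<lambda>p q. F (x \<otimes>\<^bsub>H\<^esub> p) (y \<otimes>\<^bsub>H\<^esub> q)))"
  proof (rule Sm_cong')
    fix x y assume xy: "x \<in> carrier H" "y \<in> carrier H"
    have "bil k H G (\<lambda>u v. SS G rb (\<lambda>p q. F (u \<otimes>\<^bsub>H\<^esub> (x \<otimes>\<^bsub>H\<^esub> p)) (v \<otimes>\<^bsub>H\<^esub> (y \<otimes>\<^bsub>H\<^esub> q))))"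
      by (rule bilI) (use xy in \<open>simp_all add: Fs\<close>)
    from Rinv2[OF G this] xy
    show "SS G rb (\<lambda>c d. SS G rs (\<lambda>a b. SS G rb (\<lambda>p q. F ((c \<otimes>\<^bsub>H\<^esub> a) \<otimes>\<^bsub>H\<^esub> (x \<otimes>\<^bsub>H\<^esub> p)) ((d \<otimes>\<^bsub>H\<^esub> b) \<otimes>\<^bsub>H\<^esub> (y \<otimes>\<^bsub>H\<^esub> q))))) =
      SS G rb (\<lambda>p q. F (x \<otimes>\<^bsub>H\<^esub> p) (y \<otimes>\<^bsub>H\<^esub> q))" by simp
  qed
  finally show ?thesis .
qed

text \<open>The identity (\<Delta> \<otimes> id)(R^-1) = R^-1_23 R^-1_13. Multiplicativity of
  \<Delta> makes (\<Delta> \<otimes> id)(R^-1) inverse to (\<Delta> \<otimes> id)(R) = R_13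
  R_23.\<close>

lemma Rb_hexL:
  assumes G [simp]: "abelian_group G" and F: "tri k H G F"
  shows "SS G rb (\<lambda>c d. SS G (D c) (\<lambda>x y. F x y d)) = SS G rb (\<lambda>c d. SS G rb (\<lambda>c' d'. F c' c (d \<otimes>\<^bsub>H\<^esub> d')))"
proof -
  note Fs = triD[OF F]
  \<comment> \<open>Right multiplication by the expected value R^-1_23 R^-1_13; inserting it
    together with R_13 R_23 changes nothing.\<close>
  let ?F4 = "\<lambda>x y w. SS G rb (\<lambda>p q. SS G rb (\<lambda>p' q'. F (x \<otimes>\<^bsub>H\<^esub> p') (y \<otimes>\<^bsub>H\<^esub> p) (w \<otimes>\<^bsub>H\<^esub> (q \<otimes>\<^bsub>H\<^esub> q'))))"
  have F4: "tri k H G ?F4" by (rule triI) (simp_all add: Fs)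
  have ins: "F x y d = SS G rs (\<lambda>a b. SS G rs (\<lambda>a' b'. ?F4 (x \<otimes>\<^bsub>H\<^esub> a) (y \<otimes>\<^bsub>H\<^esub> a') (d \<otimes>\<^bsub>H\<^esub> (b \<otimes>\<^bsub>H\<^esub> b'))))"
    if "x \<in> carrier H" "y \<in> carrier H" "d \<in> carrier H" for x y d
  proof -
    have b1: "bil k H G (\<lambda>u v. F (x \<otimes>\<^bsub>H\<^esub> u) y (d \<otimes>\<^bsub>H\<^esub> v))"
      by (rule bilI) (use that in \<open>simp_all add: Fs\<close>)
    have b2: "bil k H G (\<lambda>u v. SS G rb (\<lambda>p' q'. F (x \<otimes>\<^bsub>H\<^esub> (a \<otimes>\<^bsub>H\<^esub> p')) (y \<otimes>\<^bsub>H\<^esub> u) (d \<otimes>\<^bsub>H\<^esub> (b \<otimes>\<^bsub>H\<^esub> (v \<otimes>\<^bsub>H\<^esub> q')))))"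
      if "a \<in> carrier H" "b \<in> carrier H" for a b
      by (rule bilI) (use that \<open>x \<in> carrier H\<close> \<open>y \<in> carrier H\<close> \<open>d \<in> carrier H\<close> in \<open>simp_all add: Fs\<close>)
    have "F x y d = SS G rs (\<lambda>a b. SS G rb (\<lambda>p' q'. F (x \<otimes>\<^bsub>H\<^esub> (a \<otimes>\<^bsub>H\<^esub> p')) y (d \<otimes>\<^bsub>H\<^esub> (b \<otimes>\<^bsub>H\<^esub> q'))))"
      using Rinv1[OF G b1] that by simp
    also have "\<dots> = SS G rs (\<lambda>a b. SS G rs (\<lambda>a' b'. SS G rb (\<lambda>p q. SS G rb (\<lambda>p' q'.
        F (x \<otimes>\<^bsub>H\<^esub> (a \<otimes>\<^bsub>H\<^esub> p')) (y \<otimes>\<^bsub>H\<^esub> (a' \<otimes>\<^bsub>H\<^esub> p)) (d \<otimes>\<^bsub>H\<^esub> (b \<otimes>\<^bsub>H\<^esub> ((b' \<otimes>\<^bsub>H\<^esub> q) \<otimes>\<^bsub>H\<^esub> q')))))))"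
      by (rule Sm_cong', subst Rinv1[OF G b2]) (use that in simp_all)
    finally show ?thesis using that by simp
  qed
  have "SS G rb (\<lambda>c d. SS G (D c) (\<lambda>x y. F x y d)) = SS G rb (\<lambda>c d. SS G (D c) (\<lambda>x y.
      SS G rs (\<lambda>a b. SS G rs (\<lambda>a' b'. ?F4 (x \<otimes>\<^bsub>H\<^esub> a) (y \<otimes>\<^bsub>H\<^esub> a') (d \<otimes>\<^bsub>H\<^esub> (b \<otimes>\<^bsub>H\<^esub> b'))))))"
    by (rule Sm_cong', rule Sm_cong', rule ins)
  also have "\<dots> = SS G rb (\<lambda>c d. SS G (D c) (\<lambda>x y.
      SS G rs (\<lambda>a b. SS G (D a) (\<lambda>u v. ?F4 (x \<otimes>\<^bsub>H\<^esub> u) (y \<otimes>\<^bsub>H\<^esub> v) (d \<otimes>\<^bsub>H\<^esub> b)))))"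
    by (rule Sm_cong', rule Sm_cong', rule hexL[symmetric], simp, rule triI) (simp_all add: Fs)
  also have "\<dots> = SS G rb (\<lambda>c d. SS G rs (\<lambda>a b. SS G (D c) (\<lambda>x y. SS G (D a) (\<lambda>u v.
      ?F4 (x \<otimes>\<^bsub>H\<^esub> u) (y \<otimes>\<^bsub>H\<^esub> v) (d \<otimes>\<^bsub>H\<^esub> b)))))"
    by (rule Sm_cong', rule Sm_swap) (simp_all add: Fs)
  also have "\<dots> = SS G rb (\<lambda>c d. SS G rs (\<lambda>a b. SS G (D (c \<otimes>\<^bsub>H\<^esub> a)) (\<lambda>x y. ?F4 x y (d \<otimes>\<^bsub>H\<^esub> b))))"
    by (rule Sm_cong', rule Sm_cong', rule D_mult[symmetric], simp, rule bilI) (simp_all add: Fs)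
  also have "\<dots> = SS G (D \<one>\<^bsub>H\<^esub>) (\<lambda>x y. ?F4 x y \<one>\<^bsub>H\<^esub>)"
    by (rule Rinv2[OF G tri_bil_l[OF G F4]])
  also have "\<dots> = ?F4 \<one>\<^bsub>H\<^esub> \<one>\<^bsub>H\<^esub> \<one>\<^bsub>H\<^esub>"
    by (rule D_one, simp, rule bilI) (simp_all add: Fs)
  finally show ?thesis by simp
qed

text \<open>The identity (id \<otimes> \<Delta>)(R^-1) = R^-1_12 R^-1_13, by inverting (id \<otimes>
  \<Delta>)(R) = R_13 R_12 as in \<open>Rb_hexL\<close>.\<close>

lemma Rb_hexR:
  assumes G [simp]: "abelian_group G" and F: "tri k H G F"
  shows "SS G rb (\<lambda>c d. SS G (D d) (\<lambda>x y. F c x y)) = SS G rb (\<lambda>c d. SS G rb (\<lambda>c' d'. F (c \<otimes>\<^bsub>H\<^esub> c') d d'))"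
proof -
  note Fs = triD[OF F]
  \<comment> \<open>Right multiplication by R^-1_12 R^-1_13.\<close>
  let ?F4 = "\<lambda>w x y. SS G rb (\<lambda>p q. SS G rb (\<lambda>p' q'. F (w \<otimes>\<^bsub>H\<^esub> (p \<otimes>\<^bsub>H\<^esub> p')) (x \<otimes>\<^bsub>H\<^esub> q) (y \<otimes>\<^bsub>H\<^esub> q')))"
  have F4: "tri k H G ?F4" by (rule triI) (simp_all add: Fs)
  have ins: "F c x y = SS G rs (\<lambda>a b. SS G rs (\<lambda>a' b'. ?F4 (c \<otimes>\<^bsub>H\<^esub> (a \<otimes>\<^bsub>H\<^esub> a')) (x \<otimes>\<^bsub>H\<^esub> b') (y \<otimes>\<^bsub>H\<^esub> b)))"
    if "c \<in> carrier H" "x \<in> carrier H" "y \<in> carrier H" for x y c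
  proof -
    have b1: "bil k H G (\<lambda>u v. F (c \<otimes>\<^bsub>H\<^esub> u) x (y \<otimes>\<^bsub>H\<^esub> v))"
      by (rule bilI) (use that in \<open>simp_all add: Fs\<close>)
    have b2: "bil k H G (\<lambda>u v. SS G rb (\<lambda>p' q'. F (c \<otimes>\<^bsub>H\<^esub> (a \<otimes>\<^bsub>H\<^esub> (u \<otimes>\<^bsub>H\<^esub> p'))) (x \<otimes>\<^bsub>H\<^esub> v) (y \<otimes>\<^bsub>H\<^esub> (b \<otimes>\<^bsub>H\<^esub> q'))))"
      if "a \<in> carrier H" "b \<in> carrier H" for a b
      by (rule bilI) (use that \<open>x \<in> carrier H\<close> \<open>y \<in> carrier H\<close> \<open>c \<in> carrier H\<close> in \<open>simp_all add: Fs\<close>)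
    have "F c x y = SS G rs (\<lambda>a b. SS G rb (\<lambda>p' q'. F (c \<otimes>\<^bsub>H\<^esub> (a \<otimes>\<^bsub>H\<^esub> p')) x (y \<otimes>\<^bsub>H\<^esub> (b \<otimes>\<^bsub>H\<^esub> q'))))"
      using Rinv1[OF G b1] that by simp
    also have "\<dots> = SS G rs (\<lambda>a b. SS G rs (\<lambda>a' b'. SS G rb (\<lambda>p q. SS G rb (\<lambda>p' q'.
        F (c \<otimes>\<^bsub>H\<^esub> (a \<otimes>\<^bsub>H\<^esub> ((a' \<otimes>\<^bsub>H\<^esub> p) \<otimes>\<^bsub>H\<^esub> p'))) (x \<otimes>\<^bsub>H\<^esub> (b' \<otimes>\<^bsub>H\<^esub> q)) (y \<otimes>\<^bsub>H\<^esub> (b \<otimes>\<^bsub>H\<^esub> q'))))))"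
      by (rule Sm_cong', subst Rinv1[OF G b2]) (use that in simp_all)
    finally show ?thesis using that by simp
  qed
  have "SS G rb (\<lambda>c d. SS G (D d) (\<lambda>x y. F c x y)) = SS G rb (\<lambda>c d. SS G (D d) (\<lambda>x y.
      SS G rs (\<lambda>a b. SS G rs (\<lambda>a' b'. ?F4 (c \<otimes>\<^bsub>H\<^esub> (a \<otimes>\<^bsub>H\<^esub> a')) (x \<otimes>\<^bsub>H\<^esub> b') (y \<otimes>\<^bsub>H\<^esub> b)))))"
    by (rule Sm_cong', rule Sm_cong', rule ins)
  also have "\<dots> = SS G rb (\<lambda>c d. SS G (D d) (\<lambda>x y.
      SS G rs (\<lambda>a b. SS G (D b) (\<lambda>u v. ?F4 (c \<otimes>\<^bsub>H\<^esub> a) (x \<otimes>\<^bsub>H\<^esub> u) (y \<otimes>\<^bsub>H\<^esub> v)))))"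
    by (rule Sm_cong', rule Sm_cong', rule hexR[symmetric], simp, rule triI) (simp_all add: Fs)
  also have "\<dots> = SS G rb (\<lambda>c d. SS G rs (\<lambda>a b. SS G (D d) (\<lambda>x y. SS G (D b) (\<lambda>u v.
      ?F4 (c \<otimes>\<^bsub>H\<^esub> a) (x \<otimes>\<^bsub>H\<^esub> u) (y \<otimes>\<^bsub>H\<^esub> v)))))"
    by (rule Sm_cong', rule Sm_swap) (simp_all add: Fs)
  also have "\<dots> = SS G rb (\<lambda>c d. SS G rs (\<lambda>a b. SS G (D (d \<otimes>\<^bsub>H\<^esub> b)) (\<lambda>x y. ?F4 (c \<otimes>\<^bsub>H\<^esub> a) x y)))"
    by (rule Sm_cong', rule Sm_cong', rule D_mult[symmetric], simp, rule bilI) (simp_all add: Fs)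
  also have "\<dots> = SS G (D \<one>\<^bsub>H\<^esub>) (\<lambda>x y. ?F4 \<one>\<^bsub>H\<^esub> x y)"
    by (rule Rinv2[OF G tri_bil_r[OF G F4]])
  also have "\<dots> = ?F4 \<one>\<^bsub>H\<^esub> \<one>\<^bsub>H\<^esub> \<one>\<^bsub>H\<^esub>"
    by (rule D_one, simp, rule bilI) (simp_all add: Fs)
  finally show ?thesis by simp
qed

text \<open>Commutativity of L with respect to R^-1_21: let R R^-1 = 1 act on the pair, and absorb
  the outer R by one use of commutativity for R.\<close>

lemma H_comm_minus:
  assumes "l \<in> carrier L" "m \<in> carrier L"
  shows "l \<otimes>\<^bsub>L\<^esub> m = SS L rb (\<lambda>c d. act c m \<otimes>\<^bsub>L\<^esub> act d l)"
proof -
  have b: "bil k H L (\<lambda>u v. act v l \<otimes>\<^bsub>L\<^esub> act u m)"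
    by (rule bilI) (use assms in simp_all)
  have "l \<otimes>\<^bsub>L\<^esub> m = SS L rs (\<lambda>a b. SS L rb (\<lambda>c d. act (b \<otimes>\<^bsub>H\<^esub> d) l \<otimes>\<^bsub>L\<^esub> act (a \<otimes>\<^bsub>H\<^esub> c) m))"
    using Rinv1[OF _ b] assms by simp
  also have "\<dots> = SS L rb (\<lambda>c d. SS L rs (\<lambda>a b. act b (act d l) \<otimes>\<^bsub>L\<^esub> act a (act c m)))"
    by (subst Sm_swap) (use assms in simp_all)
  also have "\<dots> = SS L rb (\<lambda>c d. act c m \<otimes>\<^bsub>L\<^esub> act d l)"
    by (rule Sm_cong', rule H_comm[symmetric]) (use assms in simp_all)
  finally show ?thesis .
qed

text \<open>R^-1_21 is again a universal R-matrix, with inverse R_21, and L is commutative for it.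
  Every fact of this locale thereby gains a counterpart in which \<open>rs\<close> and
  \<open>rb\<close> are exchanged and their pairs reversed.\<close>

lemma represented_minus:
  "represented_bialgebra k H (Sm (carrier H) (kt2 k H) (map prod.swap rb) (\<lambda>a b. a \<boxtimes>\<^bsub>kt2 k H\<^esub> b)) L act D
     (map prod.swap rb) (map prod.swap rs)"
proof -
  have t: "tri k H T3 (\<lambda>a b c. (a \<boxtimes>\<^bsub>T2\<^esub> b) \<boxtimes>\<^bsub>T3\<^esub> c)" by (rule triI) simp_all
  have t': "tri k H T3 (\<lambda>a b c. (c \<boxtimes>\<^bsub>T2\<^esub> a) \<boxtimes>\<^bsub>T3\<^esub> b)" by (rule triI) simp_all
  have t'': "tri k H T3 (\<lambda>a b c. (b \<boxtimes>\<^bsub>T2\<^esub> c) \<boxtimes>\<^bsub>T3\<^esub> a)" by (rule triI) simp_all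
  have b: "bil k H T2 (\<lambda>a b. b \<boxtimes>\<^bsub>T2\<^esub> a)" by (rule bilI) simp_all
  show ?thesis
    by (rule represented_bialgebra.intro[OF H_alg L_alg])
      (simp_all add: comult_eq[symmetric] comult_add comult_smult comult_mult comult_one coassoc0
        counit_l counit_r act_prod H_comm_minus[symmetric] Rb_comm[OF _ b]
        Rb_hexL[OF _ t'] Rb_hexR[OF _ t''] Rinv1[OF _ b] Rinv2[OF _ b])
qed

end

section \<open>Tensor products over the base\<close>

text \<open>The hypotheses are symmetric in \<open>s\<close> and \<open>t\<close>; interchanging the
  two turns the tensor square over L into the one over the opposite of L.\<close>

locale base_tensor =
  fixes k :: "('k, 'x) ring_scheme" and C :: "('k, 'c, 'w) module_scheme"
    and L :: "('l, 'v) ring_scheme" and s t :: "'l \<Rightarrow> 'c"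
  assumes C_alg: "k_algebra k C"
    and s_in: "l \<in> carrier L \<Longrightarrow> s l \<in> carrier C"
    and t_in: "l \<in> carrier L \<Longrightarrow> t l \<in> carrier C"
    and st_comm: "l \<in> carrier L \<Longrightarrow> m \<in> carrier L \<Longrightarrow> s l \<otimes>\<^bsub>C\<^esub> t m = t m \<otimes>\<^bsub>C\<^esub> s l"

sublocale base_tensor \<subseteq> C: alg k C by (rule alg.intro[OF C_alg])

context base_tensor
begin

abbreviation BT where "BT \<equiv> btensor L s t C"
abbreviation BT3 where "BT3 \<equiv> btensor3 L s t C"
abbreviation bb where "bb G f \<equiv> bal (carrier L) (\<lambda>l a. t l \<otimes>\<^bsub>C\<^esub> a) (\<lambda>l b. s l \<otimes>\<^bsub>C\<^esub> b) C C G f"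

sublocale t2: tens "carrier L" "\<lambda>l a. t l \<otimes>\<^bsub>C\<^esub> a" "\<lambda>l b. s l \<otimes>\<^bsub>C\<^esub> b" C C "btensor L s t C"
  by (unfold btensor_def, rule tens_tensor) (auto simp: s_in t_in)

lemma swap: "base_tensor k C L t s"
  by unfold_locales (simp_all add: C_alg s_in t_in st_comm)

lemma st_comm': "l \<in> carrier L \<Longrightarrow> m \<in> carrier L \<Longrightarrow> x \<in> carrier C \<Longrightarrow>
    s l \<otimes>\<^bsub>C\<^esub> (t m \<otimes>\<^bsub>C\<^esub> x) = t m \<otimes>\<^bsub>C\<^esub> (s l \<otimes>\<^bsub>C\<^esub> x)"
  by (metis C.m_assoc st_comm s_in t_in)

lemma pure_t: "l \<in> carrier L \<Longrightarrow> a \<in> carrier C \<Longrightarrow> b \<in> carrier C \<Longrightarrow>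
    (t l \<otimes>\<^bsub>C\<^esub> a) \<boxtimes>\<^bsub>BT\<^esub> b = a \<boxtimes>\<^bsub>BT\<^esub> (s l \<otimes>\<^bsub>C\<^esub> b)"
  by (rule t2.pure_bal)

lemma tmul_pure_bal:
  "c \<in> carrier C \<Longrightarrow> d \<in> carrier C \<Longrightarrow> bb BT (\<lambda>a b. (a \<otimes>\<^bsub>C\<^esub> c) \<boxtimes>\<^bsub>BT\<^esub> (b \<otimes>\<^bsub>C\<^esub> d))"
  by (rule balI) (simp_all add: pure_t s_in t_in)

lemma tmul_pure_hom:
  "c \<in> carrier C \<Longrightarrow> d \<in> carrier C \<Longrightarrow> ahom BT BT (\<lambda>X. tmul_pure BT C C X c d)"
  unfolding tmul_pure_def using t2.lift_ahom[OF t2.agT tmul_pure_bal] .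

lemma tmul_pure_pure [simp]:
  "a \<in> carrier C \<Longrightarrow> b \<in> carrier C \<Longrightarrow> c \<in> carrier C \<Longrightarrow> d \<in> carrier C \<Longrightarrow>
   tmul_pure BT C C (a \<boxtimes>\<^bsub>BT\<^esub> b) c d = (a \<otimes>\<^bsub>C\<^esub> c) \<boxtimes>\<^bsub>BT\<^esub> (b \<otimes>\<^bsub>C\<^esub> d)"
  unfolding tmul_pure_def using t2.lift_pure[OF t2.agT tmul_pure_bal] by simp

lemma tmul_pure_closed [simp]:
  "X \<in> carrier BT \<Longrightarrow> c \<in> carrier C \<Longrightarrow> d \<in> carrier C \<Longrightarrow> tmul_pure BT C C X c d \<in> carrier BT"
  using ahom_closed[OF tmul_pure_hom] by simp

lemma tmul_pure_Sm [simp]: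
  assumes "\<And>x y. x \<in> P \<Longrightarrow> y \<in> P \<Longrightarrow> f x y \<in> carrier BT" "c \<in> carrier C" "d \<in> carrier C"
  shows "tmul_pure BT C C (Sm P BT xs f) c d = Sm P BT xs (\<lambda>x y. tmul_pure BT C C (f x y) c d)"
  using Sm_hom[OF tmul_pure_hom assms(1)] assms(2,3) .

lemma tmul_pure_tmul_pure:
  assumes "X \<in> carrier BT" "a \<in> carrier C" "b \<in> carrier C" "c \<in> carrier C" "d \<in> carrier C"
  shows "tmul_pure BT C C (tmul_pure BT C C X a b) c d = tmul_pure BT C C X (a \<otimes>\<^bsub>C\<^esub> c) (b \<otimes>\<^bsub>C\<^esub> d)"
  by (rule t2.ahom_eqI[OF ahom_comp[OF tmul_pure_hom tmul_pure_hom] tmul_pure_hom assms(1)])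
    (use assms in simp_all)

lemma tmul_pure_one:
  assumes "X \<in> carrier BT"
  shows "tmul_pure BT C C X \<one>\<^bsub>C\<^esub> \<one>\<^bsub>C\<^esub> = X"
proof -
  have "ahom BT BT (\<lambda>X. X)" by (rule ahomI) auto
  from t2.ahom_eqI[OF tmul_pure_hom this assms] show ?thesis by simp
qed

lemma tmul_pure_add:
  assumes "X \<in> carrier BT" "c \<in> carrier C" "c' \<in> carrier C" "d \<in> carrier C"
  shows "tmul_pure BT C C X (c \<oplus>\<^bsub>C\<^esub> c') d = tmul_pure BT C C X c d \<oplus>\<^bsub>BT\<^esub> tmul_pure BT C C X c' d"
    "tmul_pure BT C C X d (c \<oplus>\<^bsub>C\<^esub> c') = tmul_pure BT C C X d c \<oplus>\<^bsub>BT\<^esub> tmul_pure BT C C X d c'"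
proof -
  interpret B: abelian_group BT by simp
  have h: "ahom BT BT (\<lambda>X. tmul_pure BT C C X c d \<oplus>\<^bsub>BT\<^esub> tmul_pure BT C C X c' d)"
    "ahom BT BT (\<lambda>X. tmul_pure BT C C X d c \<oplus>\<^bsub>BT\<^esub> tmul_pure BT C C X d c')"
    by (rule ahomI; use assms in \<open>simp add: ahom_add[OF tmul_pure_hom] B.a_ac\<close>)+
  show "tmul_pure BT C C X (c \<oplus>\<^bsub>C\<^esub> c') d = tmul_pure BT C C X c d \<oplus>\<^bsub>BT\<^esub> tmul_pure BT C C X c' d"
    by (rule t2.ahom_eqI[OF tmul_pure_hom h(1) assms(1)]) (use assms in simp_all)
  show "tmul_pure BT C C X d (c \<oplus>\<^bsub>C\<^esub> c') = tmul_pure BT C C X d c \<oplus>\<^bsub>BT\<^esub> tmul_pure BT C C X d c'"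
    by (rule t2.ahom_eqI[OF tmul_pure_hom h(2) assms(1)]) (use assms in simp_all)
qed

text \<open>Left multiplication of the first factor by s(l) respects the relation t(m) a \<otimes> b
  = a \<otimes> s(m) b because the images of \<open>s\<close> and \<open>t\<close> commute. For
  \<open>right_bal\<close> the argument is the same in the second factor.\<close>

lemma left_bal: "l \<in> carrier L \<Longrightarrow> bb BT (\<lambda>a b. (s l \<otimes>\<^bsub>C\<^esub> a) \<boxtimes>\<^bsub>BT\<^esub> b)"
  by (rule balI; simp add: st_comm' pure_t s_in t_in)

lemma right_bal: "l \<in> carrier L \<Longrightarrow> bb BT (\<lambda>a b. a \<boxtimes>\<^bsub>BT\<^esub> (t l \<otimes>\<^bsub>C\<^esub> b))"
  by (rule balI; simp add: st_comm' pure_t s_in t_in)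

lemma left_hom: "l \<in> carrier L \<Longrightarrow> ahom BT BT (tmap BT (\<lambda>x. s l \<otimes>\<^bsub>C\<^esub> x) (\<lambda>y. y))"
  and right_hom: "l \<in> carrier L \<Longrightarrow> ahom BT BT (tmap BT (\<lambda>x. x) (\<lambda>y. t l \<otimes>\<^bsub>C\<^esub> y))"
  unfolding tmap_def[abs_def]
  using t2.lift_ahom[OF t2.agT left_bal] t2.lift_ahom[OF t2.agT right_bal] by auto

lemma left_pure [simp]: "l \<in> carrier L \<Longrightarrow> a \<in> carrier C \<Longrightarrow> b \<in> carrier C \<Longrightarrow>
    tmap BT (\<lambda>x. s l \<otimes>\<^bsub>C\<^esub> x) (\<lambda>y. y) (a \<boxtimes>\<^bsub>BT\<^esub> b) = (s l \<otimes>\<^bsub>C\<^esub> a) \<boxtimes>\<^bsub>BT\<^esub> b"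
  and right_pure [simp]: "l \<in> carrier L \<Longrightarrow> a \<in> carrier C \<Longrightarrow> b \<in> carrier C \<Longrightarrow>
    tmap BT (\<lambda>x. x) (\<lambda>y. t l \<otimes>\<^bsub>C\<^esub> y) (a \<boxtimes>\<^bsub>BT\<^esub> b) = a \<boxtimes>\<^bsub>BT\<^esub> (t l \<otimes>\<^bsub>C\<^esub> b)"
  unfolding tmap_def
  using t2.lift_pure[OF t2.agT left_bal] t2.lift_pure[OF t2.agT right_bal] by auto

lemma left_Sm [simp]:
  assumes "\<And>x y. x \<in> P \<Longrightarrow> y \<in> P \<Longrightarrow> f x y \<in> carrier BT" "l \<in> carrier L"
  shows "tmap BT (\<lambda>x. s l \<otimes>\<^bsub>C\<^esub> x) (\<lambda>y. y) (Sm P BT xs f) = Sm P BT xs (\<lambda>x y. tmap BT (\<lambda>x. s l \<otimes>\<^bsub>C\<^esub> x) (\<lambda>y. y) (f x y))"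
  using Sm_hom[OF left_hom assms(1)] assms(2) .

lemma right_Sm [simp]:
  assumes "\<And>x y. x \<in> P \<Longrightarrow> y \<in> P \<Longrightarrow> f x y \<in> carrier BT" "l \<in> carrier L"
  shows "tmap BT (\<lambda>x. x) (\<lambda>y. t l \<otimes>\<^bsub>C\<^esub> y) (Sm P BT xs f) = Sm P BT xs (\<lambda>x y. tmap BT (\<lambda>x. x) (\<lambda>y. t l \<otimes>\<^bsub>C\<^esub> y) (f x y))"
  using Sm_hom[OF right_hom assms(1)] assms(2) .

sublocale t3: tens "carrier L" "\<lambda>l. tmap (btensor L s t C) (\<lambda>a. a) (\<lambda>b. t l \<otimes>\<^bsub>C\<^esub> b)" "\<lambda>l b. s l \<otimes>\<^bsub>C\<^esub> b"
    "btensor L s t C" C "btensor3 L s t C"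
  by (unfold btensor3_def, rule tens_tensor) (auto simp: ahom_closed[OF right_hom] s_in)

lemma pure3_t: "l \<in> carrier L \<Longrightarrow> X \<in> carrier BT \<Longrightarrow> c \<in> carrier C \<Longrightarrow>
    tmap BT (\<lambda>x. x) (\<lambda>y. t l \<otimes>\<^bsub>C\<^esub> y) X \<boxtimes>\<^bsub>BT3\<^esub> c = X \<boxtimes>\<^bsub>BT3\<^esub> (s l \<otimes>\<^bsub>C\<^esub> c)"
  by (rule t3.pure_bal)

lemma flip_bal: "bb (btensor L t s C) (\<lambda>a b. b \<boxtimes>\<^bsub>btensor L t s C\<^esub> a)"
proof -
  interpret O: base_tensor k C L t s by (rule swap)
  show ?thesis by (rule balI) (simp_all add: O.pure_t s_in t_in)
qed

lemma flip_hom: "ahom BT (btensor L t s C) (tflip (btensor L t s C))"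
  and flip_pure [simp]: "a \<in> carrier C \<Longrightarrow> b \<in> carrier C \<Longrightarrow>
    tflip (btensor L t s C) (a \<boxtimes>\<^bsub>BT\<^esub> b) = b \<boxtimes>\<^bsub>btensor L t s C\<^esub> a"
proof -
  interpret O: base_tensor k C L t s by (rule swap)
  show "ahom BT (btensor L t s C) (tflip (btensor L t s C))"
    unfolding tflip_def[abs_def] by (rule t2.lift_ahom[OF O.t2.agT flip_bal])
  show "a \<in> carrier C \<Longrightarrow> b \<in> carrier C \<Longrightarrow>
    tflip (btensor L t s C) (a \<boxtimes>\<^bsub>BT\<^esub> b) = b \<boxtimes>\<^bsub>btensor L t s C\<^esub> a"
    unfolding tflip_def by (rule t2.lift_pure[OF O.t2.agT flip_bal])
qed

lemma flip_Sm [simp]: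
  assumes "\<And>x y. x \<in> P \<Longrightarrow> y \<in> P \<Longrightarrow> f x y \<in> carrier BT"
  shows "tflip (btensor L t s C) (Sm P BT xs f) =
    Sm P (btensor L t s C) xs (\<lambda>x y. tflip (btensor L t s C) (f x y))"
  using Sm_hom[OF flip_hom assms] .

lemma bracket_bal: "a \<in> carrier C \<Longrightarrow> bb BT3 (\<lambda>b c. (a \<boxtimes>\<^bsub>BT\<^esub> b) \<boxtimes>\<^bsub>BT3\<^esub> c)"
  by (rule balI) (simp_all add: s_in t_in flip: pure3_t)

text \<open>The inner sum of \<open>tmap_right\<close>, isolated so that its behaviour in
  \<open>a\<close> can be stated separately.\<close>

definition bracket where "bracket a X = tlift BT3 (\<lambda>b c. (a \<boxtimes>\<^bsub>BT\<^esub> b) \<boxtimes>\<^bsub>BT3\<^esub> c) X"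

lemma bracket_hom: "a \<in> carrier C \<Longrightarrow> ahom BT BT3 (bracket a)"
  and bracket_pure [simp]: "a \<in> carrier C \<Longrightarrow> b \<in> carrier C \<Longrightarrow> c \<in> carrier C \<Longrightarrow>
    bracket a (b \<boxtimes>\<^bsub>BT\<^esub> c) = (a \<boxtimes>\<^bsub>BT\<^esub> b) \<boxtimes>\<^bsub>BT3\<^esub> c"
  unfolding bracket_def[abs_def]
  using t2.lift_ahom[OF t3.agT bracket_bal] t2.lift_pure[OF t3.agT bracket_bal] by auto

lemma bracket_Sm [simp]:
  assumes "\<And>x y. x \<in> P \<Longrightarrow> y \<in> P \<Longrightarrow> f x y \<in> carrier BT" "a \<in> carrier C"
  shows "bracket a (Sm P BT xs f) = Sm P BT3 xs (\<lambda>x y. bracket a (f x y))"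
  using Sm_hom[OF bracket_hom assms(1)] assms(2) .

lemma bracket_add_l:
  assumes "X \<in> carrier BT" "a \<in> carrier C" "a' \<in> carrier C"
  shows "bracket (a \<oplus>\<^bsub>C\<^esub> a') X = bracket a X \<oplus>\<^bsub>BT3\<^esub> bracket a' X"
proof -
  interpret B: abelian_group BT3 by simp
  have h: "ahom BT BT3 (\<lambda>X. bracket a X \<oplus>\<^bsub>BT3\<^esub> bracket a' X)"
    by (rule ahomI; use assms in \<open>simp add: ahom_closed[OF bracket_hom] ahom_add[OF bracket_hom] B.a_ac\<close>)
  show ?thesis by (rule t2.ahom_eqI[OF bracket_hom h assms(1)]) (use assms in simp_all)
qed

lemma bracket_t:
  assumes "X \<in> carrier BT" "a \<in> carrier C" "l \<in> carrier L"
  shows "bracket (t l \<otimes>\<^bsub>C\<^esub> a) X = bracket a (tmap BT (\<lambda>x. s l \<otimes>\<^bsub>C\<^esub> x) (\<lambda>y. y) X)"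
  by (rule t2.ahom_eqI[OF bracket_hom ahom_comp[OF left_hom bracket_hom] assms(1)])
    (use assms in \<open>simp_all add: pure_t s_in t_in\<close>)

text \<open>Well-definedness of id \<otimes> f over the base: \<open>f\<close> has to turn
  multiplication by s(l) into multiplication of the first factor by s(l). The companion
  \<open>pure_map_bal\<close> asks the corresponding condition with t(l) and the second factor for f
  \<otimes> id.\<close>

lemma bracket_map_bal:
  assumes "ahom C BT f" "\<And>l a. l \<in> carrier L \<Longrightarrow> a \<in> carrier C \<Longrightarrow>
    f (s l \<otimes>\<^bsub>C\<^esub> a) = tmap BT (\<lambda>x. s l \<otimes>\<^bsub>C\<^esub> x) (\<lambda>y. y) (f a)"
  shows "bb BT3 (\<lambda>a d. bracket a (f d))"
  by (rule balI) (simp_all add: assms ahom_closed[OF bracket_hom] ahom_closed[OF assms(1)] bracket_add_l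
      ahom_add[OF assms(1)] ahom_add[OF bracket_hom] bracket_t)

lemma pure_map_bal:
  assumes "ahom C BT f" "\<And>l a. l \<in> carrier L \<Longrightarrow> a \<in> carrier C \<Longrightarrow>
    f (t l \<otimes>\<^bsub>C\<^esub> a) = tmap BT (\<lambda>x. x) (\<lambda>y. t l \<otimes>\<^bsub>C\<^esub> y) (f a)"
  shows "bb BT3 (\<lambda>a d. f a \<boxtimes>\<^bsub>BT3\<^esub> d)"
  by (rule balI) (simp_all add: assms(2) ahom_closed[OF assms(1)] ahom_add[OF assms(1)] pure3_t s_in)

lemma tmap_right_eq:
  "tmap_right BT BT3 f X = tlift BT3 (\<lambda>a d. bracket a (f d)) X"
  by (simp add: tmap_right_def bracket_def)

text \<open>Right multiplications compose, so balancing at the unit implies it everywhere. The pair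
  \<open>(u, w)\<close> is left open: \<open>(t, s)\<close> serves right factors from
  \<open>BT\<close> itself, \<open>(s, t)\<close> those from the tensor square over the other
  base.\<close>

lemma tmul_bal:
  assumes "X \<in> carrier BT" "\<And>l. l \<in> carrier L \<Longrightarrow>
    tmul_pure BT C C X (u l) \<one>\<^bsub>C\<^esub> = tmul_pure BT C C X \<one>\<^bsub>C\<^esub> (w l)"
    "\<And>l. l \<in> carrier L \<Longrightarrow> u l \<in> carrier C" "\<And>l. l \<in> carrier L \<Longrightarrow> w l \<in> carrier C"
  shows "bal (carrier L) (\<lambda>l a. u l \<otimes>\<^bsub>C\<^esub> a) (\<lambda>l b. w l \<otimes>\<^bsub>C\<^esub> b) C C BT (tmul_pure BT C C X)"
proof (rule balI)
  fix l c d assume *: "l \<in> carrier L" "c \<in> carrier C" "d \<in> carrier C"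
  have "tmul_pure BT C C (tmul_pure BT C C X (u l) \<one>\<^bsub>C\<^esub>) c d = tmul_pure BT C C (tmul_pure BT C C X \<one>\<^bsub>C\<^esub> (w l)) c d"
    using assms(2) * by simp
  then show "tmul_pure BT C C X (u l \<otimes>\<^bsub>C\<^esub> c) d = tmul_pure BT C C X c (w l \<otimes>\<^bsub>C\<^esub> d)"
    using * assms(1,3,4) by (simp add: tmul_pure_tmul_pure)
qed (use assms in \<open>simp_all add: tmul_pure_add\<close>)

end

section \<open>Presented quantum groupoids\<close>

text \<open>A pair \<open>(s, i)\<close> of algebra maps subject to \<open>smash_comm\<close>
  amounts to an algebra map out of the smash product. Working with pairs lets the smash product, its
  quotient and their opposites share one theory.\<close>

locale smash_rep = represented_bialgebra k H R L act D rs rb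
  for k :: "('k, 'x) ring_scheme" and H :: "('k, 'h, 'y) hopf_scheme" and R :: "('h, 'h) tens"
    and L :: "('k, 'l, 'z) module_scheme" and act :: "'h \<Rightarrow> 'l \<Rightarrow> 'l"
    and D :: "'h \<Rightarrow> ('h \<times> 'h) list" and rs rb :: "('h \<times> 'h) list" +
  fixes C :: "('k, 'c, 'w) module_scheme" and s :: "'l \<Rightarrow> 'c" and i :: "'h \<Rightarrow> 'c"
  assumes C_alg: "k_algebra k C" and s_hom: "s \<in> alg_hom k L C" and i_hom: "i \<in> alg_hom k H C"
    and smash_comm: "h \<in> carrier H \<Longrightarrow> l \<in> carrier L \<Longrightarrow>
      i h \<otimes>\<^bsub>C\<^esub> s l = Sm (carrier H) C (D h) (\<lambda>x y. s (act x l) \<otimes>\<^bsub>C\<^esub> i y)"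

sublocale smash_rep \<subseteq> C: alg k C by (rule alg.intro[OF C_alg])

section \<open>The target map t^+ in a representation of the smash product\<close>

context smash_rep
begin

text \<open>The multiplication rule is reversed so that products are collected inside
  \<open>s\<close>, and likewise inside \<open>i\<close>; expressions then normalise towards the
  form s(l) i(h).\<close>

lemmas s_simps [simp] = alg_homD(1,2,4,5)[OF s_hom] alg_homD(3)[OF s_hom, symmetric]
lemmas i_simps [simp] = alg_homD(1,2,4,5)[OF i_hom] alg_homD(3)[OF i_hom, symmetric]

lemma s_ahom: "ahom L C s" and i_ahom: "ahom H C i"
  using alg_hom_ahom[OF s_hom] alg_hom_ahom[OF i_hom] by auto

lemmas s_Sm [simp] = Sm_hom[OF s_ahom]
lemmas i_Sm [simp] = Sm_hom[OF i_ahom]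

lemma s_mult' [simp]: "l \<in> carrier L \<Longrightarrow> m \<in> carrier L \<Longrightarrow> x \<in> carrier C \<Longrightarrow>
    s l \<otimes>\<^bsub>C\<^esub> (s m \<otimes>\<^bsub>C\<^esub> x) = s (l \<otimes>\<^bsub>L\<^esub> m) \<otimes>\<^bsub>C\<^esub> x"
  by (simp del: C.m_assoc flip: C.m_assoc)

lemma i_mult' [simp]: "g \<in> carrier H \<Longrightarrow> h \<in> carrier H \<Longrightarrow> x \<in> carrier C \<Longrightarrow>
    i g \<otimes>\<^bsub>C\<^esub> (i h \<otimes>\<^bsub>C\<^esub> x) = i (g \<otimes>\<^bsub>H\<^esub> h) \<otimes>\<^bsub>C\<^esub> x"
  by (simp del: C.m_assoc flip: C.m_assoc)

lemma smash_comm':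
  assumes "h \<in> carrier H" "l \<in> carrier L" "x \<in> carrier C"
  shows "i h \<otimes>\<^bsub>C\<^esub> (s l \<otimes>\<^bsub>C\<^esub> x) = SS C (D h) (\<lambda>p q. s (act p l) \<otimes>\<^bsub>C\<^esub> (i q \<otimes>\<^bsub>C\<^esub> x))"
proof -
  have "i h \<otimes>\<^bsub>C\<^esub> (s l \<otimes>\<^bsub>C\<^esub> x) = (i h \<otimes>\<^bsub>C\<^esub> s l) \<otimes>\<^bsub>C\<^esub> x" using assms by simp
  also have "\<dots> = SS C (D h) (\<lambda>p q. s (act p l) \<otimes>\<^bsub>C\<^esub> (i q \<otimes>\<^bsub>C\<^esub> x))"
    using assms by (simp only: smash_comm) simp
  finally show ?thesis .
qed

text \<open>The target map t^+ read off in \<open>C\<close>. In the interpretation with R^-1_21 the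
  same definition yields t^-.\<close>

definition tp where "tp l = SS C rs (\<lambda>a b. s (act b l) \<otimes>\<^bsub>C\<^esub> i a)"

lemma tp_closed [simp]: "l \<in> carrier L \<Longrightarrow> tp l \<in> carrier C"
  and tp_add [simp]: "l \<in> carrier L \<Longrightarrow> m \<in> carrier L \<Longrightarrow> tp (l \<oplus>\<^bsub>L\<^esub> m) = tp l \<oplus>\<^bsub>C\<^esub> tp m"
  and tp_smult [simp]: "r \<in> carrier k \<Longrightarrow> l \<in> carrier L \<Longrightarrow> tp (r \<odot>\<^bsub>L\<^esub> l) = r \<odot>\<^bsub>C\<^esub> tp l"
  by (simp_all add: tp_def C.smult_Sm)

lemma tp_one: "tp \<one>\<^bsub>L\<^esub> = \<one>\<^bsub>C\<^esub>"
proof -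
  have "tp \<one>\<^bsub>L\<^esub> = i (SS H rs (\<lambda>a b. \<epsilon> b \<odot>\<^bsub>H\<^esub> a))" by (simp add: tp_def)
  then show ?thesis by (simp only: eps_R_r i_simps)
qed

text \<open>Moving s(m) to the left past i(R_1) splits R_1 by \<Delta>; (\<Delta> \<otimes> id)(R) =
  R_13 R_23 separates the two copies, and one of them reverses the product in L by
  commutativity.\<close>

lemma tp_s:
  assumes l: "l \<in> carrier L" and m: "m \<in> carrier L"
  shows "tp l \<otimes>\<^bsub>C\<^esub> s m = s m \<otimes>\<^bsub>C\<^esub> tp l"
proof -
  have "tp l \<otimes>\<^bsub>C\<^esub> s m = SS C rs (\<lambda>a b. SS C (D a) (\<lambda>x y. s (act b l \<otimes>\<^bsub>L\<^esub> act x m) \<otimes>\<^bsub>C\<^esub> i y))"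
    using assms by (simp add: tp_def smash_comm)
  also have "\<dots> = SS C rs (\<lambda>a b. SS C rs (\<lambda>c d. s (act (b \<otimes>\<^bsub>H\<^esub> d) l \<otimes>\<^bsub>L\<^esub> act a m) \<otimes>\<^bsub>C\<^esub> i c))"
    by (rule hexL, simp, rule triI) (use assms in simp_all)
  also have "\<dots> = SS C rs (\<lambda>c d. SS C rs (\<lambda>a b. s (act b (act d l) \<otimes>\<^bsub>L\<^esub> act a m) \<otimes>\<^bsub>C\<^esub> i c))"
    by (subst Sm_swap) (use assms in simp_all)
  also have "\<dots> = SS C rs (\<lambda>c d. s (SS L rs (\<lambda>a b. act b (act d l) \<otimes>\<^bsub>L\<^esub> act a m)) \<otimes>\<^bsub>C\<^esub> i c)"
    using assms by simp
  also have "\<dots> = SS C rs (\<lambda>c d. s (m \<otimes>\<^bsub>L\<^esub> act d l) \<otimes>\<^bsub>C\<^esub> i c)"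
    by (rule Sm_cong', subst H_comm[symmetric]) (use assms in simp_all)
  also have "\<dots> = s m \<otimes>\<^bsub>C\<^esub> tp l" using assms by (simp add: tp_def)
  finally show ?thesis .
qed

text \<open>Since t^+(l) commutes with \<open>s\<close>, the two copies of R can be brought
  together, where R_13 R_12 = (id \<otimes> \<Delta>)(R) merges them into one. The module algebra
  axiom then produces the product in reversed order.\<close>

lemma tp_mult:
  assumes l: "l \<in> carrier L" and m: "m \<in> carrier L"
  shows "tp l \<otimes>\<^bsub>C\<^esub> tp m = tp (m \<otimes>\<^bsub>L\<^esub> l)"
proof -
  have "tp l \<otimes>\<^bsub>C\<^esub> tp m = SS C rs (\<lambda>a b. s (act b m) \<otimes>\<^bsub>C\<^esub> (tp l \<otimes>\<^bsub>C\<^esub> i a))"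
    using assms by (simp add: tp_def[of m] tp_s flip: C.m_assoc)
  also have "\<dots> = SS C rs (\<lambda>c d. SS C rs (\<lambda>a b. s (act d m \<otimes>\<^bsub>L\<^esub> act b l) \<otimes>\<^bsub>C\<^esub> i (a \<otimes>\<^bsub>H\<^esub> c)))"
    using assms by (simp add: tp_def[of l])
  also have "\<dots> = SS C rs (\<lambda>a b. SS C rs (\<lambda>c d. s (act d m \<otimes>\<^bsub>L\<^esub> act b l) \<otimes>\<^bsub>C\<^esub> i (a \<otimes>\<^bsub>H\<^esub> c)))"
    by (rule Sm_swap) (use assms in simp_all)
  also have "\<dots> = SS C rs (\<lambda>a b. SS C (D b) (\<lambda>c d. s (act c m \<otimes>\<^bsub>L\<^esub> act d l) \<otimes>\<^bsub>C\<^esub> i a))"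
    by (rule hexR[symmetric], simp, rule triI) (use assms in simp_all)
  also have "\<dots> = tp (m \<otimes>\<^bsub>L\<^esub> l)"
    using assms by (simp add: tp_def act_prod)
  finally show ?thesis .
qed

text \<open>Cancelling R against R^-1 recovers \<open>s\<close> from t^+. This makes source and
  target interchangeable as generators, as required when passing to the coopposite.\<close>

lemma s_tp:
  assumes "l \<in> carrier L"
  shows "s l = SS C rb (\<lambda>c d. tp (act d l) \<otimes>\<^bsub>C\<^esub> i c)"
proof -
  have b: "bil k H C (\<lambda>u v. s (act v l) \<otimes>\<^bsub>C\<^esub> i u)" by (rule bilI) (use assms in simp_all)
  have "SS C rb (\<lambda>c d. tp (act d l) \<otimes>\<^bsub>C\<^esub> i c) =
      SS C rb (\<lambda>c d. SS C rs (\<lambda>a b. s (act (b \<otimes>\<^bsub>H\<^esub> d) l) \<otimes>\<^bsub>C\<^esub> i (a \<otimes>\<^bsub>H\<^esub> c)))"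
    using assms by (simp add: tp_def)
  also have "\<dots> = SS C rs (\<lambda>a b. SS C rb (\<lambda>c d. s (act (b \<otimes>\<^bsub>H\<^esub> d) l) \<otimes>\<^bsub>C\<^esub> i (a \<otimes>\<^bsub>H\<^esub> c)))"
    by (rule Sm_swap) (use assms in simp_all)
  also have "\<dots> = s l" using Rinv1[OF _ b] assms by simp
  finally show ?thesis by simp
qed

text \<open>By R \<Delta>(h) = \<Delta>^op(h) R, the map t^+ obeys the smash relation with the two
  parts of \<Delta>(h) exchanged, so t^+ can play the role of a source for the opposite
  comultiplication.\<close>

lemma i_tp:
  assumes "l \<in> carrier L" "h \<in> carrier H"
  shows "i h \<otimes>\<^bsub>C\<^esub> tp l = SS C (D h) (\<lambda>x y. tp (act y l) \<otimes>\<^bsub>C\<^esub> i x)"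
proof -
  have b: "bil k H C (\<lambda>u v. s (act v l) \<otimes>\<^bsub>C\<^esub> i u)" by (rule bilI) (use assms in simp_all)
  have "i h \<otimes>\<^bsub>C\<^esub> tp l = SS C rs (\<lambda>a b. SS C (D h) (\<lambda>x y. s (act (x \<otimes>\<^bsub>H\<^esub> b) l) \<otimes>\<^bsub>C\<^esub> i (y \<otimes>\<^bsub>H\<^esub> a)))"
    using assms by (simp add: tp_def smash_comm')
  also have "\<dots> = SS C (D h) (\<lambda>x y. SS C rs (\<lambda>a b. s (act (x \<otimes>\<^bsub>H\<^esub> b) l) \<otimes>\<^bsub>C\<^esub> i (y \<otimes>\<^bsub>H\<^esub> a)))"
    by (rule Sm_swap) (use assms in simp_all)
  also have "\<dots> = SS C rs (\<lambda>a b. SS C (D h) (\<lambda>x y. s (act (b \<otimes>\<^bsub>H\<^esub> y) l) \<otimes>\<^bsub>C\<^esub> i (a \<otimes>\<^bsub>H\<^esub> x)))"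
    by (rule Rcomm[symmetric, OF _ b]) (use assms in simp_all)
  also have "\<dots> = SS C (D h) (\<lambda>x y. SS C rs (\<lambda>a b. s (act (b \<otimes>\<^bsub>H\<^esub> y) l) \<otimes>\<^bsub>C\<^esub> i (a \<otimes>\<^bsub>H\<^esub> x)))"
    by (rule Sm_swap) (use assms in simp_all)
  also have "\<dots> = SS C (D h) (\<lambda>x y. tp (act y l) \<otimes>\<^bsub>C\<^esub> i x)"
    using assms by (simp add: tp_def)
  finally show ?thesis .
qed

lemma smash_rep_minus:
  "smash_rep k H (Sm (carrier H) (kt2 k H) (map prod.swap rb) (\<lambda>a b. a \<boxtimes>\<^bsub>kt2 k H\<^esub> b)) L act D
     (map prod.swap rb) (map prod.swap rs) C s i"
  by (intro smash_rep.intro represented_minus smash_rep_axioms.intro C_alg s_hom i_hom smash_comm)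

end

context represented_bialgebra
begin

text \<open>\<open>eps_R_r\<close> for R^-1_21 says (\<epsilon> \<otimes> id)(R^-1) = 1; applying
  \<epsilon> \<otimes> id to R R^-1 = 1 transfers this to R.\<close>

lemma eps_R_l: "SS H rs (\<lambda>a b. \<epsilon> a \<odot>\<^bsub>H\<^esub> b) = \<one>\<^bsub>H\<^esub>"
proof -
  have b: "bil k H H (\<lambda>u v. \<epsilon> u \<odot>\<^bsub>H\<^esub> v)"
    by (rule bilI) (simp_all add: H.m.smult_l_distr H_scalars)
  have m: "SS H rb (\<lambda>c d. \<epsilon> c \<odot>\<^bsub>H\<^esub> d) = \<one>\<^bsub>H\<^esub>"
    using represented_bialgebra.eps_R_r[OF represented_minus] by simp
  have "\<one>\<^bsub>H\<^esub> = SS H rs (\<lambda>a b. SS H rb (\<lambda>c d. \<epsilon> (a \<otimes>\<^bsub>H\<^esub> c) \<odot>\<^bsub>H\<^esub> (b \<otimes>\<^bsub>H\<^esub> d)))"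
    using Rinv1[OF _ b] by simp
  also have "\<dots> = SS H rs (\<lambda>a b. \<epsilon> a \<odot>\<^bsub>H\<^esub> (b \<otimes>\<^bsub>H\<^esub> SS H rb (\<lambda>c d. \<epsilon> c \<odot>\<^bsub>H\<^esub> d)))"
    by (rule Sm_cong') (simp add: H.m.smult_assoc1 H.smult_Sm)
  also have "\<dots> = SS H rs (\<lambda>a b. \<epsilon> a \<odot>\<^bsub>H\<^esub> b)" by (simp add: m)
  finally show ?thesis by simp
qed

end

text \<open>The map \<open>t\<close> is a parameter with two formulas rather than the constant
  \<open>tp\<close>: in this form the hypotheses are invariant under replacing R by R^-1_21, and
  both versions speak of the same \<open>t\<close>.\<close>

locale dynamical_rep = smash_rep k H R L act D rs rb C s i
  for k :: "('k, 'x) ring_scheme" and H :: "('k, 'h, 'y) hopf_scheme" and R :: "('h, 'h) tens"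
    and L :: "('k, 'l, 'z) module_scheme" and act :: "'h \<Rightarrow> 'l \<Rightarrow> 'l"
    and D :: "'h \<Rightarrow> ('h \<times> 'h) list" and rs rb :: "('h \<times> 'h) list"
    and C :: "('k, 'c, 'w) module_scheme" and s :: "'l \<Rightarrow> 'c" and i :: "'h \<Rightarrow> 'c" +
  fixes t :: "'l \<Rightarrow> 'c"
  assumes t_plus: "l \<in> carrier L \<Longrightarrow> t l = Sm (carrier H) C rs (\<lambda>a b. s (act b l) \<otimes>\<^bsub>C\<^esub> i a)"
    and t_minus: "l \<in> carrier L \<Longrightarrow> t l = Sm (carrier H) C rb (\<lambda>c d. s (act c l) \<otimes>\<^bsub>C\<^esub> i d)"
begin

lemma t_tp: "l \<in> carrier L \<Longrightarrow> t l = tp l"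
  by (simp add: t_plus tp_def)

lemma t_closed [simp]: "l \<in> carrier L \<Longrightarrow> t l \<in> carrier C"
  and t_add [simp]: "l \<in> carrier L \<Longrightarrow> m \<in> carrier L \<Longrightarrow> t (l \<oplus>\<^bsub>L\<^esub> m) = t l \<oplus>\<^bsub>C\<^esub> t m"
  and t_smult [simp]: "r \<in> carrier k \<Longrightarrow> l \<in> carrier L \<Longrightarrow> t (r \<odot>\<^bsub>L\<^esub> l) = r \<odot>\<^bsub>C\<^esub> t l"
  and t_one [simp]: "t \<one>\<^bsub>L\<^esub> = \<one>\<^bsub>C\<^esub>"
  and t_mult [simp]: "l \<in> carrier L \<Longrightarrow> m \<in> carrier L \<Longrightarrow> t l \<otimes>\<^bsub>C\<^esub> t m = t (m \<otimes>\<^bsub>L\<^esub> l)"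
  and s_t [simp]: "l \<in> carrier L \<Longrightarrow> m \<in> carrier L \<Longrightarrow> s m \<otimes>\<^bsub>C\<^esub> t l = t l \<otimes>\<^bsub>C\<^esub> s m"
  by (simp_all add: t_tp tp_one tp_mult tp_s)

lemma t_ahom: "ahom L C t" by (rule ahomI) simp_all
lemma t_mult' [simp]: "l \<in> carrier L \<Longrightarrow> m \<in> carrier L \<Longrightarrow> x \<in> carrier C \<Longrightarrow>
    t l \<otimes>\<^bsub>C\<^esub> (t m \<otimes>\<^bsub>C\<^esub> x) = t (m \<otimes>\<^bsub>L\<^esub> l) \<otimes>\<^bsub>C\<^esub> x"
  by (simp del: C.m_assoc flip: C.m_assoc)

lemma s_t' [simp]: "l \<in> carrier L \<Longrightarrow> m \<in> carrier L \<Longrightarrow> x \<in> carrier C \<Longrightarrow>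
    s m \<otimes>\<^bsub>C\<^esub> (t l \<otimes>\<^bsub>C\<^esub> x) = t l \<otimes>\<^bsub>C\<^esub> (s m \<otimes>\<^bsub>C\<^esub> x)"
  by (simp del: C.m_assoc flip: C.m_assoc)

lemma i_t: "l \<in> carrier L \<Longrightarrow> h \<in> carrier H \<Longrightarrow>
    i h \<otimes>\<^bsub>C\<^esub> t l = SS C (D h) (\<lambda>x y. t (act y l) \<otimes>\<^bsub>C\<^esub> i x)"
  by (simp add: t_tp i_tp)

lemma i_t':
  assumes "h \<in> carrier H" "l \<in> carrier L" "x \<in> carrier C"
  shows "i h \<otimes>\<^bsub>C\<^esub> (t l \<otimes>\<^bsub>C\<^esub> x) = SS C (D h) (\<lambda>p q. t (act q l) \<otimes>\<^bsub>C\<^esub> (i p \<otimes>\<^bsub>C\<^esub> x))"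
proof -
  have "i h \<otimes>\<^bsub>C\<^esub> (t l \<otimes>\<^bsub>C\<^esub> x) = (i h \<otimes>\<^bsub>C\<^esub> t l) \<otimes>\<^bsub>C\<^esub> x" using assms by simp
  also have "\<dots> = SS C (D h) (\<lambda>p q. t (act q l) \<otimes>\<^bsub>C\<^esub> (i p \<otimes>\<^bsub>C\<^esub> x))"
    using assms by (simp only: i_t) simp
  finally show ?thesis .
qed

lemma dynamical_rep_minus:
  "dynamical_rep k H (Sm (carrier H) (kt2 k H) (map prod.swap rb) (\<lambda>a b. a \<boxtimes>\<^bsub>kt2 k H\<^esub> b)) L act D
     (map prod.swap rb) (map prod.swap rs) C s i t"
  by (intro dynamical_rep.intro smash_rep_minus dynamical_rep_axioms.intro) (simp_all only: t_minus Sm_map_swap, simp only: t_minus[symmetric] t_plus)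

lemma s_plus: "l \<in> carrier L \<Longrightarrow> s l = SS C rb (\<lambda>c d. t (act d l) \<otimes>\<^bsub>C\<^esub> i c)"
  using s_tp by (simp add: t_tp)

text \<open>This is \<open>s_plus\<close> for R^-1_21. The inverse of that R-matrix is R_21, hence a
  sum over \<open>rs\<close> with the components exchanged.\<close>

lemma s_minus:
  assumes "l \<in> carrier L"
  shows "s l = SS C rs (\<lambda>a b. t (act a l) \<otimes>\<^bsub>C\<^esub> i b)"
proof -
  interpret m: dynamical_rep k H "Sm (carrier H) (kt2 k H) (map prod.swap rb) (\<lambda>a b. a \<boxtimes>\<^bsub>kt2 k H\<^esub> b)" L act D
     "map prod.swap rb" "map prod.swap rs" C s i t by (rule dynamical_rep_minus)
  show ?thesis using m.s_plus[OF assms] by simp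
qed

lemma base_tensor: "base_tensor k C L s t"
  by unfold_locales (simp_all add: C_alg)

end

text \<open>\<open>T\<close> is the tensor square over L, where coproducts live; \<open>O\<close> is
  the one over the opposite base, where the universal R-matrix lives.\<close>

sublocale dynamical_rep \<subseteq> T: base_tensor k C L s t by (rule base_tensor)
sublocale dynamical_rep \<subseteq> O: base_tensor k C L t s by (rule T.swap)

section \<open>Moving source and target across the two base tensor products\<close>

context dynamical_rep
begin

text \<open>Scalars act through the base, r a = s(r 1) a = t(r 1) a, so the base relations contain
  bilinearity over k.\<close>

lemma smult_T [simp]:
  assumes "r \<in> carrier k" "a \<in> carrier C" "b \<in> carrier C"
  shows "a \<boxtimes>\<^bsub>T.BT\<^esub> (r \<odot>\<^bsub>C\<^esub> b) = (r \<odot>\<^bsub>C\<^esub> a) \<boxtimes>\<^bsub>T.BT\<^esub> b"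
    "a \<boxtimes>\<^bsub>O.BT\<^esub> (r \<odot>\<^bsub>C\<^esub> b) = (r \<odot>\<^bsub>C\<^esub> a) \<boxtimes>\<^bsub>O.BT\<^esub> b"
  using T.pure_t[of "r \<odot>\<^bsub>L\<^esub> \<one>\<^bsub>L\<^esub>" a b] O.pure_t[of "r \<odot>\<^bsub>L\<^esub> \<one>\<^bsub>L\<^esub>" a b] assms by simp_all

lemma smult_T3 [simp]:
  assumes "r \<in> carrier k" "a \<in> carrier C" "b \<in> carrier C" "c \<in> carrier C"
  shows "(a \<boxtimes>\<^bsub>T.BT\<^esub> b) \<boxtimes>\<^bsub>T.BT3\<^esub> (r \<odot>\<^bsub>C\<^esub> c) = ((r \<odot>\<^bsub>C\<^esub> a) \<boxtimes>\<^bsub>T.BT\<^esub> b) \<boxtimes>\<^bsub>T.BT3\<^esub> c"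
    "(a \<boxtimes>\<^bsub>O.BT\<^esub> b) \<boxtimes>\<^bsub>O.BT3\<^esub> (r \<odot>\<^bsub>C\<^esub> c) = ((r \<odot>\<^bsub>C\<^esub> a) \<boxtimes>\<^bsub>O.BT\<^esub> b) \<boxtimes>\<^bsub>O.BT3\<^esub> c"
  using T.pure3_t[of "r \<odot>\<^bsub>L\<^esub> \<one>\<^bsub>L\<^esub>" "a \<boxtimes>\<^bsub>T.BT\<^esub> b" c] O.pure3_t[of "r \<odot>\<^bsub>L\<^esub> \<one>\<^bsub>L\<^esub>" "a \<boxtimes>\<^bsub>O.BT\<^esub> b" c]
    T.right_pure[of "r \<odot>\<^bsub>L\<^esub> \<one>\<^bsub>L\<^esub>" a b] O.right_pure[of "r \<odot>\<^bsub>L\<^esub> \<one>\<^bsub>L\<^esub>" a b] assms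
  by simp_all

text \<open>The Takeuchi condition with free factors \<open>m\<close>, \<open>c\<close>,
  \<open>d\<close>, in the form needed for left multiplication by a coproduct. t(l) passes i(x) to
  the left and takes up the second part of \<Delta>(x); coassociativity moves that part to the
  second leg, where t crosses the tensor sign and becomes \<open>s\<close>.\<close>

lemma takeuchi:
  assumes "l \<in> carrier L" "m \<in> carrier L" "h \<in> carrier H" "c \<in> carrier C" "d \<in> carrier C"
  shows "SS T.BT (D h) (\<lambda>x y. (s m \<otimes>\<^bsub>C\<^esub> (i x \<otimes>\<^bsub>C\<^esub> (t l \<otimes>\<^bsub>C\<^esub> c))) \<boxtimes>\<^bsub>T.BT\<^esub> (i y \<otimes>\<^bsub>C\<^esub> d)) =
    SS T.BT (D h) (\<lambda>x y. (s m \<otimes>\<^bsub>C\<^esub> (i x \<otimes>\<^bsub>C\<^esub> c)) \<boxtimes>\<^bsub>T.BT\<^esub> (i y \<otimes>\<^bsub>C\<^esub> (s l \<otimes>\<^bsub>C\<^esub> d)))"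
proof -
  have "SS T.BT (D h) (\<lambda>x y. (s m \<otimes>\<^bsub>C\<^esub> (i x \<otimes>\<^bsub>C\<^esub> (t l \<otimes>\<^bsub>C\<^esub> c))) \<boxtimes>\<^bsub>T.BT\<^esub> (i y \<otimes>\<^bsub>C\<^esub> d)) =
    SS T.BT (D h) (\<lambda>x y. SS T.BT (D x) (\<lambda>p q. (t (act q l) \<otimes>\<^bsub>C\<^esub> (s m \<otimes>\<^bsub>C\<^esub> (i p \<otimes>\<^bsub>C\<^esub> c))) \<boxtimes>\<^bsub>T.BT\<^esub> (i y \<otimes>\<^bsub>C\<^esub> d)))"
    using assms by (simp add: i_t')
  also have "\<dots> = SS T.BT (D h) (\<lambda>x y. SS T.BT (D y) (\<lambda>p q. (t (act p l) \<otimes>\<^bsub>C\<^esub> (s m \<otimes>\<^bsub>C\<^esub> (i x \<otimes>\<^bsub>C\<^esub> c))) \<boxtimes>\<^bsub>T.BT\<^esub> (i q \<otimes>\<^bsub>C\<^esub> d)))"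
    by (rule coassoc, simp, rule triI) (use assms in simp_all)
  also have "\<dots> = SS T.BT (D h) (\<lambda>x y. (s m \<otimes>\<^bsub>C\<^esub> (i x \<otimes>\<^bsub>C\<^esub> c)) \<boxtimes>\<^bsub>T.BT\<^esub> (i y \<otimes>\<^bsub>C\<^esub> (s l \<otimes>\<^bsub>C\<^esub> d)))"
    using assms by (simp add: T.pure_t smash_comm')
  finally show ?thesis .
qed

text \<open>The formula for \<open>t\<close> by R^-1 enters here through \<open>s_minus\<close>:
  once R_13 R_23 has separated the copies of R, one copy sends s(R_1 \<rhd> l) across the tensor
  sign as t(R_1 \<rhd> l) and rebuilds s(l) in the second leg.\<close>

lemma Q_s:
  assumes "l \<in> carrier L" "c \<in> carrier C" "d \<in> carrier C"
  shows "SS O.BT rs (\<lambda>a b. (i a \<otimes>\<^bsub>C\<^esub> (s l \<otimes>\<^bsub>C\<^esub> c)) \<boxtimes>\<^bsub>O.BT\<^esub> (i b \<otimes>\<^bsub>C\<^esub> d)) =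
    SS O.BT rs (\<lambda>a b. (i a \<otimes>\<^bsub>C\<^esub> c) \<boxtimes>\<^bsub>O.BT\<^esub> (s l \<otimes>\<^bsub>C\<^esub> (i b \<otimes>\<^bsub>C\<^esub> d)))"
proof -
  have "SS O.BT rs (\<lambda>a b. (i a \<otimes>\<^bsub>C\<^esub> (s l \<otimes>\<^bsub>C\<^esub> c)) \<boxtimes>\<^bsub>O.BT\<^esub> (i b \<otimes>\<^bsub>C\<^esub> d)) =
    SS O.BT rs (\<lambda>a b. SS O.BT (D a) (\<lambda>x y. (s (act x l) \<otimes>\<^bsub>C\<^esub> (i y \<otimes>\<^bsub>C\<^esub> c)) \<boxtimes>\<^bsub>O.BT\<^esub> (i b \<otimes>\<^bsub>C\<^esub> d)))"
    using assms by (simp add: smash_comm')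
  also have "\<dots> = SS O.BT rs (\<lambda>a b. SS O.BT rs (\<lambda>a' b'. (s (act a l) \<otimes>\<^bsub>C\<^esub> (i a' \<otimes>\<^bsub>C\<^esub> c)) \<boxtimes>\<^bsub>O.BT\<^esub> (i (b \<otimes>\<^bsub>H\<^esub> b') \<otimes>\<^bsub>C\<^esub> d)))"
    by (rule hexL, simp, rule triI) (use assms in simp_all)
  also have "\<dots> = SS O.BT rs (\<lambda>a' b'. SS O.BT rs (\<lambda>a b. (s (act a l) \<otimes>\<^bsub>C\<^esub> (i a' \<otimes>\<^bsub>C\<^esub> c)) \<boxtimes>\<^bsub>O.BT\<^esub> (i (b \<otimes>\<^bsub>H\<^esub> b') \<otimes>\<^bsub>C\<^esub> d)))"
    by (rule Sm_swap) (use assms in simp_all)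
  also have "\<dots> = SS O.BT rs (\<lambda>a b. (i a \<otimes>\<^bsub>C\<^esub> c) \<boxtimes>\<^bsub>O.BT\<^esub> (s l \<otimes>\<^bsub>C\<^esub> (i b \<otimes>\<^bsub>C\<^esub> d)))"
    using assms by (simp add: O.pure_t s_minus[OF assms(1)])
  finally show ?thesis .
qed

text \<open>Mirror image of \<open>Q_s\<close>, with (id \<otimes> \<Delta>)(R) = R_13 R_12 and with
  t(l) rebuilt in the first leg by its formula in R.\<close>

lemma Q_t:
  assumes "l \<in> carrier L" "c \<in> carrier C" "d \<in> carrier C"
  shows "SS O.BT rs (\<lambda>a b. (i a \<otimes>\<^bsub>C\<^esub> c) \<boxtimes>\<^bsub>O.BT\<^esub> (i b \<otimes>\<^bsub>C\<^esub> (t l \<otimes>\<^bsub>C\<^esub> d))) =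
    SS O.BT rs (\<lambda>a b. (t l \<otimes>\<^bsub>C\<^esub> (i a \<otimes>\<^bsub>C\<^esub> c)) \<boxtimes>\<^bsub>O.BT\<^esub> (i b \<otimes>\<^bsub>C\<^esub> d))"
proof -
  have "SS O.BT rs (\<lambda>a b. (i a \<otimes>\<^bsub>C\<^esub> c) \<boxtimes>\<^bsub>O.BT\<^esub> (i b \<otimes>\<^bsub>C\<^esub> (t l \<otimes>\<^bsub>C\<^esub> d))) =
    SS O.BT rs (\<lambda>a b. SS O.BT (D b) (\<lambda>x y. (s (act y l) \<otimes>\<^bsub>C\<^esub> (i a \<otimes>\<^bsub>C\<^esub> c)) \<boxtimes>\<^bsub>O.BT\<^esub> (i x \<otimes>\<^bsub>C\<^esub> d)))"
    using assms by (simp add: i_t' O.pure_t)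
  also have "\<dots> = SS O.BT rs (\<lambda>a b. SS O.BT rs (\<lambda>a' b'. (s (act b l) \<otimes>\<^bsub>C\<^esub> (i (a \<otimes>\<^bsub>H\<^esub> a') \<otimes>\<^bsub>C\<^esub> c)) \<boxtimes>\<^bsub>O.BT\<^esub> (i b' \<otimes>\<^bsub>C\<^esub> d)))"
    by (rule hexR, simp, rule triI) (use assms in simp_all)
  also have "\<dots> = SS O.BT rs (\<lambda>a' b'. SS O.BT rs (\<lambda>a b. (s (act b l) \<otimes>\<^bsub>C\<^esub> (i (a \<otimes>\<^bsub>H\<^esub> a') \<otimes>\<^bsub>C\<^esub> c)) \<boxtimes>\<^bsub>O.BT\<^esub> (i b' \<otimes>\<^bsub>C\<^esub> d)))"
    by (rule Sm_swap) (use assms in simp_all)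
  also have "\<dots> = SS O.BT rs (\<lambda>a b. (t l \<otimes>\<^bsub>C\<^esub> (i a \<otimes>\<^bsub>C\<^esub> c)) \<boxtimes>\<^bsub>O.BT\<^esub> (i b \<otimes>\<^bsub>C\<^esub> d))"
    using assms by (simp add: t_plus)
  finally show ?thesis .
qed

text \<open>Write t(l) = sum s(R_2 \<rhd> l) i(R_1) and carry \<open>s\<close> into the second leg
  by \<open>Q_s\<close>. The two copies of R then merge to (id \<otimes> \<Delta>)(R), which is what
  moves s(l) to the right of i(R_2).\<close>

lemma Q_bal:
  assumes "l \<in> carrier L" "c \<in> carrier C" "d \<in> carrier C"
  shows "SS O.BT rs (\<lambda>a b. (i a \<otimes>\<^bsub>C\<^esub> (t l \<otimes>\<^bsub>C\<^esub> c)) \<boxtimes>\<^bsub>O.BT\<^esub> (i b \<otimes>\<^bsub>C\<^esub> d)) =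
    SS O.BT rs (\<lambda>a b. (i a \<otimes>\<^bsub>C\<^esub> c) \<boxtimes>\<^bsub>O.BT\<^esub> (i b \<otimes>\<^bsub>C\<^esub> (s l \<otimes>\<^bsub>C\<^esub> d)))"
proof -
  let ?z = "\<lambda>p q. SS O.BT rs (\<lambda>a b. (i a \<otimes>\<^bsub>C\<^esub> (i p \<otimes>\<^bsub>C\<^esub> c)) \<boxtimes>\<^bsub>O.BT\<^esub> (s (act q l) \<otimes>\<^bsub>C\<^esub> (i b \<otimes>\<^bsub>C\<^esub> d)))"
  have "SS O.BT rs (\<lambda>a b. (i a \<otimes>\<^bsub>C\<^esub> (t l \<otimes>\<^bsub>C\<^esub> c)) \<boxtimes>\<^bsub>O.BT\<^esub> (i b \<otimes>\<^bsub>C\<^esub> d)) =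
    SS O.BT rs (\<lambda>a b. SS O.BT rs (\<lambda>p q. (i a \<otimes>\<^bsub>C\<^esub> (s (act q l) \<otimes>\<^bsub>C\<^esub> (i p \<otimes>\<^bsub>C\<^esub> c))) \<boxtimes>\<^bsub>O.BT\<^esub> (i b \<otimes>\<^bsub>C\<^esub> d)))"
    using assms by (simp add: t_plus)
  also have "\<dots> = SS O.BT rs (\<lambda>p q. SS O.BT rs (\<lambda>a b. (i a \<otimes>\<^bsub>C\<^esub> (s (act q l) \<otimes>\<^bsub>C\<^esub> (i p \<otimes>\<^bsub>C\<^esub> c))) \<boxtimes>\<^bsub>O.BT\<^esub> (i b \<otimes>\<^bsub>C\<^esub> d)))"
    by (rule Sm_swap) (use assms in simp_all)
  also have "\<dots> = SS O.BT rs (\<lambda>p q. ?z p q)"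
    by (rule Sm_cong', rule Q_s) (use assms in simp_all)
  also have "\<dots> = SS O.BT rs (\<lambda>a b. SS O.BT rs (\<lambda>p q. (i (a \<otimes>\<^bsub>H\<^esub> p) \<otimes>\<^bsub>C\<^esub> c) \<boxtimes>\<^bsub>O.BT\<^esub> (s (act q l) \<otimes>\<^bsub>C\<^esub> (i b \<otimes>\<^bsub>C\<^esub> d))))"
    by (subst Sm_swap) (use assms in simp_all)
  also have "\<dots> = SS O.BT rs (\<lambda>a b. SS O.BT (D b) (\<lambda>x y. (i a \<otimes>\<^bsub>C\<^esub> c) \<boxtimes>\<^bsub>O.BT\<^esub> (s (act x l) \<otimes>\<^bsub>C\<^esub> (i y \<otimes>\<^bsub>C\<^esub> d))))"
    by (rule hexR[symmetric], simp, rule triI) (use assms in simp_all)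
  also have "\<dots> = SS O.BT rs (\<lambda>a b. (i a \<otimes>\<^bsub>C\<^esub> c) \<boxtimes>\<^bsub>O.BT\<^esub> (i b \<otimes>\<^bsub>C\<^esub> (s l \<otimes>\<^bsub>C\<^esub> d)))"
    using assms by (simp add: smash_comm')
  finally show ?thesis .
qed

text \<open>\<open>Q_bal\<close> for R^-1_21, followed by the flip: flipping returns R^-1 and
  exchanges the two base tensor squares.\<close>

lemma Qbar_bal:
  assumes "l \<in> carrier L" "c \<in> carrier C" "d \<in> carrier C"
  shows "SS T.BT rb (\<lambda>a b. (i a \<otimes>\<^bsub>C\<^esub> (s l \<otimes>\<^bsub>C\<^esub> c)) \<boxtimes>\<^bsub>T.BT\<^esub> (i b \<otimes>\<^bsub>C\<^esub> d)) =
    SS T.BT rb (\<lambda>a b. (i a \<otimes>\<^bsub>C\<^esub> c) \<boxtimes>\<^bsub>T.BT\<^esub> (i b \<otimes>\<^bsub>C\<^esub> (t l \<otimes>\<^bsub>C\<^esub> d)))"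
proof -
  interpret m: dynamical_rep k H "Sm (carrier H) (kt2 k H) (map prod.swap rb) (\<lambda>a b. a \<boxtimes>\<^bsub>kt2 k H\<^esub> b)" L act D
     "map prod.swap rb" "map prod.swap rs" C s i t by (rule dynamical_rep_minus)
  from arg_cong[OF m.Q_bal[OF assms(1,3,2)], of "tflip T.BT"] show ?thesis using assms by simp
qed

lemma t_gen:
  assumes "l \<in> carrier L" "m \<in> carrier L" "h \<in> carrier H"
  shows "t l \<otimes>\<^bsub>C\<^esub> (s m \<otimes>\<^bsub>C\<^esub> i h) = SS C rs (\<lambda>a b. s (m \<otimes>\<^bsub>L\<^esub> act b l) \<otimes>\<^bsub>C\<^esub> i (a \<otimes>\<^bsub>H\<^esub> h))"
proof -
  have "t l \<otimes>\<^bsub>C\<^esub> (s m \<otimes>\<^bsub>C\<^esub> i h) = s m \<otimes>\<^bsub>C\<^esub> (t l \<otimes>\<^bsub>C\<^esub> i h)" using assms by simp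
  then show ?thesis using assms by (simp add: t_plus del: s_t')
qed

text \<open>Compatibility of the coproduct with \<open>t\<close>, written in sums that presuppose no
  coproduct on \<open>C\<close>. It serves presented groupoids and, once for R and once for R^-1_21,
  the proof that the coproduct descends to the quotient. The reason is (\<Delta> \<otimes> id)(R) =
  R_13 R_23: one copy of R forms t in the first leg, which crosses to \<open>s\<close> and with the
  other copy forms t(l) in the second.\<close>

lemma cop_t_gen:
  assumes "l \<in> carrier L" "m \<in> carrier L" "h \<in> carrier H"
  shows "SS T.BT rs (\<lambda>a b. SS T.BT (D a) (\<lambda>p q. SS T.BT (D h) (\<lambda>x y.
        (s (m \<otimes>\<^bsub>L\<^esub> act b l) \<otimes>\<^bsub>C\<^esub> i (p \<otimes>\<^bsub>H\<^esub> x)) \<boxtimes>\<^bsub>T.BT\<^esub> i (q \<otimes>\<^bsub>H\<^esub> y)))) =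
    SS T.BT (D h) (\<lambda>x y. (s m \<otimes>\<^bsub>C\<^esub> i x) \<boxtimes>\<^bsub>T.BT\<^esub> (t l \<otimes>\<^bsub>C\<^esub> i y))"
proof -
  have "SS T.BT rs (\<lambda>a b. SS T.BT (D a) (\<lambda>p q. SS T.BT (D h) (\<lambda>x y.
        (s (m \<otimes>\<^bsub>L\<^esub> act b l) \<otimes>\<^bsub>C\<^esub> i (p \<otimes>\<^bsub>H\<^esub> x)) \<boxtimes>\<^bsub>T.BT\<^esub> i (q \<otimes>\<^bsub>H\<^esub> y)))) = SS T.BT rs (\<lambda>a b. SS T.BT rs (\<lambda>c d. SS T.BT (D h) (\<lambda>x y.
        (s (m \<otimes>\<^bsub>L\<^esub> act (b \<otimes>\<^bsub>H\<^esub> d) l) \<otimes>\<^bsub>C\<^esub> i (a \<otimes>\<^bsub>H\<^esub> x)) \<boxtimes>\<^bsub>T.BT\<^esub> i (c \<otimes>\<^bsub>H\<^esub> y))))"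
    by (rule hexL, simp, rule triI) (use assms in simp_all)
  also have "\<dots> = SS T.BT rs (\<lambda>c d. SS T.BT rs (\<lambda>a b. SS T.BT (D h) (\<lambda>x y.
        (s (m \<otimes>\<^bsub>L\<^esub> act (b \<otimes>\<^bsub>H\<^esub> d) l) \<otimes>\<^bsub>C\<^esub> i (a \<otimes>\<^bsub>H\<^esub> x)) \<boxtimes>\<^bsub>T.BT\<^esub> i (c \<otimes>\<^bsub>H\<^esub> y))))"
    by (rule Sm_swap) (use assms in simp_all)
  also have "\<dots> = SS T.BT rs (\<lambda>c d. SS T.BT (D h) (\<lambda>x y. SS T.BT rs (\<lambda>a b.
        (s (m \<otimes>\<^bsub>L\<^esub> act (b \<otimes>\<^bsub>H\<^esub> d) l) \<otimes>\<^bsub>C\<^esub> i (a \<otimes>\<^bsub>H\<^esub> x)) \<boxtimes>\<^bsub>T.BT\<^esub> i (c \<otimes>\<^bsub>H\<^esub> y))))"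
    by (rule Sm_cong', rule Sm_swap) (use assms in simp_all)
  also have "\<dots> = SS T.BT rs (\<lambda>c d. SS T.BT (D h) (\<lambda>x y.
        SS C rs (\<lambda>a b. s (m \<otimes>\<^bsub>L\<^esub> act b (act d l)) \<otimes>\<^bsub>C\<^esub> i (a \<otimes>\<^bsub>H\<^esub> x)) \<boxtimes>\<^bsub>T.BT\<^esub> i (c \<otimes>\<^bsub>H\<^esub> y)))"
    using assms by simp
  also have "\<dots> = SS T.BT rs (\<lambda>c d. SS T.BT (D h) (\<lambda>x y.
        (t (act d l) \<otimes>\<^bsub>C\<^esub> (s m \<otimes>\<^bsub>C\<^esub> i x)) \<boxtimes>\<^bsub>T.BT\<^esub> i (c \<otimes>\<^bsub>H\<^esub> y)))"
    by (rule Sm_cong', rule Sm_cong', subst t_gen) (use assms in simp_all)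
  also have "\<dots> = SS T.BT (D h) (\<lambda>x y. SS T.BT rs (\<lambda>c d.
        (t (act d l) \<otimes>\<^bsub>C\<^esub> (s m \<otimes>\<^bsub>C\<^esub> i x)) \<boxtimes>\<^bsub>T.BT\<^esub> i (c \<otimes>\<^bsub>H\<^esub> y)))"
    by (rule Sm_swap) (use assms in simp_all)
  also have "\<dots> = SS T.BT (D h) (\<lambda>x y. (s m \<otimes>\<^bsub>C\<^esub> i x) \<boxtimes>\<^bsub>T.BT\<^esub> (t l \<otimes>\<^bsub>C\<^esub> i y))"
    using assms by (simp add: T.pure_t t_plus[OF assms(1)])
  finally show ?thesis .
qed

text \<open>Multiplicativity of the coproduct on generators, again as an identity of sums, so that
  it is available before the quotient has its coproduct.\<close>

lemma cop_mult_gen: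
  assumes "l \<in> carrier L" "m \<in> carrier L" "h \<in> carrier H" "f \<in> carrier H"
  shows "SS T.BT (D f) (\<lambda>x y. SS T.BT (D y) (\<lambda>p q. SS T.BT (D h) (\<lambda>u v.
          (s (m \<otimes>\<^bsub>L\<^esub> act x l) \<otimes>\<^bsub>C\<^esub> i (p \<otimes>\<^bsub>H\<^esub> u)) \<boxtimes>\<^bsub>T.BT\<^esub> i (q \<otimes>\<^bsub>H\<^esub> v)))) =
    SS T.BT (D h) (\<lambda>u v. SS T.BT (D f) (\<lambda>x y.
          (s m \<otimes>\<^bsub>C\<^esub> (i x \<otimes>\<^bsub>C\<^esub> (s l \<otimes>\<^bsub>C\<^esub> i u))) \<boxtimes>\<^bsub>T.BT\<^esub> (i y \<otimes>\<^bsub>C\<^esub> i v)))"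
proof -
    have "SS T.BT (D f) (\<lambda>x y. SS T.BT (D y) (\<lambda>p q. SS T.BT (D h) (\<lambda>u v.
          (s (m \<otimes>\<^bsub>L\<^esub> act x l) \<otimes>\<^bsub>C\<^esub> i (p \<otimes>\<^bsub>H\<^esub> u)) \<boxtimes>\<^bsub>T.BT\<^esub> i (q \<otimes>\<^bsub>H\<^esub> v)))) = SS T.BT (D f) (\<lambda>x y. SS T.BT (D x) (\<lambda>p q. SS T.BT (D h) (\<lambda>u v.
          (s (m \<otimes>\<^bsub>L\<^esub> act p l) \<otimes>\<^bsub>C\<^esub> i (q \<otimes>\<^bsub>H\<^esub> u)) \<boxtimes>\<^bsub>T.BT\<^esub> i (y \<otimes>\<^bsub>H\<^esub> v))))"
      by (rule coassoc[symmetric], simp, rule triI) (use assms in simp_all)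
    also have "\<dots> = SS T.BT (D f) (\<lambda>x y. SS T.BT (D h) (\<lambda>u v. SS T.BT (D x) (\<lambda>p q.
          (s (m \<otimes>\<^bsub>L\<^esub> act p l) \<otimes>\<^bsub>C\<^esub> i (q \<otimes>\<^bsub>H\<^esub> u)) \<boxtimes>\<^bsub>T.BT\<^esub> i (y \<otimes>\<^bsub>H\<^esub> v))))"
      by (rule Sm_cong', rule Sm_swap) (use assms in simp_all)
    also have "\<dots> = SS T.BT (D h) (\<lambda>u v. SS T.BT (D f) (\<lambda>x y. SS T.BT (D x) (\<lambda>p q.
          (s (m \<otimes>\<^bsub>L\<^esub> act p l) \<otimes>\<^bsub>C\<^esub> i (q \<otimes>\<^bsub>H\<^esub> u)) \<boxtimes>\<^bsub>T.BT\<^esub> i (y \<otimes>\<^bsub>H\<^esub> v))))"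
      by (rule Sm_swap) (use assms in simp_all)
    also have "\<dots> = SS T.BT (D h) (\<lambda>u v. SS T.BT (D f) (\<lambda>x y.
          (s m \<otimes>\<^bsub>C\<^esub> (i x \<otimes>\<^bsub>C\<^esub> (s l \<otimes>\<^bsub>C\<^esub> i u))) \<boxtimes>\<^bsub>T.BT\<^esub> (i y \<otimes>\<^bsub>C\<^esub> i v)))"
      using assms by (simp add: smash_comm')
    finally show ?thesis .
qed

end

text \<open>Satisfied both by \<open>H\<^sub>L\<close> and by the coopposite of \<open>(H\<^sub>L)\<^sub>o\<^sub>p\<close>.\<close>

locale presented_groupoid = dynamical_rep k H R L act D rs rb B "src B" i "tgt B"
  for k :: "('k, 'x) ring_scheme" and H :: "('k, 'h, 'y) hopf_scheme" and R :: "('h, 'h) tens"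
    and L :: "('k, 'l, 'z) module_scheme" and act :: "'h \<Rightarrow> 'l \<Rightarrow> 'l"
    and D :: "'h \<Rightarrow> ('h \<times> 'h) list" and rs rb :: "('h \<times> 'h) list"
    and B :: "('k, 'l, 'b, 'w) quantum_groupoid_scheme" and i :: "'h \<Rightarrow> 'b" +
  assumes span: "\<And>P x. x \<in> carrier B \<Longrightarrow>
      (\<And>l h. l \<in> carrier L \<Longrightarrow> h \<in> carrier H \<Longrightarrow> P (src B l \<otimes>\<^bsub>B\<^esub> i h)) \<Longrightarrow>
      (\<And>x y. x \<in> carrier B \<Longrightarrow> y \<in> carrier B \<Longrightarrow> P x \<Longrightarrow> P y \<Longrightarrow> P (x \<oplus>\<^bsub>B\<^esub> y)) \<Longrightarrow> P x"
    and copr_add: "x \<in> carrier B \<Longrightarrow> y \<in> carrier B \<Longrightarrow> cop B (x \<oplus>\<^bsub>B\<^esub> y) = cop B x \<oplus>\<^bsub>over_L L B\<^esub> cop B y"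
    and cop_gen: "l \<in> carrier L \<Longrightarrow> h \<in> carrier H \<Longrightarrow> cop B (src B l \<otimes>\<^bsub>B\<^esub> i h) =
      Sm (carrier H) (over_L L B) (D h) (\<lambda>x y. (src B l \<otimes>\<^bsub>B\<^esub> i x) \<boxtimes>\<^bsub>over_L L B\<^esub> i y)"
    and coun_add: "x \<in> carrier B \<Longrightarrow> y \<in> carrier B \<Longrightarrow> cou B (x \<oplus>\<^bsub>B\<^esub> y) = cou B x \<oplus>\<^bsub>L\<^esub> cou B y"
    and cou_gen: "l \<in> carrier L \<Longrightarrow> h \<in> carrier H \<Longrightarrow> cou B (src B l \<otimes>\<^bsub>B\<^esub> i h) = counit H h \<odot>\<^bsub>L\<^esub> l"
    and rmat_eq: "rmat B = tmap (over_Lop L B) i i R"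
begin

section \<open>Bialgebroid axioms for a presented groupoid\<close>

lemma gen_eqI:
  assumes "ahom B G f" "ahom B G g" "x \<in> carrier B"
    "\<And>l h. l \<in> carrier L \<Longrightarrow> h \<in> carrier H \<Longrightarrow> f (src B l \<otimes>\<^bsub>B\<^esub> i h) = g (src B l \<otimes>\<^bsub>B\<^esub> i h)"
  shows "f x = g x"
  by (rule span[OF assms(3)]) (simp_all add: assms(4) ahom_add[OF assms(1)] ahom_add[OF assms(2)])

lemma cop_ahom: "ahom B T.BT (cop B)"
proof (rule ahomI)
  fix x assume "x \<in> carrier B"
  then show "cop B x \<in> carrier T.BT"
    by (rule span) (simp_all add: cop_gen copr_add abelian_groupE(1)[OF T.t2.agT])
qed (simp_all add: copr_add)

lemma cou_ahom: "ahom B L (cou B)"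
proof (rule ahomI)
  fix x assume "x \<in> carrier B"
  then show "cou B x \<in> carrier L"
    by (rule span) (simp_all add: cou_gen coun_add)
qed (simp_all add: coun_add)

lemmas cop_simps [simp] = ahom_closed[OF cop_ahom] ahom_add[OF cop_ahom] Sm_hom[OF cop_ahom]
lemmas cou_simps [simp] = ahom_closed[OF cou_ahom] ahom_add[OF cou_ahom] Sm_hom[OF cou_ahom]

lemma cop_src':
  assumes "l \<in> carrier L" "a \<in> carrier B"
  shows "cop B (src B l \<otimes>\<^bsub>B\<^esub> a) = tmap T.BT (\<lambda>x. src B l \<otimes>\<^bsub>B\<^esub> x) (\<lambda>y. y) (cop B a)"
  by (rule gen_eqI[OF ahom_comp[OF C.mult_ahom_l cop_ahom] ahom_comp[OF cop_ahom T.left_hom] assms(2)])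
    (use assms in \<open>simp_all add: cop_gen\<close>)

lemma cop_tgt':
  assumes "l \<in> carrier L" "a \<in> carrier B"
  shows "cop B (tgt B l \<otimes>\<^bsub>B\<^esub> a) = tmap T.BT (\<lambda>x. x) (\<lambda>y. tgt B l \<otimes>\<^bsub>B\<^esub> y) (cop B a)"
proof (rule gen_eqI[OF ahom_comp[OF C.mult_ahom_l cop_ahom] ahom_comp[OF cop_ahom T.right_hom] assms(2)])
  fix m h assume m: "m \<in> carrier L" "h \<in> carrier H"
  have b: "bil k H T.BT (\<lambda>x y. (src B n \<otimes>\<^bsub>B\<^esub> i x) \<boxtimes>\<^bsub>T.BT\<^esub> i y)" if "n \<in> carrier L" for n
    by (rule bilI) (use that in simp_all)
  have "cop B (tgt B l \<otimes>\<^bsub>B\<^esub> (src B m \<otimes>\<^bsub>B\<^esub> i h)) =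
      SS T.BT rs (\<lambda>a b. SS T.BT (D a) (\<lambda>p q. SS T.BT (D h) (\<lambda>x y.
        (src B (m \<otimes>\<^bsub>L\<^esub> act b l) \<otimes>\<^bsub>B\<^esub> i (p \<otimes>\<^bsub>H\<^esub> x)) \<boxtimes>\<^bsub>T.BT\<^esub> i (q \<otimes>\<^bsub>H\<^esub> y))))"
    using assms m by (simp add: t_gen cop_gen D_mult[OF _ b])
  also have "\<dots> = SS T.BT (D h) (\<lambda>x y. (src B m \<otimes>\<^bsub>B\<^esub> i x) \<boxtimes>\<^bsub>T.BT\<^esub> (tgt B l \<otimes>\<^bsub>B\<^esub> i y))"
    by (rule cop_t_gen) (use assms m in simp_all)
  also have "\<dots> = tmap T.BT (\<lambda>x. x) (\<lambda>y. tgt B l \<otimes>\<^bsub>B\<^esub> y) (cop B (src B m \<otimes>\<^bsub>B\<^esub> i h))"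
    using assms m by (simp add: cop_gen)
  finally show "cop B (tgt B l \<otimes>\<^bsub>B\<^esub> (src B m \<otimes>\<^bsub>B\<^esub> i h)) =
    tmap T.BT (\<lambda>x. x) (\<lambda>y. tgt B l \<otimes>\<^bsub>B\<^esub> y) (cop B (src B m \<otimes>\<^bsub>B\<^esub> i h))" .
qed (use assms in simp_all)

lemma takeuchi_cop:
  assumes "l \<in> carrier L" "a \<in> carrier B"
  shows "tmul_pure T.BT B B (cop B a) (tgt B l) \<one>\<^bsub>B\<^esub> = tmul_pure T.BT B B (cop B a) \<one>\<^bsub>B\<^esub> (src B l)"
proof (rule gen_eqI[OF ahom_comp[OF cop_ahom T.tmul_pure_hom] ahom_comp[OF cop_ahom T.tmul_pure_hom] assms(2)])
  fix m h assume m: "m \<in> carrier L" "h \<in> carrier H"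
  show "tmul_pure T.BT B B (cop B (src B m \<otimes>\<^bsub>B\<^esub> i h)) (tgt B l) \<one>\<^bsub>B\<^esub> =
    tmul_pure T.BT B B (cop B (src B m \<otimes>\<^bsub>B\<^esub> i h)) \<one>\<^bsub>B\<^esub> (src B l)"
    using takeuchi[OF assms(1) m, of "\<one>\<^bsub>B\<^esub>" "\<one>\<^bsub>B\<^esub>"] assms m by (simp add: cop_gen)
qed (use assms in simp_all)

lemma cop_tmul_bal: "a \<in> carrier B \<Longrightarrow> T.bb T.BT (tmul_pure T.BT B B (cop B a))"
  by (rule T.tmul_bal) (simp_all add: takeuchi_cop)

text \<open>The product of two tensors over the base is a lift over the right factor, so
  \<open>b\<close> is reduced to a generator first; for such \<open>b\<close> both sides are
  additive in \<open>a\<close>.\<close>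

lemma cop_mult':
  assumes "a \<in> carrier B" "b \<in> carrier B"
  shows "cop B (a \<otimes>\<^bsub>B\<^esub> b) = tmul T.BT B B (cop B a) (cop B b)"
  unfolding tmul_def
proof (rule gen_eqI[OF ahom_comp[OF C.mult_ahom_l cop_ahom]
      ahom_comp[OF cop_ahom T.t2.lift_ahom[OF T.t2.agT cop_tmul_bal]] assms(2)])
  fix l h assume l: "l \<in> carrier L" "h \<in> carrier H"
  let ?g = "\<lambda>a. SS T.BT (D h) (\<lambda>x y. tmul_pure T.BT B B (cop B a) (src B l \<otimes>\<^bsub>B\<^esub> i x) (i y))"
  have g: "ahom B T.BT ?g"
    by (rule ahomI) (use l in \<open>simp_all add: ahom_add[OF T.tmul_pure_hom]\<close>)
  have "tlift T.BT (tmul_pure T.BT B B (cop B a)) (cop B (src B l \<otimes>\<^bsub>B\<^esub> i h)) = ?g a"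
    using l assms by (simp add: cop_gen T.t2.lift_Sm[OF T.t2.agT cop_tmul_bal] T.t2.lift_pure[OF T.t2.agT cop_tmul_bal])
  moreover have "cop B (a \<otimes>\<^bsub>B\<^esub> (src B l \<otimes>\<^bsub>B\<^esub> i h)) = ?g a"
  proof (rule gen_eqI[OF ahom_comp[OF C.mult_ahom_r cop_ahom] g assms(1)])
    fix m f assume m: "m \<in> carrier L" "f \<in> carrier H"
    have b: "bil k H T.BT (\<lambda>x y. (src B n \<otimes>\<^bsub>B\<^esub> i x) \<boxtimes>\<^bsub>T.BT\<^esub> i y)" if "n \<in> carrier L" for n
      by (rule bilI) (use that in simp_all)
    have "cop B ((src B m \<otimes>\<^bsub>B\<^esub> i f) \<otimes>\<^bsub>B\<^esub> (src B l \<otimes>\<^bsub>B\<^esub> i h)) =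
        SS T.BT (D f) (\<lambda>x y. SS T.BT (D y) (\<lambda>p q. SS T.BT (D h) (\<lambda>u v.
          (src B (m \<otimes>\<^bsub>L\<^esub> act x l) \<otimes>\<^bsub>B\<^esub> i (p \<otimes>\<^bsub>H\<^esub> u)) \<boxtimes>\<^bsub>T.BT\<^esub> i (q \<otimes>\<^bsub>H\<^esub> v))))"
      using l m by (simp add: smash_comm' cop_gen D_mult[OF _ b])
    also have "\<dots> = SS T.BT (D h) (\<lambda>u v. SS T.BT (D f) (\<lambda>x y.
          (src B m \<otimes>\<^bsub>B\<^esub> (i x \<otimes>\<^bsub>B\<^esub> (src B l \<otimes>\<^bsub>B\<^esub> i u))) \<boxtimes>\<^bsub>T.BT\<^esub> (i y \<otimes>\<^bsub>B\<^esub> i v)))"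
      by (rule cop_mult_gen) (use l m in simp_all)
    also have "\<dots> = ?g (src B m \<otimes>\<^bsub>B\<^esub> i f)"
      using l m by (simp add: cop_gen)
    finally show "cop B ((src B m \<otimes>\<^bsub>B\<^esub> i f) \<otimes>\<^bsub>B\<^esub> (src B l \<otimes>\<^bsub>B\<^esub> i h)) = ?g (src B m \<otimes>\<^bsub>B\<^esub> i f)" .
  qed (use l in simp_all)
  ultimately show "cop B (a \<otimes>\<^bsub>B\<^esub> (src B l \<otimes>\<^bsub>B\<^esub> i h)) =
    tlift T.BT (tmul_pure T.BT B B (cop B a)) (cop B (src B l \<otimes>\<^bsub>B\<^esub> i h))" by simp
qed (use assms in simp_all)

text \<open>Compatibility of the coproduct with target and source makes the two iterated coproducts
  well defined. On a generator the base element stays in the first leg on both sides, and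
  coassociativity of H remains.\<close>

lemma coassoc':
  assumes "a \<in> carrier B"
  shows "tmap T.BT3 (cop B) (\<lambda>b. b) (cop B a) = tmap_right T.BT T.BT3 (cop B) (cop B a)"
  unfolding tmap_def T.tmap_right_eq
proof -
  note b1 = T.pure_map_bal[OF cop_ahom cop_tgt'] and b2 = T.bracket_map_bal[OF cop_ahom cop_src']
  show "tlift T.BT3 (\<lambda>a b. cop B a \<boxtimes>\<^bsub>T.BT3\<^esub> b) (cop B a) = tlift T.BT3 (\<lambda>a d. T.bracket a (cop B d)) (cop B a)"
  proof (rule gen_eqI[OF ahom_comp[OF cop_ahom T.t2.lift_ahom[OF T.t3.agT b1]]
        ahom_comp[OF cop_ahom T.t2.lift_ahom[OF T.t3.agT b2]] assms])
    fix l h assume l: "l \<in> carrier L" "h \<in> carrier H"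
    have c1: "cop B (i x) = SS T.BT (D x) (\<lambda>p q. i p \<boxtimes>\<^bsub>T.BT\<^esub> i q)" if "x \<in> carrier H" for x
      using cop_gen[of "\<one>\<^bsub>L\<^esub>" x] that by simp
    have "tlift T.BT3 (\<lambda>a b. cop B a \<boxtimes>\<^bsub>T.BT3\<^esub> b) (cop B (src B l \<otimes>\<^bsub>B\<^esub> i h)) =
        SS T.BT3 (D h) (\<lambda>x y. SS T.BT3 (D x) (\<lambda>p q. ((src B l \<otimes>\<^bsub>B\<^esub> i p) \<boxtimes>\<^bsub>T.BT\<^esub> i q) \<boxtimes>\<^bsub>T.BT3\<^esub> i y))"
      using l by (simp add: cop_gen T.t2.lift_Sm[OF T.t3.agT b1] T.t2.lift_pure[OF T.t3.agT b1])
    also have "\<dots> = SS T.BT3 (D h) (\<lambda>x y. SS T.BT3 (D y) (\<lambda>p q. ((src B l \<otimes>\<^bsub>B\<^esub> i x) \<boxtimes>\<^bsub>T.BT\<^esub> i p) \<boxtimes>\<^bsub>T.BT3\<^esub> i q))"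
      by (rule coassoc, simp, rule triI) (use l in simp_all)
    also have "\<dots> = tlift T.BT3 (\<lambda>a d. T.bracket a (cop B d)) (cop B (src B l \<otimes>\<^bsub>B\<^esub> i h))"
      using l by (simp add: cop_gen c1 T.t2.lift_Sm[OF T.t3.agT b2] T.t2.lift_pure[OF T.t3.agT b2])
    finally show "tlift T.BT3 (\<lambda>a b. cop B a \<boxtimes>\<^bsub>T.BT3\<^esub> b) (cop B (src B l \<otimes>\<^bsub>B\<^esub> i h)) =
        tlift T.BT3 (\<lambda>a d. T.bracket a (cop B d)) (cop B (src B l \<otimes>\<^bsub>B\<^esub> i h))" .
  qed
qed

lemma act_eps: "h \<in> carrier H \<Longrightarrow> l \<in> carrier L \<Longrightarrow> SS L (D h) (\<lambda>x y. \<epsilon> y \<odot>\<^bsub>L\<^esub> act x l) = act h l"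
  using arg_cong[OF counit_r[of h], of "\<lambda>x. act x l"] by simp

lemma eps_act: "h \<in> carrier H \<Longrightarrow> l \<in> carrier L \<Longrightarrow> SS L (D h) (\<lambda>x y. \<epsilon> x \<odot>\<^bsub>L\<^esub> act y l) = act h l"
  using arg_cong[OF counit_l[of h], of "\<lambda>x. act x l"] by simp

lemma cou_src':
  assumes "l \<in> carrier L" "a \<in> carrier B"
  shows "cou B (src B l \<otimes>\<^bsub>B\<^esub> a) = l \<otimes>\<^bsub>L\<^esub> cou B a"
  by (rule gen_eqI[OF ahom_comp[OF C.mult_ahom_l cou_ahom] ahom_comp[OF cou_ahom L.mult_ahom_l] assms(2)])
    (use assms in \<open>simp_all add: cou_gen\<close>)

text \<open>t(l) is moved behind s(m), which puts l to the right of m, and (\<epsilon> \<otimes>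
  id)(R) = 1 removes the R-matrix hidden in t.\<close>

lemma cou_tgt':
  assumes "l \<in> carrier L" "a \<in> carrier B"
  shows "cou B (tgt B l \<otimes>\<^bsub>B\<^esub> a) = cou B a \<otimes>\<^bsub>L\<^esub> l"
proof (rule gen_eqI[OF ahom_comp[OF C.mult_ahom_l cou_ahom] ahom_comp[OF cou_ahom L.mult_ahom_r] assms(2)])
  fix m h assume m: "m \<in> carrier L" "h \<in> carrier H"
  have "SS L rs (\<lambda>a b. \<epsilon> a \<odot>\<^bsub>L\<^esub> act b l) = act (SS H rs (\<lambda>a b. \<epsilon> a \<odot>\<^bsub>H\<^esub> b)) l" using assms by simp
  also have "\<dots> = l" using assms by (simp only: eps_R_l act_one)
  finally have e: "SS L rs (\<lambda>a b. \<epsilon> a \<odot>\<^bsub>L\<^esub> act b l) = l" .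
  have "cou B (tgt B l \<otimes>\<^bsub>B\<^esub> (src B m \<otimes>\<^bsub>B\<^esub> i h)) = SS L rs (\<lambda>a b. \<epsilon> h \<odot>\<^bsub>L\<^esub> (m \<otimes>\<^bsub>L\<^esub> (\<epsilon> a \<odot>\<^bsub>L\<^esub> act b l)))"
    using assms m by (simp add: t_gen cou_gen H.m.m_comm flip: L.m.smult_assoc1)
  also have "\<dots> = \<epsilon> h \<odot>\<^bsub>L\<^esub> (m \<otimes>\<^bsub>L\<^esub> SS L rs (\<lambda>a b. \<epsilon> a \<odot>\<^bsub>L\<^esub> act b l))"
    using assms m by (simp add: L.smult_Sm)
  finally show "cou B (tgt B l \<otimes>\<^bsub>B\<^esub> (src B m \<otimes>\<^bsub>B\<^esub> i h)) = cou B (src B m \<otimes>\<^bsub>B\<^esub> i h) \<otimes>\<^bsub>L\<^esub> l"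
    using assms m by (simp add: e cou_gen)
qed (use assms in simp_all)

lemma cou_mult_src':
  assumes "a \<in> carrier B" "b \<in> carrier B"
  shows "cou B (a \<otimes>\<^bsub>B\<^esub> src B (cou B b)) = cou B (a \<otimes>\<^bsub>B\<^esub> b)"
proof (rule gen_eqI[OF ahom_comp[OF cou_ahom ahom_comp[OF s_ahom ahom_comp[OF C.mult_ahom_l cou_ahom]]]
      ahom_comp[OF C.mult_ahom_l cou_ahom] assms(2)])
  fix l h assume l: "l \<in> carrier L" "h \<in> carrier H"
  show "cou B (a \<otimes>\<^bsub>B\<^esub> src B (cou B (src B l \<otimes>\<^bsub>B\<^esub> i h))) = cou B (a \<otimes>\<^bsub>B\<^esub> (src B l \<otimes>\<^bsub>B\<^esub> i h))"
  proof (rule gen_eqI[OF ahom_comp[OF C.mult_ahom_r cou_ahom] ahom_comp[OF C.mult_ahom_r cou_ahom] assms(1)])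
    fix m g assume m: "m \<in> carrier L" "g \<in> carrier H"
    show "cou B ((src B m \<otimes>\<^bsub>B\<^esub> i g) \<otimes>\<^bsub>B\<^esub> src B (cou B (src B l \<otimes>\<^bsub>B\<^esub> i h))) =
      cou B ((src B m \<otimes>\<^bsub>B\<^esub> i g) \<otimes>\<^bsub>B\<^esub> (src B l \<otimes>\<^bsub>B\<^esub> i h))"
    proof -
      have 1: "cou B ((src B m \<otimes>\<^bsub>B\<^esub> i g) \<otimes>\<^bsub>B\<^esub> src B n) = m \<otimes>\<^bsub>L\<^esub> act g n" if n: "n \<in> carrier L" for n
      proof -
        have "cou B ((src B m \<otimes>\<^bsub>B\<^esub> i g) \<otimes>\<^bsub>B\<^esub> src B n) = m \<otimes>\<^bsub>L\<^esub> SS L (D g) (\<lambda>x y. \<epsilon> y \<odot>\<^bsub>L\<^esub> act x n)"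
          using n m by (simp add: smash_comm cou_gen)
        then show ?thesis using n m by (simp only: act_eps)
      qed
      have "cou B ((src B m \<otimes>\<^bsub>B\<^esub> i g) \<otimes>\<^bsub>B\<^esub> (src B l \<otimes>\<^bsub>B\<^esub> i h)) =
          SS L (D g) (\<lambda>x y. \<epsilon> h \<odot>\<^bsub>L\<^esub> (m \<otimes>\<^bsub>L\<^esub> (\<epsilon> y \<odot>\<^bsub>L\<^esub> act x l)))"
        using l m by (simp add: smash_comm' cou_gen H.m.m_comm flip: L.m.smult_assoc1)
      also have "\<dots> = \<epsilon> h \<odot>\<^bsub>L\<^esub> (m \<otimes>\<^bsub>L\<^esub> SS L (D g) (\<lambda>x y. \<epsilon> y \<odot>\<^bsub>L\<^esub> act x l))"
        using l m by (simp add: L.smult_Sm)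
      also have "\<dots> = \<epsilon> h \<odot>\<^bsub>L\<^esub> (m \<otimes>\<^bsub>L\<^esub> act g l)" using l m by (simp only: act_eps)
      finally show ?thesis using 1[of "\<epsilon> h \<odot>\<^bsub>L\<^esub> l"] l m by (simp add: cou_gen del: C.m_assoc)
    qed
  qed (use l in \<open>simp_all add: cou_gen\<close>)
qed (use assms in simp_all)

text \<open>With a = s(m) i(g), both \<epsilon>(a t(l)) and \<epsilon>(a s(l)) equal m (g \<rhd> l),
  the former by the left and the latter by the right counit law. This reduces the claim to the one
  for the source.\<close>

lemma cou_mult_tgt':
  assumes "a \<in> carrier B" "b \<in> carrier B"
  shows "cou B (a \<otimes>\<^bsub>B\<^esub> tgt B (cou B b)) = cou B (a \<otimes>\<^bsub>B\<^esub> b)"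
proof -
  have "cou B (a \<otimes>\<^bsub>B\<^esub> tgt B l) = cou B (a \<otimes>\<^bsub>B\<^esub> src B l)" if l: "l \<in> carrier L" for l
  proof (rule gen_eqI[OF ahom_comp[OF C.mult_ahom_r cou_ahom] ahom_comp[OF C.mult_ahom_r cou_ahom] assms(1)])
    fix m g assume m: "m \<in> carrier L" "g \<in> carrier H"
    have "cou B ((src B m \<otimes>\<^bsub>B\<^esub> i g) \<otimes>\<^bsub>B\<^esub> tgt B l) = SS L (D g) (\<lambda>x y. m \<otimes>\<^bsub>L\<^esub> (\<epsilon> x \<odot>\<^bsub>L\<^esub> act y l))"
      using l m by (simp add: i_t cou_tgt' cou_gen)
    also have "\<dots> = m \<otimes>\<^bsub>L\<^esub> SS L (D g) (\<lambda>x y. \<epsilon> x \<odot>\<^bsub>L\<^esub> act y l)" using l m by simp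
    also have "\<dots> = m \<otimes>\<^bsub>L\<^esub> SS L (D g) (\<lambda>x y. \<epsilon> y \<odot>\<^bsub>L\<^esub> act x l)" using l m by (simp only: eps_act act_eps)
    also have "\<dots> = cou B ((src B m \<otimes>\<^bsub>B\<^esub> i g) \<otimes>\<^bsub>B\<^esub> src B l)"
      using l m by (simp add: smash_comm cou_gen)
    finally show "cou B ((src B m \<otimes>\<^bsub>B\<^esub> i g) \<otimes>\<^bsub>B\<^esub> tgt B l) = cou B ((src B m \<otimes>\<^bsub>B\<^esub> i g) \<otimes>\<^bsub>B\<^esub> src B l)" .
  qed (use l in simp_all)
  then show ?thesis using assms cou_mult_src' by simp
qed

lemma cou_left':
  assumes "a \<in> carrier B"
  shows "tlift B (\<lambda>x y. src B (cou B x) \<otimes>\<^bsub>B\<^esub> y) (cop B a) = a"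
proof -
  have b: "T.bb B (\<lambda>x y. src B (cou B x) \<otimes>\<^bsub>B\<^esub> y)"
    by (rule balI) (simp_all add: cou_tgt')
  have h: "ahom B B (\<lambda>a. a)" by (rule ahomI) simp_all
  show ?thesis
  proof (rule gen_eqI[OF ahom_comp[OF cop_ahom T.t2.lift_ahom[OF C.ag b]] h assms])
    fix l h assume l: "l \<in> carrier L" "h \<in> carrier H"
    have "tlift B (\<lambda>x y. src B (cou B x) \<otimes>\<^bsub>B\<^esub> y) (cop B (src B l \<otimes>\<^bsub>B\<^esub> i h)) =
        src B l \<otimes>\<^bsub>B\<^esub> i (SS H (D h) (\<lambda>x y. \<epsilon> x \<odot>\<^bsub>H\<^esub> y))"
      using l by (simp add: cop_gen T.t2.lift_Sm[OF C.ag b] T.t2.lift_pure[OF C.ag b] cou_gen)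
    then show "tlift B (\<lambda>x y. src B (cou B x) \<otimes>\<^bsub>B\<^esub> y) (cop B (src B l \<otimes>\<^bsub>B\<^esub> i h)) = src B l \<otimes>\<^bsub>B\<^esub> i h"
      using l by (simp only: counit_l)
  qed
qed

lemma cou_right':
  assumes "a \<in> carrier B"
  shows "tlift B (\<lambda>x y. tgt B (cou B y) \<otimes>\<^bsub>B\<^esub> x) (cop B a) = a"
proof -
  have b: "T.bb B (\<lambda>x y. tgt B (cou B y) \<otimes>\<^bsub>B\<^esub> x)"
    by (rule balI) (simp_all add: cou_src')
  have h: "ahom B B (\<lambda>a. a)" by (rule ahomI) simp_all
  have c1: "cou B (i y) = \<epsilon> y \<odot>\<^bsub>L\<^esub> \<one>\<^bsub>L\<^esub>" if "y \<in> carrier H" for y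
    using cou_gen[of "\<one>\<^bsub>L\<^esub>" y] that by simp
  show ?thesis
  proof (rule gen_eqI[OF ahom_comp[OF cop_ahom T.t2.lift_ahom[OF C.ag b]] h assms])
    fix l h assume l: "l \<in> carrier L" "h \<in> carrier H"
    have "tlift B (\<lambda>x y. tgt B (cou B y) \<otimes>\<^bsub>B\<^esub> x) (cop B (src B l \<otimes>\<^bsub>B\<^esub> i h)) =
        src B l \<otimes>\<^bsub>B\<^esub> i (SS H (D h) (\<lambda>x y. \<epsilon> y \<odot>\<^bsub>H\<^esub> x))"
      using l by (simp add: cop_gen T.t2.lift_Sm[OF C.ag b] T.t2.lift_pure[OF C.ag b] c1)
    then show "tlift B (\<lambda>x y. tgt B (cou B y) \<otimes>\<^bsub>B\<^esub> x) (cop B (src B l \<otimes>\<^bsub>B\<^esub> i h)) = src B l \<otimes>\<^bsub>B\<^esub> i h"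
      using l by (simp only: counit_r)
  qed
qed

lemma bialgebroid: "bialgebroid k L B"
proof (rule bialgebroid.intro[OF L_alg C_alg s_hom])
  show "tgt B \<in> alg_hom k (opp L) B"
    by (rule alg_homI) (simp_all add: opp_def)
  show "cop B \<one>\<^bsub>B\<^esub> = \<one>\<^bsub>B\<^esub> \<boxtimes>\<^bsub>T.BT\<^esub> \<one>\<^bsub>B\<^esub>"
  proof -
    have b: "bil k H T.BT (\<lambda>x y. i x \<boxtimes>\<^bsub>T.BT\<^esub> i y)" by (rule bilI) simp_all
    show ?thesis using cop_gen[of "\<one>\<^bsub>L\<^esub>" "\<one>\<^bsub>H\<^esub>"] by (simp add: D_one[OF _ b])
  qed
  show "cou B \<one>\<^bsub>B\<^esub> = \<one>\<^bsub>L\<^esub>"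
    using cou_gen[of "\<one>\<^bsub>L\<^esub>" "\<one>\<^bsub>H\<^esub>"] by simp
qed ((rule cop_src' cop_tgt' coassoc' takeuchi_cop cop_mult' cou_src' cou_tgt' cou_mult_src'
    cou_mult_tgt' cou_left' cou_right'; assumption) | simp)+

section \<open>The universal R-matrix of a presented groupoid\<close>

lemma Q_tens: "bil k H O.BT (\<lambda>a b. i a \<boxtimes>\<^bsub>O.BT\<^esub> i b)" and Qbar_tens: "bil k H T.BT (\<lambda>a b. i a \<boxtimes>\<^bsub>T.BT\<^esub> i b)"
  by (rule bilI; simp)+

lemma Q_eq: "rmat B = SS O.BT rs (\<lambda>a b. i a \<boxtimes>\<^bsub>O.BT\<^esub> i b)"
  unfolding rmat_eq tmap_def by (rule lift_eq(2)[OF _ Q_tens]) simp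

definition Qbar where "Qbar = SS T.BT rb (\<lambda>a b. i a \<boxtimes>\<^bsub>T.BT\<^esub> i b)"

lemma Q_closed [simp]: "rmat B \<in> carrier O.BT" and Qbar_closed [simp]: "Qbar \<in> carrier T.BT"
  by (simp_all add: Q_eq Qbar_def)

lemma tmul_Q [simp]: "c \<in> carrier B \<Longrightarrow> d \<in> carrier B \<Longrightarrow> tmul_pure O.BT B B (rmat B) c d =
    SS O.BT rs (\<lambda>a b. (i a \<otimes>\<^bsub>B\<^esub> c) \<boxtimes>\<^bsub>O.BT\<^esub> (i b \<otimes>\<^bsub>B\<^esub> d))"
  and tmul_Qbar [simp]: "c \<in> carrier B \<Longrightarrow> d \<in> carrier B \<Longrightarrow> tmul_pure T.BT B B Qbar c d =
    SS T.BT rb (\<lambda>a b. (i a \<otimes>\<^bsub>B\<^esub> c) \<boxtimes>\<^bsub>T.BT\<^esub> (i b \<otimes>\<^bsub>B\<^esub> d))"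
  by (simp_all add: Q_eq Qbar_def)

lemma Q_balanced: "l \<in> carrier L \<Longrightarrow>
    tmul_pure O.BT B B (rmat B) (tgt B l) \<one>\<^bsub>B\<^esub> = tmul_pure O.BT B B (rmat B) \<one>\<^bsub>B\<^esub> (src B l)"
  using Q_bal[of l "\<one>\<^bsub>B\<^esub>" "\<one>\<^bsub>B\<^esub>"] by simp

lemma Qbar_balanced: "l \<in> carrier L \<Longrightarrow>
    tmul_pure T.BT B B Qbar (src B l) \<one>\<^bsub>B\<^esub> = tmul_pure T.BT B B Qbar \<one>\<^bsub>B\<^esub> (tgt B l)"
  using Qbar_bal[of l "\<one>\<^bsub>B\<^esub>" "\<one>\<^bsub>B\<^esub>"] by simp

lemma Q_tmul_bal: "T.bb O.BT (tmul_pure O.BT B B (rmat B))"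
  by (rule O.tmul_bal[OF Q_closed Q_balanced]) simp_all

lemma balanced_tmul:
  assumes "X \<in> carrier T.BT" "\<And>l. l \<in> carrier L \<Longrightarrow>
    tmul_pure T.BT B B X (src B l) \<one>\<^bsub>B\<^esub> = tmul_pure T.BT B B X \<one>\<^bsub>B\<^esub> (tgt B l)"
  shows "O.bb T.BT (tmul_pure T.BT B B X)"
  by (rule T.tmul_bal[OF assms]) simp_all

lemma tmul_over_Q:
  assumes "X \<in> carrier T.BT" "\<And>l. l \<in> carrier L \<Longrightarrow>
    tmul_pure T.BT B B X (src B l) \<one>\<^bsub>B\<^esub> = tmul_pure T.BT B B X \<one>\<^bsub>B\<^esub> (tgt B l)"
  shows "tmul T.BT B B X (rmat B) = SS T.BT rs (\<lambda>a b. tmul_pure T.BT B B X (i a) (i b))"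
proof -
  note b = balanced_tmul[OF assms]
  show ?thesis by (simp add: tmul_def Q_eq O.t2.lift_Sm[OF _ b] O.t2.lift_pure[OF _ b])
qed

lemma rmat_inverse_Qbar: "rmat_inverse L B (rmat B) Qbar"
  unfolding rmat_inverse_def
proof (intro conjI ballI)
  show "tmul O.BT B B (rmat B) Qbar = \<one>\<^bsub>B\<^esub> \<boxtimes>\<^bsub>O.BT\<^esub> \<one>\<^bsub>B\<^esub>"
  proof -
    have "tmul O.BT B B (rmat B) Qbar = SS O.BT rb (\<lambda>c d. SS O.BT rs (\<lambda>a b. i (a \<otimes>\<^bsub>H\<^esub> c) \<boxtimes>\<^bsub>O.BT\<^esub> i (b \<otimes>\<^bsub>H\<^esub> d)))"
      by (simp add: tmul_def Qbar_def T.t2.lift_Sm[OF _ Q_tmul_bal] T.t2.lift_pure[OF _ Q_tmul_bal])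
    also have "\<dots> = SS O.BT rs (\<lambda>a b. SS O.BT rb (\<lambda>c d. i (a \<otimes>\<^bsub>H\<^esub> c) \<boxtimes>\<^bsub>O.BT\<^esub> i (b \<otimes>\<^bsub>H\<^esub> d)))"
      by (rule Sm_swap) simp_all
    finally show ?thesis using Rinv1[OF _ Q_tens] by simp
  qed
  show "tmul T.BT B B Qbar (rmat B) = \<one>\<^bsub>B\<^esub> \<boxtimes>\<^bsub>T.BT\<^esub> \<one>\<^bsub>B\<^esub>"
  proof -
    have "tmul T.BT B B Qbar (rmat B) = SS T.BT rs (\<lambda>a b. SS T.BT rb (\<lambda>c d. i (c \<otimes>\<^bsub>H\<^esub> a) \<boxtimes>\<^bsub>T.BT\<^esub> i (d \<otimes>\<^bsub>H\<^esub> b)))"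
      by (simp add: tmul_over_Q[OF Qbar_closed Qbar_balanced])
    also have "\<dots> = SS T.BT rb (\<lambda>c d. SS T.BT rs (\<lambda>a b. i (c \<otimes>\<^bsub>H\<^esub> a) \<boxtimes>\<^bsub>T.BT\<^esub> i (d \<otimes>\<^bsub>H\<^esub> b)))"
      by (rule Sm_swap) simp_all
    finally show ?thesis using Rinv2[OF _ Qbar_tens] by simp
  qed
qed (simp_all only: Qbar_closed Qbar_balanced)

text \<open>Uniqueness: evaluate \<open>X Q Qbar\<close> in two ways.\<close>

lemma rmat_inverse_unique:
  assumes "rmat_inverse L B (rmat B) X"
  shows "X = Qbar"
proof -
  have X: "X \<in> carrier T.BT" "\<And>l. l \<in> carrier L \<Longrightarrow>
      tmul_pure T.BT B B X (src B l) \<one>\<^bsub>B\<^esub> = tmul_pure T.BT B B X \<one>\<^bsub>B\<^esub> (tgt B l)"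
    and one: "tmul T.BT B B X (rmat B) = \<one>\<^bsub>B\<^esub> \<boxtimes>\<^bsub>T.BT\<^esub> \<one>\<^bsub>B\<^esub>"
    using assms by (auto simp: rmat_inverse_def)
  have "O.bb T.BT (tmul_pure T.BT B B X)" by (rule balanced_tmul) (fact X)+
  then have bb: "tmul_pure T.BT B B X (src B l \<otimes>\<^bsub>B\<^esub> a) b = tmul_pure T.BT B B X a (tgt B l \<otimes>\<^bsub>B\<^esub> b)"
    if "l \<in> carrier L" "a \<in> carrier B" "b \<in> carrier B" for l a b
    using that by (simp add: bal_def)
  have b: "bil k H T.BT (\<lambda>a b. tmul_pure T.BT B B X (i a) (i b))"
  proof (rule bilI)
    fix r a b assume "r \<in> carrier k" "a \<in> carrier H" "b \<in> carrier H"
    then show "tmul_pure T.BT B B X (i a) (i (r \<odot>\<^bsub>H\<^esub> b)) = tmul_pure T.BT B B X (i (r \<odot>\<^bsub>H\<^esub> a)) (i b)"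
      using bb[of "r \<odot>\<^bsub>L\<^esub> \<one>\<^bsub>L\<^esub>" "i a" "i b"] by simp
  qed (simp_all add: X T.tmul_pure_add)
  have "X = SS T.BT rs (\<lambda>a b. SS T.BT rb (\<lambda>c d. tmul_pure T.BT B B X (i (a \<otimes>\<^bsub>H\<^esub> c)) (i (b \<otimes>\<^bsub>H\<^esub> d))))"
    using Rinv1[OF _ b] by (simp add: T.tmul_pure_one X)
  also have "\<dots> = SS T.BT rb (\<lambda>c d. SS T.BT rs (\<lambda>a b. tmul_pure T.BT B B X (i (a \<otimes>\<^bsub>H\<^esub> c)) (i (b \<otimes>\<^bsub>H\<^esub> d))))"
    by (rule Sm_swap) (simp_all add: X)
  also have "\<dots> = SS T.BT rb (\<lambda>c d. tmul_pure T.BT B B (tmul T.BT B B X (rmat B)) (i c) (i d))"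
    by (simp add: tmul_over_Q[OF X] X T.tmul_pure_tmul_pure)
  also have "\<dots> = Qbar" by (simp add: one Qbar_def)
  finally show ?thesis .
qed

text \<open>Evaluates the description by which \<open>coopposite\<close> defines its
  R-matrix.\<close>

lemma rmat_inverse_the: "(THE X. rmat_inverse L B (rmat B) X) = Qbar"
  using rmat_inverse_Qbar rmat_inverse_unique by (rule the_equality)

lemma cop_op_ahom: "ahom B O.BT (cop_op L B)"
  unfolding cop_op_def[abs_def] by (rule ahom_comp[OF cop_ahom T.flip_hom])

lemma cop_op_gen: "l \<in> carrier L \<Longrightarrow> h \<in> carrier H \<Longrightarrow> cop_op L B (src B l \<otimes>\<^bsub>B\<^esub> i h) =
    SS O.BT (D h) (\<lambda>x y. i y \<boxtimes>\<^bsub>O.BT\<^esub> (src B l \<otimes>\<^bsub>B\<^esub> i x))"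
  by (simp add: cop_op_def cop_gen)

lemma cop_op_i: "h \<in> carrier H \<Longrightarrow> cop_op L B (i h) = SS O.BT (D h) (\<lambda>x y. i y \<boxtimes>\<^bsub>O.BT\<^esub> i x)"
  using cop_op_gen[of "\<one>\<^bsub>L\<^esub>" h] by simp

lemma cop_op_src:
  assumes "l \<in> carrier L" "a \<in> carrier B"
  shows "cop_op L B (src B l \<otimes>\<^bsub>B\<^esub> a) = tmap O.BT (\<lambda>x. x) (\<lambda>y. src B l \<otimes>\<^bsub>B\<^esub> y) (cop_op L B a)"
  unfolding cop_op_def cop_src'[OF assms]
  by (rule T.t2.ahom_eqI[OF ahom_comp[OF T.left_hom T.flip_hom] ahom_comp[OF T.flip_hom O.right_hom]])
    (use assms in simp_all)

lemma cop_op_tgt: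
  assumes "l \<in> carrier L" "a \<in> carrier B"
  shows "cop_op L B (tgt B l \<otimes>\<^bsub>B\<^esub> a) = tmap O.BT (\<lambda>x. tgt B l \<otimes>\<^bsub>B\<^esub> x) (\<lambda>y. y) (cop_op L B a)"
  unfolding cop_op_def cop_tgt'[OF assms]
  by (rule T.t2.ahom_eqI[OF ahom_comp[OF T.right_hom T.flip_hom] ahom_comp[OF T.flip_hom O.left_hom]])
    (use assms in simp_all)

lemma flip_tmul:
  assumes "X \<in> carrier T.BT" "c \<in> carrier B" "d \<in> carrier B"
  shows "tmul_pure O.BT B B (tflip O.BT X) c d = tflip O.BT (tmul_pure T.BT B B X d c)"
  by (rule T.t2.ahom_eqI[OF ahom_comp[OF T.flip_hom O.tmul_pure_hom] ahom_comp[OF T.tmul_pure_hom T.flip_hom] assms(1)])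
    (use assms in simp_all)

lemma cop_op_balanced:
  assumes "l \<in> carrier L" "a \<in> carrier B"
  shows "tmul_pure O.BT B B (cop_op L B a) (src B l) \<one>\<^bsub>B\<^esub> = tmul_pure O.BT B B (cop_op L B a) \<one>\<^bsub>B\<^esub> (tgt B l)"
  using takeuchi_cop[OF assms] assms by (simp add: cop_op_def flip_tmul)

text \<open>On a generator, \<open>Q_s\<close> carries s(l) to the left end of the second leg; there
  it is out of the way while R \<Delta>(h) = \<Delta>^op(h) R is applied to the rest.\<close>

lemma Q_intertwines:
  assumes "a \<in> carrier B"
  shows "tmul O.BT B B (rmat B) (cop B a) = tmul O.BT B B (cop_op L B a) (rmat B)"
proof -
  let ?g = "\<lambda>x. SS O.BT rs (\<lambda>a b. tmul_pure O.BT B B (cop_op L B x) (i a) (i b))"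
  have r: "tmul O.BT B B (cop_op L B x) (rmat B) = ?g x" if "x \<in> carrier B" for x
  proof -
    have b: "O.bb O.BT (tmul_pure O.BT B B (cop_op L B x))"
      by (rule O.tmul_bal) (use that in \<open>simp_all add: ahom_closed[OF cop_op_ahom] cop_op_balanced\<close>)
    show ?thesis
      by (simp add: tmul_def Q_eq O.t2.lift_Sm[OF _ b] O.t2.lift_pure[OF _ b])
  qed
  have g: "ahom B O.BT ?g"
    by (rule ahomI) (simp_all add: ahom_closed[OF cop_op_ahom] ahom_add[OF cop_op_ahom] ahom_add[OF O.tmul_pure_hom])
  have "tlift O.BT (tmul_pure O.BT B B (rmat B)) (cop B a) = ?g a"
  proof (rule gen_eqI[OF ahom_comp[OF cop_ahom T.t2.lift_ahom[OF _ Q_tmul_bal]] g assms])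
    fix l h assume l: "l \<in> carrier L" "h \<in> carrier H"
    have b: "bil k H O.BT (\<lambda>u v. i u \<boxtimes>\<^bsub>O.BT\<^esub> (src B l \<otimes>\<^bsub>B\<^esub> i v))"
      by (rule bilI) (use l in simp_all)
    have "tlift O.BT (tmul_pure O.BT B B (rmat B)) (cop B (src B l \<otimes>\<^bsub>B\<^esub> i h)) =
        SS O.BT (D h) (\<lambda>x y. SS O.BT rs (\<lambda>a b. (i a \<otimes>\<^bsub>B\<^esub> (src B l \<otimes>\<^bsub>B\<^esub> i x)) \<boxtimes>\<^bsub>O.BT\<^esub> (i b \<otimes>\<^bsub>B\<^esub> i y)))"
      using l by (simp add: cop_gen T.t2.lift_Sm[OF _ Q_tmul_bal] T.t2.lift_pure[OF _ Q_tmul_bal])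
    also have "\<dots> = SS O.BT (D h) (\<lambda>x y. SS O.BT rs (\<lambda>a b. i (a \<otimes>\<^bsub>H\<^esub> x) \<boxtimes>\<^bsub>O.BT\<^esub> (src B l \<otimes>\<^bsub>B\<^esub> i (b \<otimes>\<^bsub>H\<^esub> y))))"
      by (rule Sm_cong', subst Q_s) (use l in simp_all)
    also have "\<dots> = SS O.BT rs (\<lambda>a b. SS O.BT (D h) (\<lambda>x y. i (a \<otimes>\<^bsub>H\<^esub> x) \<boxtimes>\<^bsub>O.BT\<^esub> (src B l \<otimes>\<^bsub>B\<^esub> i (b \<otimes>\<^bsub>H\<^esub> y))))"
      by (rule Sm_swap) (use l in simp_all)
    also have "\<dots> = SS O.BT (D h) (\<lambda>x y. SS O.BT rs (\<lambda>a b. i (y \<otimes>\<^bsub>H\<^esub> a) \<boxtimes>\<^bsub>O.BT\<^esub> (src B l \<otimes>\<^bsub>B\<^esub> i (x \<otimes>\<^bsub>H\<^esub> b))))"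
      by (rule Rcomm[OF _ b]) (use l in simp_all)
    also have "\<dots> = SS O.BT rs (\<lambda>a b. SS O.BT (D h) (\<lambda>x y. i (y \<otimes>\<^bsub>H\<^esub> a) \<boxtimes>\<^bsub>O.BT\<^esub> (src B l \<otimes>\<^bsub>B\<^esub> i (x \<otimes>\<^bsub>H\<^esub> b))))"
      by (rule Sm_swap) (use l in simp_all)
    also have "\<dots> = ?g (src B l \<otimes>\<^bsub>B\<^esub> i h)" using l by (simp add: cop_op_gen)
    finally show "tlift O.BT (tmul_pure O.BT B B (rmat B)) (cop B (src B l \<otimes>\<^bsub>B\<^esub> i h)) = ?g (src B l \<otimes>\<^bsub>B\<^esub> i h)" .
  qed simp
  then show ?thesis unfolding r[OF assms] by (simp only: tmul_def)
qed

text \<open>The right-hand side is meaningful because b \<mapsto> Q (1 \<otimes> b) respects left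
  multiplication by t(l), which is \<open>Q_t\<close>. The identity itself is (\<Delta> \<otimes>
  id)(R) = R_13 R_23 with its first two legs exchanged.\<close>

lemma hexagon_l:
  "tmap O.BT3 (cop_op L B) (\<lambda>b. b) (rmat B) =
   tmap_right O.BT O.BT3 (\<lambda>b. tmul_pure O.BT B B (rmat B) \<one>\<^bsub>B\<^esub> b) (rmat B)"
proof -
  note b1 = O.pure_map_bal[OF cop_op_ahom cop_op_src]
  let ?f = "\<lambda>b. tmul_pure O.BT B B (rmat B) \<one>\<^bsub>B\<^esub> b"
  have f: "ahom B O.BT ?f" by (rule ahomI) (simp_all add: O.tmul_pure_add)
  have b2: "O.bb O.BT3 (\<lambda>a d. O.bracket a (?f d))"
  proof (rule O.bracket_map_bal[OF f])
    fix l a assume "l \<in> carrier L" "a \<in> carrier B"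
    then show "?f (tgt B l \<otimes>\<^bsub>B\<^esub> a) = tmap O.BT (\<lambda>x. tgt B l \<otimes>\<^bsub>B\<^esub> x) (\<lambda>y. y) (?f a)"
      using Q_t[of l "\<one>\<^bsub>B\<^esub>" a] by simp
  qed
  have t: "tri k H O.BT3 (\<lambda>x y b. (i y \<boxtimes>\<^bsub>O.BT\<^esub> i x) \<boxtimes>\<^bsub>O.BT3\<^esub> i b)" by (rule triI) simp_all
  have "tlift O.BT3 (\<lambda>a b. cop_op L B a \<boxtimes>\<^bsub>O.BT3\<^esub> b) (rmat B) =
      SS O.BT3 rs (\<lambda>a b. SS O.BT3 (D a) (\<lambda>x y. (i y \<boxtimes>\<^bsub>O.BT\<^esub> i x) \<boxtimes>\<^bsub>O.BT3\<^esub> i b))"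
    by (simp add: Q_eq O.t2.lift_Sm[OF _ b1] O.t2.lift_pure[OF _ b1] cop_op_i)
  also have "\<dots> = SS O.BT3 rs (\<lambda>a b. SS O.BT3 rs (\<lambda>c d. (i c \<boxtimes>\<^bsub>O.BT\<^esub> i a) \<boxtimes>\<^bsub>O.BT3\<^esub> i (b \<otimes>\<^bsub>H\<^esub> d)))"
    by (rule hexL[OF _ t]) simp
  also have "\<dots> = SS O.BT3 rs (\<lambda>c d. SS O.BT3 rs (\<lambda>a b. (i c \<boxtimes>\<^bsub>O.BT\<^esub> i a) \<boxtimes>\<^bsub>O.BT3\<^esub> i (b \<otimes>\<^bsub>H\<^esub> d)))"
    by (rule Sm_swap) simp_all
  also have "\<dots> = SS O.BT3 rs (\<lambda>c d. O.bracket (i c) (?f (i d)))" by simp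
  also have "\<dots> = tlift O.BT3 (\<lambda>a d. O.bracket a (?f d)) (rmat B)"
    by (simp only: Q_eq O.t2.lift_Sm[OF _ b2[unfolded Q_eq]] O.t2.lift_pure[OF _ b2[unfolded Q_eq]]
        O.t2.pure_closed i_simps O.t3.agT cong: Sm_cong)
  finally show ?thesis unfolding tmap_def O.tmap_right_eq .
qed

text \<open>Here well-definedness rests on \<open>Q_s\<close>, and the identity on (id \<otimes>
  \<Delta>)(R) = R_13 R_12 with the last two legs exchanged.\<close>

lemma hexagon_r:
  "tmap_right O.BT O.BT3 (cop_op L B) (rmat B) =
   tmap O.BT3 (\<lambda>a. tmul_pure O.BT B B (rmat B) a \<one>\<^bsub>B\<^esub>) (\<lambda>b. b) (rmat B)"
proof -
  note b1 = O.bracket_map_bal[OF cop_op_ahom cop_op_tgt]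
  let ?f = "\<lambda>a. tmul_pure O.BT B B (rmat B) a \<one>\<^bsub>B\<^esub>"
  have f: "ahom B O.BT ?f" by (rule ahomI) (simp_all add: O.tmul_pure_add)
  have b2: "O.bb O.BT3 (\<lambda>a d. ?f a \<boxtimes>\<^bsub>O.BT3\<^esub> d)"
  proof (rule O.pure_map_bal[OF f])
    fix l a assume "l \<in> carrier L" "a \<in> carrier B"
    then show "?f (src B l \<otimes>\<^bsub>B\<^esub> a) = tmap O.BT (\<lambda>x. x) (\<lambda>y. src B l \<otimes>\<^bsub>B\<^esub> y) (?f a)"
      using Q_s[of l a "\<one>\<^bsub>B\<^esub>"] by simp
  qed
  have t: "tri k H O.BT3 (\<lambda>a x y. (i a \<boxtimes>\<^bsub>O.BT\<^esub> i y) \<boxtimes>\<^bsub>O.BT3\<^esub> i x)" by (rule triI) simp_all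
  have "tlift O.BT3 (\<lambda>a d. O.bracket a (cop_op L B d)) (rmat B) =
      SS O.BT3 rs (\<lambda>a b. SS O.BT3 (D b) (\<lambda>x y. (i a \<boxtimes>\<^bsub>O.BT\<^esub> i y) \<boxtimes>\<^bsub>O.BT3\<^esub> i x))"
    by (simp add: Q_eq O.t2.lift_Sm[OF _ b1] O.t2.lift_pure[OF _ b1] cop_op_i)
  also have "\<dots> = SS O.BT3 rs (\<lambda>a b. SS O.BT3 rs (\<lambda>c d. (i (a \<otimes>\<^bsub>H\<^esub> c) \<boxtimes>\<^bsub>O.BT\<^esub> i b) \<boxtimes>\<^bsub>O.BT3\<^esub> i d))"
    by (rule hexR[OF _ t]) simp
  also have "\<dots> = SS O.BT3 rs (\<lambda>c d. SS O.BT3 rs (\<lambda>a b. (i (a \<otimes>\<^bsub>H\<^esub> c) \<boxtimes>\<^bsub>O.BT\<^esub> i b) \<boxtimes>\<^bsub>O.BT3\<^esub> i d))"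
    by (rule Sm_swap) simp_all
  also have "\<dots> = SS O.BT3 rs (\<lambda>c d. ?f (i c) \<boxtimes>\<^bsub>O.BT3\<^esub> i d)" by simp
  also have "\<dots> = tlift O.BT3 (\<lambda>a d. ?f a \<boxtimes>\<^bsub>O.BT3\<^esub> d) (rmat B)"
    by (simp only: Q_eq O.t2.lift_Sm[OF _ b2[unfolded Q_eq]] O.t2.lift_pure[OF _ b2[unfolded Q_eq]]
        O.t2.pure_closed i_simps O.t3.agT cong: Sm_cong)
  finally show ?thesis unfolding tmap_def O.tmap_right_eq .
qed

lemma quantum_groupoid: "quantum_groupoid k L B"
proof (rule quantum_groupoid.intro[OF bialgebroid], rule quantum_groupoid_axioms.intro)
  show "\<exists>Q'. rmat_inverse L B (rmat B) Q'" using rmat_inverse_Qbar by blast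
qed (rule Q_closed hexagon_l hexagon_r Q_balanced Q_intertwines; assumption?)+

end

text \<open>\<open>tlift\<close> reads only carrier, addition and zero of its target. The records
  \<open>tensor\<close>, \<open>ktensor\<close>, \<open>smash_algebra\<close> and
  \<open>smash\<close> share these, so lifts into any of them agree.\<close>

lemma tlift_struct:
  assumes "carrier G = carrier G'" "add G = add G'" "\<zero>\<^bsub>G\<^esub> = \<zero>\<^bsub>G'\<^esub>"
  shows "tlift G f X = tlift G' f X"
  using assms
  by (simp add: tlift_def finsum_def finprod_def add_pow_def nat_pow_def int_pow_def m_inv_def Let_def cong: if_cong)

lemma pure_struct: "\<zero>\<^bsub>G\<^esub> = \<zero>\<^bsub>G'\<^esub> \<Longrightarrow> a \<boxtimes>\<^bsub>G\<^esub> b = a \<boxtimes>\<^bsub>G'\<^esub> b"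
  by (simp add: pure_tensor_def)

text \<open>For products of two tensors: after lifting in the right factor \<open>Y\<close>, the
  result is balanced in the left one. Each clause equates two additive maps of \<open>Y\<close>,
  which can be compared on pure tensors.\<close>

lemma (in tens) lift2_bal:
  assumes T': "tens S' \<alpha>' \<beta>' M' N' T'" and G: "abelian_group G"
    and 1: "\<And>m g. m \<in> carrier M' \<Longrightarrow> g \<in> carrier N' \<Longrightarrow> bal S \<alpha> \<beta> M N G (\<lambda>l f. \<Phi> l f m g)"
    and 2: "\<And>l f. l \<in> carrier M \<Longrightarrow> f \<in> carrier N \<Longrightarrow> bal S' \<alpha>' \<beta>' M' N' G (\<lambda>m g. \<Phi> l f m g)"
    and Y: "Y \<in> carrier T'"
  shows "bal S \<alpha> \<beta> M N G (\<lambda>l f. tlift G (\<lambda>m g. \<Phi> l f m g) Y)"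
proof -
  interpret T': tens S' \<alpha>' \<beta>' M' N' T' by fact
  interpret G: abelian_group G by fact
  interpret M: abelian_group M by simp
  interpret N: abelian_group N by simp
  note h = T'.lift_ahom[OF G 2]
  have hs: "ahom T' G (\<lambda>Y. tlift G (\<lambda>m g. \<Phi> l f m g) Y \<oplus>\<^bsub>G\<^esub> tlift G (\<lambda>m g. \<Phi> l' f' m g) Y)"
    if "l \<in> carrier M" "f \<in> carrier N" "l' \<in> carrier M" "f' \<in> carrier N" for l f l' f'
    by (rule ahomI) (use that in \<open>simp_all add: ahom_closed[OF h] ahom_add[OF h] G.a_ac G\<close>)
  show ?thesis
  proof (rule balI)
    fix a b assume "a \<in> carrier M" "b \<in> carrier N"
    then show "tlift G (\<lambda>m g. \<Phi> a b m g) Y \<in> carrier G" by (rule ahom_closed[OF h Y])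
  next
    fix a a' b assume *: "a \<in> carrier M" "a' \<in> carrier M" "b \<in> carrier N"
    show "tlift G (\<lambda>m g. \<Phi> (a \<oplus>\<^bsub>M\<^esub> a') b m g) Y =
        tlift G (\<lambda>m g. \<Phi> a b m g) Y \<oplus>\<^bsub>G\<^esub> tlift G (\<lambda>m g. \<Phi> a' b m g) Y"
      by (rule T'.ahom_eqI[OF h hs Y]) (use * 1 2 G in \<open>simp_all add: T'.lift_pure bal_def\<close>)
  next
    fix a b b' assume *: "a \<in> carrier M" "b \<in> carrier N" "b' \<in> carrier N"
    show "tlift G (\<lambda>m g. \<Phi> a (b \<oplus>\<^bsub>N\<^esub> b') m g) Y =
        tlift G (\<lambda>m g. \<Phi> a b m g) Y \<oplus>\<^bsub>G\<^esub> tlift G (\<lambda>m g. \<Phi> a b' m g) Y"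
      by (rule T'.ahom_eqI[OF h hs Y]) (use * 1 2 G in \<open>simp_all add: T'.lift_pure bal_def\<close>)
  next
    fix s a b assume *: "s \<in> S" "a \<in> carrier M" "b \<in> carrier N"
    show "tlift G (\<lambda>m g. \<Phi> (\<alpha> s a) b m g) Y = tlift G (\<lambda>m g. \<Phi> a (\<beta> s b) m g) Y"
      by (rule T'.ahom_eqI[OF h h Y])
        (use * 1 2 G in \<open>simp_all add: T'.lift_pure alpha_closed beta_closed, auto simp: bal_def\<close>)
  qed
qed

lemma (in represented_bialgebra) smash_tens:
  "tens (carrier k) (smult L) (smult H) L H (smash k H R L act)"
  by (rule tens.intro)
    (simp_all add: smash_def smash_algebra_def ktensor_def Let_def tensor_def)

section \<open>The dynamical quotient of the smash product\<close>

sublocale represented_bialgebra \<subseteq> A: tens "carrier k" "smult L" "smult H" L H "smash k H R L act"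
  by (rule smash_tens)

section \<open>The smash product algebra\<close>

context represented_bialgebra
begin

abbreviation A where "A \<equiv> smash k H R L act"

lemma A_struct:
  "carrier (ktensor k L H) = carrier A" "add (ktensor k L H) = add A" "\<zero>\<^bsub>ktensor k L H\<^esub> = \<zero>\<^bsub>A\<^esub>"
  "carrier (smash_algebra k H L act) = carrier A" "add (smash_algebra k H L act) = add A" "\<zero>\<^bsub>smash_algebra k H L act\<^esub> = \<zero>\<^bsub>A\<^esub>"
  "carrier (tensor (carrier k) (smult L) (smult H) L H) = carrier A"
  "add (tensor (carrier k) (smult L) (smult H) L H) = add A"
  "\<zero>\<^bsub>tensor (carrier k) (smult L) (smult H) L H\<^esub> = \<zero>\<^bsub>A\<^esub>"
  by (simp_all add: smash_def smash_algebra_def ktensor_def Let_def tensor_def)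

lemmas A_lift = tlift_struct[OF A_struct(1-3)] tlift_struct[OF A_struct(4-6)] tlift_struct[OF A_struct(7-9)]
  pure_struct[OF A_struct(3)] pure_struct[OF A_struct(6)] pure_struct[OF A_struct(9)]

text \<open>The product (l \<otimes> f)(m \<otimes> g); as a function of four arguments it fits the
  hypotheses of \<open>lift2_bal\<close>.\<close>

definition mu where "mu l f m g = SS A (D f) (\<lambda>x y. (l \<otimes>\<^bsub>L\<^esub> act x m) \<boxtimes>\<^bsub>A\<^esub> (y \<otimes>\<^bsub>H\<^esub> g))"

lemma smult_A [simp]: "r \<in> carrier k \<Longrightarrow> l \<in> carrier L \<Longrightarrow> h \<in> carrier H \<Longrightarrow>
    l \<boxtimes>\<^bsub>A\<^esub> (r \<odot>\<^bsub>H\<^esub> h) = (r \<odot>\<^bsub>L\<^esub> l) \<boxtimes>\<^bsub>A\<^esub> h"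
  by (rule A.pure_bal[symmetric])

lemma mu_bil: "l \<in> carrier L \<Longrightarrow> m \<in> carrier L \<Longrightarrow> g \<in> carrier H \<Longrightarrow>
    bil k H A (\<lambda>x y. (l \<otimes>\<^bsub>L\<^esub> act x m) \<boxtimes>\<^bsub>A\<^esub> (y \<otimes>\<^bsub>H\<^esub> g))"
  by (rule bilI) simp_all

lemma mu_1: "m \<in> carrier L \<Longrightarrow> g \<in> carrier H \<Longrightarrow>
    bal (carrier k) (smult L) (smult H) L H A (\<lambda>l f. mu l f m g)"
  by (rule balI) (simp_all add: mu_def D_add[OF _ mu_bil] D_smult[OF _ mu_bil])

lemma mu_2: "l \<in> carrier L \<Longrightarrow> f \<in> carrier H \<Longrightarrow>
    bal (carrier k) (smult L) (smult H) L H A (\<lambda>m g. mu l f m g)"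
  by (rule balI) (simp_all add: mu_def)

lemma A_mult: "X \<otimes>\<^bsub>A\<^esub> Y = tlift A (\<lambda>l f. tlift A (\<lambda>m g. tlift A (\<lambda>x y.
    (l \<otimes>\<^bsub>L\<^esub> act x m) \<boxtimes>\<^bsub>A\<^esub> (y \<otimes>\<^bsub>H\<^esub> g)) (comult H f)) Y) X"
proof -
  have "X \<otimes>\<^bsub>A\<^esub> Y = tlift (ktensor k L H) (\<lambda>l f. tlift (ktensor k L H) (\<lambda>m g. tlift (ktensor k L H) (\<lambda>x y.
    (l \<otimes>\<^bsub>L\<^esub> act x m) \<boxtimes>\<^bsub>ktensor k L H\<^esub> (y \<otimes>\<^bsub>H\<^esub> g)) (comult H f)) Y) X"
    by (simp add: smash_def smash_algebra_def Let_def)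
  then show ?thesis by (simp only: A_lift)
qed

lemma A_one: "\<one>\<^bsub>A\<^esub> = \<one>\<^bsub>L\<^esub> \<boxtimes>\<^bsub>A\<^esub> \<one>\<^bsub>H\<^esub>"
proof -
  have "\<one>\<^bsub>A\<^esub> = \<one>\<^bsub>L\<^esub> \<boxtimes>\<^bsub>tensor (carrier k) (smult L) (smult H) L H\<^esub> \<one>\<^bsub>H\<^esub>"
    by (simp add: smash_def smash_algebra_def Let_def ktensor_def)
  then show ?thesis by (simp only: A_lift)
qed

lemma A_smult: "r \<odot>\<^bsub>A\<^esub> X = tlift A (\<lambda>a b. (r \<odot>\<^bsub>L\<^esub> a) \<boxtimes>\<^bsub>A\<^esub> b) X"
proof -
  have "r \<odot>\<^bsub>A\<^esub> X = tmap (tensor (carrier k) (smult L) (smult H) L H) (\<lambda>a. r \<odot>\<^bsub>L\<^esub> a) (\<lambda>b. b) X"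
    by (simp add: smash_def smash_algebra_def Let_def ktensor_def)
  then show ?thesis by (simp only: A_lift tmap_def)
qed

lemma A_lift_cong:
  assumes "X \<in> carrier A" "abelian_group G"
    "\<And>l h. l \<in> carrier L \<Longrightarrow> h \<in> carrier H \<Longrightarrow> f l h = g l h"
    "bal (carrier k) (smult L) (smult H) L H G g"
  shows "tlift G f X = tlift G g X"
proof -
  have b: "bal (carrier k) (smult L) (smult H) L H G f" using assms(3,4) by (simp add: bal_def)
  show ?thesis by (rule A.ahom_eqI[OF A.lift_ahom[OF assms(2) b] A.lift_ahom[OF assms(2,4)] assms(1)])
      (use assms in \<open>simp add: A.lift_pure[OF assms(2) b] A.lift_pure[OF assms(2,4)]\<close>)
qed

lemma A_mult_mu:
  assumes "X \<in> carrier A" "Y \<in> carrier A"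
  shows "X \<otimes>\<^bsub>A\<^esub> Y = tlift A (\<lambda>l f. tlift A (\<lambda>m g. mu l f m g) Y) X"
proof -
  show ?thesis unfolding A_mult
  proof (rule A_lift_cong[OF assms(1)])
    show "bal (carrier k) (smult L) (smult H) L H A (\<lambda>l f. tlift A (\<lambda>m g. mu l f m g) Y)"
      by (rule A.lift2_bal[OF smash_tens A.agT mu_1 mu_2 assms(2)])
    fix l f assume l: "l \<in> carrier L" "f \<in> carrier H"
    show "tlift A (\<lambda>m g. tlift A (\<lambda>x y. (l \<otimes>\<^bsub>L\<^esub> act x m) \<boxtimes>\<^bsub>A\<^esub> (y \<otimes>\<^bsub>H\<^esub> g)) (comult H f)) Y = tlift A (\<lambda>m g. mu l f m g) Y"
      by (rule A_lift_cong[OF assms(2)]) (use l mu_2 in \<open>simp_all add: mu_def lift_eq(1)[OF _ mu_bil]\<close>)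
  qed simp
qed

lemma A_mult_pure:
  assumes "l \<in> carrier L" "f \<in> carrier H" "m \<in> carrier L" "g \<in> carrier H"
  shows "(l \<boxtimes>\<^bsub>A\<^esub> f) \<otimes>\<^bsub>A\<^esub> (m \<boxtimes>\<^bsub>A\<^esub> g) = mu l f m g"
  using assms by (simp add: A_mult_mu A.lift_pure[OF _ A.lift2_bal[OF smash_tens A.agT mu_1 mu_2]] A.lift_pure[OF _ mu_2])

lemma A_mult_ahom_l:
  assumes "Y \<in> carrier A"
  shows "ahom A A (\<lambda>X. X \<otimes>\<^bsub>A\<^esub> Y)"
proof -
  note h = A.lift_ahom[OF A.agT A.lift2_bal[OF smash_tens A.agT mu_1 mu_2 assms]]
  show ?thesis
    by (rule ahomI)
      (use assms in \<open>simp_all add: A_mult_mu abelian_groupE(1)[OF A.agT] ahom_closed[OF h] ahom_add[OF h]\<close>)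
qed

lemma A_mult_ahom_r:
  assumes "X \<in> carrier A"
  shows "ahom A A (\<lambda>Y. X \<otimes>\<^bsub>A\<^esub> Y)"
proof (rule ahomI)
  interpret A: abelian_group A by simp
  fix Y Z assume YZ: "Y \<in> carrier A" "Z \<in> carrier A"
  have "ahom A A (\<lambda>X. X \<otimes>\<^bsub>A\<^esub> Y \<oplus>\<^bsub>A\<^esub> X \<otimes>\<^bsub>A\<^esub> Z)"
    by (rule ahomI) (use YZ in \<open>simp_all add: ahom_closed[OF A_mult_ahom_l] ahom_add[OF A_mult_ahom_l] A.a_ac\<close>)
  from A.ahom_eqI[OF A_mult_ahom_l this assms]
  show "X \<otimes>\<^bsub>A\<^esub> (Y \<oplus>\<^bsub>A\<^esub> Z) = X \<otimes>\<^bsub>A\<^esub> Y \<oplus>\<^bsub>A\<^esub> X \<otimes>\<^bsub>A\<^esub> Z"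
    using YZ by (simp add: A_mult_mu A.lift_pure[OF _ A.lift2_bal[OF smash_tens A.agT mu_1 mu_2]] A.lift_add[OF _ mu_2])
qed (use assms ahom_closed[OF A_mult_ahom_l] in auto)

lemma A_smult_bal: "r \<in> carrier k \<Longrightarrow> bal (carrier k) (smult L) (smult H) L H A (\<lambda>a b. (r \<odot>\<^bsub>L\<^esub> a) \<boxtimes>\<^bsub>A\<^esub> b)"
  by (rule balI) (simp_all add: H.m.m_comm flip: L.m.smult_assoc1)

lemma A_smult_ahom: "r \<in> carrier k \<Longrightarrow> ahom A A (\<lambda>X. r \<odot>\<^bsub>A\<^esub> X)"
  unfolding A_smult using A.lift_ahom[OF A.agT A_smult_bal] .

lemma A_smult_pure: "r \<in> carrier k \<Longrightarrow> l \<in> carrier L \<Longrightarrow> h \<in> carrier H \<Longrightarrow>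
    r \<odot>\<^bsub>A\<^esub> (l \<boxtimes>\<^bsub>A\<^esub> h) = (r \<odot>\<^bsub>L\<^esub> l) \<boxtimes>\<^bsub>A\<^esub> h"
  unfolding A_smult using A.lift_pure[OF A.agT A_smult_bal] .

lemma mu_one: "l \<in> carrier L \<Longrightarrow> m \<in> carrier L \<Longrightarrow> g \<in> carrier H \<Longrightarrow>
    mu l \<one>\<^bsub>H\<^esub> m g = (l \<otimes>\<^bsub>L\<^esub> m) \<boxtimes>\<^bsub>A\<^esub> g"
  by (simp only: mu_def D_one[OF A.agT mu_bil]) simp

text \<open>Coassociativity matches the two ways of distributing \<open>f\<close>, and the module
  algebra axiom splits its action on a product in L.\<close>

lemma A_assoc_pure:
  assumes "l \<in> carrier L" "f \<in> carrier H" "m \<in> carrier L" "g \<in> carrier H" "n \<in> carrier L" "h \<in> carrier H"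
  shows "((l \<boxtimes>\<^bsub>A\<^esub> f) \<otimes>\<^bsub>A\<^esub> (m \<boxtimes>\<^bsub>A\<^esub> g)) \<otimes>\<^bsub>A\<^esub> (n \<boxtimes>\<^bsub>A\<^esub> h) =
    (l \<boxtimes>\<^bsub>A\<^esub> f) \<otimes>\<^bsub>A\<^esub> ((m \<boxtimes>\<^bsub>A\<^esub> g) \<otimes>\<^bsub>A\<^esub> (n \<boxtimes>\<^bsub>A\<^esub> h))"
proof -
  have "((l \<boxtimes>\<^bsub>A\<^esub> f) \<otimes>\<^bsub>A\<^esub> (m \<boxtimes>\<^bsub>A\<^esub> g)) \<otimes>\<^bsub>A\<^esub> (n \<boxtimes>\<^bsub>A\<^esub> h) =
      SS A (D f) (\<lambda>x y. SS A (D y) (\<lambda>p q. SS A (D g) (\<lambda>u v.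
        (l \<otimes>\<^bsub>L\<^esub> (act x m \<otimes>\<^bsub>L\<^esub> act p (act u n))) \<boxtimes>\<^bsub>A\<^esub> (q \<otimes>\<^bsub>H\<^esub> (v \<otimes>\<^bsub>H\<^esub> h)))))"
  proof -
    have b: "bil k H A (\<lambda>p q. (l \<otimes>\<^bsub>L\<^esub> (m' \<otimes>\<^bsub>L\<^esub> act p n)) \<boxtimes>\<^bsub>A\<^esub> (q \<otimes>\<^bsub>H\<^esub> h))" if "m' \<in> carrier L" for m'
      by (rule bilI) (use that assms in simp_all)
    show ?thesis
      using assms by (simp add: A_mult_pure mu_def Sm_hom[OF A_mult_ahom_l] D_mult[OF _ b])
  qed
  also have "\<dots> = SS A (D f) (\<lambda>x y. SS A (D x) (\<lambda>p q. SS A (D g) (\<lambda>u v.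
        (l \<otimes>\<^bsub>L\<^esub> (act p m \<otimes>\<^bsub>L\<^esub> act q (act u n))) \<boxtimes>\<^bsub>A\<^esub> (y \<otimes>\<^bsub>H\<^esub> (v \<otimes>\<^bsub>H\<^esub> h)))))"
    by (rule coassoc[symmetric], simp, rule triI) (use assms in simp_all)
  also have "\<dots> = SS A (D f) (\<lambda>x y. SS A (D g) (\<lambda>u v. SS A (D x) (\<lambda>p q.
        (l \<otimes>\<^bsub>L\<^esub> (act p m \<otimes>\<^bsub>L\<^esub> act q (act u n))) \<boxtimes>\<^bsub>A\<^esub> (y \<otimes>\<^bsub>H\<^esub> (v \<otimes>\<^bsub>H\<^esub> h)))))"
    by (rule Sm_cong', rule Sm_swap) (use assms in simp_all)
  also have "\<dots> = SS A (D g) (\<lambda>u v. SS A (D f) (\<lambda>x y. SS A (D x) (\<lambda>p q.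
        (l \<otimes>\<^bsub>L\<^esub> (act p m \<otimes>\<^bsub>L\<^esub> act q (act u n))) \<boxtimes>\<^bsub>A\<^esub> (y \<otimes>\<^bsub>H\<^esub> (v \<otimes>\<^bsub>H\<^esub> h)))))"
    by (rule Sm_swap) (use assms in simp_all)
  also have "\<dots> = (l \<boxtimes>\<^bsub>A\<^esub> f) \<otimes>\<^bsub>A\<^esub> ((m \<boxtimes>\<^bsub>A\<^esub> g) \<otimes>\<^bsub>A\<^esub> (n \<boxtimes>\<^bsub>A\<^esub> h))"
    using assms by (simp add: A_mult_pure mu_def Sm_hom[OF A_mult_ahom_r] act_prod)
  finally show ?thesis .
qed

lemma A_alg: "k_algebra k A"
proof -
  interpret A': abelian_group A by simp
  note mc [simp] = ahom_closed[OF A_mult_ahom_l] and sc [simp] = ahom_closed[OF A_smult_ahom]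
  note ml = ahom_add[OF A_mult_ahom_l] and mr = ahom_add[OF A_mult_ahom_r] and sa = ahom_add[OF A_smult_ahom]
  have assoc: "(X \<otimes>\<^bsub>A\<^esub> Y) \<otimes>\<^bsub>A\<^esub> Z = X \<otimes>\<^bsub>A\<^esub> (Y \<otimes>\<^bsub>A\<^esub> Z)"
    if X: "X \<in> carrier A" and Y: "Y \<in> carrier A" and Z: "Z \<in> carrier A" for X Y Z
    using X
  proof (induction X rule: A.induct)
    case (pure l f)
    show ?case using Y
    proof (induction Y rule: A.induct)
      case (pure m g)
      show ?case using Z
        by (induction Z rule: A.induct) (use pure \<open>l \<in> carrier L\<close> \<open>f \<in> carrier H\<close> in \<open>simp_all add: A_assoc_pure mr\<close>)
    qed (use pure Z in \<open>simp_all add: ml mr\<close>)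
  qed (use Y Z in \<open>simp_all add: ml\<close>)
  have one: "\<one>\<^bsub>A\<^esub> \<otimes>\<^bsub>A\<^esub> X = X" "X \<otimes>\<^bsub>A\<^esub> \<one>\<^bsub>A\<^esub> = X" if "X \<in> carrier A" for X
  proof -
    show "\<one>\<^bsub>A\<^esub> \<otimes>\<^bsub>A\<^esub> X = X" using that
    proof (induction X rule: A.induct)
      case (pure l f)
      then show ?case by (simp add: A_one A_mult_pure mu_one)
    qed (simp_all add: A_one mr)
    show "X \<otimes>\<^bsub>A\<^esub> \<one>\<^bsub>A\<^esub> = X" using that
    proof (induction X rule: A.induct)
      case (pure l f)
      have "(l \<boxtimes>\<^bsub>A\<^esub> f) \<otimes>\<^bsub>A\<^esub> \<one>\<^bsub>A\<^esub> = l \<boxtimes>\<^bsub>A\<^esub> SS H (D f) (\<lambda>x y. \<epsilon> x \<odot>\<^bsub>H\<^esub> y)"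
        using pure by (simp add: A_one A_mult_pure mu_def)
      then show ?case using pure by (simp only: counit_l)
    qed (simp_all add: A_one ml)
  qed
  have one_in: "\<one>\<^bsub>A\<^esub> \<in> carrier A" by (simp add: A_one)
  have ring: "ring A"
    by (rule ringI, rule A.agT, rule monoidI) (simp_all add: one one_in assoc ml mr)
  have sm1: "(r \<odot>\<^bsub>A\<^esub> X) \<otimes>\<^bsub>A\<^esub> Y = r \<odot>\<^bsub>A\<^esub> (X \<otimes>\<^bsub>A\<^esub> Y) \<and> X \<otimes>\<^bsub>A\<^esub> (r \<odot>\<^bsub>A\<^esub> Y) = r \<odot>\<^bsub>A\<^esub> (X \<otimes>\<^bsub>A\<^esub> Y)"
    if r: "r \<in> carrier k" and X: "X \<in> carrier A" and Y: "Y \<in> carrier A" for r X Y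
    using X
  proof (induction X rule: A.induct)
    case (pure l f)
    show ?case using Y
    proof (induction Y rule: A.induct)
      case (pure m g)
      then show ?case using r \<open>l \<in> carrier L\<close> \<open>f \<in> carrier H\<close>
        by (simp add: A_mult_pure A_smult_pure mu_def Sm_hom[OF A_smult_ahom])
    qed (use pure r in \<open>simp_all add: ml mr sa\<close>)
  qed (use Y r in \<open>simp_all add: ml sa\<close>)
  have "module k A"
  proof (rule moduleI)
    show "cring k" by (rule H.m.R.is_cring)
    fix a b X assume ab: "a \<in> carrier k" "b \<in> carrier k" and X: "X \<in> carrier A"
    show "(a \<oplus>\<^bsub>k\<^esub> b) \<odot>\<^bsub>A\<^esub> X = a \<odot>\<^bsub>A\<^esub> X \<oplus>\<^bsub>A\<^esub> b \<odot>\<^bsub>A\<^esub> X" using X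
      by (induction X rule: A.induct) (use ab in \<open>simp_all add: A_smult_pure L.m.smult_l_distr sa A'.a_ac\<close>)
    show "(a \<otimes>\<^bsub>k\<^esub> b) \<odot>\<^bsub>A\<^esub> X = a \<odot>\<^bsub>A\<^esub> (b \<odot>\<^bsub>A\<^esub> X)" using X
      by (induction X rule: A.induct) (use ab in \<open>simp_all add: A_smult_pure L.m.smult_assoc1 sa\<close>)
  next
    fix X assume X: "X \<in> carrier A"
    show "\<one>\<^bsub>k\<^esub> \<odot>\<^bsub>A\<^esub> X = X" using X
      by (induction X rule: A.induct) (simp_all add: A_smult_pure sa)
  qed (simp_all add: sa)
  then show ?thesis using ring sm1 by (simp add: k_algebra_def)
qed

definition sA where "sA l = l \<boxtimes>\<^bsub>A\<^esub> \<one>\<^bsub>H\<^esub>"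
definition iA where "iA h = \<one>\<^bsub>L\<^esub> \<boxtimes>\<^bsub>A\<^esub> h"

lemma sA_iA: "l \<in> carrier L \<Longrightarrow> h \<in> carrier H \<Longrightarrow> sA l \<otimes>\<^bsub>A\<^esub> iA h = l \<boxtimes>\<^bsub>A\<^esub> h"
  by (simp add: sA_def iA_def A_mult_pure mu_one)

text \<open>The tautological representation, through which all identities proved for
  \<open>smash_rep\<close> hold in the smash product itself.\<close>

lemma smash_rep_A: "smash_rep k H R L act D rs rb A sA iA"
proof (intro smash_rep.intro smash_rep_axioms.intro represented_bialgebra_axioms A_alg)
  show "sA \<in> alg_hom k L A"
    by (rule alg_homI) (simp_all add: sA_def A_mult_pure mu_one A_one A_smult_pure)
  show "iA \<in> alg_hom k H A"
  proof (rule alg_homI)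
    fix g h assume gh: "g \<in> carrier H" "h \<in> carrier H"
    have "iA g \<otimes>\<^bsub>A\<^esub> iA h = \<one>\<^bsub>L\<^esub> \<boxtimes>\<^bsub>A\<^esub> (SS H (D g) (\<lambda>x y. \<epsilon> x \<odot>\<^bsub>H\<^esub> y) \<otimes>\<^bsub>H\<^esub> h)"
      using gh by (simp add: iA_def A_mult_pure mu_def)
    then show "iA (g \<otimes>\<^bsub>H\<^esub> h) = iA g \<otimes>\<^bsub>A\<^esub> iA h" using gh by (simp only: counit_l iA_def)
  qed (simp_all add: iA_def A_one A_smult_pure)
  fix h l assume hl: "h \<in> carrier H" "l \<in> carrier L"
  then show "iA h \<otimes>\<^bsub>A\<^esub> sA l = SS A (D h) (\<lambda>x y. sA (act x l) \<otimes>\<^bsub>A\<^esub> iA y)"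
    by (simp add: sA_iA) (simp add: iA_def sA_def A_mult_pure mu_def)
qed

end

lemma the_elem_const:
  assumes "x \<in> X" "\<And>y. y \<in> X \<Longrightarrow> g y = g x"
  shows "the_elem (g ` X) = g x"
proof -
  have "g ` X = (\<lambda>_. g x) ` X" by (rule image_cong[OF refl assms(2)])
  then show ?thesis using assms(1) by (auto simp: image_constant_conv)
qed

lemma btensor_struct:
  assumes "carrier C = carrier C'" "mult C = mult C'" "add C = add C'" "s = s'" "t = t'"
  shows "btensor L s t C = btensor L s' t' C'"
  using assms by (simp add: btensor_def tensor_def tensor_relations_def Let_def)

context smash_rep
begin

definition lift where "lift = tlift C (\<lambda>l h. s l \<otimes>\<^bsub>C\<^esub> i h)"

lemma lift_bal: "bal (carrier k) (smult L) (smult H) L H C (\<lambda>l h. s l \<otimes>\<^bsub>C\<^esub> i h)"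
  by (rule balI) simp_all

lemma lift_ahom: "ahom A C lift"
  unfolding lift_def using A.lift_ahom[OF C.ag lift_bal] .

lemma lift_pure [simp]: "l \<in> carrier L \<Longrightarrow> h \<in> carrier H \<Longrightarrow> lift (l \<boxtimes>\<^bsub>A\<^esub> h) = s l \<otimes>\<^bsub>C\<^esub> i h"
  unfolding lift_def using A.lift_pure[OF C.ag lift_bal] .

lemma lift_alg_hom: "lift \<in> alg_hom k A C"
proof (rule alg_homI)
  note cl = ahom_closed[OF lift_ahom] and ad = ahom_add[OF lift_ahom]
  note mc = ahom_closed[OF A_mult_ahom_l]
  fix X Y assume X: "X \<in> carrier A" and Y: "Y \<in> carrier A"
  show "lift (X \<otimes>\<^bsub>A\<^esub> Y) = lift X \<otimes>\<^bsub>C\<^esub> lift Y" using X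
  proof (induction X rule: A.induct)
    case (pure l f)
    show ?case using Y
    proof (induction Y rule: A.induct)
      case (pure m g)
      then show ?case using \<open>l \<in> carrier L\<close> \<open>f \<in> carrier H\<close>
        by (simp add: A_mult_pure mu_def Sm_hom[OF lift_ahom] smash_comm')
    qed (use pure in \<open>simp_all add: ahom_add[OF A_mult_ahom_r] mc cl ad\<close>)
  qed (use Y in \<open>simp_all add: ahom_add[OF A_mult_ahom_l] mc cl ad\<close>)
next
  fix r X assume r: "r \<in> carrier k" and X: "X \<in> carrier A"
  show "lift (r \<odot>\<^bsub>A\<^esub> X) = r \<odot>\<^bsub>C\<^esub> lift X" using X
    by (induction X rule: A.induct)
      (use r in \<open>simp_all add: A_smult_pure ahom_add[OF A_smult_ahom] ahom_closed[OF A_smult_ahom] ahom_closed[OF lift_ahom] ahom_add[OF lift_ahom]\<close>)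
qed (simp_all add: ahom_closed[OF lift_ahom] ahom_add[OF lift_ahom] A_one)

end

section \<open>Target, coproduct, counit and phi on the smash product\<close>

context represented_bialgebra
begin

interpretation AA: smash_rep k H R L act D rs rb A sA iA by (rule smash_rep_A)

definition tA where "tA l = SS A rs (\<lambda>a b. sA (act b l) \<otimes>\<^bsub>A\<^esub> iA a)"
text \<open>The map t^-. On the smash product it is treated separately from t^+; the two are
  identified in the quotient.\<close>

definition tmA where "tmA l = SS A rb (\<lambda>c d. sA (act c l) \<otimes>\<^bsub>A\<^esub> iA d)"

lemma tA_AA: "tA = AA.tp"
  by (rule ext) (simp add: tA_def AA.tp_def)

lemma A_src: "src A l = sA l"
proof -
  have "src A l = l \<boxtimes>\<^bsub>smash_algebra k H L act\<^esub> \<one>\<^bsub>H\<^esub>" by (simp add: smash_def Let_def)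
  then show ?thesis by (simp only: A_lift sA_def)
qed

lemma A_tgt:
  assumes "l \<in> carrier L"
  shows "tgt A l = tA l"
proof -
  have b: "bil k H A (\<lambda>a b. act b l \<boxtimes>\<^bsub>A\<^esub> a)" by (rule bilI) (use assms in simp_all)
  have "tgt A l = tlift (smash_algebra k H L act) (\<lambda>a b. act b l \<boxtimes>\<^bsub>smash_algebra k H L act\<^esub> a) R"
    by (simp add: smash_def Let_def)
  also have "\<dots> = tlift A (\<lambda>a b. act b l \<boxtimes>\<^bsub>A\<^esub> a) R" by (simp only: A_lift)
  also have "\<dots> = tA l"
    using assms by (simp add: lift_eq(2)[OF _ b] tA_def sA_iA)
  finally show ?thesis .
qed

lemma A_bt: "base_tensor k A L (src A) (tgt A)"
  by unfold_locales (simp_all add: A_alg A_src A_tgt tA_AA AA.tp_s)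

abbreviation AT where "AT \<equiv> btensor L (src A) (tgt A) A"

interpretation AT: base_tensor k A L "src A" "tgt A" by (rule A_bt)

lemma AT_smult:
  assumes "r \<in> carrier k" "a \<in> carrier A" "b \<in> carrier A"
  shows "a \<boxtimes>\<^bsub>AT\<^esub> (r \<odot>\<^bsub>A\<^esub> b) = (r \<odot>\<^bsub>A\<^esub> a) \<boxtimes>\<^bsub>AT\<^esub> b"
  using AT.pure_t[of "r \<odot>\<^bsub>L\<^esub> \<one>\<^bsub>L\<^esub>" a b] assms by (simp add: A_src A_tgt tA_AA AA.tp_one)

definition cA where "cA l h = SS AT (D h) (\<lambda>x y. (l \<boxtimes>\<^bsub>A\<^esub> x) \<boxtimes>\<^bsub>AT\<^esub> (\<one>\<^bsub>L\<^esub> \<boxtimes>\<^bsub>A\<^esub> y))"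

lemma A_smult_pure_r: "r \<in> carrier k \<Longrightarrow> l \<in> carrier L \<Longrightarrow> h \<in> carrier H \<Longrightarrow>
    (r \<odot>\<^bsub>L\<^esub> l) \<boxtimes>\<^bsub>A\<^esub> h = r \<odot>\<^bsub>A\<^esub> (l \<boxtimes>\<^bsub>A\<^esub> h)"
  by (simp add: A_smult_pure)

lemma cA_bil: "l \<in> carrier L \<Longrightarrow> bil k H AT (\<lambda>x y. (l \<boxtimes>\<^bsub>A\<^esub> x) \<boxtimes>\<^bsub>AT\<^esub> (\<one>\<^bsub>L\<^esub> \<boxtimes>\<^bsub>A\<^esub> y))"
  by (rule bilI) (simp_all add: A_smult_pure_r AT_smult)

lemma cA_bal: "bal (carrier k) (smult L) (smult H) L H AT cA"
  by (rule balI) (simp_all add: cA_def D_add[OF _ cA_bil] D_smult[OF _ cA_bil])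

lemma A_cop: "cop A X = tlift AT (\<lambda>l h. tlift AT (\<lambda>x y. (l \<boxtimes>\<^bsub>A\<^esub> x) \<boxtimes>\<^bsub>AT\<^esub> (\<one>\<^bsub>L\<^esub> \<boxtimes>\<^bsub>A\<^esub> y)) (comult H h)) X"
proof -
  let ?B = "smash_algebra k H L act"
  let ?s = "\<lambda>l. l \<boxtimes>\<^bsub>?B\<^esub> \<one>\<^bsub>H\<^esub>" and ?t = "\<lambda>l. tlift ?B (\<lambda>r1 r2. act r2 l \<boxtimes>\<^bsub>?B\<^esub> r1) R"
  let ?T = "btensor L ?s ?t ?B"
  have T: "AT = ?T"
    by (rule btensor_struct) (simp_all add: smash_def Let_def)
  have "cop A X = tlift ?T (\<lambda>l h. tlift ?T (\<lambda>x y. (l \<boxtimes>\<^bsub>?B\<^esub> x) \<boxtimes>\<^bsub>?T\<^esub> (\<one>\<^bsub>L\<^esub> \<boxtimes>\<^bsub>?B\<^esub> y)) (comult H h)) X"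
    by (simp add: smash_def Let_def)
  then show ?thesis unfolding T[symmetric] by (simp only: A_lift)
qed

lemma A_cop_eq: "X \<in> carrier A \<Longrightarrow> cop A X = tlift AT cA X"
  unfolding A_cop
  by (rule A_lift_cong[OF _ AT.t2.agT _ cA_bal]) (simp_all add: cA_def lift_eq(1)[OF _ cA_bil])

lemma A_cop_ahom: "ahom A AT (cop A)"
proof -
  note h = A.lift_ahom[OF AT.t2.agT cA_bal]
  show ?thesis
    by (rule ahomI) (simp_all add: A_cop_eq abelian_groupE(1)[OF A.agT] ahom_closed[OF h] ahom_add[OF h])
qed

lemma A_cop_pure: "l \<in> carrier L \<Longrightarrow> h \<in> carrier H \<Longrightarrow> cop A (l \<boxtimes>\<^bsub>A\<^esub> h) = cA l h"
  by (simp add: A_cop_eq A.lift_pure[OF AT.t2.agT cA_bal])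

lemma eps_bal: "bal (carrier k) (smult L) (smult H) L H L (\<lambda>l h. counit H h \<odot>\<^bsub>L\<^esub> l)"
  by (rule balI) (simp_all add: L.m.smult_l_distr H.m.m_comm flip: L.m.smult_assoc1)

lemma A_cou: "cou A = tlift L (\<lambda>l h. counit H h \<odot>\<^bsub>L\<^esub> l)"
  by (simp add: smash_def Let_def)

lemma A_cou_ahom: "ahom A L (cou A)"
  unfolding A_cou by (rule A.lift_ahom[OF L.ag eps_bal])

lemma A_cou_pure: "l \<in> carrier L \<Longrightarrow> h \<in> carrier H \<Longrightarrow> cou A (l \<boxtimes>\<^bsub>A\<^esub> h) = counit H h \<odot>\<^bsub>L\<^esub> l"
  unfolding A_cou by (rule A.lift_pure[OF L.ag eps_bal])

definition ph where "ph l h = SS A rs (\<lambda>a b. SS A rs (\<lambda>c d. act (b \<otimes>\<^bsub>H\<^esub> c) l \<boxtimes>\<^bsub>A\<^esub> (a \<otimes>\<^bsub>H\<^esub> (d \<otimes>\<^bsub>H\<^esub> h))))"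

lemma ph_bal: "bal (carrier k) (smult L) (smult H) L H A ph"
  by (rule balI) (simp_all add: ph_def)

lemma phi_eq:
  assumes "X \<in> carrier A"
  shows "phi k H R L act X = tlift A ph X"
proof -
  have "tlift A (\<lambda>a b. tlift A (\<lambda>c d. act (b \<otimes>\<^bsub>H\<^esub> c) l \<boxtimes>\<^bsub>A\<^esub> (a \<otimes>\<^bsub>H\<^esub> d \<otimes>\<^bsub>H\<^esub> h)) R) R = ph l h"
    if "l \<in> carrier L" "h \<in> carrier H" for l h
  proof -
    let ?f = "\<lambda>a b c d. act (b \<otimes>\<^bsub>H\<^esub> c) l \<boxtimes>\<^bsub>A\<^esub> (a \<otimes>\<^bsub>H\<^esub> d \<otimes>\<^bsub>H\<^esub> h)"
    have b1: "bil k H A (?f a b)" if "a \<in> carrier H" "b \<in> carrier H" for a b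
      by (rule bilI) (use that \<open>l \<in> carrier L\<close> \<open>h \<in> carrier H\<close> in simp_all)
    have b2: "bil k H A (\<lambda>a b. tlift A (?f a b) R)"
      by (rule bilI) (use \<open>l \<in> carrier L\<close> \<open>h \<in> carrier H\<close> in \<open>simp_all add: lift_eq(2)[OF _ b1]\<close>)
    show ?thesis unfolding lift_eq(2)[OF A.agT b2]
      using that by (simp add: lift_eq(2)[OF _ b1] ph_def)
  qed
  then show ?thesis unfolding phi_def Let_def
    by (intro A_lift_cong[OF assms A.agT _ ph_bal])
qed

lemma phi_ahom: "ahom A A (phi k H R L act)"
proof -
  note h = A.lift_ahom[OF A.agT ph_bal]
  show ?thesis
    by (rule ahomI) (simp_all add: phi_eq abelian_groupE(1)[OF A.agT] ahom_closed[OF h] ahom_add[OF h])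
qed

lemma phi_pure: "l \<in> carrier L \<Longrightarrow> h \<in> carrier H \<Longrightarrow> phi k H R L act (l \<boxtimes>\<^bsub>A\<^esub> h) = ph l h"
  by (simp add: phi_eq A.lift_pure[OF A.agT ph_bal])

section \<open>The ideal J in terms of t^+ - t^-\<close>

lemma tmA_simps [simp]:
  "l \<in> carrier L \<Longrightarrow> tmA l \<in> carrier A"
  "l \<in> carrier L \<Longrightarrow> m \<in> carrier L \<Longrightarrow> tmA (l \<oplus>\<^bsub>L\<^esub> m) = tmA l \<oplus>\<^bsub>A\<^esub> tmA m"
  "r \<in> carrier k \<Longrightarrow> l \<in> carrier L \<Longrightarrow> tmA (r \<odot>\<^bsub>L\<^esub> l) = r \<odot>\<^bsub>A\<^esub> tmA l"
  by (simp_all add: tmA_def AA.C.smult_Sm)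

lemma tA_simps [simp]:
  "l \<in> carrier L \<Longrightarrow> tA l \<in> carrier A"
  "l \<in> carrier L \<Longrightarrow> m \<in> carrier L \<Longrightarrow> tA (l \<oplus>\<^bsub>L\<^esub> m) = tA l \<oplus>\<^bsub>A\<^esub> tA m"
  "r \<in> carrier k \<Longrightarrow> l \<in> carrier L \<Longrightarrow> tA (r \<odot>\<^bsub>L\<^esub> l) = r \<odot>\<^bsub>A\<^esub> tA l"
  by (simp_all add: tA_AA)

lemma tA_s: "l \<in> carrier L \<Longrightarrow> m \<in> carrier L \<Longrightarrow> tA l \<otimes>\<^bsub>A\<^esub> sA m = sA m \<otimes>\<^bsub>A\<^esub> tA l"
  by (simp add: tA_AA AA.tp_s)

text \<open>t^- is t^+ for R^-1_21, so both claims are instances of facts on t^+. The second one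
  recovers the source from t^- by means of R.\<close>

lemma tmA_s:
  assumes "l \<in> carrier L" "m \<in> carrier L"
  shows "tmA l \<otimes>\<^bsub>A\<^esub> sA m = sA m \<otimes>\<^bsub>A\<^esub> tmA l"
    and sA_tmA: "sA l = SS A rs (\<lambda>a b. tmA (act a l) \<otimes>\<^bsub>A\<^esub> iA b)"
proof -
  interpret m: smash_rep k H "Sm (carrier H) (kt2 k H) (map prod.swap rb) (\<lambda>a b. a \<boxtimes>\<^bsub>kt2 k H\<^esub> b)" L act D
     "map prod.swap rb" "map prod.swap rs" A sA iA by (rule AA.smash_rep_minus)
  have "tmA = m.tp" by (rule ext) (simp add: tmA_def m.tp_def)
  then show "tmA l \<otimes>\<^bsub>A\<^esub> sA m = sA m \<otimes>\<^bsub>A\<^esub> tmA l" "sA l = SS A rs (\<lambda>a b. tmA (act a l) \<otimes>\<^bsub>A\<^esub> iA b)"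
    using m.tp_s[OF assms] m.s_tp[OF assms(1)] by simp_all
qed

text \<open>The elements \<open>dd l h\<close> and the elements phi(x) - x are sums of each other
  (\<open>phi_minus\<close>, \<open>dd_phi\<close>), so they generate the same left ideal. In
  contrast to phi(x) - x they are easy to move past the source.\<close>

definition dd where "dd l h = (tA l \<ominus>\<^bsub>A\<^esub> tmA l) \<otimes>\<^bsub>A\<^esub> iA h"

lemma dd_alt: "l \<in> carrier L \<Longrightarrow> h \<in> carrier H \<Longrightarrow> dd l h = tA l \<otimes>\<^bsub>A\<^esub> iA h \<ominus>\<^bsub>A\<^esub> tmA l \<otimes>\<^bsub>A\<^esub> iA h"
  by (simp add: dd_def a_minus_def AA.C.l_minus)

text \<open>One of the two copies of R in phi assembles t^+; the other remains as an outer
  sum.\<close>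

lemma ph_tA: "l \<in> carrier L \<Longrightarrow> h \<in> carrier H \<Longrightarrow> ph l h = SS A rs (\<lambda>c d. tA (act c l) \<otimes>\<^bsub>A\<^esub> iA (d \<otimes>\<^bsub>H\<^esub> h))"
  unfolding ph_def
  by (subst Sm_swap) (simp_all add: tA_def flip: sA_iA)

text \<open>\<open>sA_tmA\<close> writes l \<otimes> h as the sum \<open>ph_tA\<close> with t^- in
  place of t^+, so subtraction takes place inside the sum.\<close>

lemma phi_minus:
  assumes "l \<in> carrier L" "h \<in> carrier H"
  shows "phi k H R L act (l \<boxtimes>\<^bsub>A\<^esub> h) \<ominus>\<^bsub>A\<^esub> (l \<boxtimes>\<^bsub>A\<^esub> h) = SS A rs (\<lambda>c d. dd (act c l) (d \<otimes>\<^bsub>H\<^esub> h))"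
proof -
  have "l \<boxtimes>\<^bsub>A\<^esub> h = sA l \<otimes>\<^bsub>A\<^esub> iA h" using assms by (simp add: sA_iA)
  also have "\<dots> = SS A rs (\<lambda>c d. tmA (act c l) \<otimes>\<^bsub>A\<^esub> iA (d \<otimes>\<^bsub>H\<^esub> h))"
    using assms by (simp add: sA_tmA)
  finally have eq: "l \<boxtimes>\<^bsub>A\<^esub> h = SS A rs (\<lambda>c d. tmA (act c l) \<otimes>\<^bsub>A\<^esub> iA (d \<otimes>\<^bsub>H\<^esub> h))" .
  have "phi k H R L act (l \<boxtimes>\<^bsub>A\<^esub> h) \<ominus>\<^bsub>A\<^esub> (l \<boxtimes>\<^bsub>A\<^esub> h) =
      SS A rs (\<lambda>c d. tA (act c l) \<otimes>\<^bsub>A\<^esub> iA (d \<otimes>\<^bsub>H\<^esub> h)) \<ominus>\<^bsub>A\<^esub> SS A rs (\<lambda>c d. tmA (act c l) \<otimes>\<^bsub>A\<^esub> iA (d \<otimes>\<^bsub>H\<^esub> h))"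
    by (subst phi_pure[OF assms], subst ph_tA[OF assms], subst eq) (rule refl)
  then show ?thesis using assms by (simp add: Sm_minus[symmetric] dd_alt)
qed

text \<open>Inverts \<open>phi_minus\<close> by cancelling R against R^-1.\<close>

lemma dd_phi:
  assumes "l \<in> carrier L" "h \<in> carrier H"
  shows "dd l h = SS A rb (\<lambda>c d. phi k H R L act (act c l \<boxtimes>\<^bsub>A\<^esub> (d \<otimes>\<^bsub>H\<^esub> h)) \<ominus>\<^bsub>A\<^esub> (act c l \<boxtimes>\<^bsub>A\<^esub> (d \<otimes>\<^bsub>H\<^esub> h)))"
proof -
  have b: "bil k H A (\<lambda>u v. tA (act u l) \<otimes>\<^bsub>A\<^esub> iA (v \<otimes>\<^bsub>H\<^esub> h))" by (rule bilI) (use assms in simp_all)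
  have "SS A rb (\<lambda>c d. phi k H R L act (act c l \<boxtimes>\<^bsub>A\<^esub> (d \<otimes>\<^bsub>H\<^esub> h))) =
      SS A rb (\<lambda>c d. SS A rs (\<lambda>a b. tA (act (a \<otimes>\<^bsub>H\<^esub> c) l) \<otimes>\<^bsub>A\<^esub> iA ((b \<otimes>\<^bsub>H\<^esub> d) \<otimes>\<^bsub>H\<^esub> h)))"
    using assms by (simp add: phi_pure ph_tA)
  also have "\<dots> = SS A rs (\<lambda>a b. SS A rb (\<lambda>c d. tA (act (a \<otimes>\<^bsub>H\<^esub> c) l) \<otimes>\<^bsub>A\<^esub> iA ((b \<otimes>\<^bsub>H\<^esub> d) \<otimes>\<^bsub>H\<^esub> h)))"
    by (rule Sm_swap) (use assms in simp_all)
  also have "\<dots> = tA l \<otimes>\<^bsub>A\<^esub> iA h" using Rinv1[OF _ b] assms by simp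
  finally have 1: "SS A rb (\<lambda>c d. phi k H R L act (act c l \<boxtimes>\<^bsub>A\<^esub> (d \<otimes>\<^bsub>H\<^esub> h))) = tA l \<otimes>\<^bsub>A\<^esub> iA h" .
  have 2: "SS A rb (\<lambda>c d. act c l \<boxtimes>\<^bsub>A\<^esub> (d \<otimes>\<^bsub>H\<^esub> h)) = tmA l \<otimes>\<^bsub>A\<^esub> iA h"
    using assms by (simp add: tmA_def flip: sA_iA)
  show ?thesis using assms by (simp add: Sm_minus ahom_closed[OF phi_ahom] 1 2 dd_alt)
qed

abbreviation J where "J \<equiv> J_phi k H R L act"

lemma J_least: "left_ideal I A \<Longrightarrow> (\<And>x. x \<in> carrier A \<Longrightarrow> phi k H R L act x \<ominus>\<^bsub>A\<^esub> x \<in> I) \<Longrightarrow> J \<subseteq> I"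
  by (auto simp: J_phi_def Let_def)

lemma J_phi_mem: "x \<in> carrier A \<Longrightarrow> phi k H R L act x \<ominus>\<^bsub>A\<^esub> x \<in> J"
  by (auto simp: J_phi_def Let_def)

lemma left_idealI:
  assumes "I \<subseteq> carrier A" "\<zero>\<^bsub>A\<^esub> \<in> I" "\<And>x y. x \<in> I \<Longrightarrow> y \<in> I \<Longrightarrow> x \<oplus>\<^bsub>A\<^esub> y \<in> I"
    "\<And>a x. a \<in> carrier A \<Longrightarrow> x \<in> I \<Longrightarrow> a \<otimes>\<^bsub>A\<^esub> x \<in> I"
  shows "left_ideal I A"
proof -
  \<comment> \<open>In a unital ring closure under negation follows from left multiplication by
    -1.\<close>
  have "\<ominus>\<^bsub>A\<^esub> x \<in> I" if "x \<in> I" for x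
    using assms(4)[of "\<ominus>\<^bsub>A\<^esub> \<one>\<^bsub>A\<^esub>" x] that assms(1) by (simp add: AA.C.l_minus subset_iff)
  then have "additive_subgroup I A"
    using assms by (intro additive_subgroup.intro subgroup.intro) (auto simp flip: a_inv_def)
  then show ?thesis using assms(4) by (simp add: left_ideal_def)
qed

lemma J_left_ideal: "left_ideal J A"
proof (rule left_idealI)
  have c: "left_ideal (carrier A) A"
    by (rule left_idealI) simp_all
  then show "J \<subseteq> carrier A"
    by (rule J_least) (simp add: ahom_closed[OF phi_ahom])
  have I: "left_ideal I A \<Longrightarrow> additive_subgroup I A \<and> (\<forall>a\<in>carrier A. \<forall>x\<in>I. a \<otimes>\<^bsub>A\<^esub> x \<in> I)" for I
    by (simp add: left_ideal_def)
  show "\<zero>\<^bsub>A\<^esub> \<in> J" using I by (auto simp: J_phi_def Let_def intro: additive_subgroup.zero_closed)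
  show "\<And>x y. x \<in> J \<Longrightarrow> y \<in> J \<Longrightarrow> x \<oplus>\<^bsub>A\<^esub> y \<in> J"
    using I by (auto simp: J_phi_def Let_def intro: additive_subgroup.a_closed)
  show "\<And>a x. a \<in> carrier A \<Longrightarrow> x \<in> J \<Longrightarrow> a \<otimes>\<^bsub>A\<^esub> x \<in> J"
    using I by (auto simp: J_phi_def Let_def)
qed

lemma J_add: "additive_subgroup J A"
  using J_left_ideal by (simp add: left_ideal_def)

lemma J_sub: "x \<in> J \<Longrightarrow> x \<in> carrier A"
  using additive_subgroup.a_Hcarr[OF J_add] by simp

lemma J_mult_l: "a \<in> carrier A \<Longrightarrow> x \<in> J \<Longrightarrow> a \<otimes>\<^bsub>A\<^esub> x \<in> J"
  using J_left_ideal by (simp add: left_ideal_def)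

lemma dd_J: "l \<in> carrier L \<Longrightarrow> h \<in> carrier H \<Longrightarrow> dd l h \<in> J"
  unfolding dd_phi by (rule Sm_mem[OF A.agT J_add]) (simp add: J_phi_mem)

lemma dd_closed [simp]: "l \<in> carrier L \<Longrightarrow> h \<in> carrier H \<Longrightarrow> dd l h \<in> carrier A"
  by (rule J_sub[OF dd_J])

text \<open>t^+(l) - t^-(l) commutes with the source because both terms do. A right factor m
  \<otimes> g therefore goes partly to the left of the difference, where the left ideal absorbs it,
  and partly into \<open>h\<close>.\<close>

lemma dd_mult:
  assumes "l \<in> carrier L" "h \<in> carrier H" "y \<in> carrier A"
  shows "dd l h \<otimes>\<^bsub>A\<^esub> y \<in> J"
  using assms(3)
proof (induction y rule: A.induct)
  case (pure m g)
  have "dd l h \<otimes>\<^bsub>A\<^esub> (m \<boxtimes>\<^bsub>A\<^esub> g) = (tA l \<ominus>\<^bsub>A\<^esub> tmA l) \<otimes>\<^bsub>A\<^esub> (iA h \<otimes>\<^bsub>A\<^esub> (sA m \<otimes>\<^bsub>A\<^esub> iA g))"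
    using assms pure by (simp add: dd_def sA_iA)
  also have "\<dots> = SS A (D h) (\<lambda>x y. ((tA l \<ominus>\<^bsub>A\<^esub> tmA l) \<otimes>\<^bsub>A\<^esub> sA (act x m)) \<otimes>\<^bsub>A\<^esub> iA (y \<otimes>\<^bsub>H\<^esub> g))"
    using assms pure by (simp add: AA.smash_comm')
  also have "\<dots> = SS A (D h) (\<lambda>x y. sA (act x m) \<otimes>\<^bsub>A\<^esub> dd l (y \<otimes>\<^bsub>H\<^esub> g))"
  proof (rule Sm_cong')
    fix x y assume xy: "x \<in> carrier H" "y \<in> carrier H"
    have "(tA l \<ominus>\<^bsub>A\<^esub> tmA l) \<otimes>\<^bsub>A\<^esub> sA (act x m) = sA (act x m) \<otimes>\<^bsub>A\<^esub> (tA l \<ominus>\<^bsub>A\<^esub> tmA l)"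
      using assms pure xy by (simp add: a_minus_def AA.C.l_minus AA.C.r_minus tA_s tmA_s(1))
    then show "((tA l \<ominus>\<^bsub>A\<^esub> tmA l) \<otimes>\<^bsub>A\<^esub> sA (act x m)) \<otimes>\<^bsub>A\<^esub> iA (y \<otimes>\<^bsub>H\<^esub> g) = sA (act x m) \<otimes>\<^bsub>A\<^esub> dd l (y \<otimes>\<^bsub>H\<^esub> g)"
      using assms pure xy by (simp add: dd_def del: AA.i_simps(5))
  qed
  also have "\<dots> \<in> J"
    by (rule Sm_mem[OF A.agT J_add]) (use assms pure in \<open>simp add: J_mult_l dd_J\<close>)
  finally show ?case .
next
  case (add y z)
  then show ?case using assms by (simp add: additive_subgroup.a_closed[OF J_add])
qed

text \<open>The elements all of whose right multiples lie in J form a left ideal. By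
  \<open>phi_minus\<close> and \<open>dd_mult\<close> it contains phi(x) - x, hence all of J by
  minimality.\<close>

lemma J_mult_r:
  assumes "x \<in> J" "y \<in> carrier A"
  shows "x \<otimes>\<^bsub>A\<^esub> y \<in> J"
proof -
  define I where "I = {x \<in> carrier A. \<forall>y\<in>carrier A. x \<otimes>\<^bsub>A\<^esub> y \<in> J}"
  have I: "left_ideal I A"
    by (rule left_idealI)
      (auto simp: I_def J_mult_l additive_subgroup.zero_closed[OF J_add] additive_subgroup.a_closed[OF J_add])
  have "phi k H R L act x \<ominus>\<^bsub>A\<^esub> x \<in> I" if x: "x \<in> carrier A" for x
    using x
  proof (induction x rule: A.induct)
    case (pure l h)
    have "(phi k H R L act (l \<boxtimes>\<^bsub>A\<^esub> h) \<ominus>\<^bsub>A\<^esub> (l \<boxtimes>\<^bsub>A\<^esub> h)) \<otimes>\<^bsub>A\<^esub> y \<in> J" if "y \<in> carrier A" for y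
      using pure that by (simp add: phi_minus, intro Sm_mem[OF A.agT J_add] dd_mult) simp_all
    then show ?case using pure by (simp add: I_def ahom_closed[OF phi_ahom])
  next
    case (add x z)
    have cl: "phi k H R L act x \<in> carrier A" "phi k H R L act z \<in> carrier A"
      using add by (simp_all add: ahom_closed[OF phi_ahom])
    have "phi k H R L act (x \<oplus>\<^bsub>A\<^esub> z) \<ominus>\<^bsub>A\<^esub> (x \<oplus>\<^bsub>A\<^esub> z) =
        (phi k H R L act x \<ominus>\<^bsub>A\<^esub> x) \<oplus>\<^bsub>A\<^esub> (phi k H R L act z \<ominus>\<^bsub>A\<^esub> z)"
      using add cl by (simp add: ahom_add[OF phi_ahom] a_minus_def AA.C.m.minus_add AA.C.m.a_ac)
    then show ?case using add additive_subgroup.a_closed[of I A] I by (simp add: left_ideal_def)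
  qed
  from J_least[OF I this] show ?thesis using assms by (auto simp: I_def)
qed

lemma J_ideal: "ideal J A"
  by (rule idealI[OF AA.C.ring_axioms])
    (use additive_subgroup.a_subgroup[OF J_add] in \<open>auto simp: J_mult_l J_mult_r\<close>)

text \<open>The criterion by which maps descend to the quotient. \<open>\<psi>\<close> is merely
  additive, so the criterion applies to the projected coproduct and to the counit as well as to
  algebra maps; under the two conditions its kernel is a left ideal containing every
  \<open>dd l h\<close>.\<close>

lemma J_kernel:
  assumes \<psi>: "ahom A G \<psi>"
    and 1: "\<And>l h. l \<in> carrier L \<Longrightarrow> h \<in> carrier H \<Longrightarrow> \<psi> (tA l \<otimes>\<^bsub>A\<^esub> iA h) = \<psi> (tmA l \<otimes>\<^bsub>A\<^esub> iA h)"
    and 2: "\<And>a x. a \<in> carrier A \<Longrightarrow> x \<in> carrier A \<Longrightarrow> \<psi> x = \<zero>\<^bsub>G\<^esub> \<Longrightarrow> \<psi> (a \<otimes>\<^bsub>A\<^esub> x) = \<zero>\<^bsub>G\<^esub>"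
    and x: "x \<in> J"
  shows "\<psi> x = \<zero>\<^bsub>G\<^esub>"
proof -
  interpret G: abelian_group G using \<psi> by (simp add: ahom_def)
  have G: "abelian_group G" by (rule G.abelian_group_axioms)
  note cl = ahom_closed[OF \<psi>]
  define I where "I = {x \<in> carrier A. \<psi> x = \<zero>\<^bsub>G\<^esub>}"
  have I: "left_ideal I A"
    by (rule left_idealI) (auto simp: I_def ahom_zero[OF \<psi>] ahom_add[OF \<psi>] 2)
  have d: "dd l h \<in> I" if "l \<in> carrier L" "h \<in> carrier H" for l h
  proof -
    have "\<psi> (dd l h) = \<psi> (tA l \<otimes>\<^bsub>A\<^esub> iA h) \<ominus>\<^bsub>G\<^esub> \<psi> (tmA l \<otimes>\<^bsub>A\<^esub> iA h)"
      using that by (simp add: dd_alt ahom_minus[OF \<psi>])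
    then show ?thesis using that by (simp add: I_def 1 cl a_minus_def G.r_neg)
  qed
  have "phi k H R L act x \<ominus>\<^bsub>A\<^esub> x \<in> I" if x: "x \<in> carrier A" for x
    using x
  proof (induction x rule: A.induct)
    case (pure l h)
    then show ?case unfolding phi_minus[OF pure]
      by (intro Sm_mem[OF A.agT] d) (use I in \<open>simp_all add: left_ideal_def\<close>)
  next
    case (add x z)
    have cl: "phi k H R L act x \<in> carrier A" "phi k H R L act z \<in> carrier A"
      using add by (simp_all add: ahom_closed[OF phi_ahom])
    have "phi k H R L act (x \<oplus>\<^bsub>A\<^esub> z) \<ominus>\<^bsub>A\<^esub> (x \<oplus>\<^bsub>A\<^esub> z) =
        (phi k H R L act x \<ominus>\<^bsub>A\<^esub> x) \<oplus>\<^bsub>A\<^esub> (phi k H R L act z \<ominus>\<^bsub>A\<^esub> z)"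
      using add cl by (simp add: ahom_add[OF phi_ahom] a_minus_def AA.C.m.minus_add AA.C.m.a_ac)
    then show ?case using add additive_subgroup.a_closed[of I A] I by (simp add: left_ideal_def)
  qed
  from J_least[OF I this] x show ?thesis by (auto simp: I_def)
qed

section \<open>The quotient and its induced structure\<close>

abbreviation DQ where "DQ \<equiv> dynamical_quotient k H R L act"
definition pj where "pj x = J +>\<^bsub>A\<^esub> x"

lemma pj_eq_iff:
  assumes "x \<in> carrier A" "y \<in> carrier A"
  shows "pj x = pj y \<longleftrightarrow> x \<ominus>\<^bsub>A\<^esub> y \<in> J"
proof -
  interpret J: ideal J A by (rule J_ideal)
  show ?thesis unfolding pj_def
    using AA.C.quotient_eq_iff_same_a_r_cos[OF J_ideal assms] by simp
qed

lemma the_elem_pj: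
  assumes "x \<in> carrier A" "\<And>y. y \<in> carrier A \<Longrightarrow> y \<ominus>\<^bsub>A\<^esub> x \<in> J \<Longrightarrow> g y = g x"
  shows "the_elem (g ` pj x) = g x"
proof -
  interpret J: ideal J A by (rule J_ideal)
  show ?thesis
  proof (rule the_elem_const)
    show "x \<in> pj x" unfolding pj_def by (rule J.a_rcos_self[OF assms(1)])
    fix y assume "y \<in> pj x"
    then obtain j where j: "j \<in> J" "y = j \<oplus>\<^bsub>A\<^esub> x" by (auto simp: pj_def a_r_coset_def')
    then have "y \<in> carrier A" "y \<ominus>\<^bsub>A\<^esub> x = j"
      using assms(1) J_sub[OF j(1)] by (simp_all add: a_minus_def AA.C.m.a_assoc AA.C.m.r_neg)
    then show "g y = g x" using assms(2) j(1) by simp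
  qed
qed

text \<open>Operations on the quotient are defined by \<open>the_elem\<close> of the image of a
  coset. They can be evaluated on a representative once the underlying additive map vanishes on
  J.\<close>

lemma the_elem_ahom:
  assumes "ahom A G g" "\<And>x. x \<in> J \<Longrightarrow> g x = \<zero>\<^bsub>G\<^esub>" "x \<in> carrier A"
  shows "the_elem (g ` pj x) = g x"
proof (rule the_elem_pj[OF assms(3)])
  interpret G: abelian_group G using assms(1) by (simp add: ahom_def)
  fix y assume y: "y \<in> carrier A" "y \<ominus>\<^bsub>A\<^esub> x \<in> J"
  then have "g (y \<ominus>\<^bsub>A\<^esub> x) = \<zero>\<^bsub>G\<^esub>" using assms(2) by blast
  then have "g y \<ominus>\<^bsub>G\<^esub> g x = \<zero>\<^bsub>G\<^esub>" using ahom_minus[OF assms(1) y(1) assms(3)] by simp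
  then show "g y = g x"
    using ahom_closed[OF assms(1)] assms(3) y(1)
    by (metis G.add.inv_closed G.add.inv_equality G.minus_minus a_minus_def)
qed

lemma DQ_struct: "carrier DQ = carrier (A Quot J)" "mult DQ = mult (A Quot J)" "one DQ = one (A Quot J)"
  "\<zero>\<^bsub>DQ\<^esub> = \<zero>\<^bsub>A Quot J\<^esub>" "add DQ = add (A Quot J)" "src DQ l = pj (src A l)" "tgt DQ l = pj (tgt A l)"
  "r \<odot>\<^bsub>DQ\<^esub> X = the_elem ((\<lambda>x. pj (r \<odot>\<^bsub>A\<^esub> x)) ` X)"
  "cou DQ X = the_elem (cou A ` X)"
  by (simp_all add: dynamical_quotient_def Let_def bialgebroid.defs quantum_groupoid.defs bialgebroid_quotient_def pj_def)

abbreviation DT where "DT \<equiv> btensor L (src DQ) (tgt DQ) DQ"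

lemma DQ_cop: "cop DQ X = the_elem ((\<lambda>x. tmap DT pj pj (cop A x)) ` X)"
proof -
  have T: "DT = btensor L (\<lambda>l. pj (src A l)) (\<lambda>l. pj (tgt A l)) (A Quot J)"
    by (rule btensor_struct) (auto simp: DQ_struct)
  have p: "pj = (\<lambda>x. J +>\<^bsub>A\<^esub> x)" by (rule ext) (simp add: pj_def)
  show ?thesis unfolding T
    by (simp add: dynamical_quotient_def Let_def bialgebroid.defs quantum_groupoid.defs bialgebroid_quotient_def p)
qed

lemma DQ_rmat: "rmat DQ = tmap (btensor L (tgt DQ) (src DQ) DQ) (\<lambda>h. pj (iA h)) (\<lambda>h. pj (iA h)) R"
proof -
  let ?B = "bialgebroid_quotient L A J"
  have T: "btensor L (tgt DQ) (src DQ) DQ = btensor L (tgt ?B) (src ?B) ?B"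
    by (rule btensor_struct) (simp_all add: dynamical_quotient_def Let_def bialgebroid.defs quantum_groupoid.defs)
  show ?thesis unfolding T
    by (simp add: dynamical_quotient_def Let_def bialgebroid.defs quantum_groupoid.defs pj_def iA_def)
qed

lemma DQ_ring: "ring DQ"
proof -
  have "ring (A Quot J)" by (rule ideal.quotient_is_ring[OF J_ideal])
  then interpret Q: ring "A Quot J" .
  have "monoid DQ" by (rule monoidI, unfold DQ_struct) (simp_all add: Q.m_assoc)
  moreover have "abelian_group DQ"
    by (rule abelian_groupI, unfold DQ_struct) (auto simp: Q.a_ac intro: Q.add.l_inv_ex)
  ultimately show ?thesis
    by (intro ringI) (simp_all add: DQ_struct(1,2,5) Q.l_distr Q.r_distr)
qed

lemma pj_surj: "X \<in> carrier DQ \<Longrightarrow> \<exists>x\<in>carrier A. X = pj x"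
  by (auto simp: DQ_struct FactRing_def A_RCOSETS_def' pj_def)

lemma pj_closed [simp]: "x \<in> carrier A \<Longrightarrow> pj x \<in> carrier DQ"
  and pj_add: "x \<in> carrier A \<Longrightarrow> y \<in> carrier A \<Longrightarrow> pj (x \<oplus>\<^bsub>A\<^esub> y) = pj x \<oplus>\<^bsub>DQ\<^esub> pj y"
  and pj_mult: "x \<in> carrier A \<Longrightarrow> y \<in> carrier A \<Longrightarrow> pj (x \<otimes>\<^bsub>A\<^esub> y) = pj x \<otimes>\<^bsub>DQ\<^esub> pj y"
  and pj_one: "pj \<one>\<^bsub>A\<^esub> = \<one>\<^bsub>DQ\<^esub>"
  using ideal.rcos_ring_hom[OF J_ideal] by (auto simp: DQ_struct pj_def ring_hom_def)

lemma pj_ahom: "ahom A DQ pj"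
  using DQ_ring by (intro ahomI) (simp_all add: pj_add ring_def)

lemma pj_J: "x \<in> J \<Longrightarrow> pj x = \<zero>\<^bsub>DQ\<^esub>"
  using pj_eq_iff[of x "\<zero>\<^bsub>A\<^esub>"] J_sub ahom_zero[OF pj_ahom] by (simp add: a_minus_def)

lemma pj_smult:
  assumes "r \<in> carrier k" "x \<in> carrier A"
  shows "r \<odot>\<^bsub>DQ\<^esub> pj x = pj (r \<odot>\<^bsub>A\<^esub> x)"
  unfolding DQ_struct
proof (rule the_elem_ahom[OF ahom_comp[OF AA.C.smult_ahom pj_ahom] _ assms(2)])
  fix y assume y: "y \<in> J"
  \<comment> \<open>Scalars act as left multiplication by r 1, so J is stable under them.\<close>
  have "r \<odot>\<^bsub>A\<^esub> y = (r \<odot>\<^bsub>A\<^esub> \<one>\<^bsub>A\<^esub>) \<otimes>\<^bsub>A\<^esub> y" using assms J_sub[OF y] by simp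
  also have "\<dots> \<in> J" by (rule J_mult_l) (use assms y in simp_all)
  finally show "pj (r \<odot>\<^bsub>A\<^esub> y) = \<zero>\<^bsub>DQ\<^esub>" by (rule pj_J)
qed (use assms in simp)

lemma DQ_alg: "k_algebra k DQ"
proof -
  interpret Q: ring DQ by (rule DQ_ring)
  have m: "module k DQ"
  proof (rule moduleI)
    show "cring k" by (rule H.m.R.is_cring)
    show "abelian_group DQ" by (rule Q.abelian_group_axioms)
  qed (auto dest!: pj_surj simp: pj_smult H.m.smult_l_distr AA.C.m.smult_l_distr AA.C.m.smult_assoc1 simp flip: pj_add)
  show ?thesis unfolding k_algebra_def
    by (intro conjI m DQ_ring) (auto dest!: pj_surj simp: pj_smult simp flip: pj_mult)
qed

definition jH where "jH h = pj (iA h)"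

lemma DQ_src: "src DQ l = pj (sA l)"
  by (simp add: DQ_struct A_src)

lemma DQ_tgt: "l \<in> carrier L \<Longrightarrow> tgt DQ l = pj (tA l)"
  by (simp add: DQ_struct A_tgt)

lemma pj_Sm: "(\<And>a b. a \<in> P \<Longrightarrow> b \<in> P \<Longrightarrow> f a b \<in> carrier A) \<Longrightarrow> pj (Sm P A xs f) = Sm P DQ xs (\<lambda>a b. pj (f a b))"
  using Sm_hom[OF pj_ahom] .

lemma DQ_smash_rep: "smash_rep k H R L act D rs rb DQ (src DQ) jH"
proof (intro smash_rep.intro smash_rep_axioms.intro represented_bialgebra_axioms DQ_alg)
  show "src DQ \<in> alg_hom k L DQ"
    by (rule alg_homI) (simp_all add: DQ_src pj_smult pj_one flip: pj_add pj_mult)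
  show "jH \<in> alg_hom k H DQ"
    by (rule alg_homI) (simp_all add: jH_def pj_smult pj_one flip: pj_add pj_mult)
  fix h l assume "h \<in> carrier H" "l \<in> carrier L"
  then show "jH h \<otimes>\<^bsub>DQ\<^esub> src DQ l = SS DQ (D h) (\<lambda>x y. src DQ (act x l) \<otimes>\<^bsub>DQ\<^esub> jH y)"
    by (simp add: jH_def DQ_src AA.smash_comm pj_Sm flip: pj_mult)
qed

lemma DQ_dynamical_rep: "dynamical_rep k H R L act D rs rb DQ (src DQ) jH (tgt DQ)"
proof (intro dynamical_rep.intro dynamical_rep_axioms.intro DQ_smash_rep)
  fix l assume l: "l \<in> carrier L"
  show "tgt DQ l = SS DQ rs (\<lambda>a b. src DQ (act b l) \<otimes>\<^bsub>DQ\<^esub> jH a)"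
    using l by (simp add: DQ_tgt tA_def pj_Sm DQ_src jH_def pj_mult)
  \<comment> \<open>At h = 1 the element \<open>dd l h\<close> is the difference itself; this is the
    point where t^+ = t^- becomes true.\<close>
  have "tA l \<ominus>\<^bsub>A\<^esub> tmA l \<in> J" using dd_J[OF l, of "\<one>\<^bsub>H\<^esub>"] l by (simp add: dd_def)
  then have "pj (tA l) = pj (tmA l)" using l by (simp add: pj_eq_iff)
  then show "tgt DQ l = SS DQ rb (\<lambda>c d. src DQ (act c l) \<otimes>\<^bsub>DQ\<^esub> jH d)"
    using l by (simp add: DQ_tgt tmA_def pj_Sm DQ_src jH_def pj_mult)
qed

interpretation DD: dynamical_rep k H R L act D rs rb DQ "src DQ" jH "tgt DQ" by (rule DQ_dynamical_rep)

lemma pp_bal: "AT.bb DT (\<lambda>a b. pj a \<boxtimes>\<^bsub>DT\<^esub> pj b)"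
proof (rule balI)
  fix l a b assume *: "l \<in> carrier L" "a \<in> carrier A" "b \<in> carrier A"
  then have "pj (tgt A l \<otimes>\<^bsub>A\<^esub> a) = tgt DQ l \<otimes>\<^bsub>DQ\<^esub> pj a" "pj (src A l \<otimes>\<^bsub>A\<^esub> b) = src DQ l \<otimes>\<^bsub>DQ\<^esub> pj b"
    by (simp_all add: DQ_struct(6,7) pj_mult A_src A_tgt)
  then show "pj (tgt A l \<otimes>\<^bsub>A\<^esub> a) \<boxtimes>\<^bsub>DT\<^esub> pj b = pj a \<boxtimes>\<^bsub>DT\<^esub> pj (src A l \<otimes>\<^bsub>A\<^esub> b)"
    using * by (simp add: DD.T.pure_t)
qed (simp_all add: pj_add)

text \<open>The coproduct of the smash product with both legs projected to the quotient; this is the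
  map that has to vanish on J.\<close>

definition cq where "cq x = tmap DT pj pj (cop A x)"

lemma cq_ahom: "ahom A DT cq"
  unfolding cq_def tmap_def
  by (rule ahom_comp[OF A_cop_ahom AT.t2.lift_ahom[OF DD.T.t2.agT pp_bal]])

lemma pj_pure: "l \<in> carrier L \<Longrightarrow> h \<in> carrier H \<Longrightarrow> pj (l \<boxtimes>\<^bsub>A\<^esub> h) = src DQ l \<otimes>\<^bsub>DQ\<^esub> jH h"
  by (simp add: DQ_src jH_def pj_mult flip: sA_iA)

lemma cq_pure:
  assumes "l \<in> carrier L" "h \<in> carrier H"
  shows "cq (l \<boxtimes>\<^bsub>A\<^esub> h) = SS DT (D h) (\<lambda>x y. (src DQ l \<otimes>\<^bsub>DQ\<^esub> jH x) \<boxtimes>\<^bsub>DT\<^esub> jH y)"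
  unfolding cq_def tmap_def A_cop_pure[OF assms] cA_def
  using assms by (simp add: AT.t2.lift_Sm[OF DD.T.t2.agT pp_bal] AT.t2.lift_pure[OF DD.T.t2.agT pp_bal] pj_pure)

lemma cq_bil: "l \<in> carrier L \<Longrightarrow> bil k H DT (\<lambda>x y. (src DQ l \<otimes>\<^bsub>DQ\<^esub> jH x) \<boxtimes>\<^bsub>DT\<^esub> jH y)"
  by (rule bilI) simp_all

text \<open>Left multiplication by a coproduct is well defined on the tensor square, so the kernel of \<open>cq\<close>
  is a left ideal.\<close>

lemma cq_left:
  assumes a: "a \<in> carrier A" and x: "x \<in> carrier A" and z: "cq x = \<zero>\<^bsub>DT\<^esub>"
  shows "cq (a \<otimes>\<^bsub>A\<^esub> x) = \<zero>\<^bsub>DT\<^esub>"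
  using a
proof (induction a rule: A.induct)
  case (pure m g)
  \<comment> \<open>Left multiplication by the projected coproduct of m \<otimes> g;
    \<open>DD.takeuchi\<close> is its balancedness.\<close>
  let ?F = "\<lambda>c d. SS DT (D g) (\<lambda>x y. (src DQ m \<otimes>\<^bsub>DQ\<^esub> (jH x \<otimes>\<^bsub>DQ\<^esub> c)) \<boxtimes>\<^bsub>DT\<^esub> (jH y \<otimes>\<^bsub>DQ\<^esub> d))"
  have b: "DD.T.bb DT ?F"
    by (rule balI) (use pure in \<open>simp_all add: DD.takeuchi del: DD.s_t DD.s_t'\<close>)
  have "cq ((m \<boxtimes>\<^bsub>A\<^esub> g) \<otimes>\<^bsub>A\<^esub> x) = tlift DT ?F (cq x)"
  proof (rule A.ahom_eqI[OF ahom_comp[OF A_mult_ahom_r cq_ahom] ahom_comp[OF cq_ahom DD.T.t2.lift_ahom[OF _ b]] x])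
    fix l h assume l: "l \<in> carrier L" "h \<in> carrier H"
    have "cq ((m \<boxtimes>\<^bsub>A\<^esub> g) \<otimes>\<^bsub>A\<^esub> (l \<boxtimes>\<^bsub>A\<^esub> h)) =
        SS DT (D g) (\<lambda>x y. SS DT (D y) (\<lambda>p q. SS DT (D h) (\<lambda>u v.
          (src DQ (m \<otimes>\<^bsub>L\<^esub> act x l) \<otimes>\<^bsub>DQ\<^esub> jH (p \<otimes>\<^bsub>H\<^esub> u)) \<boxtimes>\<^bsub>DT\<^esub> jH (q \<otimes>\<^bsub>H\<^esub> v))))"
      using l pure by (simp add: A_mult_pure mu_def Sm_hom[OF cq_ahom] cq_pure D_mult[OF _ cq_bil])
    also have "\<dots> = SS DT (D h) (\<lambda>u v. ?F (src DQ l \<otimes>\<^bsub>DQ\<^esub> jH u) (jH v))"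
      by (rule DD.cop_mult_gen) (use l pure in simp_all)
    also have "\<dots> = tlift DT ?F (cq (l \<boxtimes>\<^bsub>A\<^esub> h))"
      using l pure by (subst cq_pure) (simp_all only: DD.T.t2.lift_Sm[OF DD.T.t2.agT b] DD.T.t2.lift_pure[OF DD.T.t2.agT b]
        DD.T.t2.pure_closed DD.s_simps DD.i_simps DD.C.m_closed cong: Sm_cong)
    finally show "cq ((m \<boxtimes>\<^bsub>A\<^esub> g) \<otimes>\<^bsub>A\<^esub> (l \<boxtimes>\<^bsub>A\<^esub> h)) = tlift DT ?F (cq (l \<boxtimes>\<^bsub>A\<^esub> h))" .
  qed (use pure in simp_all)
  then show ?case using z ahom_zero[OF DD.T.t2.lift_ahom[OF _ b]] by simp
next
  case (add a b)
  interpret DT: abelian_group DT by simp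
  show ?case using add x by (simp add: ahom_add[OF cq_ahom])
qed

lemma tA_iA: "l \<in> carrier L \<Longrightarrow> h \<in> carrier H \<Longrightarrow> tA l \<otimes>\<^bsub>A\<^esub> iA h = SS A rs (\<lambda>a b. act b l \<boxtimes>\<^bsub>A\<^esub> (a \<otimes>\<^bsub>H\<^esub> h))"
  and tmA_iA: "l \<in> carrier L \<Longrightarrow> h \<in> carrier H \<Longrightarrow> tmA l \<otimes>\<^bsub>A\<^esub> iA h = SS A rb (\<lambda>c d. act c l \<boxtimes>\<^bsub>A\<^esub> (d \<otimes>\<^bsub>H\<^esub> h))"
  by (simp_all add: tA_def tmA_def flip: sA_iA)

text \<open>Both sides equal the sum of h_(1) \<otimes> t(l) h_(2): the left one by
  \<open>cop_t_gen\<close> for R, the right one by \<open>cop_t_gen\<close> for R^-1_21, with the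
  common target map of the quotient.\<close>

lemma cq_t:
  assumes "l \<in> carrier L" "h \<in> carrier H"
  shows "cq (tA l \<otimes>\<^bsub>A\<^esub> iA h) = cq (tmA l \<otimes>\<^bsub>A\<^esub> iA h)"
proof -
  interpret m: dynamical_rep k H "Sm (carrier H) (kt2 k H) (map prod.swap rb) (\<lambda>a b. a \<boxtimes>\<^bsub>kt2 k H\<^esub> b)" L act D
     "map prod.swap rb" "map prod.swap rs" DQ "src DQ" jH "tgt DQ" by (rule DD.dynamical_rep_minus)
  have "cq (tA l \<otimes>\<^bsub>A\<^esub> iA h) = SS DT rs (\<lambda>a b. SS DT (D a) (\<lambda>p q. SS DT (D h) (\<lambda>x y.
        (src DQ (\<one>\<^bsub>L\<^esub> \<otimes>\<^bsub>L\<^esub> act b l) \<otimes>\<^bsub>DQ\<^esub> jH (p \<otimes>\<^bsub>H\<^esub> x)) \<boxtimes>\<^bsub>DT\<^esub> jH (q \<otimes>\<^bsub>H\<^esub> y))))"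
    using assms by (simp add: tA_iA Sm_hom[OF cq_ahom] cq_pure D_mult[OF _ cq_bil])
  also have "\<dots> = SS DT (D h) (\<lambda>x y. (src DQ \<one>\<^bsub>L\<^esub> \<otimes>\<^bsub>DQ\<^esub> jH x) \<boxtimes>\<^bsub>DT\<^esub> (tgt DQ l \<otimes>\<^bsub>DQ\<^esub> jH y))"
    by (rule DD.cop_t_gen) (use assms in simp_all)
  also have "\<dots> = SS DT rb (\<lambda>b a. SS DT (D a) (\<lambda>p q. SS DT (D h) (\<lambda>x y.
        (src DQ (\<one>\<^bsub>L\<^esub> \<otimes>\<^bsub>L\<^esub> act b l) \<otimes>\<^bsub>DQ\<^esub> jH (p \<otimes>\<^bsub>H\<^esub> x)) \<boxtimes>\<^bsub>DT\<^esub> jH (q \<otimes>\<^bsub>H\<^esub> y))))"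
    using m.cop_t_gen[OF assms(1) _ assms(2), of "\<one>\<^bsub>L\<^esub>"] unfolding Sm_map_swap by simp
  also have "\<dots> = cq (tmA l \<otimes>\<^bsub>A\<^esub> iA h)"
    using assms by (simp add: tmA_iA Sm_hom[OF cq_ahom] cq_pure D_mult[OF _ cq_bil])
  finally show ?thesis .
qed

lemma DQ_cop_pj: "x \<in> carrier A \<Longrightarrow> cop DQ (pj x) = cq x"
  unfolding DQ_cop cq_def[symmetric]
  by (rule the_elem_ahom[OF cq_ahom J_kernel[OF cq_ahom cq_t cq_left]])

text \<open>The counit is a module map when m \<otimes> g acts on L by z \<mapsto> m (g \<rhd> z);
  hence its kernel is closed under left multiplication.\<close>

lemma cou_mult_pure:
  assumes "m \<in> carrier L" "g \<in> carrier H" "x \<in> carrier A"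
  shows "cou A ((m \<boxtimes>\<^bsub>A\<^esub> g) \<otimes>\<^bsub>A\<^esub> x) = m \<otimes>\<^bsub>L\<^esub> act g (cou A x)"
proof -
  have ah: "ahom L L (\<lambda>z. m \<otimes>\<^bsub>L\<^esub> act g z)" by (rule ahomI) (use assms in simp_all)
  show ?thesis
  proof (rule A.ahom_eqI[OF ahom_comp[OF A_mult_ahom_r A_cou_ahom] ahom_comp[OF A_cou_ahom ah] assms(3)])
    fix l h assume l: "l \<in> carrier L" "h \<in> carrier H"
    have "cou A ((m \<boxtimes>\<^bsub>A\<^esub> g) \<otimes>\<^bsub>A\<^esub> (l \<boxtimes>\<^bsub>A\<^esub> h)) = SS L (D g) (\<lambda>x y. \<epsilon> h \<odot>\<^bsub>L\<^esub> (m \<otimes>\<^bsub>L\<^esub> (\<epsilon> y \<odot>\<^bsub>L\<^esub> act x l)))"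
      using assms l by (simp add: A_mult_pure mu_def Sm_hom[OF A_cou_ahom] A_cou_pure H.m.m_comm flip: L.m.smult_assoc1)
    also have "\<dots> = \<epsilon> h \<odot>\<^bsub>L\<^esub> (m \<otimes>\<^bsub>L\<^esub> act (SS H (D g) (\<lambda>x y. \<epsilon> y \<odot>\<^bsub>H\<^esub> x)) l)"
      using assms l by (simp add: L.smult_Sm)
    also have "\<dots> = m \<otimes>\<^bsub>L\<^esub> act g (cou A (l \<boxtimes>\<^bsub>A\<^esub> h))"
      using assms l by (simp only: counit_r) (simp add: A_cou_pure)
    finally show "cou A ((m \<boxtimes>\<^bsub>A\<^esub> g) \<otimes>\<^bsub>A\<^esub> (l \<boxtimes>\<^bsub>A\<^esub> h)) = m \<otimes>\<^bsub>L\<^esub> act g (cou A (l \<boxtimes>\<^bsub>A\<^esub> h))" .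
  qed (use assms in simp_all)
qed

lemma cou_left_zero:
  assumes a: "a \<in> carrier A" and x: "x \<in> carrier A" and z: "cou A x = \<zero>\<^bsub>L\<^esub>"
  shows "cou A (a \<otimes>\<^bsub>A\<^esub> x) = \<zero>\<^bsub>L\<^esub>"
  using a
proof (induction a rule: A.induct)
  case (pure m g)
  have "ahom L L (\<lambda>z. act g z)" by (rule ahomI) (use pure in simp_all)
  from ahom_zero[OF this] show ?case using pure x z by (simp add: cou_mult_pure)
qed (use x in \<open>simp add: ahom_add[OF A_cou_ahom]\<close>)

text \<open>Each side is \<epsilon>(h) l, by (\<epsilon> \<otimes> id)(R) = 1 on the left and (id
  \<otimes> \<epsilon>)(R^-1) = 1 on the right.\<close>

lemma cou_t:
  assumes "l \<in> carrier L" "h \<in> carrier H"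
  shows "cou A (tA l \<otimes>\<^bsub>A\<^esub> iA h) = cou A (tmA l \<otimes>\<^bsub>A\<^esub> iA h)"
proof -
  have e: "SS H rb (\<lambda>c d. \<epsilon> d \<odot>\<^bsub>H\<^esub> c) = \<one>\<^bsub>H\<^esub>"
    using represented_bialgebra.eps_R_l[OF represented_minus] by simp
  have "cou A (tA l \<otimes>\<^bsub>A\<^esub> iA h) = \<epsilon> h \<odot>\<^bsub>L\<^esub> act (SS H rs (\<lambda>a b. \<epsilon> a \<odot>\<^bsub>H\<^esub> b)) l"
    using assms by (simp add: tA_iA Sm_hom[OF A_cou_ahom] A_cou_pure H.m.m_comm L.smult_Sm[symmetric] flip: L.m.smult_assoc1)
  also have "\<dots> = \<epsilon> h \<odot>\<^bsub>L\<^esub> act (SS H rb (\<lambda>c d. \<epsilon> d \<odot>\<^bsub>H\<^esub> c)) l" by (simp only: e eps_R_l)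
  also have "\<dots> = cou A (tmA l \<otimes>\<^bsub>A\<^esub> iA h)"
    using assms by (simp add: tmA_iA Sm_hom[OF A_cou_ahom] A_cou_pure H.m.m_comm L.smult_Sm[symmetric] flip: L.m.smult_assoc1)
  finally show ?thesis .
qed

lemma DQ_cou_pj: "x \<in> carrier A \<Longrightarrow> cou DQ (pj x) = cou A x"
  unfolding DQ_struct(9)
  by (rule the_elem_ahom[OF A_cou_ahom J_kernel[OF A_cou_ahom cou_t cou_left_zero]])

lemma DQ_span:
  assumes "X \<in> carrier DQ"
    and gen: "\<And>l h. l \<in> carrier L \<Longrightarrow> h \<in> carrier H \<Longrightarrow> P (src DQ l \<otimes>\<^bsub>DQ\<^esub> jH h)"
    and ad: "\<And>x y. x \<in> carrier DQ \<Longrightarrow> y \<in> carrier DQ \<Longrightarrow> P x \<Longrightarrow> P y \<Longrightarrow> P (x \<oplus>\<^bsub>DQ\<^esub> y)"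
  shows "P X"
proof -
  obtain x where x: "x \<in> carrier A" "X = pj x" using pj_surj[OF assms(1)] by blast
  have "P (pj x)" using x(1)
    by (induction x rule: A.induct) (simp_all add: pj_pure gen pj_add ad)
  then show ?thesis using x by simp
qed

lemma DQ_presented: "presented_groupoid k H R L act D rs rb DQ jH"
proof (intro presented_groupoid.intro DQ_dynamical_rep presented_groupoid_axioms.intro)
  show "rmat DQ = tmap (over_Lop L DQ) jH jH R"
    unfolding DQ_rmat jH_def ..
  fix x y assume "x \<in> carrier DQ" "y \<in> carrier DQ"
  then obtain a b where ab: "a \<in> carrier A" "x = pj a" "b \<in> carrier A" "y = pj b" using pj_surj by meson
  then show "cop DQ (x \<oplus>\<^bsub>DQ\<^esub> y) = cop DQ x \<oplus>\<^bsub>DT\<^esub> cop DQ y"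
    by (simp add: DQ_cop_pj ahom_add[OF cq_ahom] flip: pj_add)
  show "cou DQ (x \<oplus>\<^bsub>DQ\<^esub> y) = cou DQ x \<oplus>\<^bsub>L\<^esub> cou DQ y"
    using ab by (simp add: DQ_cou_pj ahom_add[OF A_cou_ahom] flip: pj_add)
next
  fix l h assume "l \<in> carrier L" "h \<in> carrier H"
  then show "cop DQ (src DQ l \<otimes>\<^bsub>DQ\<^esub> jH h) = SS DT (D h) (\<lambda>x y. (src DQ l \<otimes>\<^bsub>DQ\<^esub> jH x) \<boxtimes>\<^bsub>DT\<^esub> jH y)"
    "cou DQ (src DQ l \<otimes>\<^bsub>DQ\<^esub> jH h) = counit H h \<odot>\<^bsub>L\<^esub> l"
    by (simp_all add: DQ_cop_pj DQ_cou_pj cq_pure A_cou_pure flip: pj_pure)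
qed (rule DQ_span)

end

section \<open>The universal property of the quotient\<close>

context dynamical_rep
begin

text \<open>The factorisation of \<open>lift\<close> through the quotient. The two formulas for
  \<open>t\<close> say that \<open>lift\<close> takes the same value on t^+ and t^-.\<close>

definition dlift where "dlift X = the_elem (lift ` X)"

lemma dlift_pj:
  assumes "x \<in> carrier A"
  shows "dlift (pj x) = lift x"
proof -
  interpret AA: smash_rep k H R L act D rs rb A sA iA by (rule smash_rep_A)
  note al = alg_homD[OF lift_alg_hom]
  have lA: "lift (iA h) = i h" if "h \<in> carrier H" for h using that by (simp add: iA_def)
  have lS: "lift (sA l) = s l" if "l \<in> carrier L" for l using that by (simp add: sA_def)
  show ?thesis
    unfolding dlift_def
  proof (rule the_elem_ahom[OF lift_ahom J_kernel[OF lift_ahom] assms])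
    fix l h assume l: "l \<in> carrier L" "h \<in> carrier H"
    have "lift (tA l) = t l" "lift (tmA l) = t l"
      using l by (simp_all add: tA_def tmA_def Sm_hom[OF lift_ahom] al lA lS flip: t_plus t_minus)
    then show "lift (tA l \<otimes>\<^bsub>A\<^esub> iA h) = lift (tmA l \<otimes>\<^bsub>A\<^esub> iA h)"
      using l by (simp add: al)
  next
    fix a x assume "a \<in> carrier A" "x \<in> carrier A" "lift x = \<zero>\<^bsub>C\<^esub>"
    then show "lift (a \<otimes>\<^bsub>A\<^esub> x) = \<zero>\<^bsub>C\<^esub>" by (simp add: al)
  qed
qed

lemma dlift_alg_hom: "dlift \<in> alg_hom k DQ C"
  and dlift_src: "l \<in> carrier L \<Longrightarrow> dlift (src DQ l) = s l"
  and dlift_jH: "h \<in> carrier H \<Longrightarrow> dlift (jH h) = i h"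
proof -
  interpret AA: smash_rep k H R L act D rs rb A sA iA by (rule smash_rep_A)
  note al = alg_homD[OF lift_alg_hom]
  show "dlift \<in> alg_hom k DQ C"
  proof (rule alg_homI)
    fix X Y assume "X \<in> carrier DQ" "Y \<in> carrier DQ"
    then obtain a b where ab: "a \<in> carrier A" "X = pj a" "b \<in> carrier A" "Y = pj b" using pj_surj by meson
    then show "dlift X \<in> carrier C" "dlift (X \<oplus>\<^bsub>DQ\<^esub> Y) = dlift X \<oplus>\<^bsub>C\<^esub> dlift Y" "dlift (X \<otimes>\<^bsub>DQ\<^esub> Y) = dlift X \<otimes>\<^bsub>C\<^esub> dlift Y"
      by (simp_all add: dlift_pj al del: pj_closed flip: pj_add pj_mult)
  next
    fix r X assume "r \<in> carrier k" "X \<in> carrier DQ"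
    moreover then obtain a where "a \<in> carrier A" "X = pj a" using pj_surj by meson
    ultimately show "dlift (r \<odot>\<^bsub>DQ\<^esub> X) = r \<odot>\<^bsub>C\<^esub> dlift X" by (simp add: pj_smult dlift_pj al)
  qed (simp add: dlift_pj al flip: pj_one)
  show "l \<in> carrier L \<Longrightarrow> dlift (src DQ l) = s l" by (simp add: DQ_src dlift_pj sA_def)
  show "h \<in> carrier H \<Longrightarrow> dlift (jH h) = i h" by (simp add: jH_def dlift_pj iA_def)
qed

end

section \<open>The antipode and the opposite Hopf algebra\<close>

locale represented_hopf = represented_bialgebra k H R L act D rs rb
  for k :: "('k, 'x) ring_scheme" and H :: "('k, 'h, 'y) hopf_scheme" and R :: "('h, 'h) tens"
    and L :: "('k, 'l, 'z) module_scheme" and act :: "'h \<Rightarrow> 'l \<Rightarrow> 'l"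
    and D :: "'h \<Rightarrow> ('h \<times> 'h) list" and rs rb :: "('h \<times> 'h) list" +
  assumes g_bij: "bij_betw (antipode H) (carrier H) (carrier H)"
    and g_add [simp]: "x \<in> carrier H \<Longrightarrow> y \<in> carrier H \<Longrightarrow> antipode H (x \<oplus>\<^bsub>H\<^esub> y) = antipode H x \<oplus>\<^bsub>H\<^esub> antipode H y"
    and g_smult [simp]: "r \<in> carrier k \<Longrightarrow> x \<in> carrier H \<Longrightarrow> antipode H (r \<odot>\<^bsub>H\<^esub> x) = r \<odot>\<^bsub>H\<^esub> antipode H x"
    and g_l: "x \<in> carrier H \<Longrightarrow> Sm (carrier H) H (D x) (\<lambda>a b. antipode H a \<otimes>\<^bsub>H\<^esub> b) = counit H x \<odot>\<^bsub>H\<^esub> \<one>\<^bsub>H\<^esub>"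
    and g_r: "x \<in> carrier H \<Longrightarrow> Sm (carrier H) H (D x) (\<lambda>a b. a \<otimes>\<^bsub>H\<^esub> antipode H b) = counit H x \<odot>\<^bsub>H\<^esub> \<one>\<^bsub>H\<^esub>"
begin

abbreviation \<gamma> where "\<gamma> \<equiv> antipode H"
abbreviation \<gamma>i where "\<gamma>i \<equiv> antipode_inv H"

lemma g_closed [simp]: "x \<in> carrier H \<Longrightarrow> \<gamma> x \<in> carrier H"
  using g_bij by (auto simp: bij_betw_def)

lemma gi_closed [simp]: "x \<in> carrier H \<Longrightarrow> \<gamma>i x \<in> carrier H"
  and g_gi [simp]: "x \<in> carrier H \<Longrightarrow> \<gamma> (\<gamma>i x) = x"
  and gi_g [simp]: "x \<in> carrier H \<Longrightarrow> \<gamma>i (\<gamma> x) = x"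
  using g_bij by (auto simp: antipode_inv_def bij_betw_def inv_into_into f_inv_into_f)

lemma g_inj: "\<gamma> x = \<gamma> y \<Longrightarrow> x \<in> carrier H \<Longrightarrow> y \<in> carrier H \<Longrightarrow> x = y"
  by (metis gi_g)

lemma gi_add [simp]: "x \<in> carrier H \<Longrightarrow> y \<in> carrier H \<Longrightarrow> \<gamma>i (x \<oplus>\<^bsub>H\<^esub> y) = \<gamma>i x \<oplus>\<^bsub>H\<^esub> \<gamma>i y"
  by (rule g_inj) simp_all

lemma gi_smult [simp]: "r \<in> carrier k \<Longrightarrow> x \<in> carrier H \<Longrightarrow> \<gamma>i (r \<odot>\<^bsub>H\<^esub> x) = r \<odot>\<^bsub>H\<^esub> \<gamma>i x"
  by (rule g_inj) simp_all

lemma g_ahom: "ahom H H \<gamma>" and gi_ahom: "ahom H H \<gamma>i"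
  by (auto intro!: ahomI)

lemmas g_Sm [simp] = Sm_hom[OF g_ahom] and gi_Sm [simp] = Sm_hom[OF gi_ahom]

lemma g_l': "ahom H G f \<Longrightarrow> h \<in> carrier H \<Longrightarrow> SS G (D h) (\<lambda>a b. f (\<gamma> a \<otimes>\<^bsub>H\<^esub> b)) = f (\<epsilon> h \<odot>\<^bsub>H\<^esub> \<one>\<^bsub>H\<^esub>)"
  using Sm_hom[of H G f "carrier H" "\<lambda>a b. \<gamma> a \<otimes>\<^bsub>H\<^esub> b" "D h"] g_l[of h] by simp

lemma g_r': "ahom H G f \<Longrightarrow> h \<in> carrier H \<Longrightarrow> SS G (D h) (\<lambda>a b. f (a \<otimes>\<^bsub>H\<^esub> \<gamma> b)) = f (\<epsilon> h \<odot>\<^bsub>H\<^esub> \<one>\<^bsub>H\<^esub>)"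
  using Sm_hom[of H G f "carrier H" "\<lambda>a b. a \<otimes>\<^bsub>H\<^esub> \<gamma> b" "D h"] g_r[of h] by simp

lemma g_one [simp]: "\<gamma> \<one>\<^bsub>H\<^esub> = \<one>\<^bsub>H\<^esub>"
proof -
  have b: "bil k H H (\<lambda>a b. \<gamma> a \<otimes>\<^bsub>H\<^esub> b)" by (rule bilI) simp_all
  show ?thesis using g_l[of "\<one>\<^bsub>H\<^esub>"] D_one[OF _ b] by simp
qed

lemma gi_one [simp]: "\<gamma>i \<one>\<^bsub>H\<^esub> = \<one>\<^bsub>H\<^esub>"
  by (rule g_inj) simp_all

text \<open>Both antimultiplicativity properties are uniqueness of the convolution inverse.\<close>

lemma g_mult [simp]:
  assumes x: "x \<in> carrier H" and y: "y \<in> carrier H"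
  shows "\<gamma> (x \<otimes>\<^bsub>H\<^esub> y) = \<gamma> y \<otimes>\<^bsub>H\<^esub> \<gamma> x"
proof -
  \<comment> \<open>Summed over \<Delta>, this is \<gamma>(x_1 y_1) x_2 y_2 \<gamma>(y_3)
    \<gamma>(x_3). Collapsing the right part first leaves \<gamma>(x y), collapsing the left part
    first leaves \<gamma>(y) \<gamma>(x).\<close>
  let ?W = "\<lambda>a b1 b2. SS H (D y) (\<lambda>c d. SS H (D d) (\<lambda>d1 d2. \<gamma> (a \<otimes>\<^bsub>H\<^esub> c) \<otimes>\<^bsub>H\<^esub> (b1 \<otimes>\<^bsub>H\<^esub> (d1 \<otimes>\<^bsub>H\<^esub> (\<gamma> d2 \<otimes>\<^bsub>H\<^esub> \<gamma> b2)))))"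
  have W: "tri k H H ?W" by (rule triI) (use x y in simp_all)
  have 1: "?W a b1 b2 = \<gamma> (a \<otimes>\<^bsub>H\<^esub> y) \<otimes>\<^bsub>H\<^esub> (b1 \<otimes>\<^bsub>H\<^esub> \<gamma> b2)"
    if "a \<in> carrier H" "b1 \<in> carrier H" "b2 \<in> carrier H" for a b1 b2
  proof -
    have "?W a b1 b2 = SS H (D y) (\<lambda>c d. \<gamma> (a \<otimes>\<^bsub>H\<^esub> c) \<otimes>\<^bsub>H\<^esub> (b1 \<otimes>\<^bsub>H\<^esub> ((\<epsilon> d \<odot>\<^bsub>H\<^esub> \<one>\<^bsub>H\<^esub>) \<otimes>\<^bsub>H\<^esub> \<gamma> b2)))"
    proof (rule Sm_cong')
      fix c d assume cd: "c \<in> carrier H" "d \<in> carrier H"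
      have "ahom H H (\<lambda>z. \<gamma> (a \<otimes>\<^bsub>H\<^esub> c) \<otimes>\<^bsub>H\<^esub> (b1 \<otimes>\<^bsub>H\<^esub> (z \<otimes>\<^bsub>H\<^esub> \<gamma> b2)))"
        by (rule ahomI) (use that cd in simp_all)
      from g_r'[OF this cd(2)] show "SS H (D d) (\<lambda>d1 d2. \<gamma> (a \<otimes>\<^bsub>H\<^esub> c) \<otimes>\<^bsub>H\<^esub> (b1 \<otimes>\<^bsub>H\<^esub> (d1 \<otimes>\<^bsub>H\<^esub> (\<gamma> d2 \<otimes>\<^bsub>H\<^esub> \<gamma> b2)))) =
          \<gamma> (a \<otimes>\<^bsub>H\<^esub> c) \<otimes>\<^bsub>H\<^esub> (b1 \<otimes>\<^bsub>H\<^esub> ((\<epsilon> d \<odot>\<^bsub>H\<^esub> \<one>\<^bsub>H\<^esub>) \<otimes>\<^bsub>H\<^esub> \<gamma> b2))"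
        using that cd by simp
    qed
    also have "\<dots> = SS H (D y) (\<lambda>c d. \<gamma> (a \<otimes>\<^bsub>H\<^esub> (\<epsilon> d \<odot>\<^bsub>H\<^esub> c)) \<otimes>\<^bsub>H\<^esub> (b1 \<otimes>\<^bsub>H\<^esub> \<gamma> b2))"
      by (rule Sm_cong') (use that in simp)
    also have "\<dots> = \<gamma> (a \<otimes>\<^bsub>H\<^esub> y) \<otimes>\<^bsub>H\<^esub> (b1 \<otimes>\<^bsub>H\<^esub> \<gamma> b2)"
      by (rule counit_r'[where f="\<lambda>c. \<gamma> (a \<otimes>\<^bsub>H\<^esub> c) \<otimes>\<^bsub>H\<^esub> (b1 \<otimes>\<^bsub>H\<^esub> \<gamma> b2)"], rule ahomI) (use that y in simp_all)
    finally show ?thesis .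
  qed
  have 2: "SS H (D a) (\<lambda>a1 a2. ?W a1 a2 b) = \<epsilon> a \<odot>\<^bsub>H\<^esub> (\<gamma> y \<otimes>\<^bsub>H\<^esub> \<gamma> b)"
    if a: "a \<in> carrier H" and b: "b \<in> carrier H" for a b
  proof -
    let ?V = "\<lambda>a1 a2 c1 c2 d. \<gamma> (a1 \<otimes>\<^bsub>H\<^esub> c1) \<otimes>\<^bsub>H\<^esub> (a2 \<otimes>\<^bsub>H\<^esub> (c2 \<otimes>\<^bsub>H\<^esub> (\<gamma> d \<otimes>\<^bsub>H\<^esub> \<gamma> b)))"
    have "SS H (D a) (\<lambda>a1 a2. ?W a1 a2 b) = SS H (D a) (\<lambda>a1 a2. SS H (D y) (\<lambda>c d. SS H (D c) (\<lambda>c1 c2. ?V a1 a2 c1 c2 d)))"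
      by (rule Sm_cong', rule coassoc[symmetric], simp, rule triI) (use a b y in simp_all)
    also have "\<dots> = SS H (D y) (\<lambda>c d. SS H (D a) (\<lambda>a1 a2. SS H (D c) (\<lambda>c1 c2. ?V a1 a2 c1 c2 d)))"
      by (rule Sm_swap) (use a b y in simp_all)
    also have "\<dots> = SS H (D y) (\<lambda>c d. SS H (D (a \<otimes>\<^bsub>H\<^esub> c)) (\<lambda>p q. (\<gamma> p \<otimes>\<^bsub>H\<^esub> q) \<otimes>\<^bsub>H\<^esub> (\<gamma> d \<otimes>\<^bsub>H\<^esub> \<gamma> b)))"
    proof (rule Sm_cong')
      fix c d assume cd: "c \<in> carrier H" "d \<in> carrier H"
      have "bil k H H (\<lambda>p q. (\<gamma> p \<otimes>\<^bsub>H\<^esub> q) \<otimes>\<^bsub>H\<^esub> (\<gamma> d \<otimes>\<^bsub>H\<^esub> \<gamma> b))"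
        by (rule bilI) (use b cd in simp_all)
      from D_mult[OF H.ag this a cd(1)] show "SS H (D a) (\<lambda>a1 a2. SS H (D c) (\<lambda>c1 c2. ?V a1 a2 c1 c2 d)) =
          SS H (D (a \<otimes>\<^bsub>H\<^esub> c)) (\<lambda>p q. (\<gamma> p \<otimes>\<^bsub>H\<^esub> q) \<otimes>\<^bsub>H\<^esub> (\<gamma> d \<otimes>\<^bsub>H\<^esub> \<gamma> b))"
        using a b cd by simp
    qed
    also have "\<dots> = SS H (D y) (\<lambda>c d. (\<epsilon> (a \<otimes>\<^bsub>H\<^esub> c) \<odot>\<^bsub>H\<^esub> \<one>\<^bsub>H\<^esub>) \<otimes>\<^bsub>H\<^esub> (\<gamma> d \<otimes>\<^bsub>H\<^esub> \<gamma> b))"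
      by (rule Sm_cong', rule g_l'[OF H.mult_ahom_r]) (use a b in simp_all)
    also have "\<dots> = SS H (D y) (\<lambda>c d. \<epsilon> a \<odot>\<^bsub>H\<^esub> (\<gamma> (\<epsilon> c \<odot>\<^bsub>H\<^esub> d) \<otimes>\<^bsub>H\<^esub> \<gamma> b))"
      by (rule Sm_cong') (use a b in \<open>simp add: H.m.smult_assoc1\<close>)
    also have "\<dots> = \<epsilon> a \<odot>\<^bsub>H\<^esub> (\<gamma> y \<otimes>\<^bsub>H\<^esub> \<gamma> b)"
      by (rule counit_l'[where f="\<lambda>d. \<epsilon> a \<odot>\<^bsub>H\<^esub> (\<gamma> d \<otimes>\<^bsub>H\<^esub> \<gamma> b)"], rule ahomI) (use a b y in simp_all)
    finally show ?thesis .
  qed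
  have "\<gamma> (x \<otimes>\<^bsub>H\<^esub> y) = SS H (D x) (\<lambda>a b. \<gamma> ((\<epsilon> b \<odot>\<^bsub>H\<^esub> a) \<otimes>\<^bsub>H\<^esub> y))"
    by (rule counit_r'[where f="\<lambda>a. \<gamma> (a \<otimes>\<^bsub>H\<^esub> y)", symmetric], rule ahomI) (use x y in simp_all)
  also have "\<dots> = SS H (D x) (\<lambda>a b. \<gamma> (a \<otimes>\<^bsub>H\<^esub> y) \<otimes>\<^bsub>H\<^esub> (\<epsilon> b \<odot>\<^bsub>H\<^esub> \<one>\<^bsub>H\<^esub>))"
    by (rule Sm_cong') (use y in simp)
  also have "\<dots> = SS H (D x) (\<lambda>a b. SS H (D b) (\<lambda>b1 b2. ?W a b1 b2))"
    by (rule Sm_cong', subst g_r'[symmetric, where f="\<lambda>z. \<gamma> (_ \<otimes>\<^bsub>H\<^esub> y) \<otimes>\<^bsub>H\<^esub> z"]) (use y in \<open>auto intro: H.mult_ahom_l simp: 1\<close>)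
  also have "\<dots> = SS H (D x) (\<lambda>a b. SS H (D a) (\<lambda>a1 a2. ?W a1 a2 b))"
    by (rule coassoc[symmetric, OF H.ag W x])
  also have "\<dots> = SS H (D x) (\<lambda>a b. \<gamma> y \<otimes>\<^bsub>H\<^esub> \<gamma> (\<epsilon> a \<odot>\<^bsub>H\<^esub> b))"
    by (rule Sm_cong', subst 2) (use y in simp_all)
  also have "\<dots> = \<gamma> y \<otimes>\<^bsub>H\<^esub> \<gamma> x"
    by (rule counit_l'[where f="\<lambda>b. \<gamma> y \<otimes>\<^bsub>H\<^esub> \<gamma> b"], rule ahomI) (use x y in simp_all)
  finally show ?thesis .
qed

lemma gi_mult [simp]: "x \<in> carrier H \<Longrightarrow> y \<in> carrier H \<Longrightarrow> \<gamma>i (x \<otimes>\<^bsub>H\<^esub> y) = \<gamma>i y \<otimes>\<^bsub>H\<^esub> \<gamma>i x"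
  by (rule g_inj) simp_all

lemma D_ahom: "abelian_group G \<Longrightarrow> bil k H G F \<Longrightarrow> ahom H G (\<lambda>x. SS G (D x) F)"
  by (rule ahomI) (simp_all add: D_add bilD(1))

lemma D_g:
  assumes G [simp]: "abelian_group G" and F: "bil k H G F" and h: "h \<in> carrier H"
  shows "SS G (D (\<gamma> h)) F = SS G (D h) (\<lambda>x y. F (\<gamma> y) (\<gamma> x))"
proof -
  note Fs [simp] = bilD[OF F]
  let ?Y = "\<lambda>u v p q r s. F (u \<otimes>\<^bsub>H\<^esub> (p \<otimes>\<^bsub>H\<^esub> \<gamma> s)) (v \<otimes>\<^bsub>H\<^esub> (q \<otimes>\<^bsub>H\<^esub> \<gamma> r))"
  \<comment> \<open>Here \<open>F\<close> is evaluated on \<Delta>(\<gamma>(a)) \<Delta>(b)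
    (\<gamma> \<otimes> \<gamma>)(\<Delta>^op(c)). For (a, b, c) running over the threefold
    coproduct of h, collapsing the last two factors or the first two gives the two sides of the
    claim.\<close>
  let ?K = "\<lambda>a b c. SS G (D (\<gamma> a)) (\<lambda>u v. SS G (D b) (\<lambda>p q. SS G (D c) (\<lambda>r s. ?Y u v p q r s)))"
  have bY: "bil k H G (\<lambda>p q. SS G (D c) (\<lambda>r s. ?Y u v p q r s))"
    "bil k H G (\<lambda>r s. SS G (D b) (\<lambda>p q. ?Y u v p q r s))"
    "bil k H G (\<lambda>u v. SS G (D b) (\<lambda>p q. SS G (D c) (\<lambda>r s. ?Y u v p q r s)))"
    "p \<in> carrier H \<Longrightarrow> q \<in> carrier H \<Longrightarrow> bil k H G (\<lambda>r s. ?Y u v p q r s)"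
    if "u \<in> carrier H" "v \<in> carrier H" "b \<in> carrier H" "c \<in> carrier H" for u v b c p q
    by (rule bilI; use that in simp)+
  have K: "tri k H G ?K"
    by (rule triI) (simp_all add: D_add[OF _ bY(1)] D_add[OF _ bY(3)] D_add[OF _ bY(4)] D_smult[OF _ bY(1)] D_smult[OF _ bY(3)] D_smult[OF _ bY(4)])
  have 1: "SS G (D y) (\<lambda>b c. SS G (D b) (\<lambda>p q. SS G (D c) (\<lambda>r s. ?Y u v p q r s))) = F (\<epsilon> y \<odot>\<^bsub>H\<^esub> u) v"
    if u: "u \<in> carrier H" "v \<in> carrier H" and y: "y \<in> carrier H" for u v y
  proof -
    have b4: "bil k H G (\<lambda>r s. ?Y u v p q r s)" if "p \<in> carrier H" "q \<in> carrier H" for p q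
      by (rule bilI) (use u that in simp_all)
    have "SS G (D y) (\<lambda>b c. SS G (D b) (\<lambda>p q. SS G (D c) (\<lambda>r s. ?Y u v p q r s))) =
        SS G (D y) (\<lambda>p z. SS G (D z) (\<lambda>q c. SS G (D c) (\<lambda>r s. ?Y u v p q r s)))"
      by (rule coassoc[OF G _ y], rule triI) (use u in \<open>simp_all add: D_add[OF _ b4] D_smult[OF _ b4]\<close>)
    \<comment> \<open>After two uses of coassociativity the middle parts q and r of the fourfold
      coproduct are adjacent, so q \<gamma>(r) collapses first and p \<gamma>(s) afterwards.\<close>
    also have "\<dots> = SS G (D y) (\<lambda>p z. SS G (D z) (\<lambda>w s. SS G (D w) (\<lambda>q r. ?Y u v p q r s)))"
      by (rule Sm_cong', rule coassoc[symmetric], simp, rule triI) (use u in simp_all)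
    also have "\<dots> = SS G (D y) (\<lambda>p z. SS G (D z) (\<lambda>w s. F (u \<otimes>\<^bsub>H\<^esub> (p \<otimes>\<^bsub>H\<^esub> \<gamma> (\<epsilon> w \<odot>\<^bsub>H\<^esub> s))) v))"
    proof (rule Sm_cong', rule Sm_cong')
      fix p z w s assume c: "p \<in> carrier H" "w \<in> carrier H" "s \<in> carrier H"
      have "ahom H G (\<lambda>x. F (u \<otimes>\<^bsub>H\<^esub> (p \<otimes>\<^bsub>H\<^esub> \<gamma> s)) (v \<otimes>\<^bsub>H\<^esub> x))"
        by (rule ahomI) (use u c in simp_all)
      from g_r'[OF this c(2)] show "SS G (D w) (\<lambda>q r. ?Y u v p q r s) = F (u \<otimes>\<^bsub>H\<^esub> (p \<otimes>\<^bsub>H\<^esub> \<gamma> (\<epsilon> w \<odot>\<^bsub>H\<^esub> s))) v"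
        using u c by simp
    qed
    also have "\<dots> = SS G (D y) (\<lambda>p z. F (u \<otimes>\<^bsub>H\<^esub> (p \<otimes>\<^bsub>H\<^esub> \<gamma> z)) v)"
      by (rule Sm_cong', rule counit_l'[where f="\<lambda>s. F (u \<otimes>\<^bsub>H\<^esub> (_ \<otimes>\<^bsub>H\<^esub> \<gamma> s)) v"], rule ahomI) (use u in simp_all)
    also have "\<dots> = F (u \<otimes>\<^bsub>H\<^esub> (\<epsilon> y \<odot>\<^bsub>H\<^esub> \<one>\<^bsub>H\<^esub>)) v"
      by (rule g_r'[where f="\<lambda>x. F (u \<otimes>\<^bsub>H\<^esub> x) v"], rule ahomI) (use u y in simp_all)
    finally show ?thesis using u y by simp
  qed
  have 2: "SS G (D x) (\<lambda>a b. ?K a b c) = SS G (D (\<epsilon> x \<odot>\<^bsub>H\<^esub> c)) (\<lambda>r s. F (\<gamma> s) (\<gamma> r))"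
    if x: "x \<in> carrier H" and c: "c \<in> carrier H" for x c
  proof -
    let ?F' = "\<lambda>u v. SS G (D c) (\<lambda>r s. F (u \<otimes>\<^bsub>H\<^esub> \<gamma> s) (v \<otimes>\<^bsub>H\<^esub> \<gamma> r))"
    have F': "bil k H G ?F'" by (rule bilI) (use c in simp_all)
    have b: "bil k H G (\<lambda>r s. F (\<gamma> s) (\<gamma> r))" by (rule bilI) simp_all
    have "SS G (D x) (\<lambda>a b. ?K a b c) = SS G (D x) (\<lambda>a b. SS G (D (\<gamma> a \<otimes>\<^bsub>H\<^esub> b)) ?F')"
      by (rule Sm_cong', subst D_mult[OF G F']) (use c in simp_all)
    also have "\<dots> = SS G (D (\<epsilon> x \<odot>\<^bsub>H\<^esub> \<one>\<^bsub>H\<^esub>)) ?F'"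
      by (rule g_l'[OF D_ahom[OF G F'] x])
    also have "\<dots> = ?F' (\<epsilon> x \<odot>\<^bsub>H\<^esub> \<one>\<^bsub>H\<^esub>) \<one>\<^bsub>H\<^esub>"
    proof -
      have "bil k H G (\<lambda>a b. ?F' (\<epsilon> x \<odot>\<^bsub>H\<^esub> a) b)"
        by (rule bilI) (use c x in \<open>simp_all add: H_scalars\<close>)
      from D_one[OF G this] show ?thesis using x by (subst D_smult[OF G F']) simp_all
    qed
    finally show ?thesis using x c by (simp add: D_smult[OF G b])
  qed
  have b: "bil k H G (\<lambda>r s. F (\<gamma> s) (\<gamma> r))" by (rule bilI) simp_all
  have "SS G (D (\<gamma> h)) F = SS G (D h) (\<lambda>a y. SS G (D (\<gamma> (\<epsilon> y \<odot>\<^bsub>H\<^esub> a))) F)"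
    by (rule counit_r'[symmetric, OF ahom_comp[OF g_ahom D_ahom[OF G F]] h])
  also have "\<dots> = SS G (D h) (\<lambda>a y. SS G (D y) (\<lambda>b c. ?K a b c))"
  proof (rule Sm_cong')
    fix a y assume ay: "a \<in> carrier H" "y \<in> carrier H"
    have "SS G (D (\<gamma> (\<epsilon> y \<odot>\<^bsub>H\<^esub> a))) F = SS G (D (\<gamma> a)) (\<lambda>u v. F (\<epsilon> y \<odot>\<^bsub>H\<^esub> u) v)"
      using ay by (simp add: D_smult[OF G F])
    also have "\<dots> = SS G (D (\<gamma> a)) (\<lambda>u v. SS G (D y) (\<lambda>b c. SS G (D b) (\<lambda>p q. SS G (D c) (\<lambda>r s. ?Y u v p q r s))))"
      by (rule Sm_cong', rule 1[symmetric]) (use ay in simp_all)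
    also have "\<dots> = SS G (D y) (\<lambda>b c. ?K a b c)"
      by (rule Sm_swap) (use ay in simp_all)
    finally show "SS G (D (\<gamma> (\<epsilon> y \<odot>\<^bsub>H\<^esub> a))) F = SS G (D y) (\<lambda>b c. ?K a b c)" .
  qed
  also have "\<dots> = SS G (D h) (\<lambda>x c. SS G (D x) (\<lambda>a b. ?K a b c))"
    by (rule coassoc[symmetric, OF G K h])
  also have "\<dots> = SS G (D h) (\<lambda>x c. SS G (D (\<epsilon> x \<odot>\<^bsub>H\<^esub> c)) (\<lambda>r s. F (\<gamma> s) (\<gamma> r)))"
    by (rule Sm_cong', rule 2)
  also have "\<dots> = SS G (D h) (\<lambda>r s. F (\<gamma> s) (\<gamma> r))"
    by (rule counit_l'[OF D_ahom[OF G b] h])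
  finally show ?thesis .
qed

lemma D_gi:
  assumes "abelian_group G" and F: "bil k H G F" and h: "h \<in> carrier H"
  shows "SS G (D (\<gamma>i h)) F = SS G (D h) (\<lambda>x y. F (\<gamma>i y) (\<gamma>i x))"
proof -
  have "bil k H G (\<lambda>x y. F (\<gamma>i y) (\<gamma>i x))" by (rule bilI) (simp_all add: bilD[OF F])
  from D_g[OF assms(1) this, of "\<gamma>i h"] h show ?thesis by simp
qed

end

section \<open>Opposite algebras and the opposite Hopf algebra\<close>

lemma opp_simps [simp]:
  "carrier (opp A) = carrier A" "x \<otimes>\<^bsub>opp A\<^esub> y = y \<otimes>\<^bsub>A\<^esub> x" "\<one>\<^bsub>opp A\<^esub> = \<one>\<^bsub>A\<^esub>" "\<zero>\<^bsub>opp A\<^esub> = \<zero>\<^bsub>A\<^esub>"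
  "add (opp A) = add A"
  by (simp_all add: opp_def)

lemma smult_opp [simp]: "smult (opp A) = smult A"
  by (simp add: opp_def)

lemma hopf_op_simps [simp]:
  "carrier (hopf_op H) = carrier H" "x \<otimes>\<^bsub>hopf_op H\<^esub> y = y \<otimes>\<^bsub>H\<^esub> x" "\<one>\<^bsub>hopf_op H\<^esub> = \<one>\<^bsub>H\<^esub>"
  "\<zero>\<^bsub>hopf_op H\<^esub> = \<zero>\<^bsub>H\<^esub>" "add (hopf_op H) = add H" "smult (hopf_op H) = smult H"
  "comult (hopf_op H) = comult H" "counit (hopf_op H) = counit H" "antipode (hopf_op H) = antipode_inv H"
  by (simp_all add: hopf_op_def opp_def)

lemma Sm_struct:
  assumes "add G = add G'" "\<zero>\<^bsub>G\<^esub> = \<zero>\<^bsub>G'\<^esub>"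
  shows "Sm P G xs f = Sm P G' xs f"
  using assms by (induction xs) (simp_all add: Sm_Cons)

lemma Sm_opp [simp]: "Sm P (opp G) xs f = Sm P G xs f" "Sm P (hopf_op H) xs f = Sm P H xs f"
  by (rule Sm_struct; simp)+

lemma tensor_op_r: "tensor S \<alpha> \<beta> M (hopf_op H) = tensor S \<alpha> \<beta> M H"
  and tensor_op_l: "tensor S' \<alpha>' \<beta>' (hopf_op H') M' = tensor S' \<alpha>' \<beta>' H' M'"
  by (simp_all add: tensor_def tensor_relations_def)

lemma kt_op [simp]: "kt2 k (hopf_op H) = kt2 k H" "kt3 k (hopf_op H) = kt3 k H"
proof -
  show 2: "kt2 k (hopf_op H) = kt2 k H" by (simp add: kt2_def tensor_op_l tensor_op_r)
  show "kt3 k (hopf_op H) = kt3 k H" by (simp add: kt3_def 2 tensor_op_r)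
qed

lemma abelian_group_struct:
  assumes "abelian_group A" "carrier A' = carrier A" "add A' = add A" "\<zero>\<^bsub>A'\<^esub> = \<zero>\<^bsub>A\<^esub>"
  shows "abelian_group A'"
proof -
  interpret A: abelian_group A by fact
  show ?thesis
    by (rule abelian_groupI, unfold assms) (auto simp: A.a_ac intro: A.add.l_inv_ex)
qed

text \<open>Stated for any record with reversed product, so it serves \<open>opp\<close> and
  \<open>hopf_op\<close> and, applied twice, records that differ from an algebra only in further
  fields.\<close>

lemma k_algebra_opposite:
  assumes "k_algebra k A" "carrier A' = carrier A" "\<And>x y. x \<otimes>\<^bsub>A'\<^esub> y = y \<otimes>\<^bsub>A\<^esub> x" "\<one>\<^bsub>A'\<^esub> = \<one>\<^bsub>A\<^esub>" "\<zero>\<^bsub>A'\<^esub> = \<zero>\<^bsub>A\<^esub>"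
    "add A' = add A" "smult A' = smult A"
  shows "k_algebra k A'"
proof -
  interpret A: alg k A by (rule alg.intro[OF assms(1)])
  have ag: "abelian_group A'" by (rule abelian_group_struct[OF A.ag]) (simp_all add: assms)
  have r: "ring A'"
    by (intro ringI ag monoidI) (simp_all add: assms)
  have m: "module k A'"
    by (intro moduleI ag A.m.R.is_cring) (simp_all add: assms A.m.smult_l_distr A.m.smult_assoc1)
  show ?thesis unfolding k_algebra_def using r m by (simp add: assms)
qed

section \<open>The antipode on R and the opposite quasitriangular structure\<close>

context represented_hopf
begin

text \<open>\<epsilon>(\<gamma>(h)) = \<epsilon>(\<gamma>(h_(1))) \<epsilon>(h_(2)) =
  \<epsilon>(\<gamma>(h_(1)) h_(2)) = \<epsilon>(h).\<close>

lemma eps_g [simp]: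
  assumes h: "h \<in> carrier H"
  shows "\<epsilon> (\<gamma> h) = \<epsilon> h"
proof -
  have K: "abelian_group k" using H.m.R.is_cring by (simp add: cring_def ring_def)
  have e: "ahom H k (\<lambda>x. \<epsilon> x)" "ahom H k (\<lambda>x. \<epsilon> (\<gamma> x))" by (auto intro!: ahomI K)
  have "\<epsilon> (\<gamma> h) = SS k (D h) (\<lambda>a b. \<epsilon> (\<gamma> (\<epsilon> b \<odot>\<^bsub>H\<^esub> a)))"
    using counit_r'[OF e(2) h] by simp
  also have "\<dots> = SS k (D h) (\<lambda>a b. \<epsilon> (\<gamma> a \<otimes>\<^bsub>H\<^esub> b))"
    by (rule Sm_cong') (simp add: H.m.m_comm)
  also have "\<dots> = \<epsilon> h" using g_l'[OF e(1) h] h by simp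
  finally show ?thesis .
qed

lemma eps_gi [simp]: "h \<in> carrier H \<Longrightarrow> \<epsilon> (\<gamma>i h) = \<epsilon> h"
  using eps_g[of "\<gamma>i h"] by simp

text \<open>The image of an antipode axiom under \<gamma>^-1, which reverses products; with
  \<open>gi_r\<close> this makes \<gamma>^-1 the antipode for the opposite product.\<close>

lemma gi_l: "h \<in> carrier H \<Longrightarrow> SS H (D h) (\<lambda>a b. \<gamma>i b \<otimes>\<^bsub>H\<^esub> a) = \<epsilon> h \<odot>\<^bsub>H\<^esub> \<one>\<^bsub>H\<^esub>"
  using arg_cong[OF g_l[of h], of \<gamma>i] by simp

lemma gi_r: "h \<in> carrier H \<Longrightarrow> SS H (D h) (\<lambda>a b. b \<otimes>\<^bsub>H\<^esub> \<gamma>i a) = \<epsilon> h \<odot>\<^bsub>H\<^esub> \<one>\<^bsub>H\<^esub>"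
  using arg_cong[OF g_r[of h], of \<gamma>i] by simp

lemma eps_R_l': "ahom H G f \<Longrightarrow> SS G rs (\<lambda>a b. f (\<epsilon> a \<odot>\<^bsub>H\<^esub> b)) = f \<one>\<^bsub>H\<^esub>"
  using Sm_hom[of H G f "carrier H" "\<lambda>a b. \<epsilon> a \<odot>\<^bsub>H\<^esub> b" rs] eps_R_l by simp

lemma eps_Rb_r': "ahom H G f \<Longrightarrow> SS G rb (\<lambda>c d. f (\<epsilon> d \<odot>\<^bsub>H\<^esub> c)) = f \<one>\<^bsub>H\<^esub>"
  using Sm_hom[of H G f "carrier H" "\<lambda>c d. \<epsilon> d \<odot>\<^bsub>H\<^esub> c" rb] represented_bialgebra.eps_R_l[OF represented_minus] by simp

text \<open>(\<gamma> \<otimes> id)(R) is a left inverse of R: by R_13 R_23 = (\<Delta> \<otimes>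
  id)(R), its product with R contains \<gamma>(x_(1)) x_(2) for x = R_1, which collapses. Inserting
  R R^-1 turns this into equality with R^-1.\<close>

lemma R_g:
  assumes G [simp]: "abelian_group G" and F: "bil k H G F"
  shows "SS G rs (\<lambda>a b. F (\<gamma> a) b) = SS G rb F"
proof -
  note Fs [simp] = bilD[OF F]
  have "SS G rs (\<lambda>a b. F (\<gamma> a) b) = SS G rs (\<lambda>a b. SS G rs (\<lambda>a' b'. SS G rb (\<lambda>c d. F (\<gamma> a \<otimes>\<^bsub>H\<^esub> (a' \<otimes>\<^bsub>H\<^esub> c)) ((b \<otimes>\<^bsub>H\<^esub> b') \<otimes>\<^bsub>H\<^esub> d))))"
  proof (rule Sm_cong')
    fix a b assume ab: "a \<in> carrier H" "b \<in> carrier H"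
    have "bil k H G (\<lambda>u v. F (\<gamma> a \<otimes>\<^bsub>H\<^esub> u) (b \<otimes>\<^bsub>H\<^esub> v))" by (rule bilI) (use ab in simp_all)
    from Rinv1[OF G this] ab
    show "F (\<gamma> a) b = SS G rs (\<lambda>a' b'. SS G rb (\<lambda>c d. F (\<gamma> a \<otimes>\<^bsub>H\<^esub> (a' \<otimes>\<^bsub>H\<^esub> c)) ((b \<otimes>\<^bsub>H\<^esub> b') \<otimes>\<^bsub>H\<^esub> d)))" by simp
  qed
  also have "\<dots> = SS G rs (\<lambda>a b. SS G (D a) (\<lambda>x y. SS G rb (\<lambda>c d. F (\<gamma> x \<otimes>\<^bsub>H\<^esub> (y \<otimes>\<^bsub>H\<^esub> c)) (b \<otimes>\<^bsub>H\<^esub> d))))"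
    by (rule hexL[symmetric], simp, rule triI) simp_all
  also have "\<dots> = SS G rs (\<lambda>a b. SS G rb (\<lambda>c d. F c ((\<epsilon> a \<odot>\<^bsub>H\<^esub> b) \<otimes>\<^bsub>H\<^esub> d)))"
  proof (rule Sm_cong')
    fix a b assume ab: "a \<in> carrier H" "b \<in> carrier H"
    have "ahom H G (\<lambda>z. SS G rb (\<lambda>c d. F (z \<otimes>\<^bsub>H\<^esub> c) (b \<otimes>\<^bsub>H\<^esub> d)))" by (rule ahomI) (use ab in simp_all)
    from g_l'[OF this ab(1)] ab
    show "SS G (D a) (\<lambda>x y. SS G rb (\<lambda>c d. F (\<gamma> x \<otimes>\<^bsub>H\<^esub> (y \<otimes>\<^bsub>H\<^esub> c)) (b \<otimes>\<^bsub>H\<^esub> d))) =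
      SS G rb (\<lambda>c d. F c ((\<epsilon> a \<odot>\<^bsub>H\<^esub> b) \<otimes>\<^bsub>H\<^esub> d))" by simp
  qed
  also have "\<dots> = SS G rb (\<lambda>c d. F c (\<one>\<^bsub>H\<^esub> \<otimes>\<^bsub>H\<^esub> d))"
    by (rule eps_R_l'[where f="\<lambda>z. SS G rb (\<lambda>c d. F c (z \<otimes>\<^bsub>H\<^esub> d))"], rule ahomI) simp_all
  finally show ?thesis by simp
qed

text \<open>By the same argument with (id \<otimes> \<Delta>)(R^-1), the element (id \<otimes>
  \<gamma>)(R^-1) is a left inverse of R^-1, hence equal to R.\<close>

lemma Rb_g:
  assumes G [simp]: "abelian_group G" and F: "bil k H G F"
  shows "SS G rb (\<lambda>c d. F c (\<gamma> d)) = SS G rs F"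
proof -
  note Fs [simp] = bilD[OF F]
  have "SS G rb (\<lambda>c d. F c (\<gamma> d)) = SS G rb (\<lambda>c d. SS G rb (\<lambda>c' d'. SS G rs (\<lambda>a b. F ((c \<otimes>\<^bsub>H\<^esub> c') \<otimes>\<^bsub>H\<^esub> a) (\<gamma> d \<otimes>\<^bsub>H\<^esub> (d' \<otimes>\<^bsub>H\<^esub> b)))))"
  proof (rule Sm_cong')
    fix c d assume cd: "c \<in> carrier H" "d \<in> carrier H"
    have "bil k H G (\<lambda>u v. F (c \<otimes>\<^bsub>H\<^esub> u) (\<gamma> d \<otimes>\<^bsub>H\<^esub> v))" by (rule bilI) (use cd in simp_all)
    from Rinv2[OF G this] cd
    show "F c (\<gamma> d) = SS G rb (\<lambda>c' d'. SS G rs (\<lambda>a b. F ((c \<otimes>\<^bsub>H\<^esub> c') \<otimes>\<^bsub>H\<^esub> a) (\<gamma> d \<otimes>\<^bsub>H\<^esub> (d' \<otimes>\<^bsub>H\<^esub> b))))" by simp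
  qed
  also have "\<dots> = SS G rb (\<lambda>c d. SS G (D d) (\<lambda>x y. SS G rs (\<lambda>a b. F (c \<otimes>\<^bsub>H\<^esub> a) (\<gamma> x \<otimes>\<^bsub>H\<^esub> (y \<otimes>\<^bsub>H\<^esub> b)))))"
    by (rule Rb_hexR[symmetric], simp, rule triI) simp_all
  also have "\<dots> = SS G rb (\<lambda>c d. SS G rs (\<lambda>a b. F ((\<epsilon> d \<odot>\<^bsub>H\<^esub> c) \<otimes>\<^bsub>H\<^esub> a) b))"
  proof (rule Sm_cong')
    fix c d assume cd: "c \<in> carrier H" "d \<in> carrier H"
    have "ahom H G (\<lambda>z. SS G rs (\<lambda>a b. F (c \<otimes>\<^bsub>H\<^esub> a) (z \<otimes>\<^bsub>H\<^esub> b)))" by (rule ahomI) (use cd in simp_all)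
    from g_l'[OF this cd(2)] cd
    show "SS G (D d) (\<lambda>x y. SS G rs (\<lambda>a b. F (c \<otimes>\<^bsub>H\<^esub> a) (\<gamma> x \<otimes>\<^bsub>H\<^esub> (y \<otimes>\<^bsub>H\<^esub> b)))) =
      SS G rs (\<lambda>a b. F ((\<epsilon> d \<odot>\<^bsub>H\<^esub> c) \<otimes>\<^bsub>H\<^esub> a) b)" by simp
  qed
  also have "\<dots> = SS G rs (\<lambda>a b. F (\<one>\<^bsub>H\<^esub> \<otimes>\<^bsub>H\<^esub> a) b)"
    by (rule eps_Rb_r'[where f="\<lambda>z. SS G rs (\<lambda>a b. F (z \<otimes>\<^bsub>H\<^esub> a) b)"], rule ahomI) simp_all
  finally show ?thesis by simp
qed

lemma R_gi:
  assumes "abelian_group G" and F: "bil k H G F"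
  shows "SS G rs (\<lambda>a b. F a (\<gamma>i b)) = SS G rb F"
proof -
  have "bil k H G (\<lambda>a b. F a (\<gamma>i b))" by (rule bilI) (simp_all add: bilD[OF F])
  from Rb_g[OF assms(1) this] show ?thesis by simp
qed

lemma Rb_gg:
  assumes "abelian_group G" and F: "bil k H G F"
  shows "SS G rb (\<lambda>c d. F (\<gamma> c) (\<gamma> d)) = SS G rb F"
proof -
  have b: "bil k H G (\<lambda>a b. F (\<gamma> a) b)" by (rule bilI) (simp_all add: bilD[OF F])
  show ?thesis unfolding Rb_g[OF assms(1) b] by (rule R_g[OF assms])
qed

text \<open>(\<gamma> \<otimes> id)(R) = R^-1 and (id \<otimes> \<gamma>)(R^-1) = R compose to
  invariance of R under \<gamma> \<otimes> \<gamma>.\<close>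

lemma R_gg:
  assumes "abelian_group G" and F: "bil k H G F"
  shows "SS G rs (\<lambda>a b. F (\<gamma> a) (\<gamma> b)) = SS G rs F"
proof -
  have b: "bil k H G (\<lambda>a b. F a (\<gamma> b))" by (rule bilI) (simp_all add: bilD[OF F])
  show ?thesis unfolding R_g[OF assms(1) b] by (rule Rb_g[OF assms])
qed

lemma Rb_gigi:
  assumes "abelian_group G" and F: "bil k H G F"
  shows "SS G rb (\<lambda>c d. F (\<gamma>i c) (\<gamma>i d)) = SS G rb F"
proof -
  have "bil k H G (\<lambda>a b. F (\<gamma>i a) (\<gamma>i b))" by (rule bilI) (simp_all add: bilD[OF F])
  from Rb_gg[OF assms(1) this] show ?thesis by simp
qed

lemma R_gigi:
  assumes "abelian_group G" and F: "bil k H G F"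
  shows "SS G rs (\<lambda>a b. F (\<gamma>i a) (\<gamma>i b)) = SS G rs F"
proof -
  have "bil k H G (\<lambda>a b. F (\<gamma>i a) (\<gamma>i b))" by (rule bilI) (simp_all add: bilD[OF F])
  from R_gg[OF assms(1) this] show ?thesis by simp
qed

text \<open>Reversing the product of H turns the hexagon identities of R^-1 into those of a
  universal R-matrix, with \<open>rs\<close> and \<open>rb\<close> exchanging roles. The reversed
  product of L fits because \<gamma>^-1 reverses coproducts, and its commutativity is
  \<open>H_comm_minus\<close> together with invariance of R^-1 under \<gamma>^-1 \<otimes>
  \<gamma>^-1.\<close>

lemma represented_op:
  "represented_bialgebra k (hopf_op H) (Sm (carrier H) (kt2 k H) rb (\<lambda>a b. a \<boxtimes>\<^bsub>kt2 k H\<^esub> b)) (opp L) (act_op H act) D rb rs"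
proof -
  have Hop: "k_algebra k (hopf_op H)" by (rule k_algebra_opposite[OF H_alg]) simp_all
  have Lop: "k_algebra k (opp L)" by (rule k_algebra_opposite[OF L_alg]) simp_all
  have t1: "tri k H T3 (\<lambda>a b c. (a \<boxtimes>\<^bsub>T2\<^esub> b) \<boxtimes>\<^bsub>T3\<^esub> c)" by (rule triI) simp_all
  have b: "bil k H T2 (\<lambda>a b. a \<boxtimes>\<^bsub>T2\<^esub> b)" by (rule bilI) simp_all
  show ?thesis
  proof (rule represented_bialgebra.intro[OF Hop Lop])
    fix x y assume xy: "x \<in> carrier (hopf_op H)" "y \<in> carrier (hopf_op H)"
    then show "comult (hopf_op H) (x \<otimes>\<^bsub>hopf_op H\<^esub> y) =
        Sm (carrier (hopf_op H)) (kt2 k (hopf_op H)) (D x) (\<lambda>a b. Sm (carrier (hopf_op H)) (kt2 k (hopf_op H)) (D y)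
          (\<lambda>c d. (a \<otimes>\<^bsub>hopf_op H\<^esub> c) \<boxtimes>\<^bsub>kt2 k (hopf_op H)\<^esub> (b \<otimes>\<^bsub>hopf_op H\<^esub> d)))"
      by (simp add: comult_mult, subst Sm_swap) simp_all
  next
    show "Sm (carrier (hopf_op H)) (kt3 k (hopf_op H)) rb (\<lambda>a b. Sm (carrier (hopf_op H)) (kt3 k (hopf_op H)) (D a)
          (\<lambda>c d. (c \<boxtimes>\<^bsub>kt2 k (hopf_op H)\<^esub> d) \<boxtimes>\<^bsub>kt3 k (hopf_op H)\<^esub> b)) =
        Sm (carrier (hopf_op H)) (kt3 k (hopf_op H)) rb (\<lambda>a b. Sm (carrier (hopf_op H)) (kt3 k (hopf_op H)) rb
          (\<lambda>c d. (a \<boxtimes>\<^bsub>kt2 k (hopf_op H)\<^esub> c) \<boxtimes>\<^bsub>kt3 k (hopf_op H)\<^esub> (b \<otimes>\<^bsub>hopf_op H\<^esub> d)))"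
      using Rb_hexL[OF _ t1] by (simp, subst Sm_swap) simp_all
    show "Sm (carrier (hopf_op H)) (kt3 k (hopf_op H)) rb (\<lambda>a b. Sm (carrier (hopf_op H)) (kt3 k (hopf_op H)) (D b)
          (\<lambda>c d. (a \<boxtimes>\<^bsub>kt2 k (hopf_op H)\<^esub> c) \<boxtimes>\<^bsub>kt3 k (hopf_op H)\<^esub> d)) =
        Sm (carrier (hopf_op H)) (kt3 k (hopf_op H)) rb (\<lambda>a b. Sm (carrier (hopf_op H)) (kt3 k (hopf_op H)) rb
          (\<lambda>c d. ((a \<otimes>\<^bsub>hopf_op H\<^esub> c) \<boxtimes>\<^bsub>kt2 k (hopf_op H)\<^esub> d) \<boxtimes>\<^bsub>kt3 k (hopf_op H)\<^esub> b))"
      using Rb_hexR[OF _ t1] by (simp, subst Sm_swap) simp_all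
    show "Sm (carrier (hopf_op H)) (kt2 k (hopf_op H)) rb (\<lambda>a b. Sm (carrier (hopf_op H)) (kt2 k (hopf_op H)) rs
          (\<lambda>c d. (a \<otimes>\<^bsub>hopf_op H\<^esub> c) \<boxtimes>\<^bsub>kt2 k (hopf_op H)\<^esub> (b \<otimes>\<^bsub>hopf_op H\<^esub> d))) =
        \<one>\<^bsub>hopf_op H\<^esub> \<boxtimes>\<^bsub>kt2 k (hopf_op H)\<^esub> \<one>\<^bsub>hopf_op H\<^esub>"
      using Rinv1[OF _ b] by (simp, subst Sm_swap) simp_all
    show "Sm (carrier (hopf_op H)) (kt2 k (hopf_op H)) rs (\<lambda>a b. Sm (carrier (hopf_op H)) (kt2 k (hopf_op H)) rb
          (\<lambda>c d. (a \<otimes>\<^bsub>hopf_op H\<^esub> c) \<boxtimes>\<^bsub>kt2 k (hopf_op H)\<^esub> (b \<otimes>\<^bsub>hopf_op H\<^esub> d))) =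
        \<one>\<^bsub>hopf_op H\<^esub> \<boxtimes>\<^bsub>kt2 k (hopf_op H)\<^esub> \<one>\<^bsub>hopf_op H\<^esub>"
      using Rinv2[OF _ b] by (simp, subst Sm_swap) simp_all
    fix h assume h: "h \<in> carrier (hopf_op H)"
    then show "Sm (carrier (hopf_op H)) (kt2 k (hopf_op H)) rb (\<lambda>a b. Sm (carrier (hopf_op H)) (kt2 k (hopf_op H)) (D h)
          (\<lambda>c d. (a \<otimes>\<^bsub>hopf_op H\<^esub> c) \<boxtimes>\<^bsub>kt2 k (hopf_op H)\<^esub> (b \<otimes>\<^bsub>hopf_op H\<^esub> d))) =
        Sm (carrier (hopf_op H)) (kt2 k (hopf_op H)) (D h) (\<lambda>c d. Sm (carrier (hopf_op H)) (kt2 k (hopf_op H)) rb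
          (\<lambda>a b. (d \<otimes>\<^bsub>hopf_op H\<^esub> a) \<boxtimes>\<^bsub>kt2 k (hopf_op H)\<^esub> (c \<otimes>\<^bsub>hopf_op H\<^esub> b)))"
    proof -
      have "SS T2 rb (\<lambda>a b. SS T2 (D h) (\<lambda>c d. (c \<otimes>\<^bsub>H\<^esub> a) \<boxtimes>\<^bsub>T2\<^esub> (d \<otimes>\<^bsub>H\<^esub> b))) =
          SS T2 (D h) (\<lambda>c d. SS T2 rb (\<lambda>a b. (c \<otimes>\<^bsub>H\<^esub> a) \<boxtimes>\<^bsub>T2\<^esub> (d \<otimes>\<^bsub>H\<^esub> b)))"
        by (rule Sm_swap) simp_all
      also have "\<dots> = SS T2 rb (\<lambda>a b. SS T2 (D h) (\<lambda>c d. (a \<otimes>\<^bsub>H\<^esub> d) \<boxtimes>\<^bsub>T2\<^esub> (b \<otimes>\<^bsub>H\<^esub> c)))"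
        using Rb_comm[OF _ b, of h] h by simp
      also have "\<dots> = SS T2 (D h) (\<lambda>c d. SS T2 rb (\<lambda>a b. (a \<otimes>\<^bsub>H\<^esub> d) \<boxtimes>\<^bsub>T2\<^esub> (b \<otimes>\<^bsub>H\<^esub> c)))"
        by (rule Sm_swap) simp_all
      finally show ?thesis by simp
    qed
    fix l m assume l: "l \<in> carrier (opp L)" "m \<in> carrier (opp L)"
    have "bil k H L (\<lambda>a b. act a m \<otimes>\<^bsub>L\<^esub> act b l)" by (rule bilI) (use l in simp_all)
    from D_gi[OF L.ag this, of h] h l
    show "act_op H act h (l \<otimes>\<^bsub>opp L\<^esub> m) =
        Sm (carrier (hopf_op H)) (opp L) (D h) (\<lambda>a b. act_op H act a l \<otimes>\<^bsub>opp L\<^esub> act_op H act b m)"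
      by (simp add: act_op_def act_prod)
  next
    fix l m assume l: "l \<in> carrier (opp L)" "m \<in> carrier (opp L)"
    have "bil k H L (\<lambda>a b. act a l \<otimes>\<^bsub>L\<^esub> act b m)" by (rule bilI) (use l in simp_all)
    from Rb_gigi[OF L.ag this] H_comm_minus[of m l] l
    show "l \<otimes>\<^bsub>opp L\<^esub> m = Sm (carrier (hopf_op H)) (opp L) rb (\<lambda>a b. act_op H act b m \<otimes>\<^bsub>opp L\<^esub> act_op H act a l)"
      by (simp add: act_op_def)
  qed (simp_all add: comult_eq[symmetric] comult_add comult_smult comult_one coassoc0 counit_l counit_r act_op_def H.m.m_comm)
qed

section \<open>The Drinfeld element and its inverse\<close>

definition drv where "drv = SS H rs (\<lambda>a b. a \<otimes>\<^bsub>H\<^esub> \<gamma> b)"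
text \<open>Candidate for the inverse of v, confirmed by \<open>drv_drw\<close> and
  \<open>drw_drv\<close>. It is this expression that arises when t^+ is transported through the
  identification of opposites.\<close>

definition drw where "drw = SS H rb (\<lambda>c d. c \<otimes>\<^bsub>H\<^esub> \<gamma>i d)"

lemma drv_closed [simp]: "drv \<in> carrier H" and drw_closed [simp]: "drw \<in> carrier H"
  by (simp_all add: drv_def drw_def)

lemma drinfeld_eq: "drinfeld H R = drv"
proof -
  have "bil k H H (\<lambda>a b. a \<otimes>\<^bsub>H\<^esub> \<gamma> b)" by (rule bilI) simp_all
  from lift_eq(2)[OF _ this] show ?thesis by (simp add: drinfeld_def drv_def)
qed

text \<open>R \<Delta>(h) = \<Delta>^op(h) R is evaluated at u \<otimes> w \<mapsto> u \<gamma>(w).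
  The side with \<Delta>^op gives the sum, while on the other side h_(1) \<gamma>(h_(2)) collapses
  to \<epsilon>(h).\<close>

lemma drv_conj:
  assumes h: "h \<in> carrier H"
  shows "SS H (D h) (\<lambda>x y. y \<otimes>\<^bsub>H\<^esub> (drv \<otimes>\<^bsub>H\<^esub> \<gamma> x)) = \<epsilon> h \<odot>\<^bsub>H\<^esub> drv"
proof -
  have b: "bil k H H (\<lambda>u v. u \<otimes>\<^bsub>H\<^esub> \<gamma> v)" by (rule bilI) simp_all
  have "SS H (D h) (\<lambda>x y. y \<otimes>\<^bsub>H\<^esub> (drv \<otimes>\<^bsub>H\<^esub> \<gamma> x)) =
      SS H (D h) (\<lambda>x y. SS H rs (\<lambda>a b. (y \<otimes>\<^bsub>H\<^esub> a) \<otimes>\<^bsub>H\<^esub> \<gamma> (x \<otimes>\<^bsub>H\<^esub> b)))"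
    by (simp add: drv_def)
  also have "\<dots> = SS H rs (\<lambda>a b. SS H (D h) (\<lambda>x y. (a \<otimes>\<^bsub>H\<^esub> x) \<otimes>\<^bsub>H\<^esub> \<gamma> (b \<otimes>\<^bsub>H\<^esub> y)))"
    by (rule Rcomm[symmetric, OF _ b h]) simp
  also have "\<dots> = SS H rs (\<lambda>a b. a \<otimes>\<^bsub>H\<^esub> ((\<epsilon> h \<odot>\<^bsub>H\<^esub> \<one>\<^bsub>H\<^esub>) \<otimes>\<^bsub>H\<^esub> \<gamma> b))"
  proof (rule Sm_cong')
    fix a b assume ab: "a \<in> carrier H" "b \<in> carrier H"
    have "ahom H H (\<lambda>z. a \<otimes>\<^bsub>H\<^esub> (z \<otimes>\<^bsub>H\<^esub> \<gamma> b))" by (rule ahomI) (use ab in simp_all)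
    from g_r'[OF this h] ab h show "SS H (D h) (\<lambda>x y. (a \<otimes>\<^bsub>H\<^esub> x) \<otimes>\<^bsub>H\<^esub> \<gamma> (b \<otimes>\<^bsub>H\<^esub> y)) = a \<otimes>\<^bsub>H\<^esub> ((\<epsilon> h \<odot>\<^bsub>H\<^esub> \<one>\<^bsub>H\<^esub>) \<otimes>\<^bsub>H\<^esub> \<gamma> b)"
      by simp
  qed
  also have "\<dots> = \<epsilon> h \<odot>\<^bsub>H\<^esub> drv" using h by (simp add: drv_def H.smult_Sm)
  finally show ?thesis .
qed

text \<open>Conjugation by v is \<gamma>^-2. Expand y by the counit, replace \<epsilon>(q) v by
  \<open>drv_conj\<close>, and regroup by coassociativity: then \<gamma>(r) \<gamma>(\<gamma>(p)) =
  \<gamma>(\<gamma>(p) r) collapses.\<close>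

lemma drv_g2:
  assumes y: "y \<in> carrier H"
  shows "y \<otimes>\<^bsub>H\<^esub> drv = drv \<otimes>\<^bsub>H\<^esub> \<gamma> (\<gamma> y)"
proof -
  have "drv \<otimes>\<^bsub>H\<^esub> \<gamma> (\<gamma> y) = SS H (D y) (\<lambda>p q. drv \<otimes>\<^bsub>H\<^esub> \<gamma> (\<gamma> (\<epsilon> q \<odot>\<^bsub>H\<^esub> p)))"
    by (rule counit_r'[where f="\<lambda>p. drv \<otimes>\<^bsub>H\<^esub> \<gamma> (\<gamma> p)", symmetric], rule ahomI) (use y in simp_all)
  also have "\<dots> = SS H (D y) (\<lambda>p q. (\<epsilon> q \<odot>\<^bsub>H\<^esub> drv) \<otimes>\<^bsub>H\<^esub> \<gamma> (\<gamma> p))"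
    by simp
  also have "\<dots> = SS H (D y) (\<lambda>p q. SS H (D q) (\<lambda>r s. s \<otimes>\<^bsub>H\<^esub> (drv \<otimes>\<^bsub>H\<^esub> (\<gamma> r \<otimes>\<^bsub>H\<^esub> \<gamma> (\<gamma> p)))))"
    by (rule Sm_cong', subst drv_conj[symmetric]) simp_all
  also have "\<dots> = SS H (D y) (\<lambda>x s. SS H (D x) (\<lambda>p r. s \<otimes>\<^bsub>H\<^esub> (drv \<otimes>\<^bsub>H\<^esub> (\<gamma> r \<otimes>\<^bsub>H\<^esub> \<gamma> (\<gamma> p)))))"
    by (rule coassoc[symmetric, OF _ _ y], simp, rule triI) simp_all
  also have "\<dots> = SS H (D y) (\<lambda>x s. s \<otimes>\<^bsub>H\<^esub> (drv \<otimes>\<^bsub>H\<^esub> \<gamma> (\<epsilon> x \<odot>\<^bsub>H\<^esub> \<one>\<^bsub>H\<^esub>)))"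
  proof (rule Sm_cong')
    fix x s assume xs: "x \<in> carrier H" "s \<in> carrier H"
    have "ahom H H (\<lambda>z. s \<otimes>\<^bsub>H\<^esub> (drv \<otimes>\<^bsub>H\<^esub> \<gamma> z))" by (rule ahomI) (use xs in simp_all)
    from g_l'[OF this xs(1)] xs
    show "SS H (D x) (\<lambda>p r. s \<otimes>\<^bsub>H\<^esub> (drv \<otimes>\<^bsub>H\<^esub> (\<gamma> r \<otimes>\<^bsub>H\<^esub> \<gamma> (\<gamma> p)))) = s \<otimes>\<^bsub>H\<^esub> (drv \<otimes>\<^bsub>H\<^esub> \<gamma> (\<epsilon> x \<odot>\<^bsub>H\<^esub> \<one>\<^bsub>H\<^esub>))"
      by simp
  qed
  also have "\<dots> = SS H (D y) (\<lambda>x s. (\<epsilon> x \<odot>\<^bsub>H\<^esub> s) \<otimes>\<^bsub>H\<^esub> drv)" by simp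
  also have "\<dots> = y \<otimes>\<^bsub>H\<^esub> drv"
    by (rule counit_l'[OF H.mult_ahom_r]) (use y in simp_all)
  finally show ?thesis by simp
qed

lemma gi_drv: "y \<in> carrier H \<Longrightarrow> drv \<otimes>\<^bsub>H\<^esub> y = \<gamma>i (\<gamma>i y) \<otimes>\<^bsub>H\<^esub> drv"
  using drv_g2[of "\<gamma>i (\<gamma>i y)"] by simp

text \<open>Passing v across the first component of R^-1 puts \<gamma>^-2 on both components, as
  \<gamma>^-1(d) = \<gamma>(\<gamma>^-2(d)). R^-1 is invariant under \<gamma>^-1 \<otimes>
  \<gamma>^-1, and what remains is R^-1 R = 1 evaluated at u \<otimes> w \<mapsto> u
  \<gamma>(w).\<close>

lemma drv_drw: "drv \<otimes>\<^bsub>H\<^esub> drw = \<one>\<^bsub>H\<^esub>"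
proof -
  have b: "bil k H H (\<lambda>u v. u \<otimes>\<^bsub>H\<^esub> \<gamma> v)" by (rule bilI) simp_all
  let ?F = "\<lambda>c d. c \<otimes>\<^bsub>H\<^esub> (drv \<otimes>\<^bsub>H\<^esub> \<gamma> d)"
  have F: "bil k H H ?F" and F': "bil k H H (\<lambda>c d. ?F (\<gamma>i c) (\<gamma>i d))" by (rule bilI; simp)+
  have "drv \<otimes>\<^bsub>H\<^esub> drw = SS H rb (\<lambda>c d. (drv \<otimes>\<^bsub>H\<^esub> c) \<otimes>\<^bsub>H\<^esub> \<gamma>i d)" by (simp add: drw_def)
  also have "\<dots> = SS H rb (\<lambda>c d. ?F (\<gamma>i (\<gamma>i c)) (\<gamma>i (\<gamma>i d)))"
    by (rule Sm_cong', subst gi_drv) simp_all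
  also have "\<dots> = SS H rb ?F" unfolding Rb_gigi[OF H.ag F'] by (rule Rb_gigi[OF H.ag F])
  also have "\<dots> = SS H rb (\<lambda>c d. SS H rs (\<lambda>a b. (c \<otimes>\<^bsub>H\<^esub> a) \<otimes>\<^bsub>H\<^esub> \<gamma> (d \<otimes>\<^bsub>H\<^esub> b)))"
    by (simp add: drv_def)
  also have "\<dots> = \<one>\<^bsub>H\<^esub>" using Rinv2[OF H.ag b] by simp
  finally show ?thesis .
qed

lemma drw_drv: "drw \<otimes>\<^bsub>H\<^esub> drv = \<one>\<^bsub>H\<^esub>"
proof -
  have b: "bil k H H (\<lambda>u v. u \<otimes>\<^bsub>H\<^esub> \<gamma> v)" by (rule bilI) simp_all
  have "drw \<otimes>\<^bsub>H\<^esub> drv = SS H rb (\<lambda>c d. c \<otimes>\<^bsub>H\<^esub> (drv \<otimes>\<^bsub>H\<^esub> \<gamma> d))"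
  proof -
    have "drw \<otimes>\<^bsub>H\<^esub> drv = SS H rb (\<lambda>c d. c \<otimes>\<^bsub>H\<^esub> (\<gamma>i d \<otimes>\<^bsub>H\<^esub> drv))" by (simp add: drw_def)
    also have "\<dots> = SS H rb (\<lambda>c d. c \<otimes>\<^bsub>H\<^esub> (drv \<otimes>\<^bsub>H\<^esub> \<gamma> d))"
      by (rule Sm_cong', subst drv_g2) simp_all
    finally show ?thesis .
  qed
  also have "\<dots> = SS H rb (\<lambda>c d. SS H rs (\<lambda>a b. (c \<otimes>\<^bsub>H\<^esub> a) \<otimes>\<^bsub>H\<^esub> \<gamma> (d \<otimes>\<^bsub>H\<^esub> b)))"
    by (simp add: drv_def)
  also have "\<dots> = \<one>\<^bsub>H\<^esub>" using Rinv2[OF H.ag b] by simp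
  finally show ?thesis .
qed

lemma drw_gi2:
  assumes y: "y \<in> carrier H"
  shows "drw \<otimes>\<^bsub>H\<^esub> \<gamma>i (\<gamma>i y) = y \<otimes>\<^bsub>H\<^esub> drw"
proof -
  have "drw \<otimes>\<^bsub>H\<^esub> \<gamma>i (\<gamma>i y) = drw \<otimes>\<^bsub>H\<^esub> ((\<gamma>i (\<gamma>i y) \<otimes>\<^bsub>H\<^esub> drv) \<otimes>\<^bsub>H\<^esub> drw)"
    using y by (simp add: drv_drw)
  also have "\<dots> = (drw \<otimes>\<^bsub>H\<^esub> drv) \<otimes>\<^bsub>H\<^esub> (y \<otimes>\<^bsub>H\<^esub> drw)"
    unfolding gi_drv[OF y, symmetric] using y by simp
  also have "\<dots> = y \<otimes>\<^bsub>H\<^esub> drw" using y by (simp only: drw_drv) simp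
  finally show ?thesis .
qed

lemma inv_drinfeld: "inv\<^bsub>H\<^esub> (drinfeld H R) = drw"
  unfolding drinfeld_eq by (rule H.inv_char) (simp_all add: drv_drw drw_drv)

end

lemma Sm_pred:
  assumes "abelian_group G" "P \<zero>\<^bsub>G\<^esub>" "\<And>x y. x \<in> carrier G \<Longrightarrow> y \<in> carrier G \<Longrightarrow> P x \<Longrightarrow> P y \<Longrightarrow> P (x \<oplus>\<^bsub>G\<^esub> y)"
    "\<And>a b. a \<in> Q \<Longrightarrow> b \<in> Q \<Longrightarrow> P (f a b)" "\<And>a b. a \<in> Q \<Longrightarrow> b \<in> Q \<Longrightarrow> f a b \<in> carrier G"
  shows "P (Sm Q G xs f)"
  using assms by (induction xs) (auto simp: Sm_Cons)

lemma k_algebra_cong: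
  assumes "k_algebra k A" "carrier A' = carrier A" "\<And>x y. x \<otimes>\<^bsub>A'\<^esub> y = x \<otimes>\<^bsub>A\<^esub> y" "\<one>\<^bsub>A'\<^esub> = \<one>\<^bsub>A\<^esub>" "\<zero>\<^bsub>A'\<^esub> = \<zero>\<^bsub>A\<^esub>"
    "add A' = add A" "smult A' = smult A"
  shows "k_algebra k A'"
proof -
  have "k_algebra k (opp A)" by (rule k_algebra_opposite[OF assms(1)]) simp_all
  then show ?thesis by (rule k_algebra_opposite) (simp_all add: assms(2-))
qed

lemma coopposite_simps [simp]:
  "carrier (coopposite L B) = carrier B" "x \<otimes>\<^bsub>coopposite L B\<^esub> y = x \<otimes>\<^bsub>B\<^esub> y" "mult (coopposite L B) = mult B"
  "\<one>\<^bsub>coopposite L B\<^esub> = \<one>\<^bsub>B\<^esub>" "\<zero>\<^bsub>coopposite L B\<^esub> = \<zero>\<^bsub>B\<^esub>" "add (coopposite L B) = add B" "smult (coopposite L B) = smult B"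
  "src (coopposite L B) = tgt B" "tgt (coopposite L B) = src B" "cop (coopposite L B) = cop_op L B"
  "cou (coopposite L B) = cou B" "rmat (coopposite L B) = (THE Q'. rmat_inverse L B (rmat B) Q')"
  by (simp_all add: coopposite_def)

context dynamical_rep
begin

lemma dlift_tgt:
  assumes l: "l \<in> carrier L"
  shows "dlift (tgt DQ l) = t l"
proof -
  interpret DD: dynamical_rep k H R L act D rs rb DQ "src DQ" jH "tgt DQ" by (rule DQ_dynamical_rep)
  have h: "ahom DQ C dlift" by (rule alg_hom_ahom[OF dlift_alg_hom]) simp_all
  show ?thesis
    using l by (simp add: DD.t_plus t_plus Sm_hom[OF h] alg_homD(3)[OF dlift_alg_hom] dlift_src dlift_jH)
qed

end

section \<open>The isomorphism\<close>

locale presented_hom = P: presented_groupoid k H R L act D rs rb B i + Q: presented_groupoid k H R L act D rs rb B' i'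
  for k :: "('k, 'x) ring_scheme" and H :: "('k, 'h, 'y) hopf_scheme" and R :: "('h, 'h) tens"
    and L :: "('k, 'l, 'z) module_scheme" and act :: "'h \<Rightarrow> 'l \<Rightarrow> 'l"
    and D :: "'h \<Rightarrow> ('h \<times> 'h) list" and rs rb :: "('h \<times> 'h) list"
    and B :: "('k, 'l, 'b, 'w) quantum_groupoid_scheme" and i :: "'h \<Rightarrow> 'b"
    and B' :: "('k, 'l, 'c, 'v) quantum_groupoid_scheme" and i' :: "'h \<Rightarrow> 'c" +
  fixes f :: "'b \<Rightarrow> 'c"
  assumes f_hom: "f \<in> alg_hom k B B'" and f_bij: "bij_betw f (carrier B) (carrier B')"
    and f_src: "l \<in> carrier L \<Longrightarrow> f (src B l) = src B' l" and f_i: "h \<in> carrier H \<Longrightarrow> f (i h) = i' h"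
begin

lemmas fh = alg_homD[OF f_hom]

lemma f_ahom: "ahom B B' f" by (rule alg_hom_ahom[OF f_hom]) simp_all

lemma f_tgt: "l \<in> carrier L \<Longrightarrow> f (tgt B l) = tgt B' l"
  by (simp add: P.t_plus Q.t_plus Sm_hom[OF f_ahom] fh f_src f_i)

lemma ff_bal:
  "P.T.bb Q.T.BT (\<lambda>a b. f a \<boxtimes>\<^bsub>Q.T.BT\<^esub> f b)" "P.O.bb Q.O.BT (\<lambda>a b. f a \<boxtimes>\<^bsub>Q.O.BT\<^esub> f b)"
  by (rule balI; simp add: fh f_src f_tgt Q.T.pure_t Q.O.pure_t)+

lemma quantum_groupoid_iso: "quantum_groupoid_iso k L B B' f"
  unfolding quantum_groupoid_iso_def bialgebroid_iso_def
proof (intro conjI ballI P.quantum_groupoid Q.quantum_groupoid P.bialgebroid Q.bialgebroid f_hom f_bij)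
  fix a assume a: "a \<in> carrier B"
  show "cop B' (f a) = tmap Q.T.BT f f (cop B a)"
    unfolding tmap_def
  proof (rule P.gen_eqI[OF ahom_comp[OF f_ahom Q.cop_ahom] ahom_comp[OF P.cop_ahom P.T.t2.lift_ahom[OF Q.T.t2.agT ff_bal(1)]] a])
    fix l h assume "l \<in> carrier L" "h \<in> carrier H"
    then show "cop B' (f (src B l \<otimes>\<^bsub>B\<^esub> i h)) = tlift Q.T.BT (\<lambda>a b. f a \<boxtimes>\<^bsub>Q.T.BT\<^esub> f b) (cop B (src B l \<otimes>\<^bsub>B\<^esub> i h))"
      by (simp add: fh f_src f_i Q.cop_gen P.cop_gen P.T.t2.lift_Sm[OF Q.T.t2.agT ff_bal(1)] P.T.t2.lift_pure[OF Q.T.t2.agT ff_bal(1)])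
  qed
  show "cou B' (f a) = cou B a"
    by (rule P.gen_eqI[OF ahom_comp[OF f_ahom Q.cou_ahom] P.cou_ahom a]) (simp add: fh f_src f_i Q.cou_gen P.cou_gen)
next
  show "tmap Q.O.BT f f (rmat B) = rmat B'"
    by (simp add: tmap_def P.Q_eq Q.Q_eq f_i P.O.t2.lift_Sm[OF Q.O.t2.agT ff_bal(2)] P.O.t2.lift_pure[OF Q.O.t2.agT ff_bal(2)])
qed (simp_all add: fh f_src f_tgt)

end

section \<open>The coopposite of the opposite quotient, and the two universal maps\<close>

context represented_hopf
begin

abbreviation R' where "R' \<equiv> SS T2 rb (\<lambda>a b. a \<boxtimes>\<^bsub>T2\<^esub> b)"
abbreviation act' where "act' \<equiv> act_op H act"

interpretation OP: represented_bialgebra k "hopf_op H" R' "opp L" act' D rb rs by (rule represented_op)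
interpretation P: presented_groupoid k "hopf_op H" R' "opp L" act' D rb rs OP.DQ OP.jH by (rule OP.DQ_presented)
interpretation DD: presented_groupoid k H R L act D rs rb DQ jH by (rule DQ_presented)

abbreviation Bop where "Bop \<equiv> coopposite (opp L) OP.DQ"
definition iop where "iop h = OP.jH (\<gamma> h)"

lemma Bop_bt: "btensor L s t Bop = btensor (opp L) s t OP.DQ"
  by (simp add: btensor_def tensor_def tensor_relations_def)

lemma act'_eq: "act' x l = act (\<gamma>i x) l"
  by (simp add: act_op_def)

lemma act'_closed [simp]: "x \<in> carrier H \<Longrightarrow> l \<in> carrier L \<Longrightarrow> act' x l \<in> carrier L"
  by (simp add: act'_eq)

lemmas P_simps [simp] = P.t_add[simplified] P.t_one[simplified] P.t_smult[simplified]
  P.s_simps(2-4)[simplified] P.i_simps(2-4)[simplified]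

lemma Bop_Sm [simp]: "Sm Q Bop xs f = Sm Q OP.DQ xs f"
  by (rule Sm_struct) simp_all

text \<open>The source of the coopposite is the target of \<open>OP.DQ\<close>, for which
  \<open>P.i_t\<close> is a smash relation with the parts of \<Delta>(\<gamma>(h)) exchanged. Since
  \<gamma> reverses \<Delta>, the parts of \<Delta>(h) end up in the right order, and \<gamma>^-1 in
  the action \<open>act'\<close> cancels \<gamma>.\<close>

lemma Bop_smash_rep: "smash_rep k H R L act D rs rb Bop (src Bop) iop"
proof (intro smash_rep.intro represented_bialgebra_axioms smash_rep_axioms.intro)
  show "k_algebra k Bop" by (rule k_algebra_cong[OF OP.DQ_alg]) simp_all
  show "src Bop \<in> alg_hom k L Bop"
    by (rule alg_homI) simp_all
  show "iop \<in> alg_hom k H Bop"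
    by (rule alg_homI) (simp_all add: iop_def)
  fix h l assume hl: "h \<in> carrier H" "l \<in> carrier L"
  have b: "bil k H OP.DQ (\<lambda>x y. tgt OP.DQ (act (\<gamma>i y) l) \<otimes>\<^bsub>OP.DQ\<^esub> OP.jH x)"
    by (rule bilI) (use hl in simp_all)
  show "iop h \<otimes>\<^bsub>Bop\<^esub> src Bop l = SS Bop (D h) (\<lambda>x y. src Bop (act x l) \<otimes>\<^bsub>Bop\<^esub> iop y)"
    using hl P.i_t[of l "\<gamma> h"] D_g[OF P.C.ag b] by (simp add: iop_def act'_eq)
qed

text \<open>The target of the coopposite is the source of \<open>OP.DQ\<close>, which
  \<open>P.s_plus\<close> and \<open>P.s_minus\<close> express through the target there. The
  R-matrix on the opposite side being R^-1, the first formula involves R and the second R^-1, and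
  \<gamma> \<otimes> \<gamma> fixes both.\<close>

lemma Bop_dynamical_rep: "dynamical_rep k H R L act D rs rb Bop (src Bop) iop (tgt Bop)"
proof (intro dynamical_rep.intro Bop_smash_rep dynamical_rep_axioms.intro)
  fix l assume l: "l \<in> carrier L"
  have b: "bil k H OP.DQ (\<lambda>c d. tgt OP.DQ (act (\<gamma>i d) l) \<otimes>\<^bsub>OP.DQ\<^esub> OP.jH c)"
    "bil k H OP.DQ (\<lambda>c d. tgt OP.DQ (act (\<gamma>i c) l) \<otimes>\<^bsub>OP.DQ\<^esub> OP.jH d)"
    by (rule bilI; use l in simp)+
  show "tgt Bop l = SS Bop rs (\<lambda>a b. src Bop (act b l) \<otimes>\<^bsub>Bop\<^esub> iop a)"
    using l P.s_plus[of l] R_gg[OF P.C.ag b(1)] by (simp add: iop_def act'_eq)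
  show "tgt Bop l = SS Bop rb (\<lambda>a b. src Bop (act a l) \<otimes>\<^bsub>Bop\<^esub> iop b)"
    using l P.s_minus[of l] Rb_gg[OF P.C.ag b(2)] by (simp add: iop_def act'_eq)
qed

lemma Bop_presented: "presented_groupoid k H R L act D rs rb Bop iop"
proof (intro presented_groupoid.intro Bop_dynamical_rep presented_groupoid_axioms.intro)
  interpret BD: dynamical_rep k H R L act D rs rb Bop "src Bop" iop "tgt Bop" by (rule Bop_dynamical_rep)
  fix Pr x assume x: "x \<in> carrier Bop"
    and gen: "\<And>l h. l \<in> carrier L \<Longrightarrow> h \<in> carrier H \<Longrightarrow> Pr (src Bop l \<otimes>\<^bsub>Bop\<^esub> iop h)"
    and add: "\<And>x y. x \<in> carrier Bop \<Longrightarrow> y \<in> carrier Bop \<Longrightarrow> Pr x \<Longrightarrow> Pr y \<Longrightarrow> Pr (x \<oplus>\<^bsub>Bop\<^esub> y)"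
  show "Pr x"
  proof (rule P.span)
    show "x \<in> carrier OP.DQ" using x by simp
    fix l h assume l: "l \<in> carrier (opp L)" "h \<in> carrier (hopf_op H)"
    have g: "Pr (tgt OP.DQ m \<otimes>\<^bsub>OP.DQ\<^esub> OP.jH g)" if "m \<in> carrier L" "g \<in> carrier H" for m g
      using gen[of m "\<gamma>i g"] that by (simp add: iop_def)
    have "Pr \<zero>\<^bsub>OP.DQ\<^esub>" using g[of "\<zero>\<^bsub>L\<^esub>" "\<one>\<^bsub>H\<^esub>"] ahom_zero[OF P.t_ahom] by simp
    \<comment> \<open>Generators of \<open>OP.DQ\<close> begin with its source;
      \<open>P.s_plus\<close> rewrites them through its target, which is the source of the
      coopposite.\<close>
    moreover have "src OP.DQ l \<otimes>\<^bsub>OP.DQ\<^esub> OP.jH h = SS OP.DQ rs (\<lambda>c d. tgt OP.DQ (act' d l) \<otimes>\<^bsub>OP.DQ\<^esub> OP.jH (h \<otimes>\<^bsub>H\<^esub> c))"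
      using l by (simp add: P.s_plus)
    ultimately show "Pr (src OP.DQ l \<otimes>\<^bsub>OP.DQ\<^esub> OP.jH h)"
      using l by (simp only:) (rule Sm_pred, use add g in \<open>simp_all add: act'_eq\<close>)
  qed (use add in simp)
next
  fix l h assume l: "l \<in> carrier L" "h \<in> carrier H"
  have b: "bil k H P.O.BT (\<lambda>x y. OP.jH y \<boxtimes>\<^bsub>P.O.BT\<^esub> OP.jH x)"
    by (rule bilI) simp_all
  show "cop Bop (src Bop l \<otimes>\<^bsub>Bop\<^esub> iop h) =
      SS (over_L L Bop) (D h) (\<lambda>x y. (src Bop l \<otimes>\<^bsub>Bop\<^esub> iop x) \<boxtimes>\<^bsub>over_L L Bop\<^esub> iop y)"
    using l D_g[OF P.O.t2.agT b] by (simp add: Bop_bt iop_def P.cop_op_tgt P.cop_op_i)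
  have "cou OP.DQ (OP.jH (\<gamma> h)) = counit H h \<odot>\<^bsub>L\<^esub> \<one>\<^bsub>L\<^esub>"
    using P.cou_gen[of "\<one>\<^bsub>L\<^esub>" "\<gamma> h"] l by simp
  then show "cou Bop (src Bop l \<otimes>\<^bsub>Bop\<^esub> iop h) = counit H h \<odot>\<^bsub>L\<^esub> l"
    using l by (simp add: iop_def P.cou_tgt')
next
  have b: "bil k H P.T.BT (\<lambda>x y. OP.jH x \<boxtimes>\<^bsub>P.T.BT\<^esub> OP.jH y)"
    "bil k H P.T.BT (\<lambda>x y. OP.jH (\<gamma> x) \<boxtimes>\<^bsub>P.T.BT\<^esub> OP.jH (\<gamma> y))"
    by (rule bilI; simp)+
  \<comment> \<open>The R-matrix of the coopposite is the inverse one of \<open>OP.DQ\<close>, hence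
    the image of the inverse of R^-1, that is of R; precomposition with \<gamma> does not change
    it.\<close>
  show "rmat Bop = tmap (over_Lop L Bop) iop iop R"
    using R_gg[OF P.T.t2.agT b(1)] lift_eq(2)[OF P.T.t2.agT b(2)]
    by (simp add: Bop_bt P.rmat_inverse_the tmap_def iop_def P.Qbar_def)
qed (simp_all add: Bop_bt ahom_add[OF P.cop_op_ahom])

text \<open>The data that H_L offers to the universal property of the opposite quotient: its target
  as source, its source as target, and \<gamma>^-1 to turn the map from H into one from the opposite
  of H.\<close>

lemma back_dynamical_rep:
  "dynamical_rep k (hopf_op H) R' (opp L) act' D rb rs DQ (tgt DQ) (\<lambda>h. jH (\<gamma>i h)) (src DQ)"
proof (intro dynamical_rep.intro smash_rep.intro represented_op smash_rep_axioms.intro dynamical_rep_axioms.intro DQ_alg)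
  show "tgt DQ \<in> alg_hom k (opp L) DQ" by (rule alg_homI) simp_all
  show "(\<lambda>h. jH (\<gamma>i h)) \<in> alg_hom k (hopf_op H) DQ" by (rule alg_homI) simp_all
  fix l assume l: "l \<in> carrier (opp L)"
  have b: "bil k H DQ (\<lambda>c d. tgt DQ (act d l) \<otimes>\<^bsub>DQ\<^esub> jH c)" "bil k H DQ (\<lambda>c d. tgt DQ (act c l) \<otimes>\<^bsub>DQ\<^esub> jH d)"
    by (rule bilI; use l in simp)+
  show "src DQ l = Sm (carrier (hopf_op H)) DQ rb (\<lambda>a b. tgt DQ (act' b l) \<otimes>\<^bsub>DQ\<^esub> jH (\<gamma>i a))"
    using l DD.s_plus[of l] Rb_gigi[OF DD.C.ag b(1)] by (simp add: act'_eq)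
  show "src DQ l = Sm (carrier (hopf_op H)) DQ rs (\<lambda>a b. tgt DQ (act' a l) \<otimes>\<^bsub>DQ\<^esub> jH (\<gamma>i b))"
    using l DD.s_minus[of l] R_gigi[OF DD.C.ag b(2)] by (simp add: act'_eq)
next
  fix h l assume hl: "h \<in> carrier (hopf_op H)" "l \<in> carrier (opp L)"
  have b: "bil k H DQ (\<lambda>x y. tgt DQ (act y l) \<otimes>\<^bsub>DQ\<^esub> jH x)"
    by (rule bilI) (use hl in simp_all)
  show "jH (\<gamma>i h) \<otimes>\<^bsub>DQ\<^esub> tgt DQ l = Sm (carrier (hopf_op H)) DQ (D h) (\<lambda>x y. tgt DQ (act' x l) \<otimes>\<^bsub>DQ\<^esub> jH (\<gamma>i y))"
    using hl DD.i_t[of l "\<gamma>i h"] D_gi[OF DD.C.ag b] by (simp add: act'_eq)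
qed

interpretation BP: presented_groupoid k H R L act D rs rb Bop iop by (rule Bop_presented)
interpretation BK: dynamical_rep k "hopf_op H" R' "opp L" act' D rb rs DQ "tgt DQ" "\<lambda>h. jH (\<gamma>i h)" "src DQ"
  by (rule back_dynamical_rep)

definition fD where "fD = BP.dlift"

lemma fD_hom: "fD \<in> alg_hom k DQ Bop"
  and fD_src: "l \<in> carrier L \<Longrightarrow> fD (src DQ l) = tgt OP.DQ l"
  and fD_jH: "h \<in> carrier H \<Longrightarrow> fD (jH h) = OP.jH (\<gamma> h)"
  and fD_tgt: "l \<in> carrier L \<Longrightarrow> fD (tgt DQ l) = src OP.DQ l"
  using BP.dlift_alg_hom BP.dlift_src[of l] BP.dlift_jH[of h] BP.dlift_tgt[of l]
  by (simp_all add: fD_def iop_def)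

definition gD where "gD = BK.dlift"

lemma gD_hom: "gD \<in> alg_hom k OP.DQ DQ"
  and gD_src: "l \<in> carrier L \<Longrightarrow> gD (src OP.DQ l) = tgt DQ l"
  and gD_jH: "h \<in> carrier H \<Longrightarrow> gD (OP.jH h) = jH (\<gamma>i h)"
  and gD_tgt: "l \<in> carrier L \<Longrightarrow> gD (tgt OP.DQ l) = src DQ l"
  using BK.dlift_alg_hom BK.dlift_src[of l] BK.dlift_jH[of h] BK.dlift_tgt[of l]
  by (simp_all add: gD_def)

text \<open>The two composites fix the generators, because \<gamma> and \<gamma>^-1 cancel and
  source and target are exchanged twice.\<close>

lemma fD_iso: "quantum_groupoid_iso k L DQ Bop fD"
proof -
  have Fa: "ahom DQ OP.DQ fD"
    using alg_hom_ahom[OF fD_hom DD.C.ag BP.C.ag] by (simp add: ahom_def)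
  note Ga = alg_hom_ahom[OF gD_hom P.C.ag DD.C.ag]
  have Fm: "fD (x \<otimes>\<^bsub>DQ\<^esub> y) = fD x \<otimes>\<^bsub>OP.DQ\<^esub> fD y" if "x \<in> carrier DQ" "y \<in> carrier DQ" for x y
    using alg_homD(3)[OF fD_hom that] by simp
  note Gm = alg_homD(3)[OF gD_hom]
  have FG: "fD (gD X) = X" if X: "X \<in> carrier OP.DQ" for X
  proof (rule P.gen_eqI[where g="\<lambda>x. x", OF ahom_comp[OF Ga Fa] _ X])
    show "ahom OP.DQ OP.DQ (\<lambda>x. x)" by (rule ahomI) simp_all
    fix l h assume "l \<in> carrier (opp L)" "h \<in> carrier (hopf_op H)"
    then show "fD (gD (src OP.DQ l \<otimes>\<^bsub>OP.DQ\<^esub> OP.jH h)) = src OP.DQ l \<otimes>\<^bsub>OP.DQ\<^esub> OP.jH h"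
      by (simp add: Fm Gm gD_src gD_jH fD_tgt fD_jH)
  qed
  have GF: "gD (fD X) = X" if X: "X \<in> carrier DQ" for X
  proof (rule DD.gen_eqI[where g="\<lambda>x. x", OF ahom_comp[OF Fa Ga] _ X])
    show "ahom DQ DQ (\<lambda>x. x)" by (rule ahomI) simp_all
    fix l h assume "l \<in> carrier L" "h \<in> carrier H"
    then show "gD (fD (src DQ l \<otimes>\<^bsub>DQ\<^esub> jH h)) = src DQ l \<otimes>\<^bsub>DQ\<^esub> jH h"
      by (simp add: Fm Gm gD_tgt gD_jH fD_src fD_jH)
  qed
  have "bij_betw fD (carrier DQ) (carrier Bop)"
    by (rule bij_betw_byWitness[where f'=gD])
      (use FG GF ahom_closed[OF Fa] ahom_closed[OF Ga] in auto)
  then have "presented_hom k H R L act D rs rb DQ jH Bop iop fD"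
    by (intro presented_hom.intro DQ_presented Bop_presented presented_hom_axioms.intro fD_hom) (simp_all add: fD_src fD_jH iop_def)
  then show ?thesis by (rule presented_hom.quantum_groupoid_iso)
qed

section \<open>The identification of opposites and the antipode formula\<close>

interpretation AA: smash_rep k H R L act D rs rb A sA iA by (rule smash_rep_A)
interpretation AO: smash_rep k "hopf_op H" R' "opp L" act' D rb rs OP.A OP.sA OP.iA by (rule OP.smash_rep_A)

lemmas AO_simps [simp] = AO.s_simps(2-4)[simplified] AO.i_simps(2-4)[simplified]

lemma AO_s_Sm [simp]: "(\<And>a b. a \<in> P \<Longrightarrow> b \<in> P \<Longrightarrow> f a b \<in> carrier L) \<Longrightarrow>
    OP.sA (Sm P L xs f) = Sm P OP.A xs (\<lambda>a b. OP.sA (f a b))"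
  and AO_i_Sm [simp]: "(\<And>a b. a \<in> P \<Longrightarrow> b \<in> P \<Longrightarrow> g a b \<in> carrier H) \<Longrightarrow>
    OP.iA (Sm P H xs g) = Sm P OP.A xs (\<lambda>a b. OP.iA (g a b))"
  using AO.s_Sm[of P f xs] AO.i_Sm[of P g xs] by simp_all

text \<open>The relation to be checked reads l h = sum h_(2) (\<gamma>^-1(h_(1)) \<rhd> l) in the
  smash product. Moving h_(2) to the right by the smash relation makes h_(2) \<gamma>^-1(h_(1)) act
  on l, which is the counit.\<close>

lemma ident_rep: "smash_rep k (hopf_op H) R' (opp L) act' D rb rs (opp A) sA iA"
proof (intro smash_rep.intro represented_op smash_rep_axioms.intro)
  show "k_algebra k (opp A)" by (rule k_algebra_opposite[OF A_alg]) simp_all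
  show "sA \<in> alg_hom k (opp L) (opp A)" "iA \<in> alg_hom k (hopf_op H) (opp A)"
    by (rule alg_homI; simp)+
  fix h l assume hl: "h \<in> carrier (hopf_op H)" "l \<in> carrier (opp L)"
  have "SS A (D h) (\<lambda>x y. iA y \<otimes>\<^bsub>A\<^esub> sA (act (\<gamma>i x) l)) =
      SS A (D h) (\<lambda>x y. SS A (D y) (\<lambda>p q. sA (act p (act (\<gamma>i x) l)) \<otimes>\<^bsub>A\<^esub> iA q))"
    using hl by (simp add: AA.smash_comm)
  also have "\<dots> = SS A (D h) (\<lambda>z q. SS A (D z) (\<lambda>x p. sA (act p (act (\<gamma>i x) l)) \<otimes>\<^bsub>A\<^esub> iA q))"
    by (rule coassoc[symmetric], simp, rule triI) (use hl in simp_all)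
  also have "\<dots> = SS A (D h) (\<lambda>z q. sA (act (SS H (D z) (\<lambda>x p. p \<otimes>\<^bsub>H\<^esub> \<gamma>i x)) l) \<otimes>\<^bsub>A\<^esub> iA q)"
    using hl by simp
  also have "\<dots> = SS A (D h) (\<lambda>z q. sA (act (\<epsilon> z \<odot>\<^bsub>H\<^esub> \<one>\<^bsub>H\<^esub>) l) \<otimes>\<^bsub>A\<^esub> iA q)"
    by (rule Sm_cong') (simp only: gi_r)
  also have "\<dots> = sA l \<otimes>\<^bsub>A\<^esub> iA (SS H (D h) (\<lambda>z q. \<epsilon> z \<odot>\<^bsub>H\<^esub> q))"
    using hl by simp
  also have "\<dots> = sA l \<otimes>\<^bsub>A\<^esub> iA h" using hl by (simp only: counit_l hopf_op_simps)
  finally show "iA h \<otimes>\<^bsub>opp A\<^esub> sA l = Sm (carrier (hopf_op H)) (opp A) (D h) (\<lambda>x y. sA (act' x l) \<otimes>\<^bsub>opp A\<^esub> iA y)"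
    by (simp add: act'_eq)
qed

text \<open>Supplies the left inverse of the identification; its injectivity makes
  \<open>inv_into\<close> in \<open>smash_antipode\<close> return the intended element. The relation
  now uses \<gamma>^-1(h_(2)) h_(1) = \<epsilon>(h).\<close>

lemma ident_inv_rep: "smash_rep k H R L act D rs rb (opp OP.A) OP.sA OP.iA"
proof (intro smash_rep.intro represented_bialgebra_axioms smash_rep_axioms.intro)
  show "k_algebra k (opp OP.A)" by (rule k_algebra_opposite[OF OP.A_alg]) simp_all
  show "OP.sA \<in> alg_hom k L (opp OP.A)" "OP.iA \<in> alg_hom k H (opp OP.A)"
    by (rule alg_homI; simp)+
  fix h l assume hl: "h \<in> carrier H" "l \<in> carrier L"
  have "SS OP.A (D h) (\<lambda>x y. OP.iA y \<otimes>\<^bsub>OP.A\<^esub> OP.sA (act x l)) =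
      SS OP.A (D h) (\<lambda>x y. SS OP.A (D y) (\<lambda>p q. OP.sA (act (\<gamma>i p) (act x l)) \<otimes>\<^bsub>OP.A\<^esub> OP.iA q))"
    using hl by (simp add: AO.smash_comm act'_eq)
  also have "\<dots> = SS OP.A (D h) (\<lambda>z q. SS OP.A (D z) (\<lambda>x p. OP.sA (act (\<gamma>i p) (act x l)) \<otimes>\<^bsub>OP.A\<^esub> OP.iA q))"
    by (rule coassoc[symmetric], simp, rule triI) (use hl in simp_all)
  also have "\<dots> = SS OP.A (D h) (\<lambda>z q. OP.sA (act (SS H (D z) (\<lambda>x p. \<gamma>i p \<otimes>\<^bsub>H\<^esub> x)) l) \<otimes>\<^bsub>OP.A\<^esub> OP.iA q)"
    using hl by simp
  also have "\<dots> = SS OP.A (D h) (\<lambda>z q. OP.sA (act (\<epsilon> z \<odot>\<^bsub>H\<^esub> \<one>\<^bsub>H\<^esub>) l) \<otimes>\<^bsub>OP.A\<^esub> OP.iA q)"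
    by (rule Sm_cong') (simp only: gi_l)
  also have "\<dots> = OP.sA l \<otimes>\<^bsub>OP.A\<^esub> OP.iA (SS H (D h) (\<lambda>z q. \<epsilon> z \<odot>\<^bsub>H\<^esub> q))"
    using hl by simp
  also have "\<dots> = OP.sA l \<otimes>\<^bsub>OP.A\<^esub> OP.iA h" using hl by (simp only: counit_l)
  finally show "OP.iA h \<otimes>\<^bsub>opp OP.A\<^esub> OP.sA l = SS (opp OP.A) (D h) (\<lambda>x y. OP.sA (act x l) \<otimes>\<^bsub>opp OP.A\<^esub> OP.iA y)"
    by simp
qed

interpretation ID: smash_rep k "hopf_op H" R' "opp L" act' D rb rs "opp A" sA iA by (rule ident_rep)
interpretation II: smash_rep k H R L act D rs rb "opp OP.A" OP.sA OP.iA by (rule ident_inv_rep)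

lemma A_tlift_opp: "tlift (opp G) f X = tlift G f X"
  by (rule tlift_struct) simp_all

lemma ident_eq: "smash_op_identification k H R L act X = ID.lift X"
  by (simp add: smash_op_identification_def Let_def ID.lift_def A_tlift_opp sA_def iA_def)

lemma ident_gen:
  "l \<in> carrier L \<Longrightarrow> ID.lift (OP.sA l) = sA l" "h \<in> carrier H \<Longrightarrow> ID.lift (OP.iA h) = iA h"
  using ID.lift_pure[of l "\<one>\<^bsub>H\<^esub>"] ID.lift_pure[of "\<one>\<^bsub>L\<^esub>" h] by (simp_all add: OP.sA_def OP.iA_def)

lemma ident_inv:
  assumes "X \<in> carrier OP.A"
  shows "II.lift (ID.lift X) = X"
proof -
  note I = alg_homD[OF II.lift_alg_hom, simplified] and J = alg_homD[OF ID.lift_alg_hom, simplified]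
  have gen: "II.lift (sA l) = OP.sA l" "II.lift (iA h) = OP.iA h" if "l \<in> carrier L" "h \<in> carrier H" for l h
    using II.lift_pure[of l "\<one>\<^bsub>H\<^esub>"] II.lift_pure[of "\<one>\<^bsub>L\<^esub>" h] that by (simp_all add: sA_def iA_def)
  show ?thesis using assms
  proof (induction X rule: OP.A.induct)
    case (pure l h)
    then have lh: "l \<in> carrier L" "h \<in> carrier H" by simp_all
    have "ID.lift (l \<boxtimes>\<^bsub>OP.A\<^esub> h) = iA h \<otimes>\<^bsub>A\<^esub> sA l" using lh by simp
    then have "II.lift (ID.lift (l \<boxtimes>\<^bsub>OP.A\<^esub> h)) = OP.sA l \<otimes>\<^bsub>OP.A\<^esub> OP.iA h"
      using lh I(3)[of "iA h" "sA l"] by (simp only: AA.s_simps AA.i_simps gen)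
    then show ?case using lh OP.sA_iA[of l h] by simp
  next
    case (add X Y)
    then show ?case by (simp add: I J)
  qed
qed

lemma ident_inj: "inj_on ID.lift (carrier OP.A)"
  by (rule inj_on_inverseI[where g=II.lift]) (rule ident_inv)

text \<open>The inverse Drinfeld element enters through
  \<open>R\<^sup>-\<^sup>1\<^sub>1 \<gamma>\<^sup>-\<^sup>1(R\<^sup>-\<^sup>1\<^sub>2) = v\<^sup>-\<^sup>1\<close>.\<close>

lemma ident_tgt:
  assumes l: "l \<in> carrier L"
  shows "ID.lift (OP.tA l) = tA (act drw l)"
proof -
  have J: "ahom OP.A A ID.lift" using ID.lift_ahom by (simp add: ahom_def)
  have m: "ID.lift (x \<otimes>\<^bsub>OP.A\<^esub> y) = ID.lift y \<otimes>\<^bsub>A\<^esub> ID.lift x" if "x \<in> carrier OP.A" "y \<in> carrier OP.A" for x y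
    using alg_homD(3)[OF ID.lift_alg_hom that] by simp
  have b: "bil k H A (\<lambda>c d. sA (act (drw \<otimes>\<^bsub>H\<^esub> \<gamma>i d) l) \<otimes>\<^bsub>A\<^esub> iA c)"
    by (rule bilI) (use l in simp_all)
  have "ID.lift (OP.tA l) = SS A rb (\<lambda>c d. iA c \<otimes>\<^bsub>A\<^esub> sA (act (\<gamma>i d) l))"
    using l by (simp add: OP.tA_def Sm_hom[OF J] m ident_gen act'_eq)
  also have "\<dots> = SS A rb (\<lambda>c d. SS A (D c) (\<lambda>x y. sA (act (x \<otimes>\<^bsub>H\<^esub> \<gamma>i d) l) \<otimes>\<^bsub>A\<^esub> iA y))"
    using l by (simp add: AA.smash_comm)
  \<comment> \<open>(\<Delta> \<otimes> id)(R^-1) = R^-1_23 R^-1_13 splits off a second copy of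
    R^-1, whose components meet as R^-1_1 \<gamma>^-1(R^-1_2) and form \<open>drw\<close>.\<close>
  also have "\<dots> = SS A rb (\<lambda>c d. SS A rb (\<lambda>c' d'. sA (act (c' \<otimes>\<^bsub>H\<^esub> \<gamma>i (d \<otimes>\<^bsub>H\<^esub> d')) l) \<otimes>\<^bsub>A\<^esub> iA c))"
    by (rule Rb_hexL, simp, rule triI) (use l in simp_all)
  also have "\<dots> = SS A rb (\<lambda>c d. sA (act (drw \<otimes>\<^bsub>H\<^esub> \<gamma>i d) l) \<otimes>\<^bsub>A\<^esub> iA c)"
    using l by (simp add: drw_def)
  \<comment> \<open>R^-1 = (id \<otimes> \<gamma>^-1)(R) replaces the remaining copy by R. This
    leaves \<gamma>^-2 on R_2, which disappears when \<open>drw\<close> is moved across it.\<close>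
  also have "\<dots> = SS A rs (\<lambda>a b. sA (act (drw \<otimes>\<^bsub>H\<^esub> \<gamma>i (\<gamma>i b)) l) \<otimes>\<^bsub>A\<^esub> iA a)"
    by (rule R_gi[symmetric, OF A.agT b])
  also have "\<dots> = SS A rs (\<lambda>a b. sA (act (b \<otimes>\<^bsub>H\<^esub> drw) l) \<otimes>\<^bsub>A\<^esub> iA a)"
    by (rule Sm_cong') (simp only: drw_gi2)
  also have "\<dots> = tA (act drw l)" using l by (simp add: tA_def)
  finally show ?thesis .
qed

text \<open>The antipode in its native form inside the smash product of the opposites. The
  identification reverses products as a map into the smash product, so it carries this to
  \<gamma>(h) t^+(v^-1 \<rhd> l).\<close>

definition an where "an = tlift OP.A (\<lambda>l h. OP.tA l \<otimes>\<^bsub>OP.A\<^esub> OP.iA (\<gamma> h))"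

lemma OP_tA_simps [simp]:
  "l \<in> carrier L \<Longrightarrow> m \<in> carrier L \<Longrightarrow> OP.tA (l \<oplus>\<^bsub>L\<^esub> m) = OP.tA l \<oplus>\<^bsub>OP.A\<^esub> OP.tA m"
  "r \<in> carrier k \<Longrightarrow> l \<in> carrier L \<Longrightarrow> OP.tA (r \<odot>\<^bsub>L\<^esub> l) = r \<odot>\<^bsub>OP.A\<^esub> OP.tA l"
  using OP.tA_simps(2)[of l m] OP.tA_simps(3)[of r l] by simp_all

lemma an_bal: "bal (carrier k) (smult L) (smult H) L H OP.A (\<lambda>l h. OP.tA l \<otimes>\<^bsub>OP.A\<^esub> OP.iA (\<gamma> h))"
  by (rule balI) simp_all

lemma an_ahom: "ahom A OP.A an"
  unfolding an_def by (rule A.lift_ahom[OF OP.A.agT an_bal])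

lemma an_pure: "l \<in> carrier L \<Longrightarrow> h \<in> carrier H \<Longrightarrow> an (l \<boxtimes>\<^bsub>A\<^esub> h) = OP.tA l \<otimes>\<^bsub>OP.A\<^esub> OP.iA (\<gamma> h)"
  unfolding an_def by (rule A.lift_pure[OF OP.A.agT an_bal])

text \<open>By \<open>ident_tgt\<close> the formula evaluated in the smash product is the image of
  \<open>an X\<close> under the identification; injectivity then removes
  \<open>inv_into\<close>.\<close>

lemma smash_antipode_eq:
  assumes X: "X \<in> carrier A"
    and R'_inv: "inv\<^bsub>tensor2 k H\<^esub> R = R'"
  shows "smash_antipode k H R L act X = an X"
proof -
  let ?N = "\<lambda>l h. iA (\<gamma> h) \<otimes>\<^bsub>A\<^esub> tA (act drw l)"
  have J: "ahom OP.A A ID.lift" using ID.lift_ahom by (simp add: ahom_def)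
  have m: "ID.lift (x \<otimes>\<^bsub>OP.A\<^esub> y) = ID.lift y \<otimes>\<^bsub>A\<^esub> ID.lift x" if "x \<in> carrier OP.A" "y \<in> carrier OP.A" for x y
    using alg_homD(3)[OF ID.lift_alg_hom that] by simp
  have Nb: "bal (carrier k) (smult L) (smult H) L H A ?N" by (rule balI) simp_all
  have "tlift A (\<lambda>l h. (\<one>\<^bsub>L\<^esub> \<boxtimes>\<^bsub>A\<^esub> \<gamma> h) \<otimes>\<^bsub>A\<^esub> tgt A (act (inv\<^bsub>H\<^esub> drinfeld H R) l)) X = tlift A ?N X"
    by (rule A_lift_cong[OF X A.agT _ Nb]) (simp add: inv_drinfeld A_tgt iA_def)
  also have "\<dots> = ID.lift (an X)"
    by (rule A.ahom_eqI[OF A.lift_ahom[OF A.agT Nb] ahom_comp[OF an_ahom J] X])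
      (simp add: A.lift_pure[OF A.agT Nb] an_pure m ident_tgt ident_gen)
  finally have "smash_antipode k H R L act X = inv_into (carrier OP.A) ID.lift (ID.lift (an X))"
    unfolding smash_antipode_def Let_def R'_inv ident_eq[abs_def] by simp
  also have "\<dots> = an X"
    by (rule inv_into_f_f[OF ident_inj ahom_closed[OF an_ahom X]])
  finally show ?thesis .
qed

lemma fD_antipode:
  assumes X: "X \<in> carrier A"
  shows "fD (pj X) = OP.pj (an X)"
proof -
  have Fa: "ahom DQ OP.DQ fD"
    using alg_hom_ahom[OF fD_hom DD.C.ag BP.C.ag] by (simp add: ahom_def)
  have Fm: "fD (x \<otimes>\<^bsub>DQ\<^esub> y) = fD x \<otimes>\<^bsub>OP.DQ\<^esub> fD y" if "x \<in> carrier DQ" "y \<in> carrier DQ" for x y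
    using alg_homD(3)[OF fD_hom that] by simp
  show ?thesis
  proof (rule A.ahom_eqI[OF ahom_comp[OF pj_ahom Fa] ahom_comp[OF an_ahom OP.pj_ahom] X])
    fix l h assume l: "l \<in> carrier L" "h \<in> carrier H"
    then show "fD (pj (l \<boxtimes>\<^bsub>A\<^esub> h)) = OP.pj (an (l \<boxtimes>\<^bsub>A\<^esub> h))"
      using OP.DQ_tgt[of l] by (simp add: pj_pure Fm fD_src fD_jH an_pure OP.pj_mult OP.jH_def)
  qed
qed

theorem antipode_iso:
  assumes "inv\<^bsub>tensor2 k H\<^esub> R = R'"
  shows "\<exists>f. (\<forall>x \<in> carrier (smash k H R L act).
      f (J_phi k H R L act +>\<^bsub>smash k H R L act\<^esub> x) =
      J_phi_op k H R L act +>\<^bsub>smash_op k H R L act\<^esub> smash_antipode k H R L act x) \<and>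
    quantum_groupoid_iso k L (dynamical_quotient k H R L act)
      (coopposite (opp L) (dynamical_quotient_op k H R L act)) f"
  unfolding assms
  using fD_iso fD_antipode smash_antipode_eq[OF _ assms] by (auto simp: pj_def OP.pj_def)

end

section \<open>Products on the tensor square and cube over k\<close>

context alg
begin

abbreviation K2 where "K2 \<equiv> kt2 k A"
abbreviation K3 where "K3 \<equiv> kt3 k A"
abbreviation sm2 where "sm2 r \<equiv> tmap K2 (smult A r) (\<lambda>b. b)"

text \<open>The product of \<open>tensor2\<close>, as \<open>tensor2_mult\<close> confirms, with the
  bare group \<open>kt2\<close> as its target so that the lifting rules apply directly.\<close>

definition m2 where "m2 X Y = tlift K2 (\<lambda>c d. tlift K2 (\<lambda>a b. (a \<otimes>\<^bsub>A\<^esub> c) \<boxtimes>\<^bsub>K2\<^esub> (b \<otimes>\<^bsub>A\<^esub> d)) X) Y"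

lemma m2_bal1: "c \<in> carrier A \<Longrightarrow> d \<in> carrier A \<Longrightarrow> bil k A K2 (\<lambda>a b. (a \<otimes>\<^bsub>A\<^esub> c) \<boxtimes>\<^bsub>K2\<^esub> (b \<otimes>\<^bsub>A\<^esub> d))"
  and m2_bal2: "a \<in> carrier A \<Longrightarrow> b \<in> carrier A \<Longrightarrow> bil k A K2 (\<lambda>c d. (a \<otimes>\<^bsub>A\<^esub> c) \<boxtimes>\<^bsub>K2\<^esub> (b \<otimes>\<^bsub>A\<^esub> d))"
  by (rule bilI; simp)+

lemmas m2_bal = t2.lift2_bal[OF t2.tens_axioms t2.agT m2_bal2 m2_bal1]

lemma m2_ahom_r: "X \<in> carrier K2 \<Longrightarrow> ahom K2 K2 (m2 X)"
  unfolding m2_def by (rule t2.lift_ahom[OF t2.agT m2_bal])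

lemma m2_pure: "a \<in> carrier A \<Longrightarrow> b \<in> carrier A \<Longrightarrow> c \<in> carrier A \<Longrightarrow> d \<in> carrier A \<Longrightarrow>
    m2 (a \<boxtimes>\<^bsub>K2\<^esub> b) (c \<boxtimes>\<^bsub>K2\<^esub> d) = (a \<otimes>\<^bsub>A\<^esub> c) \<boxtimes>\<^bsub>K2\<^esub> (b \<otimes>\<^bsub>A\<^esub> d)"
  by (simp add: m2_def t2.lift_pure[OF t2.agT m2_bal] t2.lift_pure[OF t2.agT m2_bal1])

lemma m2_ahom_l:
  assumes Y: "Y \<in> carrier K2"
  shows "ahom K2 K2 (\<lambda>X. m2 X Y)"
proof (rule ahomI)
  interpret K: abelian_group K2 by simp
  fix X X' assume X: "X \<in> carrier K2" "X' \<in> carrier K2"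
  have h: "ahom K2 K2 (\<lambda>Y. m2 X Y \<oplus>\<^bsub>K2\<^esub> m2 X' Y)"
    by (rule ahomI) (use X in \<open>simp_all add: ahom_closed[OF m2_ahom_r] ahom_add[OF m2_ahom_r] K.a_ac\<close>)
  have "X \<oplus>\<^bsub>K2\<^esub> X' \<in> carrier K2" using X by simp
  from t2.ahom_eqI[OF m2_ahom_r[OF this] h Y] show "m2 (X \<oplus>\<^bsub>K2\<^esub> X') Y = m2 X Y \<oplus>\<^bsub>K2\<^esub> m2 X' Y"
    using X by (simp add: m2_def t2.lift_pure[OF t2.agT m2_bal] t2.lift_add[OF t2.agT m2_bal1])
qed (use Y ahom_closed[OF m2_ahom_r] in auto)

lemma m2_closed [simp]: "X \<in> carrier K2 \<Longrightarrow> Y \<in> carrier K2 \<Longrightarrow> m2 X Y \<in> carrier K2"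
  using ahom_closed[OF m2_ahom_r] .

lemmas sm2_closed [simp] = ahom_closed[OF tmap_smult_t2(1)]
lemmas sm2_pure [simp] = tmap_smult_t2(2)

lemma m2_smult:
  assumes "r \<in> carrier k" "X \<in> carrier K2" "Y \<in> carrier K2"
  shows "m2 (sm2 r X) Y = sm2 r (m2 X Y)" "m2 X (sm2 r Y) = sm2 r (m2 X Y)"
proof -
  have 1: "m2 (sm2 r (a \<boxtimes>\<^bsub>K2\<^esub> b)) Y = sm2 r (m2 (a \<boxtimes>\<^bsub>K2\<^esub> b) Y)" if "a \<in> carrier A" "b \<in> carrier A" for a b
    by (rule t2.ahom_eqI[OF m2_ahom_r ahom_comp[OF m2_ahom_r tmap_smult_t2(1)] assms(3)])
      (use assms that in \<open>simp_all add: m2_pure\<close>)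
  show "m2 (sm2 r X) Y = sm2 r (m2 X Y)"
    by (rule t2.ahom_eqI[OF ahom_comp[OF tmap_smult_t2(1) m2_ahom_l] ahom_comp[OF m2_ahom_l tmap_smult_t2(1)] assms(2)])
      (use assms 1 in simp_all)
  have 2: "m2 (a \<boxtimes>\<^bsub>K2\<^esub> b) (sm2 r Y) = sm2 r (m2 (a \<boxtimes>\<^bsub>K2\<^esub> b) Y)" if "a \<in> carrier A" "b \<in> carrier A" for a b
    by (rule t2.ahom_eqI[OF ahom_comp[OF tmap_smult_t2(1) m2_ahom_r] ahom_comp[OF m2_ahom_r tmap_smult_t2(1)] assms(3)])
      (use assms that in \<open>simp_all add: m2_pure\<close>)
  show "m2 X (sm2 r Y) = sm2 r (m2 X Y)"
    by (rule t2.ahom_eqI[OF m2_ahom_l ahom_comp[OF m2_ahom_l tmap_smult_t2(1)] assms(2)])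
      (use assms 2 in simp_all)
qed

lemma m2_assoc:
  assumes X: "X \<in> carrier K2" and Y: "Y \<in> carrier K2" and Z: "Z \<in> carrier K2"
  shows "m2 (m2 X Y) Z = m2 X (m2 Y Z)"
  using X
proof (induction X rule: t2.induct)
  case (pure a b)
  note ab = pure
  show ?case using Y
  proof (induction Y rule: t2.induct)
    case (pure c d)
    show ?case using Z
      by (induction Z rule: t2.induct) (use pure ab in \<open>simp_all add: m2_pure ahom_add[OF m2_ahom_r]\<close>)
  qed (use pure Z in \<open>simp_all add: ahom_add[OF m2_ahom_r] ahom_add[OF m2_ahom_l]\<close>)
qed (use Y Z in \<open>simp_all add: ahom_add[OF m2_ahom_l]\<close>)

lemma m2_one:
  assumes "X \<in> carrier K2"
  shows "m2 X (\<one>\<^bsub>A\<^esub> \<boxtimes>\<^bsub>K2\<^esub> \<one>\<^bsub>A\<^esub>) = X" "m2 (\<one>\<^bsub>A\<^esub> \<boxtimes>\<^bsub>K2\<^esub> \<one>\<^bsub>A\<^esub>) X = X"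
  using assms by (induction X rule: t2.induct) (simp_all add: m2_pure ahom_add[OF m2_ahom_r] ahom_add[OF m2_ahom_l])

definition m3 where "m3 X Y = tlift K3 (\<lambda>C d. tlift K3 (\<lambda>U b. m2 U C \<boxtimes>\<^bsub>K3\<^esub> (b \<otimes>\<^bsub>A\<^esub> d)) X) Y"

abbreviation bil3 where "bil3 \<equiv> bal (carrier k) sm2 (smult A) K2 A K3"

lemma m3_bal1: "C \<in> carrier K2 \<Longrightarrow> d \<in> carrier A \<Longrightarrow> bil3 (\<lambda>U b. m2 U C \<boxtimes>\<^bsub>K3\<^esub> (b \<otimes>\<^bsub>A\<^esub> d))"
  by (rule balI) (simp_all add: ahom_add[OF m2_ahom_l] m2_smult t3.pure_bal)

lemma m3_bal2: "U \<in> carrier K2 \<Longrightarrow> b \<in> carrier A \<Longrightarrow> bil3 (\<lambda>C d. m2 U C \<boxtimes>\<^bsub>K3\<^esub> (b \<otimes>\<^bsub>A\<^esub> d))"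
  by (rule balI) (simp_all add: ahom_add[OF m2_ahom_r] m2_smult t3.pure_bal)

lemmas m3_bal = t3.lift2_bal[OF t3.tens_axioms t3.agT m3_bal2 m3_bal1]

lemma m3_Sm:
  assumes "\<And>a b. a \<in> carrier A \<Longrightarrow> b \<in> carrier A \<Longrightarrow> f a b \<in> carrier K2" "\<And>a b. a \<in> carrier A \<Longrightarrow> b \<in> carrier A \<Longrightarrow> g a b \<in> carrier A"
    "\<And>a b. a \<in> carrier A \<Longrightarrow> b \<in> carrier A \<Longrightarrow> f' a b \<in> carrier K2" "\<And>a b. a \<in> carrier A \<Longrightarrow> b \<in> carrier A \<Longrightarrow> g' a b \<in> carrier A"
  shows "m3 (Sm (carrier A) K3 xs (\<lambda>a b. f a b \<boxtimes>\<^bsub>K3\<^esub> g a b)) (Sm (carrier A) K3 ys (\<lambda>c d. f' c d \<boxtimes>\<^bsub>K3\<^esub> g' c d)) =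
    Sm (carrier A) K3 xs (\<lambda>a b. Sm (carrier A) K3 ys (\<lambda>c d. m2 (f a b) (f' c d) \<boxtimes>\<^bsub>K3\<^esub> (g a b \<otimes>\<^bsub>A\<^esub> g' c d)))"
proof -
  have "m3 (Sm (carrier A) K3 xs (\<lambda>a b. f a b \<boxtimes>\<^bsub>K3\<^esub> g a b)) (Sm (carrier A) K3 ys (\<lambda>c d. f' c d \<boxtimes>\<^bsub>K3\<^esub> g' c d)) =
    Sm (carrier A) K3 ys (\<lambda>c d. Sm (carrier A) K3 xs (\<lambda>a b. m2 (f a b) (f' c d) \<boxtimes>\<^bsub>K3\<^esub> (g a b \<otimes>\<^bsub>A\<^esub> g' c d)))"
    using assms by (simp add: m3_def t3.lift_Sm[OF t3.agT m3_bal] t3.lift_pure[OF t3.agT m3_bal]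
        t3.lift_Sm[OF t3.agT m3_bal1] t3.lift_pure[OF t3.agT m3_bal1])
  then show ?thesis using assms by (simp, subst Sm_swap) simp_all
qed

lemma m2_Sm:
  "m2 (Sm (carrier A) K2 xs (\<lambda>a b. a \<boxtimes>\<^bsub>K2\<^esub> b)) (Sm (carrier A) K2 ys (\<lambda>a b. a \<boxtimes>\<^bsub>K2\<^esub> b)) =
   Sm (carrier A) K2 xs (\<lambda>a b. Sm (carrier A) K2 ys (\<lambda>c d. (a \<otimes>\<^bsub>A\<^esub> c) \<boxtimes>\<^bsub>K2\<^esub> (b \<otimes>\<^bsub>A\<^esub> d)))"
proof -
  have "m2 (Sm (carrier A) K2 xs (\<lambda>a b. a \<boxtimes>\<^bsub>K2\<^esub> b)) (Sm (carrier A) K2 ys (\<lambda>a b. a \<boxtimes>\<^bsub>K2\<^esub> b)) =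
    Sm (carrier A) K2 ys (\<lambda>c d. Sm (carrier A) K2 xs (\<lambda>a b. (a \<otimes>\<^bsub>A\<^esub> c) \<boxtimes>\<^bsub>K2\<^esub> (b \<otimes>\<^bsub>A\<^esub> d)))"
    by (simp add: Sm_hom[OF m2_ahom_l] Sm_hom[OF m2_ahom_r] m2_pure)
  also have "\<dots> = Sm (carrier A) K2 xs (\<lambda>a b. Sm (carrier A) K2 ys (\<lambda>c d. (a \<otimes>\<^bsub>A\<^esub> c) \<boxtimes>\<^bsub>K2\<^esub> (b \<otimes>\<^bsub>A\<^esub> d)))"
    by (rule Sm_swap) simp_all
  finally show ?thesis .
qed

definition br where "br a X = tlift K3 (\<lambda>b c. (a \<boxtimes>\<^bsub>K2\<^esub> b) \<boxtimes>\<^bsub>K3\<^esub> c) X"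

lemma br_bal: "a \<in> carrier A \<Longrightarrow> bil k A K3 (\<lambda>b c. (a \<boxtimes>\<^bsub>K2\<^esub> b) \<boxtimes>\<^bsub>K3\<^esub> c)"
  by (rule bilI) simp_all

lemma br_ahom: "a \<in> carrier A \<Longrightarrow> ahom K2 K3 (br a)"
  unfolding br_def[abs_def] by (rule t2.lift_ahom[OF t3.agT br_bal])

lemma br_pure: "a \<in> carrier A \<Longrightarrow> b \<in> carrier A \<Longrightarrow> c \<in> carrier A \<Longrightarrow> br a (b \<boxtimes>\<^bsub>K2\<^esub> c) = (a \<boxtimes>\<^bsub>K2\<^esub> b) \<boxtimes>\<^bsub>K3\<^esub> c"
  unfolding br_def by (rule t2.lift_pure[OF t3.agT br_bal])

lemma br_map_bal:
  assumes f: "ahom A K2 f" and r: "\<And>r a. r \<in> carrier k \<Longrightarrow> a \<in> carrier A \<Longrightarrow> f (r \<odot>\<^bsub>A\<^esub> a) = sm2 r (f a)"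
  shows "bil k A K3 (\<lambda>a d. br a (f d))"
proof -
  interpret K: abelian_group K3 by simp
  have ad: "br (a \<oplus>\<^bsub>A\<^esub> a') X = br a X \<oplus>\<^bsub>K3\<^esub> br a' X" if "a \<in> carrier A" "a' \<in> carrier A" "X \<in> carrier K2" for a a' X
  proof -
    have "ahom K2 K3 (\<lambda>X. br a X \<oplus>\<^bsub>K3\<^esub> br a' X)"
      by (rule ahomI) (use that in \<open>simp_all add: ahom_closed[OF br_ahom] ahom_add[OF br_ahom] K.a_ac\<close>)
    from t2.ahom_eqI[OF br_ahom this that(3)] show ?thesis using that by (simp add: br_pure)
  qed
  have sc: "br (r \<odot>\<^bsub>A\<^esub> a) X = br a (sm2 r X)" if "a \<in> carrier A" "r \<in> carrier k" "X \<in> carrier K2" for a r X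
    by (rule t2.ahom_eqI[OF br_ahom ahom_comp[OF tmap_smult_t2(1) br_ahom] that(3)]) (use that in \<open>simp_all add: br_pure\<close>)
  show ?thesis
    by (rule bilI) (simp_all add: ahom_closed[OF br_ahom] ahom_closed[OF f] ad ahom_add[OF f] ahom_add[OF br_ahom] sc r)
qed

lemma map_bal:
  assumes f: "ahom A K2 f" and r: "\<And>r a. r \<in> carrier k \<Longrightarrow> a \<in> carrier A \<Longrightarrow> f (r \<odot>\<^bsub>A\<^esub> a) = sm2 r (f a)"
  shows "bil k A K3 (\<lambda>a d. f a \<boxtimes>\<^bsub>K3\<^esub> d)"
  by (rule balI) (simp_all add: ahom_closed[OF f] ahom_add[OF f] r t3.pure_bal)

lemma list_rep: "X \<in> carrier K2 \<Longrightarrow> \<exists>xs. X = Sm (carrier A) K2 xs (\<lambda>a b. a \<boxtimes>\<^bsub>K2\<^esub> b)"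
  by (rule tens_list_rep[OF t2.tens_axioms])

lemma tensor2_struct: "carrier (tensor2 k A) = carrier K2" "add (tensor2 k A) = add K2" "\<zero>\<^bsub>tensor2 k A\<^esub> = \<zero>\<^bsub>K2\<^esub>"
  by (simp_all add: ktensor_def kt2_def Let_def)

lemmas tensor2_lift = tlift_struct[OF tensor2_struct] pure_struct[OF tensor2_struct(3)]

lemma tensor2_mult: "X \<otimes>\<^bsub>tensor2 k A\<^esub> Y = m2 X Y"
  by (simp add: ktensor_def Let_def tmul_def tmul_pure_def m2_def flip: kt2_def)

lemma tensor2_one: "\<one>\<^bsub>tensor2 k A\<^esub> = \<one>\<^bsub>A\<^esub> \<boxtimes>\<^bsub>K2\<^esub> \<one>\<^bsub>A\<^esub>"
  by (simp add: ktensor_def Let_def flip: kt2_def)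

lemma tensor2_smult: "r \<odot>\<^bsub>tensor2 k A\<^esub> X = sm2 r X"
  by (simp add: ktensor_def Let_def flip: kt2_def)

text \<open>Scalar multiplication on \<open>tensor2\<close> is \<open>sm2\<close>, so both
  constructions of the triple tensor product impose the same relations.\<close>

lemma tensor3_base: "tensor (carrier k) (smult (tensor2 k A)) (smult A) (tensor2 k A) A = K3"
proof -
  have "smult (tensor2 k A) = sm2" by (rule ext, rule ext) (rule tensor2_smult)
  then show ?thesis unfolding kt3_def by (simp add: tensor_def tensor_relations_def tensor2_struct)
qed

lemma tensor3_struct: "carrier (tensor3 k A) = carrier K3" "add (tensor3 k A) = add K3" "\<zero>\<^bsub>tensor3 k A\<^esub> = \<zero>\<^bsub>K3\<^esub>"
  by (simp_all add: ktensor_def[of k "tensor2 k A"] Let_def tensor3_base)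

lemmas tensor3_lift = tlift_struct[OF tensor3_struct] pure_struct[OF tensor3_struct(3)]

lemma tensor3_mult: "X \<otimes>\<^bsub>tensor3 k A\<^esub> Y = m3 X Y"
  by (simp add: ktensor_def[of k "tensor2 k A"] Let_def tensor3_base tmul_def tmul_pure_def m3_def tensor2_mult)

end

section \<open>From tensors to representing lists\<close>

context commutative_module_algebra
begin

interpretation H: alg k H by (rule alg.intro[OF algebra])
interpretation L: alg k L by (rule alg.intro[OF L_algebra])

text \<open>An arbitrary choice among the representing lists; bilinear evaluation does not see which
  one was taken.\<close>

definition repl :: "('h, 'h) tens \<Rightarrow> ('h \<times> 'h) list" where
  "repl X = (SOME xs. X = Sm (carrier H) (kt2 k H) xs (\<lambda>a b. a \<boxtimes>\<^bsub>kt2 k H\<^esub> b))"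

lemma repl: "X \<in> carrier (kt2 k H) \<Longrightarrow> Sm (carrier H) (kt2 k H) (repl X) (\<lambda>a b. a \<boxtimes>\<^bsub>kt2 k H\<^esub> b) = X"
  unfolding repl_def using someI_ex[OF H.list_rep, of X] by simp

lemma lift_repl:
  assumes "abelian_group G" "bil k H G F" "X \<in> carrier (kt2 k H)"
  shows "tlift G F X = Sm (carrier H) G (repl X) F"
proof -
  have "tlift G F (Sm (carrier H) (kt2 k H) (repl X) (\<lambda>a b. a \<boxtimes>\<^bsub>kt2 k H\<^esub> b)) = Sm (carrier H) G (repl X) F"
    using assms(1,2) by (simp add: H.t2.lift_Sm)
  then show ?thesis by (simp only: repl[OF assms(3)])
qed

abbreviation \<Delta> where "\<Delta> h \<equiv> repl (comult H h)"
abbreviation Ri where "Ri \<equiv> inv\<^bsub>tensor2 k H\<^esub> R"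

lemma comult_closed [simp]: "h \<in> carrier H \<Longrightarrow> comult H h \<in> carrier H.K2"
  using alg_homD(1)[OF comult_hom] by (simp add: H.tensor2_struct)

lemma comult_ahom: "ahom H H.K2 (comult H)"
  by (rule ahomI) (simp_all add: alg_homD(2)[OF comult_hom] H.tensor2_struct)

lemma comult_sm: "r \<in> carrier k \<Longrightarrow> h \<in> carrier H \<Longrightarrow> comult H (r \<odot>\<^bsub>H\<^esub> h) = H.sm2 r (comult H h)"
  using alg_homD(5)[OF comult_hom] by (simp add: H.tensor2_smult)

lemma R_closed [simp]: "R \<in> carrier H.K2"
  using R_invertible by (simp add: Units_def H.tensor2_struct)

text \<open>\<open>m_inv\<close> is a description, so its value is found from an inverse provided by
  \<open>R_invertible\<close> together with the usual uniqueness argument, carried out with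
  \<open>m2_assoc\<close> and \<open>m2_one\<close>.\<close>

lemma Ri_props: "Ri \<in> carrier H.K2" "H.m2 R Ri = \<one>\<^bsub>H\<^esub> \<boxtimes>\<^bsub>H.K2\<^esub> \<one>\<^bsub>H\<^esub>" "H.m2 Ri R = \<one>\<^bsub>H\<^esub> \<boxtimes>\<^bsub>H.K2\<^esub> \<one>\<^bsub>H\<^esub>"
proof -
  obtain y where y: "y \<in> carrier H.K2" "H.m2 R y = \<one>\<^bsub>H\<^esub> \<boxtimes>\<^bsub>H.K2\<^esub> \<one>\<^bsub>H\<^esub>" "H.m2 y R = \<one>\<^bsub>H\<^esub> \<boxtimes>\<^bsub>H.K2\<^esub> \<one>\<^bsub>H\<^esub>"
    using R_invertible by (auto simp: Units_def H.tensor2_struct H.tensor2_mult H.tensor2_one)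
  have "z = y" if z: "z \<in> carrier H.K2" "H.m2 R z = \<one>\<^bsub>H\<^esub> \<boxtimes>\<^bsub>H.K2\<^esub> \<one>\<^bsub>H\<^esub>" for z
  proof -
    have "z = H.m2 (\<one>\<^bsub>H\<^esub> \<boxtimes>\<^bsub>H.K2\<^esub> \<one>\<^bsub>H\<^esub>) z" by (simp only: H.m2_one(2)[OF z(1)])
    also have "\<dots> = H.m2 (H.m2 y R) z" by (simp only: y(3))
    also have "\<dots> = H.m2 y (H.m2 R z)" using z(1) y(1) by (simp only: H.m2_assoc[OF y(1) R_closed z(1)])
    also have "\<dots> = y" by (simp only: z(2) H.m2_one(1)[OF y(1)])
    finally show ?thesis .
  qed
  then have u: "z = y" if "z \<in> carrier H.K2 \<and> H.m2 R z = \<one>\<^bsub>H\<^esub> \<boxtimes>\<^bsub>H.K2\<^esub> \<one>\<^bsub>H\<^esub> \<and>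
      H.m2 z R = \<one>\<^bsub>H\<^esub> \<boxtimes>\<^bsub>H.K2\<^esub> \<one>\<^bsub>H\<^esub>" for z using that by blast
  have "Ri = y"
    unfolding m_inv_def H.tensor2_struct H.tensor2_mult H.tensor2_one by (rule the_equality[OF _ u]) (intro conjI y)
  then show "Ri \<in> carrier H.K2" "H.m2 R Ri = \<one>\<^bsub>H\<^esub> \<boxtimes>\<^bsub>H.K2\<^esub> \<one>\<^bsub>H\<^esub>" "H.m2 Ri R = \<one>\<^bsub>H\<^esub> \<boxtimes>\<^bsub>H.K2\<^esub> \<one>\<^bsub>H\<^esub>"
    by (simp_all only: y)
qed

lemma map_comult:
  assumes "X \<in> carrier H.K2"
  shows "tmap (tensor3 k H) (comult H) (\<lambda>b. b) X =
    Sm (carrier H) H.K3 (repl X) (\<lambda>a b. Sm (carrier H) H.K3 (\<Delta> a) (\<lambda>c d. (c \<boxtimes>\<^bsub>H.K2\<^esub> d) \<boxtimes>\<^bsub>H.K3\<^esub> b))"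
proof -
  have "tmap (tensor3 k H) (comult H) (\<lambda>b. b) X = Sm (carrier H) H.K3 (repl X) (\<lambda>a b. comult H a \<boxtimes>\<^bsub>H.K3\<^esub> b)"
    unfolding tmap_def H.tensor3_lift by (rule lift_repl[OF _ H.map_bal[OF comult_ahom comult_sm] assms]) simp
  also have "\<dots> = Sm (carrier H) H.K3 (repl X) (\<lambda>a b. Sm (carrier H) H.K2 (\<Delta> a) (\<lambda>c d. c \<boxtimes>\<^bsub>H.K2\<^esub> d) \<boxtimes>\<^bsub>H.K3\<^esub> b)"
    by (rule Sm_cong') (simp only: repl comult_closed)
  finally show ?thesis by simp
qed

lemma map_right_comult:
  assumes "X \<in> carrier H.K2"
  shows "tmap_right (tensor2 k H) (tensor3 k H) (comult H) X =
    Sm (carrier H) H.K3 (repl X) (\<lambda>a b. Sm (carrier H) H.K3 (\<Delta> b) (\<lambda>c d. (a \<boxtimes>\<^bsub>H.K2\<^esub> c) \<boxtimes>\<^bsub>H.K3\<^esub> d))"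
proof -
  have "tmap_right (tensor2 k H) (tensor3 k H) (comult H) X = Sm (carrier H) H.K3 (repl X) (\<lambda>a b. H.br a (comult H b))"
    unfolding tmap_right_def H.tensor3_lift H.tensor2_lift H.br_def[symmetric]
    by (rule lift_repl[OF _ H.br_map_bal[OF comult_ahom comult_sm] assms]) simp
  also have "\<dots> = Sm (carrier H) H.K3 (repl X) (\<lambda>a b. H.br a (Sm (carrier H) H.K2 (\<Delta> b) (\<lambda>c d. c \<boxtimes>\<^bsub>H.K2\<^esub> d)))"
    by (rule Sm_cong') (simp only: repl comult_closed)
  finally show ?thesis by (simp add: Sm_hom[OF H.br_ahom] H.br_pure)
qed

lemma legs:
  "leg12 k H R = Sm (carrier H) H.K3 (repl R) (\<lambda>a b. (a \<boxtimes>\<^bsub>H.K2\<^esub> b) \<boxtimes>\<^bsub>H.K3\<^esub> \<one>\<^bsub>H\<^esub>)"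
  "leg13 k H R = Sm (carrier H) H.K3 (repl R) (\<lambda>a b. (a \<boxtimes>\<^bsub>H.K2\<^esub> \<one>\<^bsub>H\<^esub>) \<boxtimes>\<^bsub>H.K3\<^esub> b)"
  "leg23 k H R = Sm (carrier H) H.K3 (repl R) (\<lambda>a b. (\<one>\<^bsub>H\<^esub> \<boxtimes>\<^bsub>H.K2\<^esub> a) \<boxtimes>\<^bsub>H.K3\<^esub> b)"
proof -
  have "leg12 k H R = Sm (carrier H) H.K2 (repl R) (\<lambda>a b. a \<boxtimes>\<^bsub>H.K2\<^esub> b) \<boxtimes>\<^bsub>H.K3\<^esub> \<one>\<^bsub>H\<^esub>"
    unfolding leg12_def H.tensor3_lift by (simp only: repl R_closed)
  then show "leg12 k H R = Sm (carrier H) H.K3 (repl R) (\<lambda>a b. (a \<boxtimes>\<^bsub>H.K2\<^esub> b) \<boxtimes>\<^bsub>H.K3\<^esub> \<one>\<^bsub>H\<^esub>)" by simp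
  have "bil k H H.K3 (\<lambda>a b. (a \<boxtimes>\<^bsub>H.K2\<^esub> \<one>\<^bsub>H\<^esub>) \<boxtimes>\<^bsub>H.K3\<^esub> b)" "bil k H H.K3 (\<lambda>a b. (\<one>\<^bsub>H\<^esub> \<boxtimes>\<^bsub>H.K2\<^esub> a) \<boxtimes>\<^bsub>H.K3\<^esub> b)"
    by (rule bilI; simp)+
  then show "leg13 k H R = Sm (carrier H) H.K3 (repl R) (\<lambda>a b. (a \<boxtimes>\<^bsub>H.K2\<^esub> \<one>\<^bsub>H\<^esub>) \<boxtimes>\<^bsub>H.K3\<^esub> b)"
    "leg23 k H R = Sm (carrier H) H.K3 (repl R) (\<lambda>a b. (\<one>\<^bsub>H\<^esub> \<boxtimes>\<^bsub>H.K2\<^esub> a) \<boxtimes>\<^bsub>H.K3\<^esub> b)"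
    unfolding leg13_def leg23_def tmap_def H.tensor3_lift H.tensor2_lift by (simp_all add: lift_repl)
qed

lemma m2_repl:
  assumes "X \<in> carrier H.K2" "Y \<in> carrier H.K2"
  shows "H.m2 X Y = Sm (carrier H) H.K2 (repl X) (\<lambda>a b. Sm (carrier H) H.K2 (repl Y) (\<lambda>c d. (a \<otimes>\<^bsub>H\<^esub> c) \<boxtimes>\<^bsub>H.K2\<^esub> (b \<otimes>\<^bsub>H\<^esub> d)))"
  using H.m2_Sm[of "repl X" "repl Y"] by (simp only: repl[OF assms(1)] repl[OF assms(2)])

text \<open>Each axiom stated with tensors becomes an identity of sums over the chosen lists; from
  here on the tensors themselves are used only through these lists.\<close>

lemma represented: "represented_hopf k H R L act \<Delta> (repl R) (repl Ri)"
proof (intro represented_hopf.intro represented_bialgebra.intro represented_hopf_axioms.intro algebra L_algebra antipode_bij)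
  show "x \<in> carrier H \<Longrightarrow> counit H x \<in> carrier k" for x
    using counit_hom by (auto simp: ring_hom_def)
  show "comult H \<one>\<^bsub>H\<^esub> = \<one>\<^bsub>H\<^esub> \<boxtimes>\<^bsub>H.K2\<^esub> \<one>\<^bsub>H\<^esub>"
    using alg_homD(4)[OF comult_hom] by (simp add: H.tensor2_one)
  show "R = Sm (carrier H) H.K2 (repl R) (\<lambda>a b. a \<boxtimes>\<^bsub>H.K2\<^esub> b)" by (simp only: repl R_closed)
  show "Sm (carrier H) H.K3 (repl R) (\<lambda>a b. Sm (carrier H) H.K3 (\<Delta> a) (\<lambda>c d. (c \<boxtimes>\<^bsub>H.K2\<^esub> d) \<boxtimes>\<^bsub>H.K3\<^esub> b)) =
      Sm (carrier H) H.K3 (repl R) (\<lambda>a b. Sm (carrier H) H.K3 (repl R) (\<lambda>c d. (a \<boxtimes>\<^bsub>H.K2\<^esub> c) \<boxtimes>\<^bsub>H.K3\<^esub> (b \<otimes>\<^bsub>H\<^esub> d)))"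
    using comult_R_left by (simp add: map_comult H.tensor3_mult legs H.m3_Sm H.m2_pure)
  show "Sm (carrier H) H.K3 (repl R) (\<lambda>a b. Sm (carrier H) H.K3 (\<Delta> b) (\<lambda>c d. (a \<boxtimes>\<^bsub>H.K2\<^esub> c) \<boxtimes>\<^bsub>H.K3\<^esub> d)) =
      Sm (carrier H) H.K3 (repl R) (\<lambda>a b. Sm (carrier H) H.K3 (repl R) (\<lambda>c d. ((a \<otimes>\<^bsub>H\<^esub> c) \<boxtimes>\<^bsub>H.K2\<^esub> d) \<boxtimes>\<^bsub>H.K3\<^esub> b))"
    using comult_R_right by (simp add: map_right_comult H.tensor3_mult legs H.m3_Sm H.m2_pure)
  show "Sm (carrier H) H.K2 (repl R) (\<lambda>a b. Sm (carrier H) H.K2 (repl Ri) (\<lambda>c d. (a \<otimes>\<^bsub>H\<^esub> c) \<boxtimes>\<^bsub>H.K2\<^esub> (b \<otimes>\<^bsub>H\<^esub> d))) =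
      \<one>\<^bsub>H\<^esub> \<boxtimes>\<^bsub>H.K2\<^esub> \<one>\<^bsub>H\<^esub>"
    "Sm (carrier H) H.K2 (repl Ri) (\<lambda>a b. Sm (carrier H) H.K2 (repl R) (\<lambda>c d. (a \<otimes>\<^bsub>H\<^esub> c) \<boxtimes>\<^bsub>H.K2\<^esub> (b \<otimes>\<^bsub>H\<^esub> d))) =
      \<one>\<^bsub>H\<^esub> \<boxtimes>\<^bsub>H.K2\<^esub> \<one>\<^bsub>H\<^esub>"
    using Ri_props by (simp_all only: m2_repl R_closed)
  fix x assume x: "x \<in> carrier H"
  show "comult H x = Sm (carrier H) H.K2 (\<Delta> x) (\<lambda>a b. a \<boxtimes>\<^bsub>H.K2\<^esub> b)" using x by (simp only: repl comult_closed)
  show "Sm (carrier H) H.K3 (\<Delta> x) (\<lambda>a b. Sm (carrier H) H.K3 (\<Delta> a) (\<lambda>c d. (c \<boxtimes>\<^bsub>H.K2\<^esub> d) \<boxtimes>\<^bsub>H.K3\<^esub> b)) =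
      Sm (carrier H) H.K3 (\<Delta> x) (\<lambda>a b. Sm (carrier H) H.K3 (\<Delta> b) (\<lambda>c d. (a \<boxtimes>\<^bsub>H.K2\<^esub> c) \<boxtimes>\<^bsub>H.K3\<^esub> d))"
    using coassoc[OF x] x by (simp only: map_comult map_right_comult comult_closed)
  have eps: "counit H y \<in> carrier k" if "y \<in> carrier H" for y
    using counit_hom that by (auto simp: ring_hom_def)
  have eps': "counit H (y \<oplus>\<^bsub>H\<^esub> z) = counit H y \<oplus>\<^bsub>k\<^esub> counit H z" if "y \<in> carrier H" "z \<in> carrier H" for y z
    using counit_hom that by (auto simp: ring_hom_def)
  have gc: "antipode H y \<in> carrier H" if "y \<in> carrier H" for y
    using antipode_bij that by (auto simp: bij_betw_def)
  have b: "bil k H H (\<lambda>a b. counit H a \<odot>\<^bsub>H\<^esub> b)" "bil k H H (\<lambda>a b. counit H b \<odot>\<^bsub>H\<^esub> a)"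
    "bil k H H (\<lambda>a b. antipode H a \<otimes>\<^bsub>H\<^esub> b)" "bil k H H (\<lambda>a b. a \<otimes>\<^bsub>H\<^esub> antipode H b)"
    by (rule bilI; simp add: eps eps' gc counit_linear antipode_add antipode_smult H.m.smult_l_distr H.m.m_comm flip: H.m.smult_assoc1)+
  show "Sm (carrier H) H (\<Delta> x) (\<lambda>a b. counit H a \<odot>\<^bsub>H\<^esub> b) = x" "Sm (carrier H) H (\<Delta> x) (\<lambda>a b. counit H b \<odot>\<^bsub>H\<^esub> a) = x"
    "Sm (carrier H) H (\<Delta> x) (\<lambda>a b. antipode H a \<otimes>\<^bsub>H\<^esub> b) = counit H x \<odot>\<^bsub>H\<^esub> \<one>\<^bsub>H\<^esub>"
    "Sm (carrier H) H (\<Delta> x) (\<lambda>a b. a \<otimes>\<^bsub>H\<^esub> antipode H b) = counit H x \<odot>\<^bsub>H\<^esub> \<one>\<^bsub>H\<^esub>"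
    using x lift_repl[OF H.ag b(1)] lift_repl[OF H.ag b(2)] lift_repl[OF H.ag b(3)] lift_repl[OF H.ag b(4)]
      counit_left counit_right antipode_left antipode_right by simp_all
  show "Sm (carrier H) H.K2 (repl R) (\<lambda>a b. Sm (carrier H) H.K2 (\<Delta> x) (\<lambda>c d. (a \<otimes>\<^bsub>H\<^esub> c) \<boxtimes>\<^bsub>H.K2\<^esub> (b \<otimes>\<^bsub>H\<^esub> d))) =
      Sm (carrier H) H.K2 (\<Delta> x) (\<lambda>c d. Sm (carrier H) H.K2 (repl R) (\<lambda>a b. (d \<otimes>\<^bsub>H\<^esub> a) \<boxtimes>\<^bsub>H.K2\<^esub> (c \<otimes>\<^bsub>H\<^esub> b)))"
  proof -
    have "bil k H H.K2 (\<lambda>a b. b \<boxtimes>\<^bsub>H.K2\<^esub> a)" by (rule bilI) simp_all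
    \<comment> \<open>\<Delta>^op(x) is represented by the list of \<Delta>(x) with its pairs
      reversed.\<close>
    then have f: "tflip (tensor2 k H) (comult H x) = Sm (carrier H) H.K2 (map prod.swap (\<Delta> x)) (\<lambda>a b. a \<boxtimes>\<^bsub>H.K2\<^esub> b)"
      unfolding tflip_def H.tensor2_lift using x by (simp add: lift_repl)
    have "H.m2 R (comult H x) = H.m2 (Sm (carrier H) H.K2 (map prod.swap (\<Delta> x)) (\<lambda>a b. a \<boxtimes>\<^bsub>H.K2\<^esub> b))
        (Sm (carrier H) H.K2 (repl R) (\<lambda>a b. a \<boxtimes>\<^bsub>H.K2\<^esub> b))"
      using R_comult[OF x] by (simp only: H.tensor2_mult f repl R_closed)
    then show ?thesis unfolding H.m2_Sm m2_repl[OF R_closed comult_closed[OF x]] by simp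
  qed
  fix y assume y: "y \<in> carrier H"
  show "comult H (x \<otimes>\<^bsub>H\<^esub> y) = Sm (carrier H) H.K2 (\<Delta> x) (\<lambda>a b. Sm (carrier H) H.K2 (\<Delta> y) (\<lambda>c d. (a \<otimes>\<^bsub>H\<^esub> c) \<boxtimes>\<^bsub>H.K2\<^esub> (b \<otimes>\<^bsub>H\<^esub> d)))"
    using alg_homD(3)[OF comult_hom x y] x y by (simp add: H.tensor2_mult m2_repl)
next
  fix r x assume r: "r \<in> carrier k" "x \<in> carrier H"
  have "comult H (r \<odot>\<^bsub>H\<^esub> x) = H.sm2 r (Sm (carrier H) H.K2 (\<Delta> x) (\<lambda>a b. a \<boxtimes>\<^bsub>H.K2\<^esub> b))"
    using r by (simp only: comult_sm repl comult_closed)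
  then show "comult H (r \<odot>\<^bsub>H\<^esub> x) = Sm (carrier H) H.K2 (\<Delta> x) (\<lambda>a b. (r \<odot>\<^bsub>H\<^esub> a) \<boxtimes>\<^bsub>H.K2\<^esub> b)"
    using r by (simp add: Sm_hom[OF H.tmap_smult_t2(1)])
next
  fix x l m assume x: "x \<in> carrier H" "l \<in> carrier L" "m \<in> carrier L"
  have "bil k H L (\<lambda>a b. act a l \<otimes>\<^bsub>L\<^esub> act b m)"
    by (rule bilI) (use x in \<open>simp_all add: act_closed act_add_left act_smult_left\<close>)
  then show "act x (l \<otimes>\<^bsub>L\<^esub> m) = Sm (carrier H) L (\<Delta> x) (\<lambda>a b. act a l \<otimes>\<^bsub>L\<^esub> act b m)"
    using x by (simp add: act_prod lift_repl)
next
  fix l m assume x: "l \<in> carrier L" "m \<in> carrier L"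
  have "bil k H L (\<lambda>a b. act b m \<otimes>\<^bsub>L\<^esub> act a l)"
    by (rule bilI) (use x in \<open>simp_all add: act_closed act_add_left act_smult_left\<close>)
  then show "l \<otimes>\<^bsub>L\<^esub> m = Sm (carrier H) L (repl R) (\<lambda>a b. act b m \<otimes>\<^bsub>L\<^esub> act a l)"
    by (rule trans[OF H_commutative[OF x] lift_repl[OF L.ag _ R_closed]])
qed (((rule act_closed act_add_left act_add_right act_smult_left act_smult_right act_mult act_one act_unit
        antipode_add antipode_smult counit_linear ahom_add[OF comult_ahom]; assumption) |
      (use counit_hom in \<open>simp add: ring_hom_def\<close>))+)

end

theorem proposition5p8:
  fixes k :: "'k ring" and H :: "('k, 'h) hopf" and R :: "('h, 'h) tens"
    and L :: "('k, 'l) module" and act :: "'h \<Rightarrow> 'l \<Rightarrow> 'l"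
  assumes "base_ring k"
    and "quasitriangular_hopf k H R"
    and "commutative_module_algebra k H R L act"
  shows "\<exists>f. (\<forall>x \<in> carrier (smash k H R L act).
                f (J_phi k H R L act +>\<^bsub>smash k H R L act\<^esub> x) =
                J_phi_op k H R L act +>\<^bsub>smash_op k H R L act\<^esub> smash_antipode k H R L act x) \<and>
             quantum_groupoid_iso k L
               (dynamical_quotient k H R L act)
               (coopposite (opp L) (dynamical_quotient_op k H R L act)) f"
proof -
  interpret C: commutative_module_algebra k H R L act by fact
  interpret represented_hopf k H R L act "\<lambda>h. C.repl (comult H h)" "C.repl R" "C.repl C.Ri" by (rule C.represented)
  show ?thesis by (rule antipode_iso) (simp only: C.repl[OF C.Ri_props(1)])
qed

end
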